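(* Let $T$ be a complete NIP theory with monster model $\mathfrak{C}$, let $G$ be a $\varnothing$-definable group of $T$, and suppose that $\mathrm{dcl}(\varnothing)=M_0$ is a model. Then: 1. The definable subsets of $G$ that are not piecewise f-generic form a translation-invariant ideal. In fact, a definable subset of $G$ is piecewise f-generic if and only if it is weakly generic, meaning that its union with some non-generic definable subset of $G$ is generic. 2. The definable subsets of $G$ that are not piecewise strong f-generic form a translation-invariant ideal. 3. The definable subsets of $G$ that are not piecewise strong f-generic with witnesses in $M_0$ form an S1 ideal.
   Context: Setting: $T$ is a complete first-order theory in a language $L$ with NIP (every partitioned formula has finite VC-dimension), $\mathfrak{C}$ is a monster model (sufficiently saturated and strongly homogeneous; "small" means of size less than its degree of saturation), $G=G(\mathfrak{C})$ is a $\varnothing$-definable group, $G(M)$ denotes its $M$-points for $M\preccurlyeq\mathfrak{C}$, and $M_0=\mathrm{dcl}(\varnothing)$ is an elementary substructure of $\mathfrak{C}$. "Definable" means definable with parameters from $\mathfrak{C}$; a definable subset of $G$ is identified with a formula $\phi(x,b)$ defining it, where $\phi(x,y)$ is an $L$-formula implying $x\in G$. Forking: $\phi(x,b)$ divides over $A$ if there are $k\in\omega$ and a sequence $(b_i:i\in\omega)$ with $\mathrm{tp}(b_i/A)=\mathrm{tp}(b/A)$ such that $(\phi(x,b_i):i\in\omega)$ is $k$-inconsistent; a formula forks over $A$ if it implies a finite disjunction of formulas each dividing over $A$. For $g\in G$, $g\phi(x,b)$ is (the formula defining) the left translate by $g$ of the set defined by $\phi(x,b)$. For finite $s\subset G(\mathfrak{C})$,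 $s\phi(x,b):=\bigvee_{g\in s}g\phi(x,b)$. A definable subset $\phi(x,b)$ of $G$ is f-generic if there is some small model $M$ such that no left translate of $\phi(x,b)$ forks over $M$; it is strong f-generic if no left translate of $\phi(x,b)$ forks over $M_0$. It is piecewise f-generic if there is a finite $s\subset G(\mathfrak{C})$ such that $s\phi(x,b)$ is f-generic; piecewise strong f-generic if there is a finite $s\subset G(\mathfrak{C})$ such that $s\phi(x,b)$ is strong f-generic; piecewise strong f-generic with witnesses in $M_0$ if there is a finite $s\subset G(M_0)$ such that $s\phi(x,b)$ is strong f-generic. A definable subset of $G$ is generic if finitely many left translates of it cover $G$. An ideal is an ideal of the Boolean algebra of definable subsets of $G$ (closed under definable subsets and finite unions); call its members small. It is translation-invariant if whenever $\phi(x,b)$ is small, so is $g\phi(x,b)$ for all $g\in G$. It is S1 if, for every formula $\phi(x,y)$ implying $x\in G$ and any $b_1,b_2$ that start an indiscernible sequence, if $\phi(x,b_1)\wedge\phi(x,b_2)$ is small then $\phi(x,b_1)$ is small. *)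

theory Defs
  imports "HOL-Algebra.Coset"
begin

unbundle cardinal_syntax

section \<open>Languages, structures and satisfaction\<close>

text \<open>
  A language assigns an arity to each of its function and relation symbols; \<open>None\<close> means
  that the symbol does not belong to the language, so either kind of symbol may be absent.
  Variables are de Bruijn indices into the list of values: \<open>Ex\<close> binds index \<open>0\<close> and
  shifts the others. \<open>wf_fm L n \<phi>\<close> says that \<open>\<phi>\<close> is a formula of \<open>L\<close> whose free variables are
  among the first \<open>n\<close>; a formula \<open>\<phi>(x, y)\<close> with \<open>n\<close> variables \<open>x\<close> and \<open>m\<close> variables
  \<open>y\<close> is evaluated at the list \<open>x @ y\<close>.
\<close>

record ('f, 'r) language =
  fun_ar :: "'f \<Rightarrow> nat option"
  rel_ar :: "'r \<Rightarrow> nat option"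

datatype 'f tm = Var nat | Fn 'f "'f tm list"

datatype ('f, 'r) fm =
    Equal "'f tm" "'f tm"
  | Pred 'r "'f tm list"
  | Neg "('f, 'r) fm"
  | Conj "('f, 'r) fm" "('f, 'r) fm"
  | Ex "('f, 'r) fm"

primrec wf_tm :: "('f, 'r) language \<Rightarrow> nat \<Rightarrow> 'f tm \<Rightarrow> bool" where
  "wf_tm L n (Var i) \<longleftrightarrow> i < n"
| "wf_tm L n (Fn f ts) \<longleftrightarrow> fun_ar L f = Some (length ts) \<and> list_all id (map (wf_tm L n) ts)"

primrec wf_fm :: "('f, 'r) language \<Rightarrow> nat \<Rightarrow> ('f, 'r) fm \<Rightarrow> bool" where
  "wf_fm L n (Equal s t) \<longleftrightarrow> wf_tm L n s \<and> wf_tm L n t"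
| "wf_fm L n (Pred r ts) \<longleftrightarrow> rel_ar L r = Some (length ts) \<and> list_all (wf_tm L n) ts"
| "wf_fm L n (Neg \<phi>) \<longleftrightarrow> wf_fm L n \<phi>"
| "wf_fm L n (Conj \<phi> \<psi>) \<longleftrightarrow> wf_fm L n \<phi> \<and> wf_fm L n \<psi>"
| "wf_fm L n (Ex \<phi>) \<longleftrightarrow> wf_fm L (Suc n) \<phi>"

definition formulas :: "('f, 'r) language \<Rightarrow> ('f, 'r) fm set" where
  "formulas L = {\<phi>. \<exists>n. wf_fm L n \<phi>}"

definition sentences :: "('f, 'r) language \<Rightarrow> ('f, 'r) fm set" where
  "sentences L = {\<phi>. wf_fm L 0 \<phi>}"

record ('a, 'f, 'r) struct =
  univ :: "'a set"
  fun_int :: "'f \<Rightarrow> 'a list \<Rightarrow> 'a"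
  rel_int :: "'r \<Rightarrow> 'a list \<Rightarrow> bool"

definition tuples :: "'a set \<Rightarrow> nat \<Rightarrow> 'a list set" where
  "tuples A n = {xs. length xs = n \<and> set xs \<subseteq> A}"

definition is_structure :: "('f, 'r) language \<Rightarrow> ('a, 'f, 'r) struct \<Rightarrow> bool" where
  "is_structure L C \<longleftrightarrow> univ C \<noteq> {} \<and>
     (\<forall>f k. fun_ar L f = Some k \<longrightarrow> (\<forall>xs \<in> tuples (univ C) k. fun_int C f xs \<in> univ C))"

primrec tm_val :: "('a, 'f, 'r) struct \<Rightarrow> 'a list \<Rightarrow> 'f tm \<Rightarrow> 'a" where
  "tm_val C xs (Var i) = xs ! i"
| "tm_val C xs (Fn f ts) = fun_int C f (map (tm_val C xs) ts)"

primrec sat :: "('a, 'f, 'r) struct \<Rightarrow> 'a list \<Rightarrow> ('f, 'r) fm \<Rightarrow> bool" where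
  "sat C xs (Equal s t) \<longleftrightarrow> tm_val C xs s = tm_val C xs t"
| "sat C xs (Pred r ts) \<longleftrightarrow> rel_int C r (map (tm_val C xs) ts)"
| "sat C xs (Neg \<phi>) \<longleftrightarrow> \<not> sat C xs \<phi>"
| "sat C xs (Conj \<phi> \<psi>) \<longleftrightarrow> sat C xs \<phi> \<and> sat C xs \<psi>"
| "sat C xs (Ex \<phi>) \<longleftrightarrow> (\<exists>a \<in> univ C. sat C (a # xs) \<phi>)"

definition is_model ::
    "('f, 'r) language \<Rightarrow> ('f, 'r) fm set \<Rightarrow> ('a, 'f, 'r) struct \<Rightarrow> bool" where
  "is_model L T C \<longleftrightarrow> is_structure L C \<and> (\<forall>\<phi> \<in> T. sat C [] \<phi>)"

text \<open>
  Semantic consequence cannot quantify over structures of every type. By the downward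
  Loewenheim-Skolem theorem it is enough to consider structures with at most as many elements as
  there are formulas of \<open>L\<close>, hence those whose universe is a set of syntactic formulas.
\<close>

definition entails ::
    "('f, 'r) language \<Rightarrow> ('f, 'r) fm set \<Rightarrow> ('f, 'r) fm \<Rightarrow> bool" where
  "entails L T \<phi> \<longleftrightarrow>
     (\<forall>C :: (('f, 'r) fm, 'f, 'r) struct. is_model L T C \<longrightarrow> sat C [] \<phi>)"

definition complete_theory :: "('f, 'r) language \<Rightarrow> ('f, 'r) fm set \<Rightarrow> bool" where
  "complete_theory L T \<longleftrightarrow> T \<subseteq> sentences L \<and>
     (\<exists>C :: (('f, 'r) fm, 'f, 'r) struct. is_model L T C) \<and>
     (\<forall>\<phi> \<in> sentences L. entails L T \<phi> \<or> entails L T (Neg \<phi>))"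

section \<open>Definable sets, types and elementary substructures\<close>

text \<open>The subset of the \<open>n\<close>-th power of \<open>C\<close> defined by \<open>\<phi>(x, b)\<close>.\<close>

definition solutions ::
    "('a, 'f, 'r) struct \<Rightarrow> nat \<Rightarrow> ('f, 'r) fm \<Rightarrow> 'a list \<Rightarrow> 'a list set" where
  "solutions C n \<phi> b = {x \<in> tuples (univ C) n. sat C (x @ b) \<phi>}"

definition definable_over ::
    "('f, 'r) language \<Rightarrow> ('a, 'f, 'r) struct \<Rightarrow> 'a set \<Rightarrow> nat \<Rightarrow> 'a list set \<Rightarrow> bool" where
  "definable_over L C A n X \<longleftrightarrow>
     (\<exists>m \<phi> b. b \<in> tuples A m \<and> wf_fm L (n + m) \<phi> \<and> X = solutions C n \<phi> b)"

definition dcl :: "('f, 'r) language \<Rightarrow> ('a, 'f, 'r) struct \<Rightarrow> 'a set \<Rightarrow> 'a set" where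
  "dcl L C A = {a \<in> univ C. definable_over L C A 1 {[a]}}"

definition elementary_substructure ::
    "('f, 'r) language \<Rightarrow> ('a, 'f, 'r) struct \<Rightarrow> 'a set \<Rightarrow> bool" where
  "elementary_substructure L C M \<longleftrightarrow> M \<subseteq> univ C \<and> is_structure L (C\<lparr>univ := M\<rparr>) \<and>
     (\<forall>n \<phi>. wf_fm L n \<phi> \<longrightarrow> (\<forall>xs \<in> tuples M n. sat (C\<lparr>univ := M\<rparr>) xs \<phi> \<longleftrightarrow> sat C xs \<phi>))"

definition same_type ::
    "('f, 'r) language \<Rightarrow> ('a, 'f, 'r) struct \<Rightarrow> 'a set \<Rightarrow> 'a list \<Rightarrow> 'a list \<Rightarrow> bool" where
  "same_type L C A b c \<longleftrightarrow> length b = length c \<and>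
     (\<forall>k \<phi> a. wf_fm L (length b + k) \<phi> \<longrightarrow> a \<in> tuples A k \<longrightarrow>
        (sat C (b @ a) \<phi> \<longleftrightarrow> sat C (c @ a) \<phi>))"

definition indiscernible ::
    "('f, 'r) language \<Rightarrow> ('a, 'f, 'r) struct \<Rightarrow> nat \<Rightarrow> (nat \<Rightarrow> 'a list) \<Rightarrow> bool" where
  "indiscernible L C m b \<longleftrightarrow> (\<forall>i. b i \<in> tuples (univ C) m) \<and>
     (\<forall>is js. length is = length js \<longrightarrow> sorted_wrt (<) is \<longrightarrow> sorted_wrt (<) js \<longrightarrow>
        same_type L C {} (concat (map b is)) (concat (map b js)))"

section \<open>NIP\<close>

definition shatters :: "'b set set \<Rightarrow> 'b set \<Rightarrow> bool" where
  "shatters F A \<longleftrightarrow> (\<forall>B \<subseteq> A. \<exists>S \<in> F. S \<inter> A = B)"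

definition finite_VC_dim :: "'b set set \<Rightarrow> bool" where
  "finite_VC_dim F \<longleftrightarrow> (\<exists>d. \<forall>A. finite A \<longrightarrow> shatters F A \<longrightarrow> card A \<le> d)"

text \<open>
  Finiteness of the VC-dimension of a formula is first-order, so a complete theory has NIP exactly
  when any one of its models does.
\<close>

definition NIP :: "('f, 'r) language \<Rightarrow> ('a, 'f, 'r) struct \<Rightarrow> bool" where
  "NIP L C \<longleftrightarrow> (\<forall>n m \<phi>. wf_fm L (n + m) \<phi> \<longrightarrow>
     finite_VC_dim {solutions C n \<phi> b | b. b \<in> tuples (univ C) m})"

section \<open>Monster models\<close>

definition small :: "'k rel \<Rightarrow> 'a set \<Rightarrow> bool" where
  "small \<kappa> A \<longleftrightarrow> |A| <o \<kappa>"

text \<open>A partial \<open>n\<close>-type over \<open>A\<close> is given by the family of sets its formulas define.\<close>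

definition saturated ::
    "('f, 'r) language \<Rightarrow> 'k rel \<Rightarrow> ('a, 'f, 'r) struct \<Rightarrow> bool" where
  "saturated L \<kappa> C \<longleftrightarrow> (\<forall>A n p. A \<subseteq> univ C \<longrightarrow> small \<kappa> A \<longrightarrow>
     (\<forall>X \<in> p. definable_over L C A n X) \<longrightarrow>
     (\<forall>q \<subseteq> p. finite q \<longrightarrow> (\<exists>x \<in> tuples (univ C) n. \<forall>X \<in> q. x \<in> X)) \<longrightarrow>
     (\<exists>x \<in> tuples (univ C) n. \<forall>X \<in> p. x \<in> X))"

definition automorphism ::
    "('f, 'r) language \<Rightarrow> ('a, 'f, 'r) struct \<Rightarrow> ('a \<Rightarrow> 'a) \<Rightarrow> bool" where
  "automorphism L C \<sigma> \<longleftrightarrow> bij_betw \<sigma> (univ C) (univ C) \<and>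
     (\<forall>f k. fun_ar L f = Some k \<longrightarrow> (\<forall>xs \<in> tuples (univ C) k.
        \<sigma> (fun_int C f xs) = fun_int C f (map \<sigma> xs))) \<and>
     (\<forall>r k. rel_ar L r = Some k \<longrightarrow> (\<forall>xs \<in> tuples (univ C) k.
        rel_int C r xs \<longleftrightarrow> rel_int C r (map \<sigma> xs)))"

definition elementary_map ::
    "('f, 'r) language \<Rightarrow> ('a, 'f, 'r) struct \<Rightarrow> 'a set \<Rightarrow> ('a \<Rightarrow> 'a) \<Rightarrow> bool" where
  "elementary_map L C A h \<longleftrightarrow> h ` A \<subseteq> univ C \<and>
     (\<forall>n \<phi>. wf_fm L n \<phi> \<longrightarrow> (\<forall>xs \<in> tuples A n. sat C xs \<phi> \<longleftrightarrow> sat C (map h xs) \<phi>))"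

definition strongly_homogeneous ::
    "('f, 'r) language \<Rightarrow> 'k rel \<Rightarrow> ('a, 'f, 'r) struct \<Rightarrow> bool" where
  "strongly_homogeneous L \<kappa> C \<longleftrightarrow> (\<forall>A h. A \<subseteq> univ C \<longrightarrow> small \<kappa> A \<longrightarrow> elementary_map L C A h \<longrightarrow>
     (\<exists>\<sigma>. automorphism L C \<sigma> \<and> (\<forall>a \<in> A. \<sigma> a = h a)))"

text \<open>
  The degree of saturation \<open>\<kappa>\<close> may be any cardinal larger than the number of formulas (which is
  infinite), so every stronger requirement on \<open>\<kappa>\<close> is covered.
\<close>

definition monster_model ::
    "('f, 'r) language \<Rightarrow> ('f, 'r) fm set \<Rightarrow> 'k rel \<Rightarrow> ('a, 'f, 'r) struct \<Rightarrow> bool" where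
  "monster_model L T \<kappa> C \<longleftrightarrow> is_model L T C \<and> Card_order \<kappa> \<and> |formulas L| <o \<kappa> \<and>
     saturated L \<kappa> C \<and> strongly_homogeneous L \<kappa> C"

section \<open>Forking\<close>

definition k_inconsistent :: "nat \<Rightarrow> 'b set \<Rightarrow> (nat \<Rightarrow> 'b set) \<Rightarrow> bool" where
  "k_inconsistent k U X \<longleftrightarrow> (\<forall>I. finite I \<longrightarrow> card I = k \<longrightarrow> \<not> (\<exists>x \<in> U. \<forall>i \<in> I. x \<in> X i))"

definition divides ::
    "('f, 'r) language \<Rightarrow> ('a, 'f, 'r) struct \<Rightarrow> nat \<Rightarrow> 'a set \<Rightarrow> ('f, 'r) fm \<Rightarrow> 'a list \<Rightarrow> bool" where
  "divides L C n A \<phi> b \<longleftrightarrow> (\<exists>k c. (\<forall>i. c i \<in> tuples (univ C) (length b) \<and> same_type L C A (c i) b) \<and>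
     k_inconsistent k (tuples (univ C) n) (\<lambda>i. solutions C n \<phi> (c i)))"

text \<open>
  Forking of a formula depends only on the set it defines, so it is stated for sets; \<open>D\<close> is the
  finite set of disjuncts \<open>\<psi>(x, c)\<close>, which need not imply that \<open>x\<close> lies in a given group.
\<close>

definition forks ::
    "('f, 'r) language \<Rightarrow> ('a, 'f, 'r) struct \<Rightarrow> nat \<Rightarrow> 'a set \<Rightarrow> 'a list set \<Rightarrow> bool" where
  "forks L C n A X \<longleftrightarrow> (\<exists>D. finite D \<and>
     (\<forall>(\<psi>, c) \<in> D. c \<in> tuples (univ C) (length c) \<and> wf_fm L (n + length c) \<psi> \<and>
        divides L C n A \<psi> c) \<and>
     X \<subseteq> (\<Union>(\<psi>, c) \<in> D. solutions C n \<psi> c))"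

section \<open>Definable groups\<close>

text \<open>Elements of a definable group are \<open>n\<close>-tuples from \<open>C\<close>.\<close>

definition definable_group ::
    "('f, 'r) language \<Rightarrow> ('a, 'f, 'r) struct \<Rightarrow> nat \<Rightarrow> 'a list monoid \<Rightarrow> bool" where
  "definable_group L C n G \<longleftrightarrow> group G \<and> definable_over L C {} n (carrier G) \<and>
     definable_over L C {} (n + (n + n))
       {x @ y @ (x \<otimes>\<^bsub>G\<^esub> y) | x y. x \<in> carrier G \<and> y \<in> carrier G}"

definition definable_subset ::
    "('f, 'r) language \<Rightarrow> ('a, 'f, 'r) struct \<Rightarrow> nat \<Rightarrow> 'a list monoid \<Rightarrow> 'a list set \<Rightarrow> bool" where
  "definable_subset L C n G X \<longleftrightarrow> definable_over L C (univ C) n X \<and> X \<subseteq> carrier G"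

definition points :: "nat \<Rightarrow> 'a list monoid \<Rightarrow> 'a set \<Rightarrow> 'a list set" where
  "points n G M = carrier G \<inter> tuples M n"

definition f_generic ::
    "('f, 'r) language \<Rightarrow> 'k rel \<Rightarrow> ('a, 'f, 'r) struct \<Rightarrow> nat \<Rightarrow> 'a list monoid \<Rightarrow> 'a list set \<Rightarrow> bool" where
  "f_generic L \<kappa> C n G X \<longleftrightarrow> (\<exists>M. elementary_substructure L C M \<and> small \<kappa> M \<and>
     (\<forall>g \<in> carrier G. \<not> forks L C n M (g <#\<^bsub>G\<^esub> X)))"

definition strong_f_generic ::
    "('f, 'r) language \<Rightarrow> ('a, 'f, 'r) struct \<Rightarrow> nat \<Rightarrow> 'a list monoid \<Rightarrow> 'a set \<Rightarrow> 'a list set \<Rightarrow> bool" where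
  "strong_f_generic L C n G M\<^sub>0 X \<longleftrightarrow> (\<forall>g \<in> carrier G. \<not> forks L C n M\<^sub>0 (g <#\<^bsub>G\<^esub> X))"

definition piecewise_f_generic ::
    "('f, 'r) language \<Rightarrow> 'k rel \<Rightarrow> ('a, 'f, 'r) struct \<Rightarrow> nat \<Rightarrow> 'a list monoid \<Rightarrow> 'a list set \<Rightarrow> bool" where
  "piecewise_f_generic L \<kappa> C n G X \<longleftrightarrow>
     (\<exists>s. finite s \<and> s \<subseteq> carrier G \<and> f_generic L \<kappa> C n G (s <#>\<^bsub>G\<^esub> X))"

text \<open>\<open>W\<close> is the group of points from which the finite set of translating elements is taken.\<close>

definition piecewise_strong_f_generic_in ::
    "'a list set \<Rightarrow> ('f, 'r) language \<Rightarrow> ('a, 'f, 'r) struct \<Rightarrow> nat \<Rightarrow> 'a list monoid \<Rightarrow> 'a set \<Rightarrow> 'a list set \<Rightarrow> bool" where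
  "piecewise_strong_f_generic_in W L C n G M\<^sub>0 X \<longleftrightarrow>
     (\<exists>s. finite s \<and> s \<subseteq> W \<and> strong_f_generic L C n G M\<^sub>0 (s <#>\<^bsub>G\<^esub> X))"

definition generic :: "'a list monoid \<Rightarrow> 'a list set \<Rightarrow> bool" where
  "generic G X \<longleftrightarrow> (\<exists>s. finite s \<and> s \<subseteq> carrier G \<and> carrier G \<subseteq> (\<Union>g \<in> s. g <#\<^bsub>G\<^esub> X))"

definition weakly_generic ::
    "('f, 'r) language \<Rightarrow> ('a, 'f, 'r) struct \<Rightarrow> nat \<Rightarrow> 'a list monoid \<Rightarrow> 'a list set \<Rightarrow> bool" where
  "weakly_generic L C n G X \<longleftrightarrow>
     (\<exists>Y. definable_subset L C n G Y \<and> \<not> generic G Y \<and> generic G (X \<union> Y))"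

section \<open>Ideals of definable subsets\<close>

definition definable_ideal ::
    "('f, 'r) language \<Rightarrow> ('a, 'f, 'r) struct \<Rightarrow> nat \<Rightarrow> 'a list monoid \<Rightarrow> 'a list set set \<Rightarrow> bool" where
  "definable_ideal L C n G J \<longleftrightarrow> (\<forall>X \<in> J. definable_subset L C n G X) \<and> {} \<in> J \<and>
     (\<forall>X \<in> J. \<forall>Y. definable_subset L C n G Y \<longrightarrow> Y \<subseteq> X \<longrightarrow> Y \<in> J) \<and>
     (\<forall>X \<in> J. \<forall>Y \<in> J. X \<union> Y \<in> J)"

definition translation_invariant :: "'a list monoid \<Rightarrow> 'a list set set \<Rightarrow> bool" where
  "translation_invariant G J \<longleftrightarrow> (\<forall>X \<in> J. \<forall>g \<in> carrier G. g <#\<^bsub>G\<^esub> X \<in> J)"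

definition S1 ::
    "('f, 'r) language \<Rightarrow> ('a, 'f, 'r) struct \<Rightarrow> nat \<Rightarrow> 'a list monoid \<Rightarrow> 'a list set set \<Rightarrow> bool" where
  "S1 L C n G J \<longleftrightarrow> (\<forall>m \<phi> b. wf_fm L (n + m) \<phi> \<longrightarrow>
     (\<forall>c \<in> tuples (univ C) m. solutions C n \<phi> c \<subseteq> carrier G) \<longrightarrow>
     indiscernible L C m b \<longrightarrow>
     solutions C n \<phi> (b 0) \<inter> solutions C n \<phi> (b 1) \<in> J \<longrightarrow> solutions C n \<phi> (b 0) \<in> J)"

end

theory Submission
  imports Defs Complex_Main "HOL-Library.FuncSet" "HOL-Library.Infinite_Set"
begin

text \<open>
  For a formula \<open>\<phi>(x, t)\<close> let \<open>Y\<^sub>t\<close> be the set that it defines, and call the family of the \<open>Y\<^sub>t\<close> with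
  \<open>t \<in> D\<close> pierceable if for some \<open>N\<close> every finite subfamily is met by a set of at most \<open>N\<close> points. Everything
  rests on one translation (\<open>forks_iff_not_uniformly_pierced\<close>): in an NIP theory, \<open>\<phi>(x, t)\<close> does not fork over a small
  model \<open>M\<close> exactly when \<open>t\<close> lies in an \<open>M\<close>-definable \<open>D\<close> over which the family is pierceable. If there is no
  such \<open>D\<close>, the \<open>(p, q)\<close>-theorem for families of finite VC-dimension (\<open>pq_theorem\<close>) yields arbitrarily long
  inconsistent sequences inside every \<open>D\<close>, and saturation turns them into one sequence that witnesses dividing.
  Conversely a dividing formula is never pierceable, by the pigeonhole principle, and neither is a finite union of
  such formulas (\<open>uniformly_pierced_disj\<close>); the latter is the analogue of the fact that forking equals dividing over
  models of NIP theories, and its proof follows the same pattern: if an infinite supply of inconsistent sequences were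
  consistent across sequences, one would see too many traces for a family of finite VC-dimension. Being
  pierceable by \<open>N\<close> points is a first-order property, so it passes from \<open>M\<close> to the monster model.

  Part 1. Suppose that \<open>s X\<close> is f-generic. By compactness one number \<open>N\<close> serves all translates, so any finitely
  many translates of \<open>s X\<close> are pierced by \<open>N\<close> points. Enlarging \<open>s\<close> allows one to discard the piercing points
  one by one, until any finitely many translates of \<open>s' X\<close> have a common point; call such a set thick
  (\<open>pierced_translates_thick\<close>). Conversely, the translates of a thick set are pierced by a single point, so a
  thick set is f-generic over any small model that contains its parameters. On the other hand \<open>Z\<close> is thick exactly when
  finitely many translates of its complement never cover \<open>G\<close>, which identifies the sets with a thick \<open>s X\<close> with the
  weakly generic ones (\<open>weakly_generic_iff\<close>). That the sets that are not weakly generic form an ideal is immediate from the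
  definition.

  Parts 2 and 3. Let \<open>\<Gamma> = G(M\<^sub>0)\<close> and suppose that \<open>X \<union> Y\<close> is strong f-generic. Compactness gives two
  \<open>\<emptyset>\<close>-definable pierceable conditions such that every translate \<open>u X\<close> or \<open>u Y\<close> satisfies one of them,
  uniformly when the parameters of \<open>X\<close> and \<open>Y\<close> vary in a \<open>\<emptyset>\<close>-definable set. Either finitely many elements of \<open>\<Gamma>\<close>
  suffice to bring all triples \<open>(c, d, y)\<close> with \<open>c, d \<in> \<Gamma>\<close> and \<open>y\<close> in \<open>M\<^sub>0\<close> under the first condition at
  \<open>c\<close> or under the second at \<open>d\<close>, up to a common left factor on finite sets of triples, or products of elements of \<open>\<Gamma>\<close> shatter arbitrarily
  large finite sets, against NIP (\<open>shattered_product_cover\<close>). Hence for a finite \<open>S \<subseteq> \<Gamma>\<close> the sets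
  \<open>c S X\<^sub>y \<union> d S Y\<^sub>y\<close> with coordinates in \<open>M\<^sub>0\<close> are pierceable. This passes to the monster model, so
  \<open>c S X \<union> d S Y\<close> never forks over \<open>M\<^sub>0\<close>, and thus \<open>S X\<close> or \<open>S Y\<close> is strong f-generic (\<open>strong_Un_group_fibre\<close>).

  For S1, let \<open>X\<^sub>i\<close> be the sets given by an indiscernible sequence, with \<open>s X\<^sub>0\<close> strong f-generic. One number \<open>N\<close> bounds
  the piercing sets of the translates of all \<open>s X\<^sub>i\<close>. Among more than \<open>N |s|\<close> indices two share both the piercing point and
  the element of \<open>s\<close>, so the union of the sets \<open>X\<^sub>i \<inter> X\<^sub>j\<close> with \<open>i < j \<le> N |s|\<close> becomes strong f-generic after
  multiplication by \<open>s\<close>. By the ideal property one of these intersections is not small, and by indiscernibility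
  \<open>X\<^sub>0 \<inter> X\<^sub>1\<close> is not small.
\<close>

section \<open>Traces of families of finite VC-dimension\<close>

definition vc_le :: "'b set set \<Rightarrow> nat \<Rightarrow> bool" where
  "vc_le F d \<longleftrightarrow> (\<forall>A. finite A \<longrightarrow> shatters F A \<longrightarrow> card A \<le> d)"

lemma vc_leD: "vc_le F d \<Longrightarrow> finite A \<Longrightarrow> shatters F A \<Longrightarrow> card A \<le> d"
  by (auto simp: vc_le_def)

lemma shattersE:
  assumes "shatters F A" "B \<subseteq> A" obtains S where "S \<in> F" "S \<inter> A = B"
  using assms by (auto simp: shatters_def)

lemma shatters_mono:
  assumes "shatters F A" "F \<subseteq> F'" shows "shatters F' A"
  unfolding shatters_def
proof (intro allI impI)
  fix B assume "B \<subseteq> A"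
  then obtain S where "S \<in> F" "S \<inter> A = B" using assms(1) by (auto simp: shatters_def)
  then show "\<exists>S\<in>F'. S \<inter> A = B" using assms(2) by auto
qed

lemma vc_le_mono:
  assumes "vc_le F d" "F' \<subseteq> F" "d \<le> d'" shows "vc_le F' d'"
  unfolding vc_le_def
proof (intro allI impI)
  fix A assume "finite A" "shatters F' A"
  then have "card A \<le> d" using assms(1) shatters_mono[OF _ assms(2)] by (simp add: vc_le_def)
  then show "card A \<le> d'" using assms(3) by simp
qed

text \<open>
  Pajor's form of the Sauer-Shelah lemma. In the inductive step the sets are split by whether they can be changed at the new
  point without leaving the family; what a set shatters in the doubled part stays shattered after adding the point.
\<close>

lemma card_le_card_shattered:
  assumes "finite A" "F \<subseteq> Pow A"
  shows "card F \<le> card {B. B \<subseteq> A \<and> shatters F B}"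
  using assms
proof (induction A arbitrary: F rule: finite_induct)
  case empty
  then have "F = {} \<or> F = {{}}" by auto
  then show ?case
  proof
    assume "F = {{}}"
    then have "{B. B \<subseteq> {} \<and> shatters F B} = {{}}" by (auto simp: shatters_def)
    then show ?thesis using \<open>F = {{}}\<close> by simp
  qed simp
next
  case (insert a A)
  define F1 where "F1 = (\<lambda>S. S - {a}) ` F"
  define F2 where "F2 = {S. S \<subseteq> A \<and> S \<in> F \<and> insert a S \<in> F}"
  have fin: "finite F" using insert.prems insert.hyps(1) by (auto intro: finite_subset)
  have fin12: "finite F1" "finite F2" using fin by (auto simp: F1_def F2_def)
  have sub: "F1 \<subseteq> Pow A" "F2 \<subseteq> Pow A" using insert.prems by (auto simp: F1_def F2_def)
  define Fn where "Fn = {S \<in> F. a \<notin> S}"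
  define Fa where "Fa = {S \<in> F. a \<in> S}"
  have FF: "F = Fn \<union> Fa" "Fn \<inter> Fa = {}" by (auto simp: Fn_def Fa_def)
  have Fa': "card ((\<lambda>S. S - {a}) ` Fa) = card Fa"
    by (rule card_image) (auto simp: inj_on_def Fa_def)
  have F1': "F1 = Fn \<union> (\<lambda>S. S - {a}) ` Fa"
  proof -
    have "(\<lambda>S. S - {a}) ` Fn = Fn" by (force simp: Fn_def)
    then show ?thesis unfolding F1_def using FF(1) by (metis image_Un)
  qed
  have F2': "F2 = Fn \<inter> (\<lambda>S. S - {a}) ` Fa"
  proof
    show "F2 \<subseteq> Fn \<inter> (\<lambda>S. S - {a}) ` Fa"
    proof
      fix S assume S: "S \<in> F2"
      then have "a \<notin> S" using insert.hyps(2) by (auto simp: F2_def)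
      then have "S \<in> Fn" "insert a S \<in> Fa" "S = insert a S - {a}" using S by (auto simp: F2_def Fn_def Fa_def)
      then show "S \<in> Fn \<inter> (\<lambda>S. S - {a}) ` Fa" by blast
    qed
  next
    show "Fn \<inter> (\<lambda>S. S - {a}) ` Fa \<subseteq> F2"
      using insert.prems by (auto simp: F2_def Fn_def Fa_def insert_absorb)
  qed
  have "card F = card Fn + card Fa"
    by (subst FF(1), rule card_Un_disjoint) (use fin FF(2) in \<open>auto simp: Fn_def Fa_def\<close>)
  also have "\<dots> = card F1 + card F2"
    unfolding F1' F2' Fa'[symmetric]
    by (rule card_Un_Int) (use fin in \<open>auto simp: Fn_def Fa_def\<close>)
  finally have c: "card F = card F1 + card F2" .
  let ?S1 = "{B. B \<subseteq> A \<and> shatters F1 B}" and ?S2 = "{B. B \<subseteq> A \<and> shatters F2 B}"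
  let ?S = "{B. B \<subseteq> insert a A \<and> shatters F B}"
  have i2: "card (insert a ` ?S2) = card ?S2"
    by (rule card_image) (use insert.hyps(2) in \<open>auto simp: inj_on_def\<close>)
  have s1: "?S1 \<subseteq> ?S"
  proof (safe)
    fix B assume B: "B \<subseteq> A" "shatters F1 B"
    show "shatters F B" unfolding shatters_def
    proof (intro allI impI)
      fix B' assume "B' \<subseteq> B"
      then obtain S where "S \<in> F1" "S \<inter> B = B'" by (rule shattersE[OF B(2)])
      then obtain S' where "S' \<in> F" "S = S' - {a}" by (auto simp: F1_def)
      moreover have "a \<notin> B" using B(1) insert.hyps(2) by auto
      ultimately have "S' \<inter> B = B'" using \<open>S \<inter> B = B'\<close> by auto
      then show "\<exists>S\<in>F. S \<inter> B = B'" using \<open>S' \<in> F\<close> by blast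
    qed
  qed auto
  have s2: "insert a ` ?S2 \<subseteq> ?S"
  proof (safe)
    fix B assume B: "B \<subseteq> A" "shatters F2 B"
    show "shatters F (insert a B)" unfolding shatters_def
    proof (intro allI impI)
      fix B' assume B': "B' \<subseteq> insert a B"
      then have "B' - {a} \<subseteq> B" by auto
      then obtain S where S: "S \<in> F2" "S \<inter> B = B' - {a}" by (rule shattersE[OF B(2)])
      have aS: "a \<notin> S" using S(1) insert.hyps(2) by (auto simp: F2_def)
      have aB: "a \<notin> B" using B(1) insert.hyps(2) by auto
      show "\<exists>S\<in>F. S \<inter> insert a B = B'"
      proof (cases "a \<in> B'")
        case True
        then have "insert a S \<inter> insert a B = B'" using S(2) by auto
        moreover have "insert a S \<in> F" using S(1) by (simp add: F2_def)
        ultimately show ?thesis by (rule bexI)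
      next
        case False
        then have "S \<inter> insert a B = B'" using S(2) aS by auto
        moreover have "S \<in> F" using S(1) by (simp add: F2_def)
        ultimately show ?thesis by (rule bexI)
      qed
    qed
  qed auto
  have finS: "finite ?S" using insert.hyps(1) by auto
  have dj: "?S1 \<inter> insert a ` ?S2 = {}" using insert.hyps(2) by auto
  have "card F \<le> card ?S1 + card (insert a ` ?S2)"
    using insert.IH[OF sub(1)] insert.IH[OF sub(2)] unfolding c i2 by simp
  also have "\<dots> = card (?S1 \<union> insert a ` ?S2)"
    by (rule card_Un_disjoint[symmetric, OF finite_subset[OF s1 finS] finite_subset[OF s2 finS] dj])
  also have "\<dots> \<le> card ?S" by (rule card_mono[OF finS]) (use s1 s2 in auto)
  finally show ?case .
qed

lemma card_subsets_bounded:
  assumes "finite A" shows "card {B. B \<subseteq> A \<and> card B \<le> d} \<le> (card A + 1) ^ d"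
proof (induction d)
  case 0
  have "{B. B \<subseteq> A \<and> card B \<le> 0} = {{}}" using assms by (auto dest: finite_subset)
  then show ?case by simp
next
  case (Suc d)
  let ?X = "{B. B \<subseteq> A \<and> card B \<le> d}"
  let ?f = "\<lambda>(B, x). case x of None \<Rightarrow> B | Some y \<Rightarrow> insert y B"
  have fin: "finite ?X" using assms by auto
  have "{B. B \<subseteq> A \<and> card B \<le> Suc d} \<subseteq> ?f ` (?X \<times> insert None (Some ` A))"
  proof safe
    fix B assume B: "B \<subseteq> A" "card B \<le> Suc d"
    show "B \<in> ?f ` (?X \<times> insert None (Some ` A))"
    proof (cases "card B \<le> d")
      case True
      then show ?thesis using B by (intro image_eqI[where x="(B, None)"]) auto
    next
      case False
      then have "B \<noteq> {}" by auto
      then obtain y where y: "y \<in> B" by blast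
      have "finite B" using B assms finite_subset by blast
      then have "card (B - {y}) \<le> d" using B(2) y by simp
      then show ?thesis using B y by (intro image_eqI[where x="(B - {y}, Some y)"]) auto
    qed
  qed
  then have "card {B. B \<subseteq> A \<and> card B \<le> Suc d} \<le> card (?f ` (?X \<times> insert None (Some ` A)))"
    by (rule card_mono[rotated]) (use fin assms in auto)
  also have "\<dots> \<le> card (?X \<times> insert None (Some ` A))"
    by (rule card_image_le) (use fin assms in auto)
  also have "\<dots> = card ?X * (card A + 1)"
    using assms by (simp add: card_cartesian_product card_insert_if card_image)
  also have "\<dots> \<le> (card A + 1) ^ d * (card A + 1)" using Suc.IH by (rule mult_right_mono) simp
  finally show ?case by (simp add: mult.commute)
qed

text \<open>
  A set of indices that is shattered must be mapped injectively by \<open>g\<close>, so pulling a family back along an arbitrary map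
  cannot raise its VC-dimension. This covers samples with repetitions.
\<close>

lemma vc_le_traces:
  assumes "vc_le F d"
  shows "vc_le {{j \<in> J. g j \<in> S} |S. S \<in> F} d"
  unfolding vc_le_def
proof (intro allI impI)
  let ?T = "{{j \<in> J. g j \<in> S} |S. S \<in> F}"
  fix B assume finB: "finite B" and sh: "shatters ?T B"
  have "B \<subseteq> J"
  proof -
    obtain S' where "S' \<in> ?T" "S' \<inter> B = B" by (rule shattersE[OF sh subset_refl])
    then show ?thesis by auto
  qed
  have inj: "inj_on g B"
  proof (rule inj_onI, rule ccontr)
    fix x y assume xy: "x \<in> B" "y \<in> B" "g x = g y" "x \<noteq> y"
    have "{x} \<subseteq> B" using xy by auto
    then obtain S' where "S' \<in> ?T" "S' \<inter> B = {x}" by (rule shattersE[OF sh])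
    then obtain S where "S \<in> F" "{j \<in> J. g j \<in> S} \<inter> B = {x}" by auto
    moreover have "x \<in> {j \<in> J. g j \<in> S} \<longleftrightarrow> y \<in> {j \<in> J. g j \<in> S}" using xy \<open>B \<subseteq> J\<close> by auto
    ultimately show False using xy(1,2,4) by (metis (no_types) IntD1 IntI singletonD singletonI)
  qed
  have "shatters F (g ` B)" unfolding shatters_def
  proof (intro allI impI)
    fix D assume D: "D \<subseteq> g ` B"
    have "{j \<in> B. g j \<in> D} \<subseteq> B" by auto
    then obtain S' where "S' \<in> ?T" "S' \<inter> B = {j \<in> B. g j \<in> D}" by (rule shattersE[OF sh])
    then obtain S where S: "S \<in> F" "{j \<in> J. g j \<in> S} \<inter> B = {j \<in> B. g j \<in> D}" by auto
    have "g j \<in> S \<longleftrightarrow> g j \<in> D" if "j \<in> B" for j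
    proof -
      have "j \<in> {j \<in> J. g j \<in> S} \<inter> B \<longleftrightarrow> j \<in> {j \<in> B. g j \<in> D}" by (simp only: S(2))
      then show ?thesis using that \<open>B \<subseteq> J\<close> by auto
    qed
    then have "S \<inter> g ` B = D" using D by auto
    then show "\<exists>S\<in>F. S \<inter> g ` B = D" using S(1) by blast
  qed
  then have "card (g ` B) \<le> d" using assms finB by (auto simp: vc_le_def)
  then show "card B \<le> d" using card_image[OF inj] by simp
qed

lemma card_traces_le:
  assumes "finite J" "vc_le F d"
  shows "card {{j \<in> J. g j \<in> S} |S. S \<in> F} \<le> (card J + 1) ^ d"
proof -
  let ?T = "{{j \<in> J. g j \<in> S} |S. S \<in> F}"
  have "card ?T \<le> card {B. B \<subseteq> J \<and> shatters ?T B}"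
    by (rule card_le_card_shattered) (use assms in auto)
  also have "\<dots> \<le> card {B. B \<subseteq> J \<and> card B \<le> d}"
  proof (rule card_mono)
    show "finite {B. B \<subseteq> J \<and> card B \<le> d}" using assms(1) by auto
    show "{B. B \<subseteq> J \<and> shatters ?T B} \<subseteq> {B. B \<subseteq> J \<and> card B \<le> d}"
      using vc_leD[OF vc_le_traces[OF assms(2)]] assms(1) by (auto dest: finite_subset)
  qed
  also have "\<dots> \<le> (card J + 1) ^ d" by (rule card_subsets_bounded[OF assms(1)])
  finally show ?thesis .
qed

section \<open>Fractional Helly theorem\<close>

lemma sum_PiE_prod:
  fixes w :: "'i \<Rightarrow> real"
  assumes "finite J" "finite I" "sum w I = 1"
  shows "(\<Sum>f\<in>PiE J (\<lambda>_. I). \<Prod>j\<in>J. w (f j)) = 1"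
  using prod_sum_PiE[of J "\<lambda>_. I" "\<lambda>_ i. w i"] assms by simp

text \<open>
  Fubini for the product weight on sequences of samples: a bound that holds for the sample at \<open>j0\<close>, whatever the others are,
  holds on average.
\<close>

lemma sum_PiE_resample:
  fixes w :: "'i \<Rightarrow> real"
  assumes J: "finite J" "j0 \<in> J" and I: "finite I" "sum w I = 1" "\<And>i. i \<in> I \<Longrightarrow> 0 \<le> w i"
    and le: "\<And>g. g \<in> PiE (J - {j0}) (\<lambda>_. I) \<Longrightarrow> (\<Sum>i\<in>I. w i * of_bool (P (g(j0 := i)))) \<le> \<beta>"
  shows "(\<Sum>f\<in>PiE J (\<lambda>_. I). (\<Prod>j\<in>J. w (f j)) * of_bool (P f)) \<le> \<beta>"
proof -
  let ?J = "J - {j0}"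
  have J': "J = insert j0 ?J" using J by auto
  have inj: "inj_on (\<lambda>(y, g). g(j0 := y)) (I \<times> PiE ?J (\<lambda>_. I))"
    using inj_combinator[of j0 ?J "\<lambda>_. I"] by simp
  have "(\<Sum>f\<in>PiE J (\<lambda>_. I). (\<Prod>j\<in>J. w (f j)) * of_bool (P f))
      = (\<Sum>(i, g)\<in>I \<times> PiE ?J (\<lambda>_. I). (\<Prod>j\<in>J. w ((g(j0 := i)) j)) * of_bool (P (g(j0 := i))))"
    apply (subst J', subst PiE_insert_eq, subst sum.reindex[OF inj])
    using J' by (simp add: case_prod_unfold)
  also have "\<dots> = (\<Sum>(i, g)\<in>I \<times> PiE ?J (\<lambda>_. I). (\<Prod>j\<in>?J. w (g j)) * (w i * of_bool (P (g(j0 := i)))))"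
  proof (rule sum.cong[OF refl], safe)
    fix i g
    have "(\<Prod>j\<in>J. w ((g(j0 := i)) j)) = w i * (\<Prod>j\<in>?J. w ((g(j0 := i)) j))"
      using J by (subst prod.remove[of J j0]) auto
    also have "(\<Prod>j\<in>?J. w ((g(j0 := i)) j)) = (\<Prod>j\<in>?J. w (g j))" by (rule prod.cong) auto
    finally show "(\<Prod>j\<in>J. w ((g(j0 := i)) j)) * of_bool (P (g(j0 := i)))
      = (\<Prod>j\<in>?J. w (g j)) * (w i * of_bool (P (g(j0 := i))))" by simp
  qed
  also have "\<dots> = (\<Sum>g\<in>PiE ?J (\<lambda>_. I). \<Sum>i\<in>I. (\<Prod>j\<in>?J. w (g j)) * (w i * of_bool (P (g(j0 := i)))))"
    by (subst sum.cartesian_product[symmetric], rule sum.swap)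
  also have "\<dots> = (\<Sum>g\<in>PiE ?J (\<lambda>_. I). (\<Prod>j\<in>?J. w (g j)) * (\<Sum>i\<in>I. w i * of_bool (P (g(j0 := i)))))"
    by (simp add: sum_distrib_left)
  also have "\<dots> \<le> (\<Sum>g\<in>PiE ?J (\<lambda>_. I). (\<Prod>j\<in>?J. w (g j)) * \<beta>)"
  proof (intro sum_mono mult_left_mono le prod_nonneg ballI I(3))
    fix g j assume "g \<in> PiE ?J (\<lambda>_. I)" "j \<in> ?J"
    then show "g j \<in> I" by auto
  qed
  also have "\<dots> = \<beta>"
    using sum_PiE_prod[of ?J I w] J I by (simp add: sum_distrib_right[symmetric])
  finally show ?thesis .
qed

text \<open>
  Double counting of pairs \<open>K \<subseteq> P\<close>: every \<open>p\<close>-set contains a good \<open>k\<close>-set, and every \<open>k\<close>-set lies in equally many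
  \<open>p\<close>-sets.
\<close>

lemma card_subset_family_ge:
  fixes S :: "nat set"
  assumes fin: "finite S" and k: "k \<le> p" "p \<le> card S"
    and ex: "\<And>P. P \<subseteq> S \<Longrightarrow> card P = p \<Longrightarrow> \<exists>K\<subseteq>P. card K = k \<and> Q K"
  shows "card S choose k \<le> card {K. K \<subseteq> S \<and> card K = k \<and> Q K} * (p choose k)"
proof -
  let ?m = "card S"
  let ?PP = "{P. P \<subseteq> S \<and> card P = p}" and ?KK = "{K. K \<subseteq> S \<and> card K = k \<and> Q K}"
  have f: "finite ?PP" "finite ?KK" using fin by auto
  have "?m choose p = card ?PP" using n_subsets[OF fin] by simp
  also have "\<dots> = (\<Sum>P\<in>?PP. 1)" by simp
  also have "\<dots> \<le> (\<Sum>P\<in>?PP. card {K \<in> ?KK. K \<subseteq> P})"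
  proof (rule sum_mono)
    fix P assume P: "P \<in> ?PP"
    then obtain K where "K \<subseteq> P" "card K = k" "Q K" using ex by auto
    then have "K \<in> {K \<in> ?KK. K \<subseteq> P}" using P by auto
    then show "1 \<le> card {K \<in> ?KK. K \<subseteq> P}" using f(2) card_gt_0_iff
      by (metis (no_types, lifting) One_nat_def Suc_leI card_eq_0_iff empty_iff finite_subset mem_Collect_eq neq0_conv subsetI)
  qed
  also have "\<dots> = (\<Sum>P\<in>?PP. \<Sum>K\<in>?KK. of_bool (K \<subseteq> P))"
    using f by (intro sum.cong refl) (simp add: of_bool_def sum.If_cases Int_def)
  also have "\<dots> = (\<Sum>K\<in>?KK. \<Sum>P\<in>?PP. of_bool (K \<subseteq> P))" by (rule sum.swap)
  also have "\<dots> = (\<Sum>K\<in>?KK. card {P \<in> ?PP. K \<subseteq> P})"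
    using f by (intro sum.cong refl) (simp add: of_bool_def sum.If_cases Int_def)
  also have "\<dots> = (\<Sum>K\<in>?KK. (?m - k) choose (p - k))"
  proof (rule sum.cong[OF refl])
    fix K assume K: "K \<in> ?KK"
    have finK: "finite K" using K fin finite_subset by auto
    have "bij_betw (\<lambda>P. P - K) {P \<in> ?PP. K \<subseteq> P} {R. R \<subseteq> S - K \<and> card R = p - k}"
    proof (rule bij_betw_byWitness[where f' = "\<lambda>R. R \<union> K"])
      show "(\<lambda>P. P - K) ` {P \<in> ?PP. K \<subseteq> P} \<subseteq> {R. R \<subseteq> S - K \<and> card R = p - k}"
        using K finK by (auto simp: card_Diff_subset)
      show "(\<lambda>R. R \<union> K) ` {R. R \<subseteq> S - K \<and> card R = p - k} \<subseteq> {P \<in> ?PP. K \<subseteq> P}"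
      proof safe
        fix R assume R: "R \<subseteq> S - K" "card R = p - k"
        have "finite R" using R(1) fin finite_subset by blast
        then have "card (R \<union> K) = card R + card K" using R(1) finK by (intro card_Un_disjoint) auto
        then show "card (R \<union> K) = p" using R(2) K k by simp
      qed (use K in auto)
    qed auto
    then have "card {P \<in> ?PP. K \<subseteq> P} = card {R. R \<subseteq> S - K \<and> card R = p - k}"
      by (rule bij_betw_same_card)
    also have "\<dots> = card (S - K) choose (p - k)" by (rule n_subsets) (use fin in auto)
    also have "card (S - K) = ?m - k" using K finK by (simp add: card_Diff_subset)
    finally show "card {P \<in> ?PP. K \<subseteq> P} = (?m - k) choose (p - k)" .
  qed
  also have "\<dots> = card ?KK * ((?m - k) choose (p - k))" by simp
  finally have "?m choose p \<le> card ?KK * ((?m - k) choose (p - k))" .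
  then have "(?m choose p) * (p choose k) \<le> card ?KK * ((?m - k) choose (p - k)) * (p choose k)"
    by (rule mult_right_mono) simp
  then have "(?m choose k) * ((?m - k) choose (p - k)) \<le> card ?KK * (p choose k) * ((?m - k) choose (p - k))"
    unfolding choose_mult[OF k] by (simp only: mult_ac)
  moreover have "0 < (?m - k) choose (p - k)" using k by (simp add: zero_less_binomial)
  ultimately show ?thesis by (simp only: mult_le_cancel2)
qed

lemma ex_binomial_large:
  fixes c :: nat
  shows "\<exists>m\<ge>p. Suc d \<le> m \<and> c * ((m + 1) ^ d + 1) \<le> (m choose Suc d)"
proof -
  let ?k = "Suc d"
  define m where "m = p + ?k + c * 2 ^ ?k * ?k ^ ?k"
  have m: "p \<le> m" "?k \<le> m" "c * 2 ^ ?k * ?k ^ ?k \<le> m" "1 \<le> m" by (auto simp: m_def)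
  have "(m + 1) ^ d + 1 \<le> (2 * m) ^ d + (2 * m) ^ d"
    using m(4) by (intro add_mono power_mono) auto
  also have "\<dots> = 2 ^ ?k * m ^ d" by (simp add: power_mult_distrib)
  finally have 1: "(m + 1) ^ d + 1 \<le> 2 ^ ?k * m ^ d" .
  have "c * ((m + 1) ^ d + 1) * ?k ^ ?k \<le> c * (2 ^ ?k * m ^ d) * ?k ^ ?k"
    using 1 by (intro mult_right_mono mult_left_mono) auto
  also have "\<dots> = (c * 2 ^ ?k * ?k ^ ?k) * m ^ d" by (simp add: mult_ac)
  also have "\<dots> \<le> m * m ^ d" using m(3) by (rule mult_right_mono) simp
  finally have "real (c * ((m + 1) ^ d + 1) * ?k ^ ?k) \<le> real (m ^ ?k)"
    by (simp only: of_nat_le_iff power_Suc)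
  then have "real (c * ((m + 1) ^ d + 1)) \<le> (real m / real ?k) ^ ?k"
    by (simp only: power_divide) (subst pos_le_divide_eq, simp, simp only: of_nat_mult of_nat_power)
  also have "\<dots> \<le> real (m choose ?k)" by (rule binomial_ge_n_over_k_pow_k[OF m(2)])
  finally show ?thesis using m by (intro exI[of _ m]) linarith
qed

text \<open>
  Sample \<open>m\<close> indices independently with weight \<open>w\<close>. By double counting a fixed fraction of the \<open>Suc d\<close>-subsets of the
  sample have a common point. If no point were heavy, the point chosen for such a subset \<open>K\<close> would rarely lie in a set that
  was sampled outside \<open>K\<close>, so that \<open>K\<close> is often the exact trace of that point on the sample. But there are only about \<open>m ^ d\<close>
  traces, while there are about \<open>m ^ Suc d\<close> subsets.
\<close>

lemma fractional_Helly:
  fixes d p :: nat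
  obtains \<beta> :: real where "0 < \<beta>" "\<beta> \<le> 1"
    and "\<And>(I :: 'i set) (w :: 'i \<Rightarrow> real) (Y :: 'i \<Rightarrow> 'x set).
      finite I \<Longrightarrow> (\<And>i. i \<in> I \<Longrightarrow> 0 \<le> w i) \<Longrightarrow> sum w I = 1 \<Longrightarrow>
      vc_le {{i \<in> I. x \<in> Y i} |x. True} d \<Longrightarrow>
      (\<And>f. f \<in> {..<p} \<rightarrow> I \<Longrightarrow> \<exists>K\<subseteq>{..<p}. card K = Suc d \<and> (\<exists>x. \<forall>j\<in>K. x \<in> Y (f j))) \<Longrightarrow>
      \<exists>x. \<beta> \<le> sum w {i \<in> I. x \<in> Y i}"
proof -
  let ?k = "Suc d"
  \<comment> \<open>The sample size is chosen so that the binomial coefficient beats the number of traces.\<close>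
  obtain m where m: "p \<le> m" "?k \<le> m" "2 * (p choose ?k) * ((m + 1) ^ d + 1) \<le> (m choose ?k)"
    using ex_binomial_large[of p d "2 * (p choose ?k)"] by auto
  define c where "c = real (max 1 (p choose ?k))"
  define \<beta> where "\<beta> = 1 / (2 * real m * c)"
  have c1: "1 \<le> c" by (simp add: c_def)
  have m1: "1 \<le> real m" using m(2) by simp
  have mc: "1 \<le> real m * c" using mult_mono[OF m1 c1] by simp
  have \<beta>: "0 < \<beta>" "\<beta> \<le> 1"
  proof -
    have "1 \<le> 2 * real m * c" using mc by linarith
    then show "0 < \<beta>" "\<beta> \<le> 1" unfolding \<beta>_def by (meson divide_le_eq_1_pos less_le_trans zero_less_divide_1_iff zero_less_one)+
  qed
  show thesis
  proof (rule that[OF \<beta>])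
    fix I :: "'i set" and w :: "'i \<Rightarrow> real" and Y :: "'i \<Rightarrow> 'x set"
    assume I: "finite I" and w0: "\<And>i. i \<in> I \<Longrightarrow> 0 \<le> w i" and w1: "sum w I = 1"
      and vc: "vc_le {{i \<in> I. x \<in> Y i} |x. True} d"
      and pk: "\<And>f. f \<in> {..<p} \<rightarrow> I \<Longrightarrow> \<exists>K\<subseteq>{..<p}. card K = ?k \<and> (\<exists>x. \<forall>j\<in>K. x \<in> Y (f j))"
    show "\<exists>x. \<beta> \<le> sum w {i \<in> I. x \<in> Y i}"
    proof (rule ccontr)
      assume "\<not> ?thesis"
      then have light: "sum w {i \<in> I. x \<in> Y i} < \<beta>" for x by (metis not_le)
      let ?J = "{..<m}"
      let ?F = "PiE ?J (\<lambda>_. I)"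
      let ?KK = "{K. K \<subseteq> ?J \<and> card K = ?k}"
      define W where "W f = (\<Prod>j\<in>?J. w (f j))" for f
      define good where "good K f \<longleftrightarrow> (\<exists>x. \<forall>j\<in>K. x \<in> Y (f j))" for K :: "nat set" and f
      define pt where "pt K f = (SOME x. \<forall>j\<in>K. x \<in> Y (f j))" for K :: "nat set" and f
      have finKK: "finite ?KK" by auto
      have cardKK: "card ?KK = m choose ?k" using n_subsets[of ?J ?k] by simp
      have finF: "finite ?F" using I by (simp add: finite_PiE)
      have W0: "0 \<le> W f" if "f \<in> ?F" for f unfolding W_def
        using that by (intro prod_nonneg ballI w0) auto
      have W1: "sum W ?F = 1" unfolding W_def using sum_PiE_prod[of ?J I w] I w1 by simp
      have ptg: "\<forall>j\<in>K. pt K f \<in> Y (f j)" if "good K f" for K f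
        using someI_ex[of "\<lambda>x. \<forall>j\<in>K. x \<in> Y (f j)"] that by (simp add: good_def pt_def)
      have "?F \<noteq> {}" using W1 by auto
      then obtain f0 where f0: "f0 \<in> ?F" by auto
      have kp: "?k \<le> p"
      proof -
        have "f0 \<in> {..<p} \<rightarrow> I" using f0 m(1) by (auto simp: PiE_iff)
        then obtain K where K: "K \<subseteq> {..<p}" "card K = ?k" using pk by blast
        then show ?thesis using card_mono[of "{..<p}" K] by simp
      qed
      then have "0 < p choose ?k" by (simp only: zero_less_binomial)
      then have c: "c = real (p choose ?k)" unfolding c_def by (simp only: max_absorb2 Suc_le_eq One_nat_def)
      have many: "real (m choose ?k) / c \<le> real (card {K \<in> ?KK. good K f})" if f: "f \<in> ?F" for f
      proof -
        have "card ?J choose ?k \<le> card {K. K \<subseteq> ?J \<and> card K = ?k \<and> good K f} * (p choose ?k)"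
        proof (rule card_subset_family_ge)
          fix P assume P: "P \<subseteq> ?J" "card P = p"
          have "finite P" using P(1) finite_subset by blast
          then obtain h where h: "bij_betw h {..<p} P" using P(2) ex_bij_betw_nat_finite[of P] by (auto simp: atLeast0LessThan)
          have "(\<lambda>j. f (h j)) \<in> {..<p} \<rightarrow> I"
          proof
            fix j assume "j \<in> {..<p}"
            then have "h j \<in> ?J" using h P(1) by (auto simp: bij_betw_def)
            then show "f (h j) \<in> I" using f by auto
          qed
          then obtain K x where K: "K \<subseteq> {..<p}" "card K = ?k" "\<forall>j\<in>K. x \<in> Y (f (h j))"
            using pk by blast
          have "h ` K \<subseteq> P" using h K(1) by (auto simp: bij_betw_def)
          moreover have "card (h ` K) = ?k"
            using h K(1,2) by (metis bij_betw_def card_image inj_on_subset)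
          moreover have "good (h ` K) f" using K(3) by (auto simp: good_def)
          ultimately show "\<exists>K\<subseteq>P. card K = ?k \<and> good K f" by blast
        qed (use kp m in auto)
        then have "real (m choose ?k) \<le> real (card {K \<in> ?KK. good K f}) * c"
          unfolding c by (simp flip: of_nat_mult add: conj_assoc)
        then show ?thesis using c1 by (simp add: divide_le_eq)
      qed
      define hit where "hit K j f \<longleftrightarrow> good K f \<and> pt K f \<in> Y (f j)" for K j f
      have few: "real (card {K \<in> ?KK. good K f}) - (\<Sum>K\<in>?KK. \<Sum>j\<in>?J - K. of_bool (hit K j f)) \<le> real ((m + 1) ^ d)"
        if f: "f \<in> ?F" for f
      proof -
        let ?A = "{K \<in> ?KK. good K f \<and> (\<forall>j\<in>?J - K. \<not> hit K j f)}"
        let ?T = "{{j \<in> ?J. f j \<in> S} |S. S \<in> {{i \<in> I. x \<in> Y i} |x. True}}"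
        have "?A \<subseteq> ?T"
        proof
          fix K assume K: "K \<in> ?A"
          have "K = {j \<in> ?J. f j \<in> {i \<in> I. pt K f \<in> Y i}}"
          proof (rule Set.set_eqI)
            fix j
            show "j \<in> K \<longleftrightarrow> j \<in> {j \<in> ?J. f j \<in> {i \<in> I. pt K f \<in> Y i}}"
              using K ptg[of K f] f by (auto simp: hit_def PiE_iff)
          qed
          then show "K \<in> ?T" by blast
        qed
        moreover have "finite ?T" by (rule finite_subset[of _ "Pow ?J"]) auto
        ultimately have "card ?A \<le> card ?T" by (intro card_mono)
        also have "\<dots> \<le> (card ?J + 1) ^ d" by (rule card_traces_le[OF _ vc]) simp
        finally have A: "card ?A \<le> (m + 1) ^ d" by simp
        have "real (card {K \<in> ?KK. good K f}) = (\<Sum>K\<in>?KK. of_bool (good K f))"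
          using finKK by (simp add: of_bool_def sum.If_cases Int_def)
        also have "\<dots> \<le> (\<Sum>K\<in>?KK. of_bool (K \<in> ?A) + (\<Sum>j\<in>?J - K. of_bool (hit K j f)))"
        proof (rule sum_mono)
          fix K assume K: "K \<in> ?KK"
          show "of_bool (good K f) \<le> (of_bool (K \<in> ?A) + (\<Sum>j\<in>?J - K. of_bool (hit K j f)) :: real)"
          proof (cases "K \<in> ?A \<or> \<not> good K f")
            case True
            then show ?thesis by (auto intro!: add_nonneg_nonneg sum_nonneg)
          next
            case False
            then obtain j where j: "j \<in> ?J - K" "hit K j f" using K by blast
            have "(1::real) = of_bool (hit K j f)" using j by simp
            also have "\<dots> \<le> (\<Sum>j\<in>?J - K. of_bool (hit K j f))"
              by (rule member_le_sum[of j]) (use j in auto)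
            finally show ?thesis by simp
          qed
        qed
        also have "\<dots> = real (card ?A) + (\<Sum>K\<in>?KK. \<Sum>j\<in>?J - K. of_bool (hit K j f))"
          using finKK by (simp add: sum.distrib of_bool_def sum.If_cases Int_def conj_ac)
        finally show ?thesis using A by linarith
      qed
      \<comment> \<open>The point chosen for \<open>K\<close> depends only on the samples in \<open>K\<close>, hence is independent of the sample at \<open>j\<close>.\<close>
      have hitb: "(\<Sum>f\<in>?F. W f * of_bool (hit K j f)) \<le> \<beta>" if K: "K \<in> ?KK" "j \<in> ?J - K" for K j
        unfolding W_def
      proof (rule sum_PiE_resample)
        fix g assume g: "g \<in> PiE (?J - {j}) (\<lambda>_. I)"
        have eq: "hit K j (g(j := i)) \<longleftrightarrow> good K g \<and> pt K g \<in> Y i" for i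
        proof -
          have "\<And>x. (\<forall>l\<in>K. x \<in> Y ((g(j := i)) l)) \<longleftrightarrow> (\<forall>l\<in>K. x \<in> Y (g l))" using K(2) by auto
          then show ?thesis by (simp add: hit_def good_def pt_def)
        qed
        have "(\<Sum>i\<in>I. w i * of_bool (hit K j (g(j := i)))) \<le> (\<Sum>i\<in>I. w i * of_bool (pt K g \<in> Y i))"
          by (intro sum_mono mult_left_mono w0) (auto simp: eq)
        also have "\<dots> = sum w {i \<in> I. pt K g \<in> Y i}"
          using I by (simp add: of_bool_def sum.If_cases Int_def if_distrib[of "\<lambda>t. _ * t"] cong: if_cong)
        also have "\<dots> \<le> \<beta>" using light[of "pt K g"] by simp
        finally show "(\<Sum>i\<in>I. w i * of_bool (hit K j (g(j := i)))) \<le> \<beta>" .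
      qed (use K I w1 w0 in auto)
      have "real (m choose ?k) / c = (\<Sum>f\<in>?F. W f * (real (m choose ?k) / c))"
        using W1 by (simp add: sum_distrib_right[symmetric] sum_divide_distrib[symmetric])
      also have "\<dots> \<le> (\<Sum>f\<in>?F. W f * (real ((m + 1) ^ d) + (\<Sum>K\<in>?KK. \<Sum>j\<in>?J - K. of_bool (hit K j f))))"
      proof (intro sum_mono mult_left_mono W0)
        fix f assume f: "f \<in> ?F"
        show "real (m choose ?k) / c \<le> real ((m + 1) ^ d) + (\<Sum>K\<in>?KK. \<Sum>j\<in>?J - K. of_bool (hit K j f))"
          using many[OF f] few[OF f] by linarith
      qed
      also have "\<dots> = real ((m + 1) ^ d) * sum W ?F + (\<Sum>f\<in>?F. \<Sum>K\<in>?KK. \<Sum>j\<in>?J - K. W f * of_bool (hit K j f))"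
        by (simp add: distrib_left sum.distrib sum_distrib_left sum_distrib_right mult.commute)
      also have "(\<Sum>f\<in>?F. \<Sum>K\<in>?KK. \<Sum>j\<in>?J - K. W f * of_bool (hit K j f))
          = (\<Sum>K\<in>?KK. \<Sum>j\<in>?J - K. \<Sum>f\<in>?F. W f * of_bool (hit K j f))"
        apply (subst sum.swap)
        apply (rule sum.cong[OF refl])
        apply (rule sum.swap)
        done
      also have "\<dots> \<le> (\<Sum>K\<in>?KK. \<Sum>j\<in>?J - K. \<beta>)" by (intro sum_mono hitb) auto
      also have "\<dots> \<le> (\<Sum>K\<in>?KK. real m * \<beta>)"
      proof (rule sum_mono)
        fix K assume "K \<in> ?KK"
        have "card (?J - K) \<le> m" using card_mono[of ?J "?J - K"] by auto
        then show "(\<Sum>j\<in>?J - K. \<beta>) \<le> real m * \<beta>" using \<beta> by (simp add: mult_right_mono)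
      qed
      also have "\<dots> = real (m choose ?k) * (real m * \<beta>)" using cardKK by simp
      also have "real m * \<beta> = 1 / (2 * c)" using m1 by (simp add: \<beta>_def)
      finally have "real (m choose ?k) / c \<le> real ((m + 1) ^ d) + real (m choose ?k) * (1 / (2 * c))"
        using W1 by simp
      then have "real (m choose ?k) \<le> 2 * c * real ((m + 1) ^ d)"
        using c1 by (simp add: field_simps)
      moreover have "2 * c * (real ((m + 1) ^ d) + 1) \<le> real (m choose ?k)"
      proof -
        have "real (2 * (p choose ?k) * ((m + 1) ^ d + 1)) \<le> real (m choose ?k)"
          using m(3) of_nat_le_iff by blast
        then show ?thesis by (simp add: c distrib_left)
      qed
      ultimately show False using c1 by (simp add: distrib_left)
    qed
  qed
qed

section \<open>The (p, q)-theorem\<close>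

text \<open>
  The finite minimax argument behind passing from heavy points to a measure: always choose a point that is heavy for the current weights, then
  halve the weights of the sets that contain it. The total weight decays like \<open>(1 - \<beta>/2) ^ R\<close>, so no
  single set can have been missed by most of the points.
\<close>

lemma multiplicative_weights:
  fixes Y :: "'t \<Rightarrow> 'x set" and \<beta> :: real
  assumes T: "finite T" "T \<noteq> {}" and \<beta>: "0 < \<beta>" "\<beta> \<le> 1"
    and ex: "\<And>w. (\<And>t. t \<in> T \<Longrightarrow> 0 \<le> w t) \<Longrightarrow> sum w T = 1 \<Longrightarrow> \<exists>x. \<beta> \<le> sum w {t \<in> T. x \<in> Y t}"
  obtains R xs where "0 < R" "\<And>t. t \<in> T \<Longrightarrow> \<beta> / 4 * real R \<le> real (card {r. r < R \<and> xs r \<in> Y t})"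
proof -
  define h where "h R xs t = card {r. r < R \<and> xs r \<in> Y t}" for R :: nat and xs :: "nat \<Rightarrow> 'x" and t
  have "\<exists>xs. (\<Sum>t\<in>T. (1/2 :: real) ^ h R xs t) \<le> real (card T) * (1 - \<beta>/2) ^ R" for R
  proof (induction R)
    case 0
    then show ?case by (simp add: h_def)
  next
    case (Suc R)
    then obtain xs where xs: "(\<Sum>t\<in>T. (1/2 :: real) ^ h R xs t) \<le> real (card T) * (1 - \<beta>/2) ^ R" by blast
    define W where "W = (\<Sum>t\<in>T. (1/2 :: real) ^ h R xs t)"
    have W: "0 < W" unfolding W_def using T by (intro sum_pos) auto
    obtain x where x: "\<beta> \<le> (\<Sum>t\<in>{t \<in> T. x \<in> Y t}. (1/2) ^ h R xs t / W)"
      using ex[of "\<lambda>t. (1/2) ^ h R xs t / W"] W by (auto simp: W_def sum_divide_distrib[symmetric])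
    then have x': "\<beta> * W \<le> (\<Sum>t\<in>{t \<in> T. x \<in> Y t}. (1/2) ^ h R xs t)"
      using W by (simp add: sum_divide_distrib[symmetric] le_divide_eq)
    let ?xs = "xs(R := x)"
    have h: "h (Suc R) ?xs t = h R xs t + of_bool (x \<in> Y t)" for t
    proof -
      have "{r. r < Suc R \<and> ?xs r \<in> Y t} = {r. r < R \<and> xs r \<in> Y t} \<union> {r. r = R \<and> x \<in> Y t}" by auto
      then have "h (Suc R) ?xs t = card ({r. r < R \<and> xs r \<in> Y t} \<union> {r. r = R \<and> x \<in> Y t})"
        by (simp only: h_def)
      also have "\<dots> = h R xs t + card {r. r = R \<and> x \<in> Y t}"
        unfolding h_def by (rule card_Un_disjoint) auto
      also have "card {r. r = R \<and> x \<in> Y t} = of_bool (x \<in> Y t)" by (cases "x \<in> Y t") auto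
      finally show ?thesis .
    qed
    have "(\<Sum>t\<in>T. (1/2 :: real) ^ h (Suc R) ?xs t)
        = (\<Sum>t\<in>T. (1/2) ^ h R xs t - (if x \<in> Y t then (1/2) ^ h R xs t / 2 else 0))"
      by (intro sum.cong refl) (simp add: h)
    also have "\<dots> = W - (\<Sum>t\<in>{t \<in> T. x \<in> Y t}. (1/2) ^ h R xs t) / 2"
      using T by (simp add: sum_subtractf W_def sum.If_cases Int_def sum_divide_distrib)
    also have "\<dots> \<le> W * (1 - \<beta>/2)" using x' by (simp add: algebra_simps)
    also have "\<dots> \<le> real (card T) * (1 - \<beta>/2) ^ R * (1 - \<beta>/2)"
      using xs \<beta> unfolding W_def by (intro mult_right_mono) auto
    also have "\<dots> = real (card T) * (1 - \<beta>/2) ^ Suc R" by simp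
    finally have "(\<Sum>t\<in>T. (1/2 :: real) ^ h (Suc R) ?xs t) \<le> real (card T) * (1 - \<beta>/2) ^ Suc R" .
    then show ?case by blast
  qed
  then obtain xs where xs: "\<And>R. (\<Sum>t\<in>T. (1/2 :: real) ^ h R (xs R) t) \<le> real (card T) * (1 - \<beta>/2) ^ R"
    by metis
  have n1: "1 \<le> real (card T)" using T by (simp add: Suc_le_eq card_gt_0_iff)
  define R where "R = nat \<lceil>4 * ln (real (card T)) / \<beta>\<rceil> + 1"
  have R: "4 * ln (real (card T)) / \<beta> \<le> real R" unfolding R_def by linarith
  then have R': "ln (real (card T)) \<le> real R * \<beta> / 4" using \<beta> by (simp add: field_simps)
  show thesis
  proof (rule that[of R "xs R"])
    show "0 < R" by (simp add: R_def)
    fix t assume t: "t \<in> T"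
    let ?h = "h R (xs R) t"
    have "(1/2 :: real) ^ ?h \<le> (\<Sum>t\<in>T. (1/2 :: real) ^ h R (xs R) t)"
      using T t by (intro member_le_sum) auto
    also have "\<dots> \<le> real (card T) * (1 - \<beta>/2) ^ R" by (rule xs)
    finally have "ln ((1/2 :: real) ^ ?h) \<le> ln (real (card T) * (1 - \<beta>/2) ^ R)"
      using n1 \<beta> by (subst ln_le_cancel_iff) auto
    then have "real ?h * ln (1/2) \<le> ln (real (card T)) + real R * ln (1 - \<beta>/2)"
      using n1 \<beta> by (simp add: ln_realpow ln_mult_pos)
    moreover have "ln (1 - \<beta>/2) \<le> - \<beta>/2" using ln_add_one_self_le_self2[of "- \<beta>/2"] \<beta> by simp
    then have "real R * ln (1 - \<beta>/2) \<le> real R * (- \<beta>/2)" by (rule mult_left_mono) simp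
    moreover have "ln (1/2 :: real) = - ln 2" by (simp add: ln_div)
    moreover have "real ?h * ln 2 \<le> real ?h" using ln_2_less_1 by (simp add: mult_left_le)
    ultimately have "\<beta> / 4 * real R \<le> real ?h" using R' by (simp add: algebra_simps)
    then show "\<beta> / 4 * real R \<le> real (card {r. r < R \<and> xs R r \<in> Y t})" by (simp add: h_def)
  qed
qed

lemma vc_le_complements:
  assumes "vc_le F d" shows "vc_le ((\<lambda>S. J - S) ` F) d"
  unfolding vc_le_def
proof (intro allI impI)
  fix A assume A: "finite A" "shatters ((\<lambda>S. J - S) ` F) A"
  have AJ: "A \<subseteq> J"
  proof -
    obtain S where "S \<in> (\<lambda>S. J - S) ` F" "S \<inter> A = A" by (rule shattersE[OF A(2) subset_refl])
    then show ?thesis by auto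
  qed
  have "shatters F A" unfolding shatters_def
  proof (intro allI impI)
    fix B assume B: "B \<subseteq> A"
    obtain S' where "S' \<in> (\<lambda>S. J - S) ` F" "S' \<inter> A = A - B" by (rule shattersE[OF A(2), of "A - B"]) auto
    then obtain S where S: "S \<in> F" "(J - S) \<inter> A = A - B" by auto
    have "x \<in> S \<longleftrightarrow> x \<in> B" if "x \<in> A" for x
    proof -
      have "x \<in> (J - S) \<inter> A \<longleftrightarrow> x \<in> A - B" by (simp only: S(2))
      then show ?thesis using that AJ by auto
    qed
    then have "S \<inter> A = B" using B by auto
    then show "\<exists>S\<in>F. S \<inter> A = B" using S(1) by (rule bexI)
  qed
  then show "card A \<le> d" using vc_leD[OF assms A(1)] by simp
qed

text \<open>
  If no \<open>Suc d\<close> points pierced the family, the complements would satisfy the hypothesis of the fractional Helly theorem in the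
  dual family: any \<open>Suc d\<close> points lie in a common complement. So some complement would be heavy.
\<close>

lemma near_full_pierced:
  fixes d :: nat
  obtains \<eta> :: real where "0 < \<eta>" "\<eta> \<le> 1"
    and "\<And>(J :: 'j set) (v :: 'j \<Rightarrow> real) (T :: 't set) Y.
      finite J \<Longrightarrow> (\<And>j. j \<in> J \<Longrightarrow> 0 \<le> v j) \<Longrightarrow> sum v J = 1 \<Longrightarrow> vc_le (Y ` T) d \<Longrightarrow>
      (\<And>t. t \<in> T \<Longrightarrow> sum v {j \<in> J. j \<notin> Y t} < \<eta>) \<Longrightarrow>
      \<exists>P\<subseteq>J. finite P \<and> card P \<le> Suc d \<and> (\<forall>t\<in>T. Y t \<inter> P \<noteq> {})"
proof -
  obtain \<eta> :: real where \<eta>: "0 < \<eta>" "\<eta> \<le> 1"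
    and fh: "\<And>(I :: 'j set) (w :: 'j \<Rightarrow> real) (Y :: 'j \<Rightarrow> 't set).
      finite I \<Longrightarrow> (\<And>i. i \<in> I \<Longrightarrow> 0 \<le> w i) \<Longrightarrow> sum w I = 1 \<Longrightarrow>
      vc_le {{i \<in> I. x \<in> Y i} |x. True} d \<Longrightarrow>
      (\<And>f. f \<in> {..<Suc d} \<rightarrow> I \<Longrightarrow> \<exists>K\<subseteq>{..<Suc d}. card K = Suc d \<and> (\<exists>x. \<forall>j\<in>K. x \<in> Y (f j))) \<Longrightarrow>
      \<exists>x. \<eta> \<le> sum w {i \<in> I. x \<in> Y i}"
    by (rule fractional_Helly[of d "Suc d", where 'i='j and 'x='t]) blast
  show thesis
  proof (rule that[OF \<eta>])
    fix J :: "'j set" and v :: "'j \<Rightarrow> real" and T :: "'t set" and Y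
    assume J: "finite J" "\<And>j. j \<in> J \<Longrightarrow> 0 \<le> v j" "sum v J = 1" and vc: "vc_le (Y ` T) d"
      and full: "\<And>t. t \<in> T \<Longrightarrow> sum v {j \<in> J. j \<notin> Y t} < \<eta>"
    show "\<exists>P\<subseteq>J. finite P \<and> card P \<le> Suc d \<and> (\<forall>t\<in>T. Y t \<inter> P \<noteq> {})"
    proof (rule ccontr)
      assume no: "\<not> ?thesis"
      have "T \<noteq> {}"
      proof
        assume "T = {}"
        then have "{} \<subseteq> J \<and> finite {} \<and> card ({} :: 'j set) \<le> Suc d \<and> (\<forall>t\<in>T. Y t \<inter> {} \<noteq> {})" by simp
        then show False using no by blast
      qed
      then obtain t0 where t0: "t0 \<in> T" by blast
      define Z where "Z t = (if t \<in> T then Y t else Y t0)" for t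
      have "\<exists>x. \<eta> \<le> sum v {j \<in> J. x \<in> {t. j \<notin> Z t}}"
      proof (rule fh)
        have "{{i \<in> J. x \<in> {t. i \<notin> Z t}} |x. True} \<subseteq> (\<lambda>S. J - S) ` (Y ` T)"
          using t0 by (auto simp: Z_def)
        then show "vc_le {{i \<in> J. x \<in> {t. i \<notin> Z t}} |x. True} d"
          using vc_le_mono[OF vc_le_complements[OF vc]] by blast
        fix f :: "nat \<Rightarrow> 'j" assume f: "f \<in> {..<Suc d} \<rightarrow> J"
        have "f ` {..<Suc d} \<subseteq> J" "finite (f ` {..<Suc d})" "card (f ` {..<Suc d}) \<le> Suc d"
          using f card_image_le[of "{..<Suc d}" f] by auto
        then obtain t where t: "t \<in> T" "Y t \<inter> f ` {..<Suc d} = {}" using no by blast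
        have "\<forall>j\<in>{..<Suc d}. t \<in> {t. f j \<notin> Z t}" using t by (auto simp: Z_def)
        then show "\<exists>K\<subseteq>{..<Suc d}. card K = Suc d \<and> (\<exists>x. \<forall>j\<in>K. x \<in> {t. f j \<notin> Z t})"
          by (intro exI[of _ "{..<Suc d}"]) auto
      qed (use J in auto)
      then obtain x where x: "\<eta> \<le> sum v {j \<in> J. j \<notin> Z x}" by auto
      have "Z x = Y (if x \<in> T then x else t0)" by (simp add: Z_def)
      then show False using x full[of "if x \<in> T then x else t0"] t0 by (auto split: if_splits)
    qed
  qed
qed

lemma ex_exponential_small:
  fixes \<delta> :: real
  assumes "0 < \<delta>" "\<delta> \<le> 1"
  shows "\<exists>m. (real ((m + 1) ^ d + 1))\<^sup>2 * (1 - \<delta>) ^ m < 1"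
proof -
  let ?k = "Suc (2 * d)"
  define c where "c = nat \<lceil>4 / \<delta> ^ ?k\<rceil>"
  have c: "4 \<le> real c * \<delta> ^ ?k"
  proof -
    have "4 / \<delta> ^ ?k \<le> real c" unfolding c_def by linarith
    then show ?thesis using assms by (simp add: field_simps)
  qed
  obtain m where m: "?k \<le> m" "c * ((m + 1) ^ (2 * d) + 1) \<le> (m choose ?k)"
    using ex_binomial_large[of 0 "2 * d" c] by auto
  have "real ((m + 1) ^ d + 1) \<le> 2 * real (m + 1) ^ d"
    using one_le_power[of "real (m + 1)" d] by (simp add: add.commute)
  then have "(real ((m + 1) ^ d + 1))\<^sup>2 \<le> (2 * real (m + 1) ^ d)\<^sup>2" by (intro power_mono) auto
  also have "\<dots> = 4 * real (m + 1) ^ (2 * d)" by (simp add: power_mult_distrib power_mult[symmetric] mult.commute)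
  also have "\<dots> < real c * \<delta> ^ ?k * (real (m + 1) ^ (2 * d) + 1)"
  proof -
    have "4 * real (m + 1) ^ (2 * d) < 4 * (real (m + 1) ^ (2 * d) + 1)" by simp
    also have "\<dots> \<le> real c * \<delta> ^ ?k * (real (m + 1) ^ (2 * d) + 1)"
      by (rule mult_right_mono[OF c]) (simp add: add_nonneg_nonneg)
    finally show ?thesis .
  qed
  also have "\<dots> = real (c * ((m + 1) ^ (2 * d) + 1)) * \<delta> ^ ?k"
    by (simp only: of_nat_mult of_nat_add of_nat_power of_nat_1 mult_ac)
  also have "\<dots> \<le> real (m choose ?k) * \<delta> ^ ?k"
    using m(2) assms by (intro mult_right_mono) (simp_all only: of_nat_le_iff zero_le_power less_imp_le)
  also have "\<dots> = (\<Sum>k\<in>{?k}. real (m choose k) * \<delta> ^ k * 1 ^ (m - k))" by simp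
  also have "\<dots> \<le> (\<Sum>k\<le>m. real (m choose k) * \<delta> ^ k * 1 ^ (m - k))"
    using m(1) assms by (intro sum_mono2) auto
  also have "\<dots> = (\<delta> + 1) ^ m" by (rule binomial_ring[symmetric])
  finally have lt: "(real ((m + 1) ^ d + 1))\<^sup>2 < (1 + \<delta>) ^ m" by (simp add: add.commute)
  have "(real ((m + 1) ^ d + 1))\<^sup>2 * (1 - \<delta>) ^ m < 1"
  proof (cases "\<delta> = 1")
    case True
    then show ?thesis using m(1) by (simp add: power_0_left)
  next
    case False
    then have "0 < (1 - \<delta>) ^ m" using assms by simp
    then have "(real ((m + 1) ^ d + 1))\<^sup>2 * (1 - \<delta>) ^ m < (1 + \<delta>) ^ m * (1 - \<delta>) ^ m"
      using lt by (rule mult_strict_right_mono[rotated])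
    also have "\<dots> = (1 - \<delta>\<^sup>2) ^ m" by (simp add: power_mult_distrib[symmetric] algebra_simps power2_eq_square)
    also have "\<dots> \<le> 1" using assms by (intro power_le_one) (auto simp: power_le_one)
    finally show ?thesis .
  qed
  then show ?thesis by blast
qed

text \<open>
  A random sample of \<open>m\<close> points distinguishes all members of a family whose symmetric differences are heavy, except with
  probability at most \<open>K\<^sup>2 (1 - \<delta>) ^ m\<close>; a sample that distinguishes them has as many traces as there are
  members, and traces are few.
\<close>

lemma separated_family_bounded:
  fixes \<delta> :: real
  assumes \<delta>: "0 < \<delta>" "\<delta> \<le> 1"
  obtains K where "\<And>(J :: 'j set) (v :: 'j \<Rightarrow> real) (S :: 't set) Y.
      finite J \<Longrightarrow> (\<And>j. j \<in> J \<Longrightarrow> 0 \<le> v j) \<Longrightarrow> sum v J = 1 \<Longrightarrow> finite S \<Longrightarrow> vc_le (Y ` S) d \<Longrightarrow>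
      (\<And>s s'. s \<in> S \<Longrightarrow> s' \<in> S \<Longrightarrow> s \<noteq> s' \<Longrightarrow> \<delta> \<le> sum v {j \<in> J. (j \<in> Y s) \<noteq> (j \<in> Y s')}) \<Longrightarrow> card S < K"
proof -
  obtain m where m: "(real ((m + 1) ^ d + 1))\<^sup>2 * (1 - \<delta>) ^ m < 1"
    using ex_exponential_small[OF \<delta>] by blast
  let ?K = "(m + 1) ^ d + 1"
  show thesis
  proof (rule that[of ?K], rule ccontr)
    fix J :: "'j set" and v :: "'j \<Rightarrow> real" and S :: "'t set" and Y
    assume J: "finite J" "\<And>j. j \<in> J \<Longrightarrow> 0 \<le> v j" "sum v J = 1" and S: "finite S" and vc: "vc_le (Y ` S) d"
      and sep: "\<And>s s'. s \<in> S \<Longrightarrow> s' \<in> S \<Longrightarrow> s \<noteq> s' \<Longrightarrow> \<delta> \<le> sum v {j \<in> J. (j \<in> Y s) \<noteq> (j \<in> Y s')}"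
      and big: "\<not> card S < ?K"
    from big have "?K \<le> card S" by simp
    then obtain S' where S': "S' \<subseteq> S" "card S' = ?K" by (rule obtain_subset_with_card_n) blast
    have finS': "finite S'" using S' S finite_subset by blast
    let ?J = "{..<m}"
    let ?F = "PiE ?J (\<lambda>_. J)"
    let ?pairs = "{(s, s') \<in> S' \<times> S'. s \<noteq> s'}"
    define V where "V f = (\<Prod>j\<in>?J. v (f j))" for f
    define D where "D = (\<lambda>(s, s'). {j. (j \<in> Y s) \<noteq> (j \<in> Y s')})"
    have V1: "sum V ?F = 1" unfolding V_def using sum_PiE_prod[of ?J J v] J by simp
    have V0: "0 \<le> V f" if "f \<in> ?F" for f unfolding V_def
      using that by (intro prod_nonneg ballI J(2)) auto
    have finp: "finite ?pairs" using finS' by (auto intro: finite_subset[of _ "S' \<times> S'"])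
    have cardp: "real (card ?pairs) \<le> (real ?K)\<^sup>2"
    proof -
      have "card ?pairs \<le> card (S' \<times> S')" by (rule card_mono) (use finS' in auto)
      also have "\<dots> = ?K * ?K" using S' by (simp add: card_cartesian_product)
      finally have "real (card ?pairs) \<le> real (?K * ?K)" by (simp only: of_nat_le_iff)
      then show ?thesis by (simp only: power2_eq_square of_nat_mult)
    qed
    have miss: "(\<Sum>f\<in>?F. V f * of_bool (\<forall>j\<in>?J. f j \<notin> D q)) \<le> (1 - \<delta>) ^ m" if q: "q \<in> ?pairs" for q
    proof -
      have "(\<Sum>f\<in>?F. V f * of_bool (\<forall>j\<in>?J. f j \<notin> D q)) = (\<Sum>f\<in>?F. \<Prod>j\<in>?J. v (f j) * of_bool (f j \<notin> D q))"
      proof (rule sum.cong[OF refl])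
        fix f
        have "(\<Prod>j\<in>?J. of_bool (f j \<notin> D q)) = (of_bool (\<forall>j\<in>?J. f j \<notin> D q) :: real)"
        proof (cases "\<forall>j\<in>?J. f j \<notin> D q")
          case False
          then have "(\<Prod>j\<in>?J. of_bool (f j \<notin> D q)) = (0 :: real)" by (intro prod_zero) auto
          then show ?thesis using False by simp
        qed simp
        then show "V f * of_bool (\<forall>j\<in>?J. f j \<notin> D q) = (\<Prod>j\<in>?J. v (f j) * of_bool (f j \<notin> D q))"
          by (simp only: V_def prod.distrib)
      qed
      also have "\<dots> = (\<Prod>j\<in>?J. \<Sum>i\<in>J. v i * of_bool (i \<notin> D q))"
        by (rule prod_sum_PiE[symmetric]) (use J in auto)
      also have "\<dots> = (\<Sum>i\<in>J. v i * of_bool (i \<notin> D q)) ^ m" by simp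
      also have "\<dots> \<le> (1 - \<delta>) ^ m"
      proof (rule power_mono)
        have "(\<Sum>i\<in>J. v i * of_bool (i \<notin> D q)) + (\<Sum>i\<in>J. v i * of_bool (i \<in> D q)) = sum v J"
          by (subst sum.distrib[symmetric], rule sum.cong) auto
        moreover have "(\<Sum>i\<in>J. v i * of_bool (i \<in> D q)) = sum v {j \<in> J. j \<in> D q}"
          using J by (simp add: of_bool_def sum.If_cases Int_def if_distrib[of "\<lambda>t. _ * t"] cong: if_cong)
        moreover have "\<delta> \<le> sum v {j \<in> J. j \<in> D q}"
        proof -
          obtain s s' where ss: "q = (s, s')" by fastforce
          have "s \<in> S" "s' \<in> S" "s \<noteq> s'" using q S' by (auto simp: ss)
          from sep[OF this] show ?thesis by (simp add: ss D_def)
        qed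
        ultimately show "(\<Sum>i\<in>J. v i * of_bool (i \<notin> D q)) \<le> 1 - \<delta>" using J by simp
        show "0 \<le> (\<Sum>i\<in>J. v i * of_bool (i \<notin> D q))" using J by (intro sum_nonneg) auto
      qed
      finally show ?thesis .
    qed
    have "\<exists>f\<in>?F. \<forall>q\<in>?pairs. \<exists>j\<in>?J. f j \<in> D q"
    proof (rule ccontr)
      assume no: "\<not> ?thesis"
      have "1 = sum V ?F" by (rule V1[symmetric])
      also have "\<dots> \<le> (\<Sum>f\<in>?F. \<Sum>q\<in>?pairs. V f * of_bool (\<forall>j\<in>?J. f j \<notin> D q))"
      proof (rule sum_mono)
        fix f assume f: "f \<in> ?F"
        then obtain q where q: "q \<in> ?pairs" "\<forall>j\<in>?J. f j \<notin> D q" using no by blast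
        have "V f = V f * of_bool (\<forall>j\<in>?J. f j \<notin> D q)" using q(2) by simp
        also have "\<dots> \<le> (\<Sum>q\<in>?pairs. V f * of_bool (\<forall>j\<in>?J. f j \<notin> D q))"
          by (rule member_le_sum[of q]) (use q finp V0[OF f] in auto)
        finally show "V f \<le> (\<Sum>q\<in>?pairs. V f * of_bool (\<forall>j\<in>?J. f j \<notin> D q))" .
      qed
      also have "\<dots> = (\<Sum>q\<in>?pairs. \<Sum>f\<in>?F. V f * of_bool (\<forall>j\<in>?J. f j \<notin> D q))" by (rule sum.swap)
      also have "\<dots> \<le> (\<Sum>q\<in>?pairs. (1 - \<delta>) ^ m)" by (intro sum_mono miss)
      also have "\<dots> = real (card ?pairs) * (1 - \<delta>) ^ m" by simp
      also have "\<dots> \<le> (real ?K)\<^sup>2 * (1 - \<delta>) ^ m" by (intro mult_right_mono cardp) (use \<delta> in simp)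
      also have "\<dots> < 1" by (rule m)
      finally show False by simp
    qed
    then obtain f where f: "f \<in> ?F" "\<forall>q\<in>?pairs. \<exists>j\<in>?J. f j \<in> D q" by blast
    let ?tr = "\<lambda>s. {j \<in> ?J. f j \<in> Y s}"
    have "inj_on ?tr S'"
    proof (rule inj_onI, rule ccontr)
      fix s s' assume s: "s \<in> S'" "s' \<in> S'" "?tr s = ?tr s'" "s \<noteq> s'"
      then obtain j where j: "j \<in> ?J" "f j \<in> D (s, s')" using f(2) by blast
      have "j \<in> ?tr s \<longleftrightarrow> j \<in> ?tr s'" by (simp only: s(3))
      then show False using j by (auto simp: D_def)
    qed
    then have "?K = card (?tr ` S')" using S' by (simp add: card_image)
    also have "\<dots> \<le> card {{j \<in> ?J. f j \<in> A} |A. A \<in> Y ` S}"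
    proof (rule card_mono)
      show "finite {{j \<in> ?J. f j \<in> A} |A. A \<in> Y ` S}" using S by simp
      show "?tr ` S' \<subseteq> {{j \<in> ?J. f j \<in> A} |A. A \<in> Y ` S}" using S' by blast
    qed
    also have "\<dots> \<le> (card ?J + 1) ^ d" by (rule card_traces_le[OF _ vc]) simp
    finally show False by simp
  qed
qed

text \<open>
  Take a maximal family of members that are far apart in measure. It has bounded size, and every other member almost contains one of them in
  measure, relative to which it is nearly full; so a bounded number of points pierces everything near a given
  centre.
\<close>

lemma eps_net:
  fixes \<epsilon> :: real
  assumes \<epsilon>: "0 < \<epsilon>"
  obtains N where "\<And>(J :: 'j set) (v :: 'j \<Rightarrow> real) (T :: 't set) Y.
      finite J \<Longrightarrow> (\<And>j. j \<in> J \<Longrightarrow> 0 \<le> v j) \<Longrightarrow> sum v J = 1 \<Longrightarrow> finite T \<Longrightarrow> vc_le (Y ` T) d \<Longrightarrow>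
      (\<And>t. t \<in> T \<Longrightarrow> Y t \<subseteq> J \<and> \<epsilon> \<le> sum v (Y t)) \<Longrightarrow>
      \<exists>P\<subseteq>J. finite P \<and> card P \<le> N \<and> (\<forall>t\<in>T. Y t \<inter> P \<noteq> {})"
proof -
  obtain \<eta> :: real where \<eta>: "0 < \<eta>" "\<eta> \<le> 1"
    and full: "\<And>(J :: 'j set) (v :: 'j \<Rightarrow> real) (T :: 't set) Y.
      finite J \<Longrightarrow> (\<And>j. j \<in> J \<Longrightarrow> 0 \<le> v j) \<Longrightarrow> sum v J = 1 \<Longrightarrow> vc_le (Y ` T) d \<Longrightarrow>
      (\<And>t. t \<in> T \<Longrightarrow> sum v {j \<in> J. j \<notin> Y t} < \<eta>) \<Longrightarrow>
      \<exists>P\<subseteq>J. finite P \<and> card P \<le> Suc d \<and> (\<forall>t\<in>T. Y t \<inter> P \<noteq> {})"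
    by (rule near_full_pierced[where 'j='j and 't='t]) blast
  define \<delta> where "\<delta> = min 1 (\<epsilon> * \<eta>)"
  have \<delta>: "0 < \<delta>" "\<delta> \<le> 1" "\<delta> \<le> \<epsilon> * \<eta>" using \<epsilon> \<eta> by (auto simp: \<delta>_def)
  obtain K where K: "\<And>(J :: 'j set) (v :: 'j \<Rightarrow> real) (S :: 't set) Y.
      finite J \<Longrightarrow> (\<And>j. j \<in> J \<Longrightarrow> 0 \<le> v j) \<Longrightarrow> sum v J = 1 \<Longrightarrow> finite S \<Longrightarrow> vc_le (Y ` S) d \<Longrightarrow>
      (\<And>s s'. s \<in> S \<Longrightarrow> s' \<in> S \<Longrightarrow> s \<noteq> s' \<Longrightarrow> \<delta> \<le> sum v {j \<in> J. (j \<in> Y s) \<noteq> (j \<in> Y s')}) \<Longrightarrow> card S < K"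
    by (rule separated_family_bounded[OF \<delta>(1,2), where 'j='j and 't='t]) blast
  show thesis
  proof (rule that[of "K * Suc d"])
    fix J :: "'j set" and v :: "'j \<Rightarrow> real" and T :: "'t set" and Y
    assume J: "finite J" "\<And>j. j \<in> J \<Longrightarrow> 0 \<le> v j" "sum v J = 1" and T: "finite T" and vc: "vc_le (Y ` T) d"
      and Y: "\<And>t. t \<in> T \<Longrightarrow> Y t \<subseteq> J \<and> \<epsilon> \<le> sum v (Y t)"
    \<comment> \<open>\<open>df\<close> is the pseudometric given by the measure of the symmetric difference.\<close>
    define df where "df s t = sum v {j \<in> J. (j \<in> Y s) \<noteq> (j \<in> Y t)}" for s t
    let ?sep = "\<lambda>S. S \<subseteq> T \<and> (\<forall>s\<in>S. \<forall>s'\<in>S. s \<noteq> s' \<longrightarrow> \<delta> \<le> df s s')"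
    define \<S> where "\<S> = {S. ?sep S}"
    have "finite \<S>" unfolding \<S>_def by (rule finite_subset[of _ "Pow T"]) (use T in auto)
    moreover have "{} \<in> \<S>" by (simp add: \<S>_def)
    then have "\<S> \<noteq> {}" by blast
    ultimately obtain S where "S \<in> \<S>" and max: "\<forall>S'\<in>\<S>. S \<subseteq> S' \<longrightarrow> S = S'"
      by (auto dest: finite_has_maximal)
    then have S: "?sep S" by (simp add: \<S>_def)
    have Smax: "S' = S" if "?sep S'" "S \<subseteq> S'" for S'
    proof -
      have "S' \<in> \<S>" using that(1) by (simp add: \<S>_def)
      then have "S = S'" using max that(2) by blast
      then show ?thesis by (rule sym)
    qed
    have finS: "finite S" using S T finite_subset by blast
    have "card S < K"
    proof (rule K[OF J finS])
      show "vc_le (Y ` S) d" using S by (intro vc_le_mono[OF vc]) auto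
    qed (use S in \<open>auto simp: df_def\<close>)
    have df_commute: "df s t = df t s" for s t unfolding df_def by (rule arg_cong[of _ _ "sum v"]) auto
    have close: "\<exists>s\<in>S. df s t < \<delta>" if t: "t \<in> T" for t
    proof (rule ccontr)
      assume "\<not> ?thesis"
      then have far: "\<forall>s\<in>S. \<delta> \<le> df s t" by auto
      then have "?sep (insert t S)" using S t df_commute by auto
      then have "insert t S = S" by (rule Smax) auto
      then have "\<delta> \<le> df t t" using far by auto
      then show False using \<delta> by (simp add: df_def)
    qed
    have "\<exists>P\<subseteq>J. finite P \<and> card P \<le> Suc d \<and> (\<forall>t\<in>{t \<in> T. df s t < \<delta>}. Y t \<inter> P \<noteq> {})" if s: "s \<in> S" for s
    proof -
      have sT: "s \<in> T" using S s by auto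
      define M where "M = sum v (Y s)"
      have M: "\<epsilon> \<le> M" "0 < M" using Y[OF sT] \<epsilon> by (auto simp: M_def)
      have "\<exists>P\<subseteq>Y s. finite P \<and> card P \<le> Suc d \<and> (\<forall>t\<in>{t \<in> T. df s t < \<delta>}. Y t \<inter> P \<noteq> {})"
      proof (rule full[of "Y s" "\<lambda>j. v j / M"])
        show "finite (Y s)" using Y[OF sT] J(1) finite_subset by blast
        show "0 \<le> v j / M" if "j \<in> Y s" for j using Y[OF sT] J(2) M that by auto
        show "(\<Sum>j\<in>Y s. v j / M) = 1" using M by (simp add: sum_divide_distrib[symmetric] M_def)
        show "vc_le (Y ` {t \<in> T. df s t < \<delta>}) d" by (rule vc_le_mono[OF vc]) auto
        fix t assume t: "t \<in> {t \<in> T. df s t < \<delta>}"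
        have "sum v {j \<in> Y s. j \<notin> Y t} \<le> df s t" unfolding df_def
          by (rule sum_mono2) (use J Y[OF sT] in auto)
        also have "\<dots> < \<epsilon> * \<eta>" using t \<delta> by simp
        also have "\<dots> \<le> M * \<eta>" using M \<eta> by (simp add: mult_right_mono)
        finally show "(\<Sum>j\<in>{j \<in> Y s. j \<notin> Y t}. v j / M) < \<eta>"
          using M by (simp add: sum_divide_distrib[symmetric] divide_less_eq mult.commute)
      qed
      then show ?thesis using Y[OF sT] by (meson order_trans)
    qed
    then obtain P where P: "\<And>s. s \<in> S \<Longrightarrow> P s \<subseteq> J \<and> finite (P s) \<and> card (P s) \<le> Suc d
        \<and> (\<forall>t\<in>{t \<in> T. df s t < \<delta>}. Y t \<inter> P s \<noteq> {})" by metis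
    have "card (\<Union>s\<in>S. P s) \<le> (\<Sum>s\<in>S. card (P s))" by (rule card_UN_le[OF finS])
    also have "\<dots> \<le> (\<Sum>s\<in>S. Suc d)" using P by (intro sum_mono) auto
    also have "\<dots> = card S * Suc d" by simp
    also have "\<dots> \<le> K * Suc d" using \<open>card S < K\<close> by (intro mult_right_mono) auto
    finally have "card (\<Union>s\<in>S. P s) \<le> K * Suc d" .
    moreover have "\<forall>t\<in>T. Y t \<inter> (\<Union>s\<in>S. P s) \<noteq> {}"
    proof
      fix t assume t: "t \<in> T"
      then obtain s where "s \<in> S" "df s t < \<delta>" using close by blast
      then show "Y t \<inter> (\<Union>s\<in>S. P s) \<noteq> {}" using P[of s] t by blast
    qed
    moreover have "(\<Union>s\<in>S. P s) \<subseteq> J" "finite (\<Union>s\<in>S. P s)" using P finS by auto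
    ultimately show "\<exists>P\<subseteq>J. finite P \<and> card P \<le> K * Suc d \<and> (\<forall>t\<in>T. Y t \<inter> P \<noteq> {})" by blast
  qed
qed

text \<open>
  The \<open>(p, q)\<close>-theorem with \<open>q = Suc d\<close>. Fractional Helly provides a heavy point for every weight on the family,
  multiplicative weights convert these into a finite list of points in which every member is heavy, and an
  \<open>\<epsilon>\<close>-net for that list pierces the family.
\<close>

lemma pq_theorem:
  fixes d p :: nat
  obtains N where "\<And>(T :: 't set) (Y :: 't \<Rightarrow> 'x set).
    finite T \<Longrightarrow> vc_le (Y ` T) d \<Longrightarrow> vc_le {{t \<in> T. x \<in> Y t} |x. True} d \<Longrightarrow>
    (\<And>f. f \<in> {..<p} \<rightarrow> T \<Longrightarrow> \<exists>K\<subseteq>{..<p}. card K = Suc d \<and> (\<exists>x. \<forall>j\<in>K. x \<in> Y (f j))) \<Longrightarrow>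
    \<exists>P. finite P \<and> card P \<le> N \<and> (\<forall>t\<in>T. Y t \<inter> P \<noteq> {})"
proof -
  obtain \<beta> :: real where \<beta>: "0 < \<beta>" "\<beta> \<le> 1"
    and fh: "\<And>(I :: 't set) (w :: 't \<Rightarrow> real) (Y :: 't \<Rightarrow> 'x set).
      finite I \<Longrightarrow> (\<And>i. i \<in> I \<Longrightarrow> 0 \<le> w i) \<Longrightarrow> sum w I = 1 \<Longrightarrow>
      vc_le {{i \<in> I. x \<in> Y i} |x. True} d \<Longrightarrow>
      (\<And>f. f \<in> {..<p} \<rightarrow> I \<Longrightarrow> \<exists>K\<subseteq>{..<p}. card K = Suc d \<and> (\<exists>x. \<forall>j\<in>K. x \<in> Y (f j))) \<Longrightarrow>
      \<exists>x. \<beta> \<le> sum w {i \<in> I. x \<in> Y i}"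
    by (rule fractional_Helly[of d p, where 'i='t and 'x='x]) blast
  have b4: "0 < \<beta> / 4" using \<beta> by simp
  obtain N where N: "\<And>(J :: nat set) (v :: nat \<Rightarrow> real) (T :: 't set) Y.
      finite J \<Longrightarrow> (\<And>j. j \<in> J \<Longrightarrow> 0 \<le> v j) \<Longrightarrow> sum v J = 1 \<Longrightarrow> finite T \<Longrightarrow> vc_le (Y ` T) d \<Longrightarrow>
      (\<And>t. t \<in> T \<Longrightarrow> Y t \<subseteq> J \<and> \<beta> / 4 \<le> sum v (Y t)) \<Longrightarrow>
      \<exists>P\<subseteq>J. finite P \<and> card P \<le> N \<and> (\<forall>t\<in>T. Y t \<inter> P \<noteq> {})"
    by (rule eps_net[OF b4, where 't='t]) blast
  show thesis
  proof (rule that[of N])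
    fix T :: "'t set" and Y :: "'t \<Rightarrow> 'x set"
    assume T: "finite T" and vc: "vc_le (Y ` T) d" and dvc: "vc_le {{t \<in> T. x \<in> Y t} |x. True} d"
      and pk: "\<And>f. f \<in> {..<p} \<rightarrow> T \<Longrightarrow> \<exists>K\<subseteq>{..<p}. card K = Suc d \<and> (\<exists>x. \<forall>j\<in>K. x \<in> Y (f j))"
    show "\<exists>P. finite P \<and> card P \<le> N \<and> (\<forall>t\<in>T. Y t \<inter> P \<noteq> {})"
    proof (cases "T = {}")
      case False
      have ex: "\<exists>x. \<beta> \<le> sum w {t \<in> T. x \<in> Y t}" if "\<And>t. t \<in> T \<Longrightarrow> 0 \<le> w t" "sum w T = 1" for w
        by (rule fh[OF T that dvc pk])
      obtain R xs where R: "0 < R" "\<And>t. t \<in> T \<Longrightarrow> \<beta> / 4 * real R \<le> real (card {r. r < R \<and> xs r \<in> Y t})"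
        using multiplicative_weights[OF T False \<beta> ex] by blast
      define Z where "Z t = {r \<in> {..<R}. xs r \<in> Y t}" for t
      have "\<exists>P\<subseteq>{..<R}. finite P \<and> card P \<le> N \<and> (\<forall>t\<in>T. Z t \<inter> P \<noteq> {})"
      proof (rule N[of _ "\<lambda>_. 1 / real R"])
        have "Z ` T = {{j \<in> {..<R}. xs j \<in> S} |S. S \<in> Y ` T}" by (auto simp: Z_def)
        then show "vc_le (Z ` T) d" by (simp only: vc_le_traces[OF vc])
        fix t assume "t \<in> T"
        then show "Z t \<subseteq> {..<R} \<and> \<beta> / 4 \<le> sum (\<lambda>_. 1 / real R) (Z t)"
          using R(1) R(2)[of t] by (auto simp: Z_def le_divide_eq)
      qed (use R T in auto)
      then obtain P where P: "P \<subseteq> {..<R}" "finite P" "card P \<le> N" "\<forall>t\<in>T. Z t \<inter> P \<noteq> {}" by blast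
      have "card (xs ` P) \<le> N" using card_image_le[OF P(2), of xs] P(3) by simp
      moreover have "\<forall>t\<in>T. Y t \<inter> xs ` P \<noteq> {}" using P(4) by (fastforce simp: Z_def)
      ultimately show ?thesis using P(2) by blast
    qed (auto intro: exI[of _ "{}"])
  qed
qed

section \<open>Unions of dividing families\<close>

definition ultra :: "'b filter \<Rightarrow> bool" where
  "ultra U \<longleftrightarrow> U \<noteq> bot \<and> (\<forall>P. eventually P U \<or> eventually (\<lambda>x. \<not> P x) U)"

lemma ultraD: "ultra U \<Longrightarrow> \<not> eventually P U \<Longrightarrow> eventually (\<lambda>x. \<not> P x) U"
  by (auto simp: ultra_def)

lemma eventually_contradiction:
  assumes "U \<noteq> bot" "eventually P U" "eventually (\<lambda>x. \<not> P x) U" shows False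
proof -
  have "eventually (\<lambda>x. False) U" using assms(2,3) by eventually_elim simp
  then show False using assms(1) by (simp add: trivial_limit_def)
qed

lemma ex_ultra:
  fixes F :: "'b filter"
  assumes "F \<noteq> bot" shows "\<exists>U\<le>F. ultra U"
proof -
  define A where "A = {S :: ('b \<Rightarrow> bool) set. is_filter (\<lambda>P. P \<in> S) \<and> {P. eventually P F} \<subseteq> S \<and> (\<lambda>_. False) \<notin> S}"
  have "{P. eventually P F} \<in> A"
    using assms by (auto simp: A_def is_filter_def eventually_conj trivial_limit_def elim: eventually_mono)
  then have ne: "A \<noteq> {}" by blast
  have "\<exists>M\<in>A. \<forall>X\<in>A. M \<subseteq> X \<longrightarrow> X = M"
  proof (rule subset_Zorn_nonempty[OF ne])
    fix C assume C: "C \<noteq> {}" "subset.chain A C"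
    have CA: "S \<in> A" if "S \<in> C" for S using C(2) that by (auto simp: subset.chain_def)
    have lin: "S \<subseteq> S' \<or> S' \<subseteq> S" if "S \<in> C" "S' \<in> C" for S S'
      using C(2) that by (auto simp: subset.chain_def)
    have "is_filter (\<lambda>P. P \<in> \<Union>C)"
    proof (rule is_filter.intro)
      obtain S where "S \<in> C" using C(1) by blast
      then show "(\<lambda>x. True) \<in> \<Union>C" using CA[of S] by (auto simp: A_def is_filter_def)
    next
      fix P Q assume "P \<in> \<Union>C" "Q \<in> \<Union>C"
      then obtain S S' where S: "S \<in> C" "P \<in> S" "S' \<in> C" "Q \<in> S'" by blast
      then obtain S'' where "S'' \<in> C" "P \<in> S''" "Q \<in> S''" using lin[of S S'] by blast
      then show "(\<lambda>x. P x \<and> Q x) \<in> \<Union>C" using CA[of S''] by (auto simp: A_def is_filter_def)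
    next
      fix P Q assume PQ: "\<forall>x. P x \<longrightarrow> Q x" "P \<in> \<Union>C"
      then obtain S where "S \<in> C" "P \<in> S" by blast
      then have "Q \<in> S" using CA[of S] PQ(1) unfolding A_def is_filter_def by blast
      then show "Q \<in> \<Union>C" using \<open>S \<in> C\<close> by blast
    qed
    moreover have "{P. eventually P F} \<subseteq> \<Union>C"
    proof -
      obtain S where "S \<in> C" using C(1) by blast
      then show ?thesis using CA[of S] by (auto simp: A_def)
    qed
    moreover have "(\<lambda>_. False) \<notin> \<Union>C" using CA by (auto simp: A_def)
    ultimately show "\<Union>C \<in> A" by (simp add: A_def)
  qed
  then obtain M where M: "M \<in> A" and Mmax: "\<And>X. X \<in> A \<Longrightarrow> M \<subseteq> X \<Longrightarrow> X = M" by blast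
  have Mf: "is_filter (\<lambda>P. P \<in> M)" using M by (simp add: A_def)
  have MI: "\<And>P Q. P \<in> M \<Longrightarrow> Q \<in> M \<Longrightarrow> (\<lambda>x. P x \<and> Q x) \<in> M"
    and MM: "\<And>P Q. P \<in> M \<Longrightarrow> \<forall>x. P x \<longrightarrow> Q x \<Longrightarrow> Q \<in> M" and MT: "(\<lambda>_. True) \<in> M"
    using Mf by (auto simp: is_filter_def)
  define U where "U = Abs_filter (\<lambda>P. P \<in> M)"
  have ev: "eventually P U \<longleftrightarrow> P \<in> M" for P unfolding U_def by (rule eventually_Abs_filter[OF Mf])
  have "U \<le> F" using M by (auto simp: le_filter_def ev A_def)
  moreover have "ultra U" unfolding ultra_def
  proof (intro conjI allI)
    show "U \<noteq> bot" using M by (simp add: trivial_limit_def ev A_def)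
    fix P
    show "eventually P U \<or> eventually (\<lambda>x. \<not> P x) U"
    proof (rule ccontr)
      assume no: "\<not> ?thesis"
      define M' where "M' = {Q. \<exists>R\<in>M. \<forall>x. R x \<and> P x \<longrightarrow> Q x}"
      have "is_filter (\<lambda>Q. Q \<in> M')"
      proof (rule is_filter.intro)
        show "(\<lambda>x. True) \<in> M'" using MT by (auto simp: M'_def)
      next
        fix Q Q' assume "Q \<in> M'" "Q' \<in> M'"
        then obtain R R' where "R \<in> M" "\<forall>x. R x \<and> P x \<longrightarrow> Q x" "R' \<in> M" "\<forall>x. R' x \<and> P x \<longrightarrow> Q' x"
          by (auto simp: M'_def)
        then show "(\<lambda>x. Q x \<and> Q' x) \<in> M'" unfolding M'_def mem_Collect_eq
          by (intro bexI[of _ "\<lambda>x. R x \<and> R' x"] MI) auto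
      next
        fix Q Q' assume "\<forall>x. Q x \<longrightarrow> Q' x" "Q \<in> M'"
        then show "Q' \<in> M'" unfolding M'_def by blast
      qed
      moreover have "M \<subseteq> M'" unfolding M'_def by blast
      moreover have "{P. eventually P F} \<subseteq> M'" using M \<open>M \<subseteq> M'\<close> by (auto simp: A_def)
      moreover have "(\<lambda>_. False) \<notin> M'"
      proof
        assume "(\<lambda>_. False) \<in> M'"
        then obtain R where "R \<in> M" "\<forall>x. R x \<and> P x \<longrightarrow> False" unfolding M'_def by blast
        then have "(\<lambda>x. \<not> P x) \<in> M" using MM[of R "\<lambda>x. \<not> P x"] by blast
        then show False using no ev by simp
      qed
      ultimately have "M' = M" by (intro Mmax) (simp_all add: A_def)
      moreover have "P \<in> M'" unfolding M'_def using MT by blast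
      ultimately show False using no ev by simp
    qed
  qed
  ultimately show ?thesis by blast
qed

text \<open>
  Iterated quantification along a filter, which is the product filter on lists without having to build it: the head of the list is quantified
  first.
\<close>

primrec almost_all :: "nat \<Rightarrow> 'b filter \<Rightarrow> ('b list \<Rightarrow> bool) \<Rightarrow> bool" where
  "almost_all 0 U P \<longleftrightarrow> P []"
| "almost_all (Suc m) U P \<longleftrightarrow> eventually (\<lambda>s. almost_all m U (\<lambda>xs. P (s # xs))) U"

lemma almost_all_mono:
  "almost_all m U P \<Longrightarrow> (\<And>xs. length xs = m \<Longrightarrow> P xs \<Longrightarrow> Q xs) \<Longrightarrow> almost_all m U Q"
proof (induction m arbitrary: P Q)
  case (Suc m)
  have "eventually (\<lambda>s. almost_all m U (\<lambda>xs. P (s # xs))) U" using Suc.prems(1) by simp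
  then have "eventually (\<lambda>s. almost_all m U (\<lambda>xs. Q (s # xs))) U"
    by (rule eventually_mono) (erule Suc.IH, simp add: Suc.prems(2))
  then show ?case by simp
qed simp

lemma almost_all_True: "almost_all m U (\<lambda>_. True)"
  by (induction m) simp_all

lemma almost_all_conj: "almost_all m U P \<Longrightarrow> almost_all m U Q \<Longrightarrow> almost_all m U (\<lambda>xs. P xs \<and> Q xs)"
proof (induction m arbitrary: P Q)
  case (Suc m)
  have "eventually (\<lambda>s. almost_all m U (\<lambda>xs. P (s # xs))) U" "eventually (\<lambda>s. almost_all m U (\<lambda>xs. Q (s # xs))) U"
    using Suc.prems by simp_all
  then have "eventually (\<lambda>s. almost_all m U (\<lambda>xs. P (s # xs) \<and> Q (s # xs))) U"
    by eventually_elim (rule Suc.IH)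
  then show ?case by simp
qed simp

lemma almost_all_ball: "finite A \<Longrightarrow> (\<And>a. a \<in> A \<Longrightarrow> almost_all m U (P a)) \<Longrightarrow> almost_all m U (\<lambda>xs. \<forall>a\<in>A. P a xs)"
proof (induction A rule: finite_induct)
  case empty
  then show ?case by (simp add: almost_all_True)
next
  case (insert a A)
  have "almost_all m U (\<lambda>xs. P a xs \<and> (\<forall>a\<in>A. P a xs))" using insert by (intro almost_all_conj) auto
  then show ?case by simp
qed

lemma almost_all_not: "ultra U \<Longrightarrow> \<not> almost_all m U P \<Longrightarrow> almost_all m U (\<lambda>xs. \<not> P xs)"
proof (induction m arbitrary: P)
  case (Suc m)
  then have "eventually (\<lambda>s. \<not> almost_all m U (\<lambda>xs. P (s # xs))) U" by (auto dest: ultraD)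
  then have "eventually (\<lambda>s. almost_all m U (\<lambda>xs. \<not> P (s # xs))) U"
    by (rule eventually_mono) (rule Suc.IH[OF Suc.prems(1)])
  then show ?case by simp
qed simp

lemma almost_all_ex: "U \<noteq> bot \<Longrightarrow> almost_all m U P \<Longrightarrow> \<exists>xs. length xs = m \<and> P xs"
proof (induction m arbitrary: P)
  case (Suc m)
  have "eventually (\<lambda>s. almost_all m U (\<lambda>xs. P (s # xs))) U" using Suc.prems by simp
  then obtain s where "almost_all m U (\<lambda>xs. P (s # xs))" using Suc.prems(1) eventually_happens' by blast
  then obtain xs where "length xs = m" "P (s # xs)" using Suc.IH[OF Suc.prems(1)] by blast
  then have "length (s # xs) = Suc m \<and> P (s # xs)" by simp
  then show ?case by blast
qed simp

lemma almost_all_all: "eventually E U \<Longrightarrow> almost_all m U (\<lambda>xs. \<forall>x\<in>set xs. E x)"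
proof (induction m)
  case (Suc m)
  have "eventually (\<lambda>s. almost_all m U (\<lambda>xs. E s \<and> (\<forall>x\<in>set xs. E x))) U"
    using Suc.prems
  proof eventually_elim
    case (elim s)
    show ?case by (rule almost_all_mono[OF Suc.IH[OF Suc.prems]]) (use elim in auto)
  qed
  then show ?case by simp
qed simp

lemma power_lt_two_power: "\<exists>m. (2 * k * m + 1) ^ d < (2 :: nat) ^ m"
proof -
  obtain m where m: "(2 * k + 1) ^ d * ((m + 1) ^ d + 1) \<le> (m choose Suc d)" "Suc d \<le> m"
    using ex_binomial_large[of 0 d "(2 * k + 1) ^ d"] by blast
  have "(2 * k * m + 1) ^ d \<le> ((2 * k + 1) * (m + 1)) ^ d" by (intro power_mono) auto
  also have "\<dots> = (2 * k + 1) ^ d * (m + 1) ^ d" by (rule power_mult_distrib)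
  also have "\<dots> < (2 * k + 1) ^ d * ((m + 1) ^ d + 1)" by simp
  also have "\<dots> \<le> (m choose Suc d)" by (rule m(1))
  also have "\<dots> \<le> (\<Sum>i\<le>m. m choose i)" by (rule member_le_sum) (use m(2) in auto)
  also have "\<dots> = 2 ^ m" by (rule choose_row_sum)
  finally show ?thesis by blast
qed

definition k_inconsistent_upto :: "nat \<Rightarrow> ('b \<Rightarrow> 'c set) \<Rightarrow> nat \<Rightarrow> (nat \<Rightarrow> 'b) \<Rightarrow> bool" where
  "k_inconsistent_upto k Z p s \<longleftrightarrow> (\<forall>I\<subseteq>{..<p}. card I = k \<longrightarrow> \<not> (\<exists>x. \<forall>i\<in>I. x \<in> Z (s i)))"

lemma k_inconsistent_upto_reindex:
  assumes "k_inconsistent_upto k Z q s" "inj_on f {..<p}" "f ` {..<p} \<subseteq> {..<q}" shows "k_inconsistent_upto k Z p (\<lambda>i. s (f i))"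
  unfolding k_inconsistent_upto_def
proof (intro allI impI)
  fix I assume I: "I \<subseteq> {..<p}" "card I = k"
  have "f ` I \<subseteq> {..<q}" using I(1) assms(3) by blast
  moreover have "card (f ` I) = k" using I inj_on_subset[OF assms(2)] by (metis card_image)
  ultimately have "\<not> (\<exists>x. \<forall>i\<in>f ` I. x \<in> Z (s i))" using assms(1) unfolding k_inconsistent_upto_def by blast
  then show "\<not> (\<exists>x. \<forall>i\<in>I. x \<in> Z (s (f i)))" by simp
qed

text \<open>
  Count the paths through an array with \<open>m\<close> inconsistent rows of length \<open>2 * k\<close>, each path being realised by a point. The
  trace of a point meets every row in fewer than \<open>k\<close> places, so a trace accounts for at most \<open>k ^ m\<close> of the \<open>(2 * k) ^ m\<close>
  paths, which requires \<open>2 ^ m\<close> traces. There are only polynomially many.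
\<close>

lemma no_consistent_array:
  assumes vc: "vc_le {{t. x \<in> Z t} |x. True} d" and k: "0 < k"
    and big: "(2 * k * m + 1) ^ d < (2 :: nat) ^ m"
    and Rs: "length Rs = m" "\<And>R. R \<in> set Rs \<Longrightarrow> k_inconsistent_upto k Z (2 * k) R"
    and paths: "\<And>cs. length cs = m \<Longrightarrow> (\<forall>c\<in>set cs. c < 2 * k) \<Longrightarrow>
      \<exists>x. \<forall>t\<in>set (map2 (\<lambda>R c. R c) Rs cs). x \<in> Z t"
  shows False
proof -
  let ?l = "2 * k"
  let ?J = "{..<m} \<times> {..<?l}"
  let ?P = "PiE {..<m} (\<lambda>_. {..<?l})"
  define g where "g = (\<lambda>(j, c). (Rs ! j) c)"
  have "\<exists>x. \<forall>j<m. x \<in> Z (g (j, f j))" if f: "f \<in> ?P" for f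
  proof -
    have "\<forall>c\<in>set (map f [0..<m]). c < ?l" using f by (auto simp: PiE_iff)
    then obtain x where x: "\<forall>t\<in>set (map2 (\<lambda>R c. R c) Rs (map f [0..<m])). x \<in> Z t"
      using paths[of "map f [0..<m]"] by auto
    have "x \<in> Z (g (j, f j))" if j: "j < m" for j
    proof -
      have "map2 (\<lambda>R c. R c) Rs (map f [0..<m]) ! j = g (j, f j)" using j Rs(1) by (simp add: g_def)
      moreover have "map2 (\<lambda>R c. R c) Rs (map f [0..<m]) ! j \<in> set (map2 (\<lambda>R c. R c) Rs (map f [0..<m]))"
        by (rule nth_mem) (use j Rs(1) in simp)
      ultimately show ?thesis using x by metis
    qed
    then show ?thesis by blast
  qed
  then obtain pt where pt: "\<And>f j. f \<in> ?P \<Longrightarrow> j < m \<Longrightarrow> pt f \<in> Z (g (j, f j))" by metis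
  define tr where "tr f = {q \<in> ?J. g q \<in> {t. pt f \<in> Z t}}" for f
  have finP: "finite ?P" by (simp add: finite_PiE)
  have fib: "card {h \<in> ?P. tr h = tr f} \<le> k ^ m" if f: "f \<in> ?P" for f
  proof -
    let ?S = "\<lambda>j. {c. (j, c) \<in> tr f}"
    have Sfin: "finite (?S j)" for j by (rule finite_subset[of _ "{..<?l}"]) (auto simp: tr_def)
    have Scard: "card (?S j) \<le> k" if j: "j < m" for j
    proof (rule ccontr)
      assume "\<not> ?thesis"
      then have "k \<le> card (?S j)" by simp
      then obtain I where I: "I \<subseteq> ?S j" "card I = k" by (rule obtain_subset_with_card_n) blast
      have "I \<subseteq> {..<?l}" using I(1) by (auto simp: tr_def)
      moreover have "\<forall>c\<in>I. pt f \<in> Z ((Rs ! j) c)" using I(1) by (auto simp: tr_def g_def)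
      moreover have "Rs ! j \<in> set Rs" using j Rs(1) by simp
      ultimately show False using Rs(2)[of "Rs ! j"] I(2) unfolding k_inconsistent_upto_def by blast
    qed
    have "{h \<in> ?P. tr h = tr f} \<subseteq> PiE {..<m} ?S"
    proof
      fix h assume h: "h \<in> {h \<in> ?P. tr h = tr f}"
      have "(j, h j) \<in> tr f" if "j < m" for j
      proof -
        have "(j, h j) \<in> tr h" using h that pt[of h j] by (auto simp: tr_def PiE_iff)
        then show ?thesis using h by simp
      qed
      then show "h \<in> PiE {..<m} ?S" using h by (auto simp: PiE_iff)
    qed
    then have "card {h \<in> ?P. tr h = tr f} \<le> card (PiE {..<m} ?S)"
      by (rule card_mono[rotated]) (simp add: finite_PiE Sfin)
    also have "\<dots> = (\<Prod>j<m. card (?S j))" by (simp add: card_PiE)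
    also have "\<dots> \<le> (\<Prod>j<m. k)" by (rule prod_mono) (use Scard in auto)
    finally show ?thesis by simp
  qed
  have traces: "card (tr ` ?P) \<le> (2 * k * m + 1) ^ d"
  proof -
    let ?F = "{{t. x \<in> Z t} |x. True}"
    have "tr ` ?P \<subseteq> {{j \<in> ?J. g j \<in> S} |S. S \<in> ?F}" unfolding tr_def by blast
    moreover have "finite {{j \<in> ?J. g j \<in> S} |S. S \<in> ?F}" by (rule finite_subset[of _ "Pow ?J"]) auto
    ultimately have "card (tr ` ?P) \<le> card {{j \<in> ?J. g j \<in> S} |S. S \<in> ?F}" by (intro card_mono)
    also have "\<dots> \<le> (card ?J + 1) ^ d" by (rule card_traces_le[OF _ vc]) simp
    finally show ?thesis by (simp add: card_cartesian_product mult_ac)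
  qed
  have "(2 * k) ^ m = card ?P" by (simp add: card_PiE)
  also have "?P = (\<Union>\<tau>\<in>tr ` ?P. {h \<in> ?P. tr h = \<tau>})" by auto
  also have "card \<dots> \<le> (\<Sum>\<tau>\<in>tr ` ?P. card {h \<in> ?P. tr h = \<tau>})"
    by (rule card_UN_le) (use finP in simp)
  also have "\<dots> \<le> (\<Sum>\<tau>\<in>tr ` ?P. k ^ m)" by (rule sum_mono) (use fib in auto)
  also have "\<dots> = card (tr ` ?P) * k ^ m" by simp
  also have "\<dots> \<le> (2 * k * m + 1) ^ d * k ^ m" by (rule mult_right_mono[OF traces]) simp
  also have "\<dots> < 2 ^ m * k ^ m" using big k by simp
  finally show False by (simp add: power_mult_distrib)
qed

text \<open>
  If the filter supports arbitrarily long \<open>k\<close>-inconsistent sequences, it can be refined to an ultrafilter \<open>U\<close> that is an ultraproduct of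
  the sequences: first choose a place \<open>i\<close> in the sequence, then the sequence. If finite lists of
  \<open>U\<close>-generic elements were consistent, an array with inconsistent rows and consistent paths would exist.
\<close>

lemma iterated_inconsistent:
  fixes F :: "'b filter" and Z :: "'b \<Rightarrow> 'c set"
  assumes F: "F \<noteq> bot"
    and inc: "\<And>P p. eventually P F \<Longrightarrow> \<exists>s. (\<forall>i<p. P (s i)) \<and> k_inconsistent_upto k Z p s"
    and vc: "vc_le {{t. x \<in> Z t} |x. True} d"
  obtains U m where "ultra U" "U \<le> F" "almost_all m U (\<lambda>xs. \<not> (\<exists>x. \<forall>t\<in>set xs. x \<in> Z t))"
proof (rule ccontr)
  assume "\<not> thesis"
  then have cons: "almost_all m U (\<lambda>xs. \<exists>x. \<forall>t\<in>set xs. x \<in> Z t)" if "ultra U" "U \<le> F" for U m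
    using that almost_all_not[of U m "\<lambda>xs. \<exists>x. \<forall>t\<in>set xs. x \<in> Z t"] \<open>\<And>U m. ultra U \<Longrightarrow> U \<le> F \<Longrightarrow> almost_all m U (\<lambda>xs. \<not> (\<exists>x. \<forall>t\<in>set xs. x \<in> Z t)) \<Longrightarrow> thesis\<close>
    by blast
  have k: "0 < k"
  proof (rule ccontr)
    assume "\<not> 0 < k"
    moreover have "\<not> k_inconsistent_upto 0 Z 0 s" for s by (auto simp: k_inconsistent_upto_def)
    ultimately show False using inc[of "\<lambda>_. True" 0] by simp
  qed
  \<comment> \<open>\<open>H\<close> is generated by the sets of long inconsistent sequences with entries in a given large set.\<close>
  define H where "H = (INF q\<in>{P. eventually P F} \<times> (UNIV :: nat set).
      principal {s. (\<forall>i<snd q. fst q (s i)) \<and> k_inconsistent_upto k Z (snd q) s})"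
  have evH: "eventually Q H \<longleftrightarrow> (\<exists>q\<in>{P. eventually P F} \<times> (UNIV :: nat set).
      eventually Q (principal {s. (\<forall>i<snd q. fst q (s i)) \<and> k_inconsistent_upto k Z (snd q) s}))" for Q
    unfolding H_def
  proof (rule eventually_INF_base)
    show "{P. eventually P F} \<times> (UNIV :: nat set) \<noteq> {}" by (auto intro: exI[of _ "\<lambda>_. True"])
    fix a b assume ab: "a \<in> {P. eventually P F} \<times> (UNIV :: nat set)" "b \<in> {P. eventually P F} \<times> (UNIV :: nat set)"
    let ?c = "(\<lambda>x. fst a x \<and> fst b x, max (snd a) (snd b))"
    have "?c \<in> {P. eventually P F} \<times> UNIV" using ab by (auto intro: eventually_conj)
    moreover have "k_inconsistent_upto k Z (max (snd a) (snd b)) s \<Longrightarrow> k_inconsistent_upto k Z (snd a) s \<and> k_inconsistent_upto k Z (snd b) s" for s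
      using k_inconsistent_upto_reindex[of k Z "max (snd a) (snd b)" s "\<lambda>i. i"] by auto
    ultimately show "\<exists>x\<in>{P. eventually P F} \<times> (UNIV :: nat set).
        principal {s. (\<forall>i<snd x. fst x (s i)) \<and> k_inconsistent_upto k Z (snd x) s}
        \<le> inf (principal {s. (\<forall>i<snd a. fst a (s i)) \<and> k_inconsistent_upto k Z (snd a) s})
             (principal {s. (\<forall>i<snd b. fst b (s i)) \<and> k_inconsistent_upto k Z (snd b) s})"
      by (intro bexI[of _ ?c]) auto
  qed
  have "H \<noteq> bot"
  proof
    assume "H = bot"
    then have "eventually (\<lambda>_. False) H" by simp
    then obtain q where q: "eventually (fst q) F" "{s. (\<forall>i<snd q. fst q (s i)) \<and> k_inconsistent_upto k Z (snd q) s} = {}"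
      unfolding evH by (auto simp: eventually_principal)
    then show False using inc[OF q(1), of "snd q"] by blast
  qed
  then obtain V where V: "V \<le> H" "ultra V" using ex_ultra by blast
  obtain W where W: "W \<le> (sequentially :: nat filter)" "ultra W"
    using ex_ultra[of "sequentially :: nat filter"] by auto
  define U where "U = Abs_filter (\<lambda>P. eventually (\<lambda>i. eventually (\<lambda>s. P (s i)) V) W)"
  have "is_filter (\<lambda>P. eventually (\<lambda>i. eventually (\<lambda>s. P (s i)) V) W)"
  proof (rule is_filter.intro)
    fix P Q assume "eventually (\<lambda>i. eventually (\<lambda>s. P (s i)) V) W" "eventually (\<lambda>i. eventually (\<lambda>s. Q (s i)) V) W"
    then show "eventually (\<lambda>i. eventually (\<lambda>s. P (s i) \<and> Q (s i)) V) W"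
      by eventually_elim (rule eventually_conj)
  next
    fix P Q :: "'b \<Rightarrow> bool"
    assume PQ: "\<forall>x. P x \<longrightarrow> Q x" and "eventually (\<lambda>i. eventually (\<lambda>s. P (s i)) V) W"
    from this(2) show "eventually (\<lambda>i. eventually (\<lambda>s. Q (s i)) V) W"
      by (rule eventually_mono) (erule eventually_mono, use PQ in blast)
  qed simp
  then have evU: "eventually P U \<longleftrightarrow> eventually (\<lambda>i. eventually (\<lambda>s. P (s i)) V) W" for P
    unfolding U_def by (rule eventually_Abs_filter)
  have VN: "V \<noteq> bot" "W \<noteq> bot" using V W by (auto simp: ultra_def)
  have "ultra U" unfolding ultra_def
  proof (intro conjI allI)
    show "U \<noteq> bot"
    proof
      assume "U = bot"
      then have "eventually (\<lambda>_. False) U" by simp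
      then have "eventually (\<lambda>i. eventually (\<lambda>s. False) V) W" by (simp only: evU)
      then have "eventually (\<lambda>s. False) V" using eventually_happens'[OF VN(2)] by blast
      then show False using eventually_happens'[OF VN(1)] by blast
    qed
    fix P
    show "eventually P U \<or> eventually (\<lambda>x. \<not> P x) U"
    proof (cases "eventually P U")
      case False
      then have "eventually (\<lambda>i. \<not> eventually (\<lambda>s. P (s i)) V) W" using ultraD[OF W(2)] by (simp add: evU)
      then have "eventually (\<lambda>i. eventually (\<lambda>s. \<not> P (s i)) V) W"
        by (rule eventually_mono) (rule ultraD[OF V(2)])
      then show ?thesis by (simp add: evU)
    qed simp
  qed
  moreover have "U \<le> F" unfolding le_filter_def
  proof (intro allI impI)
    fix P assume P: "eventually P F"
    have "eventually (\<lambda>s. P (s i)) V" for i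
    proof (rule filter_leD[OF V(1)])
      show "eventually (\<lambda>s. P (s i)) H"
        unfolding evH using P by (intro bexI[of _ "(P, Suc i)"]) (auto simp: eventually_principal)
    qed
    then show "eventually P U" by (simp add: evU)
  qed
  ultimately have consU: "almost_all m U (\<lambda>xs. \<exists>x. \<forall>t\<in>set xs. x \<in> Z t)" for m by (rule cons)
  have kincV: "eventually (k_inconsistent_upto k Z p) V" for p
  proof (rule filter_leD[OF V(1)])
    show "eventually (k_inconsistent_upto k Z p) H"
      unfolding evH by (intro bexI[of _ "(\<lambda>_. True, p)"]) (auto simp: eventually_principal)
  qed
  have array: "\<exists>Rs. length Rs = m \<and> (\<forall>R\<in>set Rs. k_inconsistent_upto k Z l R) \<and>
      (\<forall>cs. length cs = m \<longrightarrow> (\<forall>c\<in>set cs. c < l) \<longrightarrow> Q (map2 (\<lambda>R c. R c) Rs cs))"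
    if "almost_all m U Q" for m l Q
    using that
  proof (induction m arbitrary: Q)
    case (Suc m)
    define A where "A = {i. eventually (\<lambda>s. almost_all m U (\<lambda>xs. Q (s i # xs))) V}"
    have evA: "eventually (\<lambda>i. i \<in> A) W" using Suc.prems by (simp add: evU A_def)
    have "infinite A"
    proof
      assume "finite A"
      then obtain N where "\<forall>i\<in>A. i < N" using finite_nat_set_iff_bounded by blast
      moreover have "eventually (\<lambda>i. N \<le> i) W" using filter_leD[OF W(1)] eventually_ge_at_top by blast
      then have "eventually (\<lambda>i. i \<in> A \<and> N \<le> i) W" using evA by (rule eventually_conj[rotated])
      then obtain i where "i \<in> A" "N \<le> i" using VN(2) eventually_happens' by blast
      ultimately show False by auto
    qed
    then obtain f :: "nat \<Rightarrow> nat" where f: "strict_mono f" "\<forall>n. f n \<in> A" using infinite_enumerate by blast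
    have "eventually (\<lambda>s. \<forall>c\<in>{..<l}. almost_all m U (\<lambda>xs. Q (s (f c) # xs))) V"
      by (rule eventually_ball_finite) (use f(2) in \<open>auto simp: A_def\<close>)
    then have "eventually (\<lambda>s. (\<forall>c\<in>{..<l}. almost_all m U (\<lambda>xs. Q (s (f c) # xs))) \<and> k_inconsistent_upto k Z (f l) s) V"
      using kincV by (rule eventually_conj)
    then obtain s where s: "\<forall>c\<in>{..<l}. almost_all m U (\<lambda>xs. Q (s (f c) # xs))" "k_inconsistent_upto k Z (f l) s"
      using VN(1) eventually_happens' by blast
    have "f ` {..<l} \<subseteq> {..<f l}" using f(1) by (auto simp: strict_mono_def)
    then have R: "k_inconsistent_upto k Z l (\<lambda>c. s (f c))"
      using k_inconsistent_upto_reindex[OF s(2)] strict_mono_imp_inj_on[OF f(1)] inj_on_subset by blast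
    have "almost_all m U (\<lambda>xs. \<forall>c\<in>{..<l}. Q (s (f c) # xs))" by (rule almost_all_ball) (use s in auto)
    then obtain Rs where Rs: "length Rs = m" "\<forall>R\<in>set Rs. k_inconsistent_upto k Z l R"
      "\<forall>cs. length cs = m \<longrightarrow> (\<forall>c\<in>set cs. c < l) \<longrightarrow> (\<forall>c\<in>{..<l}. Q (s (f c) # map2 (\<lambda>R c. R c) Rs cs))"
      using Suc.IH[of "\<lambda>xs. \<forall>c\<in>{..<l}. Q (s (f c) # xs)"] by blast
    show ?case
    proof (intro exI[of _ "(\<lambda>c. s (f c)) # Rs"] conjI allI impI)
      fix cs assume cs: "length cs = Suc m" "\<forall>c\<in>set cs. c < l"
      then obtain c cs' where "cs = c # cs'" by (cases cs) auto
      then show "Q (map2 (\<lambda>R c. R c) ((\<lambda>c. s (f c)) # Rs) cs)" using cs Rs(3) by simp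
    qed (use Rs R in auto)
  qed simp
  obtain m where m: "(2 * k * m + 1) ^ d < (2 :: nat) ^ m" using power_lt_two_power by blast
  obtain Rs where "length Rs = m" "\<forall>R\<in>set Rs. k_inconsistent_upto k Z (2 * k) R"
    "\<forall>cs. length cs = m \<longrightarrow> (\<forall>c\<in>set cs. c < 2 * k) \<longrightarrow> (\<exists>x. \<forall>t\<in>set (map2 (\<lambda>R c. R c) Rs cs). x \<in> Z t)"
    using array[OF consU, of m "2 * k"] by blast
  then show False using no_consistent_array[OF vc k m, of Rs] by blast
qed

text \<open>
  \<open>Sig p S\<close> says that \<open>p\<close> of the sets \<open>X\<close> have their intersection covered by the sets \<open>Y\<close> of the list \<open>S\<close>. The filter decides
  \<open>Sig\<close>, so a property of \<open>U\<close>-generic elements holds already near the filter \<open>F\<close>, where inconsistent instances of \<open>Y\<close> are found.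
  Intersecting the witnesses for these instances removes one element of the list, at the cost of multiplying \<open>p\<close> by \<open>k\<close>.
\<close>

lemma vacate_union:
  fixes F U :: "'b filter" and D0 :: "'b set" and X Y :: "'b \<Rightarrow> 'c set"
  defines "Sig \<equiv> \<lambda>p S. \<exists>es. length es = p \<and> set es \<subseteq> D0 \<and> (\<forall>x. (\<forall>e\<in>set es. x \<in> X e) \<longrightarrow> (\<exists>s\<in>set S. x \<in> Y s))"
  assumes U: "ultra U" "U \<le> F" and evM: "eventually (\<lambda>s. s \<in> M) F"
    and dec: "\<And>p S. 0 < p \<Longrightarrow> set S \<subseteq> M \<Longrightarrow> eventually (\<lambda>s. Sig p (s # S)) F \<or> eventually (\<lambda>s. \<not> Sig p (s # S)) F"
    and qd: "\<And>P. eventually P F \<Longrightarrow> \<exists>es. length es = k \<and> (\<forall>e\<in>set es. P e) \<and> \<not> (\<exists>x. \<forall>e\<in>set es. x \<in> Y e)"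
    and pos: "0 < k" "0 < p"
  shows "set S \<subseteq> M \<Longrightarrow> almost_all m U (\<lambda>xs. Sig p (xs @ S)) \<Longrightarrow> Sig (k ^ m * p) S"
proof (induction m arbitrary: S)
  case (Suc m)
  have Un: "U \<noteq> bot" using U by (auto simp: ultra_def)
  have "eventually (\<lambda>s. almost_all m U (\<lambda>xs. Sig p (s # xs @ S))) U" using Suc.prems(2) by simp
  moreover have "eventually (\<lambda>s. s \<in> M) U" using filter_leD[OF U(2) evM] .
  ultimately have evS: "eventually (\<lambda>s. Sig (k ^ m * p) (s # S)) U"
  proof eventually_elim
    case (elim s)
    have "set (s # S) \<subseteq> M" using elim(2) Suc.prems(1) by simp
    moreover have "almost_all m U (\<lambda>xs. Sig p (xs @ s # S))"
    proof (rule almost_all_mono[OF elim(1)])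
      fix xs assume "Sig p (s # xs @ S)"
      then show "Sig p (xs @ s # S)" unfolding Sig_def by (simp add: disj_ac bex_Un)
    qed
    ultimately show ?case by (rule Suc.IH)
  qed
  let ?q = "k ^ m * p"
  have q: "0 < ?q" using pos by simp
  have "eventually (\<lambda>s. Sig ?q (s # S)) F"
  proof (rule ccontr)
    assume "\<not> ?thesis"
    then have "eventually (\<lambda>s. \<not> Sig ?q (s # S)) F" using dec[OF q Suc.prems(1)] by blast
    then show False using eventually_contradiction[OF Un evS] filter_leD[OF U(2)] by blast
  qed
  then obtain es where es: "length es = k" "\<forall>e\<in>set es. Sig ?q (e # S)" "\<not> (\<exists>x. \<forall>e\<in>set es. x \<in> Y e)"
    using qd by blast
  from es(2) have "\<forall>e\<in>set es. \<exists>ds. length ds = ?q \<and> set ds \<subseteq> D0 \<and>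
      (\<forall>x. (\<forall>t\<in>set ds. x \<in> X t) \<longrightarrow> (\<exists>s\<in>set (e # S). x \<in> Y s))" by (simp only: Sig_def)
  then obtain ds where ds: "\<forall>e\<in>set es. length (ds e) = ?q \<and> set (ds e) \<subseteq> D0 \<and>
      (\<forall>x. (\<forall>t\<in>set (ds e). x \<in> X t) \<longrightarrow> (\<exists>s\<in>set (e # S). x \<in> Y s))" by metis
  let ?L = "concat (map ds es)"
  have "length ?L = k * ?q"
  proof -
    have "length ?L = sum_list (map (\<lambda>e. length (ds e)) es)" by (simp add: length_concat comp_def)
    also have "map (\<lambda>e. length (ds e)) es = map (\<lambda>_. ?q) es" using ds by simp
    also have "sum_list \<dots> = k * ?q" using es(1) by (simp add: sum_list_triv)
    finally show ?thesis .
  qed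
  moreover have "set ?L \<subseteq> D0" using ds by auto
  moreover have "\<forall>x. (\<forall>t\<in>set ?L. x \<in> X t) \<longrightarrow> (\<exists>s\<in>set S. x \<in> Y s)"
  proof (intro allI impI)
    fix x assume x: "\<forall>t\<in>set ?L. x \<in> X t"
    obtain e where e: "e \<in> set es" "x \<notin> Y e" using es(3) by blast
    have "\<forall>t\<in>set (ds e). x \<in> X t" using x e(1) by auto
    then have "\<exists>s\<in>set (e # S). x \<in> Y s" using ds e(1) by blast
    then show "\<exists>s\<in>set S. x \<in> Y s" using e(2) by simp
  qed
  ultimately have "length ?L = k * ?q \<and> set ?L \<subseteq> D0 \<and> (\<forall>x. (\<forall>t\<in>set ?L. x \<in> X t) \<longrightarrow> (\<exists>s\<in>set S. x \<in> Y s))"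
    by blast
  then have "Sig (k * ?q) S" unfolding Sig_def by blast
  then show ?case by (simp add: mult_ac)
qed simp

text \<open>
  A long generic list is inconsistent for \<open>Z\<close>, so the corresponding intersection of the sets \<open>X \<subseteq> Y \<union> Z\<close> is covered by
  sets \<open>Y\<close>. Removing these one after another leaves an empty intersection of sets \<open>X\<close>. This is the broom argument for
  forking over models.
\<close>

lemma union_of_dividing:
  fixes F :: "'b filter" and D0 :: "'b set" and X Y Z :: "'b \<Rightarrow> 'c set"
  defines "Sig \<equiv> \<lambda>p S. \<exists>es. length es = p \<and> set es \<subseteq> D0 \<and> (\<forall>x. (\<forall>e\<in>set es. x \<in> X e) \<longrightarrow> (\<exists>s\<in>set S. x \<in> Y s))"
  assumes F: "F \<noteq> bot" and evM: "eventually (\<lambda>s. s \<in> M) F" and evD: "eventually (\<lambda>s. s \<in> D0) F"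
    and cover: "\<And>t. t \<in> D0 \<Longrightarrow> X t \<subseteq> Y t \<union> Z t"
    and fip: "\<And>es. set es \<subseteq> D0 \<Longrightarrow> \<exists>x. \<forall>e\<in>set es. x \<in> X e"
    and dec: "\<And>p S. 0 < p \<Longrightarrow> set S \<subseteq> M \<Longrightarrow> eventually (\<lambda>s. Sig p (s # S)) F \<or> eventually (\<lambda>s. \<not> Sig p (s # S)) F"
    and incY: "\<And>P. eventually P F \<Longrightarrow> \<exists>es. length es = k \<and> (\<forall>e\<in>set es. P e) \<and> \<not> (\<exists>x. \<forall>e\<in>set es. x \<in> Y e)"
    and incZ: "\<And>P p. eventually P F \<Longrightarrow> \<exists>s. (\<forall>i<p. P (s i)) \<and> k_inconsistent_upto k' Z p s"
    and vcZ: "vc_le {{t. x \<in> Z t} |x. True} d"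
  shows False
proof -
  obtain U m where U: "ultra U" "U \<le> F" "almost_all m U (\<lambda>xs. \<not> (\<exists>x. \<forall>t\<in>set xs. x \<in> Z t))"
    by (rule iterated_inconsistent[OF F incZ vcZ])
  have "almost_all m U (\<lambda>xs. \<forall>x\<in>set xs. x \<in> D0)" by (rule almost_all_all[OF filter_leD[OF U(2) evD]])
  from almost_all_conj[OF U(3) this] have "almost_all m U (\<lambda>xs. Sig m (xs @ []))"
  proof (rule almost_all_mono)
    fix xs assume xs: "length xs = m" "\<not> (\<exists>x. \<forall>t\<in>set xs. x \<in> Z t) \<and> (\<forall>x\<in>set xs. x \<in> D0)"
    have "\<forall>x. (\<forall>e\<in>set xs. x \<in> X e) \<longrightarrow> (\<exists>s\<in>set (xs @ []). x \<in> Y s)"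
    proof (intro allI impI)
      fix x assume x: "\<forall>e\<in>set xs. x \<in> X e"
      obtain t where t: "t \<in> set xs" "x \<notin> Z t" using xs(2) by blast
      then have "x \<in> Y t" using x xs(2) cover[of t] by blast
      then show "\<exists>s\<in>set (xs @ []). x \<in> Y s" using t(1) by auto
    qed
    then show "Sig m (xs @ [])" unfolding Sig_def using xs by (intro exI[of _ xs]) auto
  qed
  moreover have "0 < m" using U(3) by (cases m) auto
  moreover have "0 < k" using incY[of "\<lambda>_. True"] by (cases k) auto
  ultimately have "Sig (k ^ m * m) []"
    unfolding Sig_def
    by (intro vacate_union[OF U(1,2) evM dec[unfolded Sig_def] incY]) simp_all
  then obtain es where "set es \<subseteq> D0" "\<not> (\<exists>x. \<forall>e\<in>set es. x \<in> X e)" unfolding Sig_def by auto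
  then show False using fip by blast
qed

section \<open>Translates in groups\<close>

lemma (in group) mem_l_coset_iff:
  assumes "g \<in> carrier G" "X \<subseteq> carrier G" "x \<in> carrier G"
  shows "x \<in> g <# X \<longleftrightarrow> inv g \<otimes> x \<in> X"
proof
  assume "x \<in> g <# X"
  then obtain y where "y \<in> X" "x = g \<otimes> y" by (auto simp: l_coset_def)
  then show "inv g \<otimes> x \<in> X" using assms by (auto simp: m_assoc[symmetric])
next
  assume "inv g \<otimes> x \<in> X"
  moreover have "x = g \<otimes> (inv g \<otimes> x)" using assms by (simp add: m_assoc[symmetric])
  ultimately show "x \<in> g <# X" by (auto simp: l_coset_def)
qed

lemma (in group) l_coset_set_mult_UN:
  assumes "g \<in> carrier G" "s \<subseteq> carrier G" "X \<subseteq> carrier G"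
  shows "g <# (s <#> X) = (\<Union>h\<in>s. (g \<otimes> h) <# X)"
  using assms by (auto simp: l_coset_def set_mult_def) (metis m_assoc subsetD)+

text \<open>
  If some finitely many translates \<open>h s X\<close> with \<open>h \<in> t\<close> have no common point, replace \<open>s\<close> by \<open>t s\<close>. A piercing set of the finer family of translates by
  \<open>g h\<close> can be spared any one of its points: a translate by \<open>g\<close> that is met only in that point would contain it
  for every \<open>h \<in> t\<close>.
\<close>

lemma (in group) pierced_translates_thick:
  assumes X: "X \<subseteq> carrier G"
  shows "s \<subseteq> carrier G \<Longrightarrow> finite s \<Longrightarrow>
    (\<And>T. finite T \<Longrightarrow> T \<subseteq> carrier G \<Longrightarrow> \<exists>P. finite P \<and> card P \<le> N \<and> (\<forall>g\<in>T. (g <# (s <#> X)) \<inter> P \<noteq> {})) \<Longrightarrow>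
    \<exists>s'. finite s' \<and> s' \<subseteq> carrier G \<and> (\<forall>T. finite T \<longrightarrow> T \<subseteq> carrier G \<longrightarrow> (\<exists>x. \<forall>g\<in>T. x \<in> g <# (s' <#> X)))"
proof (induction N arbitrary: s)
  case 0
  obtain P :: "'a set" where "finite P" "card P \<le> 0" "\<forall>g\<in>{\<one>}. (g <# (s <#> X)) \<inter> P \<noteq> {}"
    using "0.prems"(3)[of "{\<one>}"] by auto
  then show ?case by simp
next
  case (Suc N)
  show ?case
  proof (cases "\<forall>T. finite T \<longrightarrow> T \<subseteq> carrier G \<longrightarrow> (\<exists>x. \<forall>g\<in>T. x \<in> g <# (s <#> X))")
    case True
    show ?thesis by (intro exI[of _ s] conjI Suc.prems(1,2) True)
  next
    case False
    then obtain t where t: "finite t" "t \<subseteq> carrier G" and no: "\<And>x. \<exists>h\<in>t. x \<notin> h <# (s <#> X)" by auto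
    have sX: "s <#> X \<subseteq> carrier G" using Suc.prems(1) X by (auto simp: set_mult_def)
    have ts: "t <#> s \<subseteq> carrier G" using Suc.prems(1) t by (auto simp: set_mult_def)
    have eq: "g <# ((t <#> s) <#> X) = (\<Union>h\<in>t. (g \<otimes> h) <# (s <#> X))" if "g \<in> carrier G" for g
      using l_coset_set_mult_UN[OF that t(2) sX] set_mult_assoc[OF t(2) Suc.prems(1) X] by simp
    show ?thesis
    proof (rule Suc.IH[OF ts])
      have "t <#> s = (\<lambda>(x, y). x \<otimes> y) ` (t \<times> s)" by (auto simp: set_mult_def)
      then show "finite (t <#> s)" using t(1) Suc.prems(2) by simp
      fix T assume T: "finite T" "T \<subseteq> carrier G"
      let ?T = "(\<lambda>(x, y). x \<otimes> y) ` (T \<times> t)"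
      have "finite ?T" "?T \<subseteq> carrier G" using T t by auto
      then obtain P where P: "finite P" "card P \<le> Suc N" "\<forall>g\<in>?T. (g <# (s <#> X)) \<inter> P \<noteq> {}"
        using Suc.prems(3)[of ?T] by blast
      define p where "p = (SOME p. p \<in> P)"
      have "card (P - {p}) \<le> N"
      proof (cases "P = {}")
        case False
        then have "p \<in> P" unfolding p_def by (simp add: some_in_eq)
        then show ?thesis using P by simp
      qed simp
      moreover have "(g <# ((t <#> s) <#> X)) \<inter> (P - {p}) \<noteq> {}" if g: "g \<in> T" for g
      proof
        assume empty: "(g <# ((t <#> s) <#> X)) \<inter> (P - {p}) = {}"
        have gc: "g \<in> carrier G" using g T by auto
        have "p \<in> (g \<otimes> h) <# (s <#> X)" if h: "h \<in> t" for h
        proof -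
          have "g \<otimes> h \<in> ?T" using g h by force
          then obtain q where q: "q \<in> (g \<otimes> h) <# (s <#> X)" "q \<in> P" using P(3) by blast
          then have "q \<in> g <# ((t <#> s) <#> X)" using eq[OF gc] h by blast
          then have "q = p" using empty q(2) by blast
          then show ?thesis using q(1) by simp
        qed
        then have p: "p \<in> g <# (h <# (s <#> X))" if "h \<in> t" for h
          using that lcos_m_assoc[OF sX gc, of h] t(2) by (metis subsetD)
        obtain h0 where h0: "h0 \<in> t" using no[of p] by blast
        have hX: "h <# (s <#> X) \<subseteq> carrier G" if "h \<in> t" for h
          using that t(2) sX by (auto simp: l_coset_def)
        have pc: "p \<in> carrier G"
          using p[OF h0] hX[OF h0] gc by (auto simp: l_coset_def[of _ g])
        have "inv g \<otimes> p \<in> h <# (s <#> X)" if "h \<in> t" for h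
          using p[OF that] mem_l_coset_iff[OF gc hX[OF that] pc] by simp
        then show False using no[of "inv g \<otimes> p"] by blast
      qed
      ultimately show "\<exists>P. finite P \<and> card P \<le> N \<and> (\<forall>g\<in>T. (g <# ((t <#> s) <#> X)) \<inter> P \<noteq> {})"
        using P(1) by (intro exI[of _ "P - {p}"]) auto
    qed
  qed
qed

text \<open>
  A pair \<open>(f, R)\<close> is good if on each finite part of \<open>R\<close> one element \<open>u\<close> brings all \<open>c f\<close> under \<open>A\<close>, or all \<open>d f\<close> under \<open>B\<close>. If
  no finite union of good sets \<open>R\<close> is everything, an ultrafilter \<open>U\<close> on triples avoids all of them. Take generic triples
  \<open>\<tau>\<^sub>1, ..., \<tau>\<^sub>n\<close> and, for a sequence \<open>e\<close> of bits, let \<open>x\<^sub>e\<close> be the product of the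
  elements \<open>c\<close> or \<open>d\<close> of the triples as chosen by \<open>e\<close>. Badness at each factor says that \<open>A x\<^sub>e y\<^sub>i\<close> fails where \<open>c\<close> was
  chosen, and \<open>B x\<^sub>e y\<^sub>i\<close> fails where \<open>d\<close> was chosen. By the covering hypothesis the \<open>x\<^sub>e\<close> then shatter the \<open>y\<^sub>i\<close>.
\<close>

lemma (in group) shattered_product_cover:
  fixes A B :: "'a \<Rightarrow> 'y \<Rightarrow> bool" and H :: "'a set" and Bs :: "'y set"
  assumes H: "H \<subseteq> carrier G" "\<one> \<in> H" "\<And>x y. x \<in> H \<Longrightarrow> y \<in> H \<Longrightarrow> x \<otimes> y \<in> H"
    and cov: "\<And>u y. u \<in> H \<Longrightarrow> y \<in> Bs \<Longrightarrow> A u y \<or> B u y"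
    and vc: "vc_le {{y \<in> Bs. A u y} |u. u \<in> H} d"
  obtains \<R> where "finite \<R>" "H \<times> H \<times> Bs \<subseteq> (\<Union>(f, R)\<in>\<R>. R)"
    "\<And>f R. (f, R) \<in> \<R> \<Longrightarrow> f \<in> H \<and>
       ((\<forall>R'\<subseteq>R. finite R' \<longrightarrow> (\<exists>u\<in>H. \<forall>(c, d, y)\<in>R'. A (u \<otimes> c \<otimes> f) y)) \<or>
        (\<forall>R'\<subseteq>R. finite R' \<longrightarrow> (\<exists>u\<in>H. \<forall>(c, d, y)\<in>R'. B (u \<otimes> d \<otimes> f) y)))"
proof (rule ccontr)
  assume nthesis: "\<not> thesis"
  let ?T = "H \<times> H \<times> Bs"
  define GA where "GA f R \<longleftrightarrow> (\<forall>R'\<subseteq>R. finite R' \<longrightarrow> (\<exists>u\<in>H. \<forall>(c, d, y)\<in>R'. A (u \<otimes> c \<otimes> f) y))" for f and R :: "('a \<times> 'a \<times> 'y) set"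
  define GB where "GB f R \<longleftrightarrow> (\<forall>R'\<subseteq>R. finite R' \<longrightarrow> (\<exists>u\<in>H. \<forall>(c, d, y)\<in>R'. B (u \<otimes> d \<otimes> f) y))" for f and R :: "('a \<times> 'a \<times> 'y) set"
  define \<G> where "\<G> = {(f, R). f \<in> H \<and> (GA f R \<or> GB f R)}"
  define F where "F = (INF (f, R)\<in>\<G>. principal (?T - R))"
  have oneG: "(\<one>, {}) \<in> \<G>" using H(2) by (auto simp: \<G>_def GA_def)
  have "F \<noteq> bot"
  proof
    assume "F = bot"
    then have "eventually (\<lambda>_. False) F" by simp
    then obtain X where X: "X \<subseteq> \<G>" "finite X" "eventually (\<lambda>_. False) (INF q\<in>X. case q of (f, R) \<Rightarrow> principal (?T - R))"
      unfolding F_def eventually_INF[of _ _ \<G>] by blast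
    have "(INF q\<in>X. case q of (f, R) \<Rightarrow> principal (?T - R)) = (INF q\<in>X. principal (?T - snd q))"
      by (rule INF_cong) auto
    also have "\<dots> = principal (\<Inter>q\<in>X. ?T - snd q)" by (rule INF_principal_finite[OF X(2)])
    finally have "\<forall>\<tau>\<in>(\<Inter>q\<in>X. ?T - snd q). False" using X(3) by (simp only: eventually_principal)
    then have empty: "\<exists>q\<in>X. \<tau> \<notin> ?T - snd q" for \<tau> by blast
    have "?T \<subseteq> (\<Union>(f, R)\<in>X. R)"
    proof
      fix \<tau> assume "\<tau> \<in> ?T"
      then obtain q where "q \<in> X" "\<tau> \<in> snd q" using empty[of \<tau>] by blast
      then show "\<tau> \<in> (\<Union>(f, R)\<in>X. R)" by (auto simp: case_prod_unfold)
    qed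
    then show False using nthesis that[OF X(2)] X(1) unfolding \<G>_def GA_def GB_def by blast
  qed
  then obtain U where U: "U \<le> F" "ultra U" using ex_ultra by blast
  have Un: "U \<noteq> bot" using U(2) by (simp add: ultra_def)
  have avoid: "eventually (\<lambda>\<tau>. \<tau> \<in> ?T - R) U" if "(f, R) \<in> \<G>" for f R
  proof (rule filter_leD[OF U(1)])
    have "F \<le> principal (?T - R)" unfolding F_def using that by (intro INF_lower2[of "(f, R)"]) auto
    then show "eventually (\<lambda>\<tau>. \<tau> \<in> ?T - R) F" by (rule filter_leD) (simp add: eventually_principal)
  qed
  have evT: "eventually (\<lambda>\<tau>. \<tau> \<in> ?T) U" using avoid[OF oneG] by simp
  \<comment> \<open>\<open>val zs f\<close> is the product of the chosen entries, the last one leftmost, times \<open>f\<close>.\<close>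
  define \<pi> where "\<pi> e \<tau> = (if e then fst (snd \<tau>) else fst \<tau>)" for e and \<tau> :: "'a \<times> 'a \<times> 'y"
  define val where "val zs f = foldl (\<lambda>f (\<tau>, e). \<pi> e \<tau> \<otimes> f) f zs" for zs :: "(('a \<times> 'a \<times> 'y) \<times> bool) list" and f
  define cond where "cond \<tau> e x \<longleftrightarrow> (if e then \<not> B x (snd (snd \<tau>)) else \<not> A x (snd (snd \<tau>)))"
    for e and \<tau> :: "'a \<times> 'a \<times> 'y" and x
  have val_Nil: "val [] f = f" and val_Cons: "val ((\<tau>, e) # zs) f = val zs (\<pi> e \<tau> \<otimes> f)" for \<tau> e zs f
    by (simp_all add: val_def)
  have \<pi>H: "\<pi> e \<tau> \<in> H" if "\<tau> \<in> ?T" for e \<tau> using that by (auto simp: \<pi>_def)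
  have valH: "val zs f \<in> H" if "\<forall>z\<in>set zs. fst z \<in> ?T" "f \<in> H" for zs f
    using that
  proof (induction zs arbitrary: f)
    case (Cons z zs)
    then show ?case by (cases z) (auto simp: val_Cons intro!: Cons.IH H(3) \<pi>H)
  qed (simp add: val_Nil)
  have val_eq: "val zs f = val zs \<one> \<otimes> f" if "\<forall>z\<in>set zs. fst z \<in> ?T" "f \<in> H" for zs f
    using that
  proof (induction zs arbitrary: f)
    case (Cons z zs)
    obtain \<tau> e where z: "z = (\<tau>, e)" by (cases z)
    have zs: "\<forall>z\<in>set zs. fst z \<in> ?T" and \<pi>: "\<pi> e \<tau> \<in> H" using Cons.prems \<pi>H[of \<tau> e] z by auto
    have C: "val zs \<one> \<in> carrier G" "\<pi> e \<tau> \<in> carrier G" "f \<in> carrier G"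
      using valH[OF zs H(2)] \<pi> Cons.prems(2) H(1) by auto
    have "val (z # zs) f = val zs \<one> \<otimes> (\<pi> e \<tau> \<otimes> f)"
      unfolding z val_Cons by (rule Cons.IH[OF zs]) (use \<pi> Cons.prems H(3) in auto)
    also have "\<dots> = (val zs \<one> \<otimes> \<pi> e \<tau>) \<otimes> f" using C by (simp add: m_assoc)
    also have "val zs \<one> \<otimes> \<pi> e \<tau> = val zs (\<pi> e \<tau>)" by (rule Cons.IH[OF zs \<pi>, symmetric])
    also have "val zs (\<pi> e \<tau>) = val (z # zs) \<one>" using C by (simp add: z val_Cons)
    finally show ?case .
  qed (use H(1) in \<open>auto simp: val_Nil\<close>)
  have zipT: "\<forall>z\<in>set (zip xs es). fst z \<in> ?T" if "\<forall>x\<in>set xs. x \<in> ?T" for xs :: "('a \<times> 'a \<times> 'y) list" and es :: "bool list"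
  proof
    fix z assume "z \<in> set (zip xs es)"
    then have "fst z \<in> set xs" by (metis prod.collapse set_zip_leftD)
    then show "fst z \<in> ?T" using that by blast
  qed
  \<comment> \<open>Otherwise the set of bad \<open>\<tau>\<close> would itself be a good \<open>R\<close>, with \<open>u\<close> the product of the later factors.\<close>
  have step: "eventually (\<lambda>\<tau>. almost_all m U (\<lambda>xs. cond \<tau> e (val (zip xs es) (\<pi> e \<tau> \<otimes> f)))) U"
    if f: "f \<in> H" for f m e es
  proof (rule ccontr)
    assume "\<not> ?thesis"
    then have "eventually (\<lambda>\<tau>. \<not> almost_all m U (\<lambda>xs. cond \<tau> e (val (zip xs es) (\<pi> e \<tau> \<otimes> f)))) U"
      by (rule ultraD[OF U(2)])
    then have bad: "eventually (\<lambda>\<tau>. almost_all m U (\<lambda>xs. \<not> cond \<tau> e (val (zip xs es) (\<pi> e \<tau> \<otimes> f)))) U"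
      by (rule eventually_mono) (rule almost_all_not[OF U(2)])
    define R where "R = {\<tau> \<in> ?T. almost_all m U (\<lambda>xs. \<not> cond \<tau> e (val (zip xs es) (\<pi> e \<tau> \<otimes> f)))}"
    have common: "\<exists>u\<in>H. \<forall>\<tau>\<in>R'. \<not> cond \<tau> e (u \<otimes> \<pi> e \<tau> \<otimes> f)" if R': "R' \<subseteq> R" "finite R'" for R'
    proof -
      have "almost_all m U (\<lambda>xs. \<forall>\<tau>\<in>R'. \<not> cond \<tau> e (val (zip xs es) (\<pi> e \<tau> \<otimes> f)))"
        by (rule almost_all_ball[OF R'(2)]) (use R'(1) in \<open>auto simp: R_def\<close>)
      from almost_all_ex[OF Un almost_all_conj[OF this almost_all_all[OF evT]]]
      obtain xs where xs: "\<forall>\<tau>\<in>R'. \<not> cond \<tau> e (val (zip xs es) (\<pi> e \<tau> \<otimes> f))" "\<forall>x\<in>set xs. x \<in> ?T"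
        by blast
      have u: "val (zip xs es) \<one> \<in> H" using valH[OF zipT[OF xs(2)] H(2)] .
      have "val (zip xs es) (\<pi> e \<tau> \<otimes> f) = val (zip xs es) \<one> \<otimes> \<pi> e \<tau> \<otimes> f" if "\<tau> \<in> R'" for \<tau>
      proof -
        have \<pi>: "\<pi> e \<tau> \<in> H" using that R'(1) by (intro \<pi>H) (auto simp: R_def)
        have "val (zip xs es) \<one> \<in> carrier G" "\<pi> e \<tau> \<in> carrier G" "f \<in> carrier G" using u \<pi> f H(1) by auto
        then show ?thesis using val_eq[OF zipT[OF xs(2)] H(3)[OF \<pi> f]] by (simp add: m_assoc)
      qed
      then show ?thesis using xs(1) u by auto
    qed
    have "GA f R \<or> GB f R"
    proof (cases e)
      case True
      have "GB f R" unfolding GB_def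
      proof (intro allI impI)
        fix R' assume "R' \<subseteq> R" "finite R'"
        then obtain u where u: "u \<in> H" "\<forall>\<tau>\<in>R'. \<not> cond \<tau> e (u \<otimes> \<pi> e \<tau> \<otimes> f)" using common by blast
        have "\<forall>(c, d, y)\<in>R'. B (u \<otimes> d \<otimes> f) y"
        proof clarify
          fix c d y assume "(c, d, y) \<in> R'"
          then have "\<not> cond (c, d, y) e (u \<otimes> \<pi> e (c, d, y) \<otimes> f)" using u(2) by blast
          then show "B (u \<otimes> d \<otimes> f) y" using True by (simp add: cond_def \<pi>_def)
        qed
        then show "\<exists>u\<in>H. \<forall>(c, d, y)\<in>R'. B (u \<otimes> d \<otimes> f) y" using u(1) by (rule bexI)
      qed
      then show ?thesis ..
    next
      case False
      have "GA f R" unfolding GA_def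
      proof (intro allI impI)
        fix R' assume "R' \<subseteq> R" "finite R'"
        then obtain u where u: "u \<in> H" "\<forall>\<tau>\<in>R'. \<not> cond \<tau> e (u \<otimes> \<pi> e \<tau> \<otimes> f)" using common by blast
        have "\<forall>(c, d, y)\<in>R'. A (u \<otimes> c \<otimes> f) y"
        proof clarify
          fix c d y assume "(c, d, y) \<in> R'"
          then have "\<not> cond (c, d, y) e (u \<otimes> \<pi> e (c, d, y) \<otimes> f)" using u(2) by blast
          then show "A (u \<otimes> c \<otimes> f) y" using False by (simp add: cond_def \<pi>_def)
        qed
        then show "\<exists>u\<in>H. \<forall>(c, d, y)\<in>R'. A (u \<otimes> c \<otimes> f) y" using u(1) by (rule bexI)
      qed
      then show ?thesis ..
    qed
    then have "(f, R) \<in> \<G>" using f by (simp add: \<G>_def)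
    then have "eventually (\<lambda>\<tau>. \<tau> \<in> ?T - R) U" by (rule avoid)
    then have "eventually (\<lambda>\<tau>. \<tau> \<notin> R) U" by (rule eventually_mono) simp
    moreover have "eventually (\<lambda>\<tau>. \<tau> \<in> R) U" using bad evT by eventually_elim (simp add: R_def)
    ultimately show False using eventually_contradiction[OF Un] by blast
  qed
  have all: "almost_all n U (\<lambda>xs. \<forall>i<n. cond (xs ! i) (es ! i) (val (zip xs es) f))"
    if "length es = n" "f \<in> H" for es n f
    using that
  proof (induction n arbitrary: es f)
    case 0
    then show ?case by simp
  next
    case (Suc n)
    obtain e es' where es: "es = e # es'" "length es' = n" using Suc.prems(1) by (cases es) auto
    have "eventually (\<lambda>\<tau>. almost_all n U (\<lambda>xs. \<forall>i<Suc n. cond ((\<tau> # xs) ! i) (es ! i) (val (zip (\<tau> # xs) es) f))) U"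
      using step[OF Suc.prems(2), of n e es'] evT
    proof eventually_elim
      case (elim \<tau>)
      have "\<pi> e \<tau> \<otimes> f \<in> H" using \<pi>H[OF elim(2)] Suc.prems(2) H(3) by blast
      from almost_all_conj[OF elim(1) Suc.IH[OF es(2) this]]
      show ?case by (rule almost_all_mono) (auto simp: es val_Cons less_Suc_eq_0_disj)
    qed
    then show ?case by simp
  qed
  let ?n = "Suc d"
  have "almost_all ?n U (\<lambda>xs. \<forall>es\<in>{es. length es = ?n}. \<forall>i<?n. cond (xs ! i) (es ! i) (val (zip xs es) \<one>))"
  proof (rule almost_all_ball)
    have "finite {es :: bool list. set es \<subseteq> UNIV \<and> length es = ?n}" by (rule finite_lists_length_eq) simp
    then show "finite {es :: bool list. length es = ?n}" by simp
    show "almost_all ?n U (\<lambda>xs. \<forall>i<?n. cond (xs ! i) (es ! i) (val (zip xs es) \<one>))"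
      if "es \<in> {es. length es = ?n}" for es
      using that by (intro all H(2)) simp
  qed
  from almost_all_ex[OF Un almost_all_conj[OF this almost_all_all[OF evT]]]
  obtain xs where xs: "length xs = ?n" "\<forall>x\<in>set xs. x \<in> ?T"
    and pat: "\<And>es i. length es = ?n \<Longrightarrow> i < ?n \<Longrightarrow> cond (xs ! i) (es ! i) (val (zip xs es) \<one>)" by blast
  define y where "y i = snd (snd (xs ! i))" for i
  have yB: "y i \<in> Bs" if "i < ?n" for i
  proof -
    have "xs ! i \<in> ?T" using xs that by auto
    then show ?thesis by (auto simp: y_def)
  qed
  have xH: "val (zip xs es) \<one> \<in> H" for es using valH[OF zipT[OF xs(2)] H(2)] .
  have sh: "A (val (zip xs es) \<one>) (y i) \<longleftrightarrow> es ! i" if "length es = ?n" "i < ?n" for es i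
    using pat[OF that] cov[OF xH[of es] yB[OF that(2)]] by (auto simp: cond_def y_def split: if_splits)
  have "inj_on y {..<?n}"
  proof (rule inj_onI, rule ccontr)
    fix i j assume ij: "i \<in> {..<?n}" "j \<in> {..<?n}" "y i = y j" "i \<noteq> j"
    let ?es = "map (\<lambda>l. l = i) [0..<?n]"
    have nth: "l < ?n \<Longrightarrow> ?es ! l \<longleftrightarrow> l = i" for l by (subst nth_map) (simp_all del: upt_Suc)
    have "?es ! i \<longleftrightarrow> ?es ! j" using sh[of ?es i] sh[of ?es j] ij by (simp del: upt_Suc)
    then show False using nth[of i] nth[of j] ij by simp
  qed
  then have "card (y ` {..<?n}) = ?n" by (simp add: card_image)
  moreover have "shatters {{y \<in> Bs. A u y} |u. u \<in> H} (y ` {..<?n})"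
    unfolding shatters_def
  proof (intro allI impI)
    fix D assume D: "D \<subseteq> y ` {..<?n}"
    let ?es = "map (\<lambda>i. y i \<in> D) [0..<?n]"
    have nth: "i < ?n \<Longrightarrow> ?es ! i \<longleftrightarrow> y i \<in> D" for i by (subst nth_map) (simp_all del: upt_Suc)
    let ?x = "val (zip xs ?es) \<one>"
    have "A ?x (y i) \<longleftrightarrow> y i \<in> D" if "i < ?n" for i
      using sh[of ?es i] nth[OF that] that by (simp del: upt_Suc)
    then have "{y \<in> Bs. A ?x y} \<inter> y ` {..<?n} = D" using D yB by auto
    moreover have "{y \<in> Bs. A ?x y} \<in> {{y \<in> Bs. A u y} |u. u \<in> H}" using xH by blast
    ultimately show "\<exists>S\<in>{{y \<in> Bs. A u y} |u. u \<in> H}. S \<inter> y ` {..<?n} = D" by (rule bexI)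
  qed
  ultimately show False using vc_leD[OF vc, of "y ` {..<?n}"] by simp
qed

section \<open>Definable relations\<close>

lemma vc_le_insert_empty:
  assumes "vc_le F d" shows "vc_le (insert {} F) (Suc d)"
  unfolding vc_le_def
proof (intro allI impI)
  fix A assume A: "finite A" "shatters (insert {} F) A"
  show "card A \<le> Suc d"
  proof (cases "A = {}")
    case False
    then obtain a where a: "a \<in> A" by blast
    have "shatters F (A - {a})" unfolding shatters_def
    proof (intro allI impI)
      fix B assume B: "B \<subseteq> A - {a}"
      then have "insert a B \<subseteq> A" using a by auto
      then obtain S where S: "S \<in> insert {} F" "S \<inter> A = insert a B" by (rule shattersE[OF A(2)])
      then have "S \<noteq> {}" by auto
      then have SF: "S \<in> F" using S(1) by simp
      have "S \<inter> (A - {a}) = (S \<inter> A) - {a}" by auto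
      also have "\<dots> = B" using S(2) B by auto
      finally show "\<exists>S\<in>F. S \<inter> (A - {a}) = B" using SF by (rule bexI)
    qed
    then have "card (A - {a}) \<le> d" using vc_leD[OF assms] A(1) by simp
    then show ?thesis using a A(1) by simp
  qed simp
qed

text \<open>
  Renaming of variables. Under a quantifier the index \<open>0\<close> is kept and the others are shifted.
\<close>

primrec ren_tm :: "(nat \<Rightarrow> nat) \<Rightarrow> 'f tm \<Rightarrow> 'f tm" where
  "ren_tm f (Var i) = Var (f i)"
| "ren_tm f (Fn g ts) = Fn g (map (ren_tm f) ts)"

primrec ren :: "(nat \<Rightarrow> nat) \<Rightarrow> ('f, 'r) fm \<Rightarrow> ('f, 'r) fm" where
  "ren f (Equal s t) = Equal (ren_tm f s) (ren_tm f t)"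
| "ren f (Pred r ts) = Pred r (map (ren_tm f) ts)"
| "ren f (Neg \<phi>) = Neg (ren f \<phi>)"
| "ren f (Conj \<phi> \<psi>) = Conj (ren f \<phi>) (ren f \<psi>)"
| "ren f (Ex \<phi>) = Ex (ren (case_nat 0 (\<lambda>i. Suc (f i))) \<phi>)"

lemma wf_ren_tm: "wf_tm L n t \<Longrightarrow> (\<And>i. i < n \<Longrightarrow> f i < N) \<Longrightarrow> wf_tm L N (ren_tm f t)"
  by (induction t) (auto simp: list_all_iff)

lemma wf_ren: "wf_fm L n \<phi> \<Longrightarrow> (\<And>i. i < n \<Longrightarrow> f i < N) \<Longrightarrow> wf_fm L N (ren f \<phi>)"
proof (induction \<phi> arbitrary: n N f)
  case (Ex \<phi>)
  have "wf_fm L (Suc N) (ren (case_nat 0 (\<lambda>i. Suc (f i))) \<phi>)"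
    by (rule Ex.IH[of "Suc n"]) (use Ex.prems in \<open>auto split: nat.split\<close>)
  then show ?case by simp
qed (auto simp: wf_ren_tm list_all_iff)

lemma tm_val_ren: "wf_tm L n t \<Longrightarrow> (\<And>i. i < n \<Longrightarrow> xs ! f i = ys ! i) \<Longrightarrow> tm_val C xs (ren_tm f t) = tm_val C ys t"
proof (induction t)
  case (Fn g ts)
  have "map (tm_val C xs \<circ> ren_tm f) ts = map (tm_val C ys) ts"
    using Fn by (auto simp: list_all_iff)
  then show ?case by (simp only: ren_tm.simps tm_val.simps map_map)
qed simp

lemma sat_ren: "wf_fm L n \<phi> \<Longrightarrow> (\<And>i. i < n \<Longrightarrow> xs ! f i = ys ! i) \<Longrightarrow> sat C xs (ren f \<phi>) \<longleftrightarrow> sat C ys \<phi>"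
proof (induction \<phi> arbitrary: n f xs ys)
  case (Equal s t)
  then show ?case using tm_val_ren[of L n _ xs f ys C] by simp
next
  case (Pred r ts)
  have "map (tm_val C xs \<circ> ren_tm f) ts = map (tm_val C ys) ts"
    using Pred tm_val_ren[of L n _ xs f ys C] by (auto simp: list_all_iff)
  then show ?case by (simp only: ren.simps sat.simps map_map)
next
  case (Ex \<phi>)
  have "sat C (a # xs) (ren (case_nat 0 (\<lambda>i. Suc (f i))) \<phi>) \<longleftrightarrow> sat C (a # ys) \<phi>" for a
    by (rule Ex.IH[of "Suc n"]) (use Ex.prems in \<open>auto split: nat.split simp: nth_Cons\<close>)
  then show ?case by simp
next
  case (Conj \<phi>1 \<phi>2)
  then show ?case by (metis ren.simps(4) sat.simps(4) wf_fm.simps(4))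
next
  case (Neg \<phi>)
  then show ?case by (metis ren.simps(3) sat.simps(3) wf_fm.simps(3))
qed

text \<open>
  Maps that only select and rearrange coordinates.
\<close>

definition coord :: "nat \<Rightarrow> nat \<Rightarrow> ('a list \<Rightarrow> 'a list) \<Rightarrow> bool" where
  "coord K k f \<longleftrightarrow> (\<exists>js. length js = k \<and> (\<forall>i\<in>set js. i < K) \<and> (\<forall>xs. length xs = K \<longrightarrow> f xs = map ((!) xs) js))"

lemma coord_id: "coord K K (\<lambda>xs. xs)"
  unfolding coord_def by (intro exI[of _ "[0..<K]"]) (auto simp: map_nth)

lemma coord_take: "coord K k f \<Longrightarrow> j \<le> k \<Longrightarrow> coord K j (\<lambda>xs. take j (f xs))"
  unfolding coord_def
  by (elim exE, rename_tac js, rule_tac x="take j js" in exI) (auto simp: take_map dest: in_set_takeD)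

lemma coord_drop: "coord K k f \<Longrightarrow> k = j + i \<Longrightarrow> coord K i (\<lambda>xs. drop j (f xs))"
  unfolding coord_def
  by (elim exE, rename_tac js, rule_tac x="drop j js" in exI) (auto simp: drop_map dest: in_set_dropD)

lemma coord_append: "coord K a f \<Longrightarrow> coord K b g \<Longrightarrow> c = a + b \<Longrightarrow> coord K c (\<lambda>xs. f xs @ g xs)"
  unfolding coord_def
  by (elim exE, rename_tac js ks, rule_tac x="js @ ks" in exI) auto

text \<open>
  Finite sequences of \<open>n\<close>-tuples are stored as one long tuple.
\<close>

definition block :: "nat \<Rightarrow> nat \<Rightarrow> 'a list \<Rightarrow> 'a list" where
  "block n i xs = take n (drop (i * n) xs)"

lemma coord_block:
  assumes "coord K k f" "Suc i * n \<le> k" shows "coord K n (\<lambda>xs. block n i (f xs))"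
proof -
  have "coord K (k - i * n) (\<lambda>xs. drop (i * n) (f xs))" by (rule coord_drop[OF assms(1)]) (use assms(2) in simp)
  then show ?thesis unfolding block_def by (rule coord_take) (use assms(2) in simp)
qed

lemma tuples_append: "x \<in> tuples A n \<Longrightarrow> y \<in> tuples A m \<Longrightarrow> x @ y \<in> tuples A (n + m)"
  by (auto simp: tuples_def)

lemma tuples_take: "x \<in> tuples A (n + m) \<Longrightarrow> take n x \<in> tuples A n"
  by (auto simp: tuples_def dest: in_set_takeD)

lemma tuples_drop: "x \<in> tuples A (n + m) \<Longrightarrow> drop n x \<in> tuples A m"
  by (auto simp: tuples_def dest: in_set_dropD)

lemma tuples_mono: "A \<subseteq> B \<Longrightarrow> x \<in> tuples A n \<Longrightarrow> x \<in> tuples B n"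
  by (auto simp: tuples_def)

lemma tuples_length: "x \<in> tuples A n \<Longrightarrow> length x = n"
  by (auto simp: tuples_def)

lemma block_tuples:
  assumes "q \<in> tuples A (N * n)" "j < N" shows "block n j q \<in> tuples A n"
proof -
  have "Suc j * n \<le> N * n" using assms(2) by (intro mult_right_mono) auto
  then have "n \<le> length q - j * n" using tuples_length[OF assms(1)] by simp
  then show ?thesis using assms(1)
    by (auto simp: block_def tuples_def dest!: in_set_takeD in_set_dropD)
qed

lemma concat_tuples: "(\<And>t. t \<in> set ts \<Longrightarrow> t \<in> tuples A m) \<Longrightarrow> concat ts \<in> tuples A (length ts * m)"
  by (induction ts) (auto simp: tuples_def)

lemma block_concat:
  "(\<And>t. t \<in> set ts \<Longrightarrow> length t = m) \<Longrightarrow> i < length ts \<Longrightarrow> block m i (concat ts) = ts ! i"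
proof (induction ts arbitrary: i)
  case (Cons t ts)
  show ?case
  proof (cases i)
    case 0
    then show ?thesis using Cons.prems(1)[of t] by (simp add: block_def)
  next
    case (Suc j)
    have "block m j (concat ts) = ts ! j" by (rule Cons.IH) (use Cons.prems Suc in auto)
    then show ?thesis using Cons.prems(1)[of t] Suc by (simp add: block_def)
  qed
qed simp

lemma enum_points:
  assumes "finite Q" "Q \<subseteq> tuples A n" "card Q \<le> N" "A \<noteq> {}"
  obtains q where "q \<in> tuples A (N * n)" "Q \<subseteq> (\<lambda>j. block n j q) ` {..<N}"
proof -
  obtain qs where qs: "set qs = Q" "distinct qs" using finite_distinct_list[OF assms(1)] by blast
  obtain a where a: "a \<in> A" using assms(4) by blast
  let ?qs = "qs @ replicate (N - length qs) (replicate n a)"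
  have len: "length ?qs = N" using qs assms(3) distinct_card[of qs] by simp
  have mem: "t \<in> tuples A n" if "t \<in> set ?qs" for t
    using that qs assms(2) a by (auto simp: tuples_def split: if_splits)
  have "concat ?qs \<in> tuples A (N * n)" using concat_tuples[of ?qs, OF mem] len by simp
  moreover have "Q \<subseteq> (\<lambda>j. block n j (concat ?qs)) ` {..<N}"
  proof
    fix x assume "x \<in> Q"
    then have "x \<in> set ?qs" using qs by simp
    then obtain j where j: "j < N" "?qs ! j = x" using len by (metis in_set_conv_nth)
    have "block n j (concat ?qs) = x"
      using block_concat[of ?qs n j] mem tuples_length j len by metis
    then show "x \<in> (\<lambda>j. block n j (concat ?qs)) ` {..<N}" using j(1) by blast
  qed
  ultimately show thesis by (rule that)
qed

locale fo_structure =
  fixes L :: "('f, 'r) language" and C :: "('a, 'f, 'r) struct"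
  assumes struct: "is_structure L C"
begin

abbreviation TT :: "nat \<Rightarrow> 'a list set" where "TT k \<equiv> tuples (univ C) k"

text \<open>
  Definability without parameters as a property of a relation on tuples, so that formulas need not be written out: closure
  under connectives, quantifiers and rearranging of coordinates is all that is used.
\<close>

definition defrel :: "nat \<Rightarrow> ('a list \<Rightarrow> bool) \<Rightarrow> bool" where
  "defrel k P \<longleftrightarrow> (\<exists>\<phi>. wf_fm L k \<phi> \<and> (\<forall>xs\<in>TT k. P xs \<longleftrightarrow> sat C xs \<phi>))"

lemma univ_ne: "univ C \<noteq> {}" using struct by (simp add: is_structure_def)

lemma defrel_sat: "wf_fm L k \<phi> \<Longrightarrow> defrel k (\<lambda>xs. sat C xs \<phi>)"
  by (auto simp: defrel_def)

lemma defrel_cong: "defrel k P \<Longrightarrow> (\<And>xs. xs \<in> TT k \<Longrightarrow> Q xs \<longleftrightarrow> P xs) \<Longrightarrow> defrel k Q"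
  by (auto simp: defrel_def)

lemma defrel_not: "defrel k P \<Longrightarrow> defrel k (\<lambda>xs. \<not> P xs)"
  unfolding defrel_def by (elim exE, rule_tac x="Neg \<phi>" in exI) auto

lemma defrel_conj: "defrel k P \<Longrightarrow> defrel k Q \<Longrightarrow> defrel k (\<lambda>xs. P xs \<and> Q xs)"
  unfolding defrel_def by (elim exE, rename_tac \<phi> \<psi>, rule_tac x="Conj \<phi> \<psi>" in exI) auto

lemma defrel_disj: "defrel k P \<Longrightarrow> defrel k Q \<Longrightarrow> defrel k (\<lambda>xs. P xs \<or> Q xs)"
  by (rule defrel_cong[OF defrel_not[OF defrel_conj[OF defrel_not defrel_not]]]) auto

lemma defrel_imp: "defrel k P \<Longrightarrow> defrel k Q \<Longrightarrow> defrel k (\<lambda>xs. P xs \<longrightarrow> Q xs)"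
  by (rule defrel_cong[OF defrel_disj[OF defrel_not]]) auto

lemma defrel_True: "defrel k (\<lambda>xs. True)"
  unfolding defrel_def by (rule exI[of _ "Ex (Equal (Var 0) (Var 0))"]) (use univ_ne in auto)

lemma defrel_const: "defrel k (\<lambda>xs. b)"
  by (cases b) (use defrel_True defrel_not[OF defrel_True] in auto)

lemma defrel_ball: "finite A \<Longrightarrow> (\<And>a. a \<in> A \<Longrightarrow> defrel k (P a)) \<Longrightarrow> defrel k (\<lambda>xs. \<forall>a\<in>A. P a xs)"
proof (induction A rule: finite_induct)
  case empty
  then show ?case by (simp add: defrel_True)
next
  case (insert a A)
  have "defrel k (\<lambda>xs. P a xs \<and> (\<forall>a\<in>A. P a xs))" using insert by (intro defrel_conj) auto
  then show ?case by simp
qed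

lemma defrel_bex: "finite A \<Longrightarrow> (\<And>a. a \<in> A \<Longrightarrow> defrel k (P a)) \<Longrightarrow> defrel k (\<lambda>xs. \<exists>a\<in>A. P a xs)"
  by (rule defrel_cong[OF defrel_not[OF defrel_ball[of A k "\<lambda>a xs. \<not> P a xs"]]]) (auto intro: defrel_not)

lemma defrel_sub:
  assumes "defrel k P" "coord K k f" shows "defrel K (\<lambda>xs. P (f xs))"
proof -
  obtain \<phi> where \<phi>: "wf_fm L k \<phi>" "\<And>xs. xs \<in> TT k \<Longrightarrow> P xs \<longleftrightarrow> sat C xs \<phi>" using assms(1) by (auto simp: defrel_def)
  obtain js where js: "length js = k" "\<forall>i\<in>set js. i < K" "\<And>xs. length xs = K \<Longrightarrow> f xs = map ((!) xs) js"
    using assms(2) by (auto simp: coord_def)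
  have "wf_fm L K (ren ((!) js) \<phi>)" by (rule wf_ren[OF \<phi>(1)]) (use js in auto)
  moreover have "P (f xs) \<longleftrightarrow> sat C xs (ren ((!) js) \<phi>)" if "xs \<in> TT K" for xs
  proof -
    have len: "length xs = K" using that by (rule tuples_length)
    have "f xs \<in> TT k" using that js len by (auto simp: tuples_def)
    then have "P (f xs) \<longleftrightarrow> sat C (f xs) \<phi>" by (rule \<phi>(2))
    also have "\<dots> \<longleftrightarrow> sat C xs (ren ((!) js) \<phi>)"
      by (rule sat_ren[OF \<phi>(1), symmetric]) (use js len in auto)
    finally show ?thesis .
  qed
  ultimately show ?thesis unfolding defrel_def by blast
qed

lemma defrel_ex1: "defrel (Suc k) P \<Longrightarrow> defrel k (\<lambda>xs. \<exists>a\<in>univ C. P (a # xs))"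
  unfolding defrel_def by (elim exE, rule_tac x="Ex \<phi>" in exI) (auto simp: tuples_def)

lemma coord_rotate: "coord (Suc k) (Suc k) (\<lambda>xs. tl xs @ [hd xs])"
  unfolding coord_def
proof (intro exI[of _ "[1..<Suc k] @ [0]"] conjI allI impI)
  fix xs :: "'x list" assume xs: "length xs = Suc k"
  then obtain y ys where ys: "xs = y # ys" "length ys = k" by (cases xs) auto
  have "map ((!) xs) [1..<Suc k] = ys" using ys by (auto intro: nth_equalityI simp del: upt_Suc)
  then show "tl xs @ [hd xs] = map ((!) xs) ([1..<Suc k] @ [0])" using ys by simp
qed auto

lemma defrel_ex_append: "defrel (k + l) P \<Longrightarrow> defrel k (\<lambda>xs. \<exists>ys\<in>TT l. P (xs @ ys))"
proof (induction l arbitrary: k)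
  case 0
  have "TT 0 = {[]}" by (auto simp: tuples_def)
  then show ?case using 0 by simp
next
  case (Suc l)
  have "defrel (Suc k) (\<lambda>xs. \<exists>ys\<in>TT l. P (xs @ ys))" using Suc.IH[of "Suc k"] Suc.prems by simp
  from defrel_ex1[OF defrel_sub[OF this coord_rotate]]
  show ?case
  proof (rule defrel_cong)
    fix xs
    have "TT (Suc l) = {a # ys |a ys. a \<in> univ C \<and> ys \<in> TT l}"
      by (auto simp: tuples_def length_Suc_conv)
    then show "(\<exists>ys\<in>TT (Suc l). P (xs @ ys)) \<longleftrightarrow> (\<exists>a\<in>univ C. \<exists>ys\<in>TT l. P ((tl (a # xs) @ [hd (a # xs)]) @ ys))"
      by auto
  qed
qed

lemma defrel_ex:
  assumes "defrel (k + l) (\<lambda>zs. Q (take k zs) (drop k zs))" shows "defrel k (\<lambda>xs. \<exists>ys\<in>TT l. Q xs ys)"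
  by (rule defrel_cong[OF defrel_ex_append[OF assms]]) (auto simp: tuples_length)

lemma defrel_all:
  assumes "defrel (k + l) (\<lambda>zs. Q (take k zs) (drop k zs))" shows "defrel k (\<lambda>xs. \<forall>ys\<in>TT l. Q xs ys)"
  by (rule defrel_cong[OF defrel_not[OF defrel_ex[OF defrel_not[OF assms]]]]) auto

lemma definable_overI:
  assumes "defrel (k + m) P" "b \<in> tuples A m" "A \<subseteq> univ C"
  shows "definable_over L C A k {x \<in> TT k. P (x @ b)}"
proof -
  obtain \<phi> where \<phi>: "wf_fm L (k + m) \<phi>" "\<forall>xs\<in>TT (k + m). P xs \<longleftrightarrow> sat C xs \<phi>"
    using assms(1) by (auto simp: defrel_def)
  have "{x \<in> TT k. P (x @ b)} = solutions C k \<phi> b"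
    using \<phi>(2) tuples_append[OF _ tuples_mono[OF assms(3,2)]] by (auto simp: solutions_def)
  then show ?thesis unfolding definable_over_def using assms(2) \<phi>(1) by blast
qed

lemma definable_overE:
  assumes "definable_over L C A k X"
  obtains m P b where "defrel (k + m) P" "b \<in> tuples A m" "X = {x \<in> TT k. P (x @ b)}"
  using assms unfolding definable_over_def solutions_def using defrel_sat by blast

lemma definable_over_cong: "definable_over L C A k X \<Longrightarrow> Y = X \<Longrightarrow> definable_over L C A k Y"
  by simp

lemma definable_over_sub: "definable_over L C A k X \<Longrightarrow> X \<subseteq> TT k"
  by (auto simp: definable_over_def solutions_def)

lemma definable_over_Int:
  assumes "definable_over L C A k X" "definable_over L C A k Y" "A \<subseteq> univ C"
  shows "definable_over L C A k (X \<inter> Y)"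
proof -
  obtain m P b where 1: "defrel (k + m) P" "b \<in> tuples A m" "X = {x \<in> TT k. P (x @ b)}"
    using assms(1) by (rule definable_overE)
  obtain m' P' b' where 2: "defrel (k + m') P'" "b' \<in> tuples A m'" "Y = {x \<in> TT k. P' (x @ b')}"
    using assms(2) by (rule definable_overE)
  have lb: "length b = m" using 1(2) by (rule tuples_length)
  have "defrel (k + (m + m')) (\<lambda>zs. P (take (k + m) zs) \<and> P' (take k zs @ drop (k + m) zs))"
    by (intro defrel_conj defrel_sub[OF 1(1)] defrel_sub[OF 2(1)] coord_append[of _ k _ m'] coord_take[OF coord_id] coord_drop[OF coord_id]) auto
  from definable_overI[OF this tuples_append[OF 1(2) 2(2)] assms(3)]
  show ?thesis
    by (rule definable_over_cong) (auto simp: 1(3) 2(3) tuples_length lb)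
qed

lemma definable_over_Compl:
  assumes "definable_over L C A k X" "A \<subseteq> univ C"
  shows "definable_over L C A k (TT k - X)"
proof -
  obtain m P b where 1: "defrel (k + m) P" "b \<in> tuples A m" "X = {x \<in> TT k. P (x @ b)}"
    using assms(1) by (rule definable_overE)
  from definable_overI[OF defrel_not[OF 1(1)] 1(2) assms(2)]
  show ?thesis by (rule definable_over_cong) (auto simp: 1(3))
qed

lemma definable_over_Un:
  assumes "definable_over L C A k X" "definable_over L C A k Y" "A \<subseteq> univ C"
  shows "definable_over L C A k (X \<union> Y)"
proof -
  have "X \<union> Y = TT k - ((TT k - X) \<inter> (TT k - Y))"
    using definable_over_sub[OF assms(1)] definable_over_sub[OF assms(2)] by auto
  then show ?thesis using definable_over_Compl definable_over_Int assms by metis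
qed

lemma definable_over_mono:
  assumes "definable_over L C A k X" "A \<subseteq> B" shows "definable_over L C B k X"
  using assms tuples_mono unfolding definable_over_def by blast

lemma definable_over_TT: "A \<subseteq> univ C \<Longrightarrow> definable_over L C A k (TT k)"
  using definable_overI[of k 0 "\<lambda>_. True" "[]" A] by (simp add: defrel_True tuples_def)

lemma definable_over_empty: "A \<subseteq> univ C \<Longrightarrow> definable_over L C A k {}"
  using definable_overI[of k 0 "\<lambda>_. False" "[]" A] by (simp add: defrel_const tuples_def)

lemma definable_over_empty_params:
  "definable_over L C {} k X \<longleftrightarrow> (\<exists>P. defrel k P \<and> X = {x \<in> TT k. P x})"
proof
  assume "definable_over L C {} k X"
  then obtain m P b where 1: "defrel (k + m) P" "b \<in> tuples {} m" "X = {x \<in> TT k. P (x @ b)}"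
    by (rule definable_overE)
  then show "\<exists>P. defrel k P \<and> X = {x \<in> TT k. P x}" by (auto simp: tuples_def)
next
  assume "\<exists>P. defrel k P \<and> X = {x \<in> TT k. P x}"
  then show "definable_over L C {} k X"
    using definable_overI[of k 0 _ "[]" "{}"] by (auto simp: tuples_def)
qed

lemma elem_sub: "elementary_substructure L C M \<Longrightarrow> M \<subseteq> univ C"
  by (simp add: elementary_substructure_def)

lemma elem_ex1:
  assumes M: "elementary_substructure L C M" and P: "defrel (Suc k) P" and a: "a \<in> tuples M k"
    and ex: "\<exists>x\<in>univ C. P (x # a)"
  shows "\<exists>x\<in>M. P (x # a)"
proof -
  obtain \<phi> where \<phi>: "wf_fm L (Suc k) \<phi>" "\<And>xs. xs \<in> TT (Suc k) \<Longrightarrow> P xs \<longleftrightarrow> sat C xs \<phi>"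
    using P by (auto simp: defrel_def)
  have el: "\<And>n \<phi> xs. wf_fm L n \<phi> \<Longrightarrow> xs \<in> tuples M n \<Longrightarrow> sat (C\<lparr>univ := M\<rparr>) xs \<phi> \<longleftrightarrow> sat C xs \<phi>"
    using M by (auto simp: elementary_substructure_def)
  have Ma: "M \<subseteq> univ C" "a \<in> TT k" using elem_sub[OF M] tuples_mono a by auto
  have "sat C a (Ex \<phi>)" using ex \<phi>(2) Ma by (auto simp: tuples_def)
  then have "sat (C\<lparr>univ := M\<rparr>) a (Ex \<phi>)" using el[of k "Ex \<phi>" a] \<phi>(1) a by simp
  then obtain x where x: "x \<in> M" "sat (C\<lparr>univ := M\<rparr>) (x # a) \<phi>" by auto
  have xa: "x # a \<in> tuples M (Suc k)" using x(1) a by (auto simp: tuples_def)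
  then have "sat C (x # a) \<phi>" using el[OF \<phi>(1)] x(2) by blast
  then show ?thesis using \<phi>(2)[of "x # a"] tuples_mono[OF Ma(1) xa] x(1) by blast
qed

text \<open>
  The Tarski-Vaught property for tuples: the coordinates are found one at a time.
\<close>

lemma elem_ex:
  assumes M: "elementary_substructure L C M"
  shows "defrel (k + l) P \<Longrightarrow> a \<in> tuples M k \<Longrightarrow> \<exists>x\<in>TT l. P (a @ x) \<Longrightarrow> \<exists>x\<in>tuples M l. P (a @ x)"
proof (induction l arbitrary: k a)
  case 0
  then show ?case by (auto simp: tuples_def)
next
  case (Suc l)
  obtain x where "x \<in> TT (Suc l)" "P (a @ x)" using Suc.prems(3) by blast
  then obtain y ys where y: "y \<in> univ C" "ys \<in> TT l" "P (a @ y # ys)"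
    by (cases x) (auto simp: tuples_def)
  define Q where "Q xs = (\<exists>ys\<in>TT l. P (xs @ ys))" for xs
  have dQ: "defrel (Suc k) Q" unfolding Q_def using defrel_ex_append[of "Suc k" l P] Suc.prems(1) by simp
  have "\<exists>x\<in>univ C. Q (tl (x # a) @ [hd (x # a)])" using y by (auto simp: Q_def)
  from elem_ex1[OF M defrel_sub[OF dQ coord_rotate] Suc.prems(2) this]
  obtain x where x: "x \<in> M" "\<exists>ys\<in>TT l. P ((a @ [x]) @ ys)" by (auto simp: Q_def)
  have "\<exists>ys\<in>tuples M l. P ((a @ [x]) @ ys)"
    by (rule Suc.IH[of "Suc k"]) (use Suc.prems x in \<open>auto simp: tuples_def\<close>)
  then obtain ys where "ys \<in> tuples M l" "P (a @ x # ys)" by auto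
  then have "x # ys \<in> tuples M (Suc l)" "P (a @ x # ys)" using x(1) by (auto simp: tuples_def)
  then show ?case by blast
qed

lemma definable_over_elem_point:
  assumes M: "elementary_substructure L C M" and D: "definable_over L C M k D" "t \<in> D"
  shows "\<exists>s\<in>tuples M k. s \<in> D"
proof -
  obtain m P b where 1: "defrel (k + m) P" "b \<in> tuples M m" "D = {x \<in> TT k. P (x @ b)}"
    using D(1) by (rule definable_overE)
  have "defrel (m + k) (\<lambda>zs. P (drop m zs @ take m zs))"
    by (intro defrel_sub[OF 1(1)] coord_append[of _ k _ m] coord_take[OF coord_id] coord_drop[OF coord_id]) auto
  moreover have "\<exists>x\<in>TT k. P (drop m (b @ x) @ take m (b @ x))"
    using D(2) 1 by (auto simp: tuples_length)
  ultimately obtain x where "x \<in> tuples M k" "P (drop m (b @ x) @ take m (b @ x))"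
    using elem_ex[OF M _ 1(2)] by blast
  then have "x \<in> tuples M k" "P (x @ b)" using 1(2) by (auto simp: tuples_length)
  then show ?thesis using 1(3) tuples_mono[OF elem_sub[OF M]] by blast
qed

definition fibre :: "nat \<Rightarrow> nat \<Rightarrow> ('a list \<Rightarrow> bool) \<Rightarrow> 'a list \<Rightarrow> 'a list set" where
  "fibre n m P t = {x. x \<in> TT n \<and> t \<in> TT m \<and> P (x @ t)}"

lemma NIP_vc:
  assumes "NIP L C" "defrel (n + m) P"
  shows "\<exists>d. vc_le {{x \<in> TT n. P (x @ b)} |b. b \<in> TT m} d"
proof -
  obtain \<phi> where \<phi>: "wf_fm L (n + m) \<phi>" "\<And>xs. xs \<in> TT (n + m) \<Longrightarrow> P xs \<longleftrightarrow> sat C xs \<phi>"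
    using assms(2) by (auto simp: defrel_def)
  have "{x \<in> TT n. P (x @ b)} = solutions C n \<phi> b" if "b \<in> TT m" for b
    using \<phi>(2)[OF tuples_append[OF _ that]] by (auto simp: solutions_def)
  then have "{{x \<in> TT n. P (x @ b)} |b. b \<in> TT m} = {solutions C n \<phi> b |b. b \<in> TT m}"
    unfolding Setcompr_eq_image by (intro image_cong refl)
  moreover have "finite_VC_dim {solutions C n \<phi> b |b. b \<in> TT m}"
    using assms(1) \<phi>(1) by (simp add: NIP_def)
  ultimately show ?thesis by (simp add: finite_VC_dim_def vc_le_def)
qed

lemma NIP_fibre:
  assumes "NIP L C" "defrel (n + m) P"
  shows "\<exists>d. vc_le (fibre n m P ` TT m) d \<and> vc_le {{t. x \<in> fibre n m P t} |x. True} d"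
proof -
  obtain d1 where d1: "vc_le {{x \<in> TT n. P (x @ b)} |b. b \<in> TT m} d1" using NIP_vc[OF assms] by blast
  have "defrel (m + n) (\<lambda>zs. P (drop m zs @ take m zs))"
    by (intro defrel_sub[OF assms(2)] coord_append[of _ n _ m] coord_take[OF coord_id] coord_drop[OF coord_id]) auto
  then obtain d2 where d2: "vc_le {{t \<in> TT m. P (drop m (t @ x) @ take m (t @ x))} |x. x \<in> TT n} d2"
    using NIP_vc[OF assms(1), of m n "\<lambda>zs. P (drop m zs @ take m zs)"] by blast
  let ?d = "max d1 (Suc d2)"
  have "vc_le (fibre n m P ` TT m) ?d"
    by (rule vc_le_mono[OF d1]) (auto simp: fibre_def)
  moreover have "vc_le {{t. x \<in> fibre n m P t} |x. True} ?d"
  proof (rule vc_le_mono[OF vc_le_insert_empty[OF d2]])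
    show "{{t. x \<in> fibre n m P t} |x. True} \<subseteq>
        insert {} {{t \<in> TT m. P (drop m (t @ x) @ take m (t @ x))} |x. x \<in> TT n}"
    proof
      fix S assume "S \<in> {{t. x \<in> fibre n m P t} |x. True}"
      then obtain x where S: "S = {t. x \<in> fibre n m P t}" by blast
      show "S \<in> insert {} {{t \<in> TT m. P (drop m (t @ x) @ take m (t @ x))} |x. x \<in> TT n}"
      proof (cases "x \<in> TT n")
        case True
        then have "S = {t \<in> TT m. P (drop m (t @ x) @ take m (t @ x))}"
          unfolding S fibre_def by (auto simp: tuples_length)
        then show ?thesis using True by blast
      qed (simp add: S fibre_def)
    qed
  qed simp
  ultimately show ?thesis by blast
qed

end

section \<open>Pierceable definable families\<close>

definition pierceable :: "('b \<Rightarrow> 'c set) \<Rightarrow> 'b set \<Rightarrow> nat \<Rightarrow> bool" where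
  "pierceable Y D N \<longleftrightarrow> (\<forall>T\<subseteq>D. finite T \<longrightarrow> (\<exists>Q. finite Q \<and> card Q \<le> N \<and> (\<forall>t\<in>T. Y t \<inter> Q \<noteq> {})))"

lemma pierceableE:
  assumes "pierceable Y D N" "T \<subseteq> D" "finite T"
  obtains Q where "finite Q" "card Q \<le> N" "\<And>t. t \<in> T \<Longrightarrow> Y t \<inter> Q \<noteq> {}"
proof -
  have "\<exists>Q. finite Q \<and> card Q \<le> N \<and> (\<forall>t\<in>T. Y t \<inter> Q \<noteq> {})"
    using assms(1)[unfolded pierceable_def, rule_format, OF assms(2,3)] .
  then show thesis using that by auto
qed

lemma pierceable_mono:
  assumes "pierceable Y D N" "D' \<subseteq> D" "N \<le> N'" "\<And>t. t \<in> D' \<Longrightarrow> Y t \<subseteq> Y' t"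
  shows "pierceable Y' D' N'"
  unfolding pierceable_def
proof (intro allI impI)
  fix T assume T: "T \<subseteq> D'" "finite T"
  then have "T \<subseteq> D" using assms(2) by blast
  then obtain Q where Q: "finite Q" "card Q \<le> N" "\<And>t. t \<in> T \<Longrightarrow> Y t \<inter> Q \<noteq> {}"
    using pierceableE[OF assms(1) _ T(2)] by blast
  have "Y' t \<inter> Q \<noteq> {}" if "t \<in> T" for t using Q(3)[OF that] assms(4)[of t] T(1) that by blast
  then show "\<exists>Q. finite Q \<and> card Q \<le> N' \<and> (\<forall>t\<in>T. Y' t \<inter> Q \<noteq> {})"
    using Q(1,2) assms(3) by (intro exI[of _ Q]) simp
qed

lemma pierceable_Un:
  assumes "pierceable Y D N" "pierceable Y D' N'" shows "pierceable Y (D \<union> D') (N + N')"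
  unfolding pierceable_def
proof (intro allI impI)
  fix T assume T: "T \<subseteq> D \<union> D'" "finite T"
  obtain Q where Q: "finite Q" "card Q \<le> N" "\<And>t. t \<in> T \<inter> D \<Longrightarrow> Y t \<inter> Q \<noteq> {}"
    by (rule pierceableE[OF assms(1), of "T \<inter> D"]) (use T in auto)
  obtain Q' where Q': "finite Q'" "card Q' \<le> N'" "\<And>t. t \<in> T \<inter> D' \<Longrightarrow> Y t \<inter> Q' \<noteq> {}"
    by (rule pierceableE[OF assms(2), of "T \<inter> D'"]) (use T in auto)
  have "card (Q \<union> Q') \<le> N + N'" using card_Un_le[of Q Q'] Q(2) Q'(2) by linarith
  moreover have "Y t \<inter> (Q \<union> Q') \<noteq> {}" if t: "t \<in> T" for t
  proof (cases "t \<in> D")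
    case True
    then show ?thesis using Q(3)[of t] t by blast
  next
    case False
    then show ?thesis using Q'(3)[of t] t T(1) by blast
  qed
  ultimately show "\<exists>Q. finite Q \<and> card Q \<le> N + N' \<and> (\<forall>t\<in>T. Y t \<inter> Q \<noteq> {})"
    using Q(1) Q'(1) by (intro exI[of _ "Q \<union> Q'"]) simp
qed

text \<open>
  The \<open>(p, q)\<close>-theorem read as a dichotomy, with a piercing bound that depends on the VC-dimension and \<open>p\<close> alone.
\<close>

lemma pierceable_or_inc:
  fixes Y :: "'b \<Rightarrow> 'c set"
  assumes vc: "vc_le (Y ` E) d" "vc_le {{t. x \<in> Y t} |x. True} d"
  shows "(\<exists>N. pierceable Y E N) \<or> (\<forall>p. \<exists>s. (\<forall>i<p. s i \<in> E) \<and> k_inconsistent_upto (Suc d) Y p s)"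
proof (rule ccontr)
  assume no: "\<not> ?thesis"
  then obtain p where p: "\<And>s. (\<forall>i<p. s i \<in> E) \<Longrightarrow> \<not> k_inconsistent_upto (Suc d) Y p s" by blast
  obtain N where N: "\<And>(T :: 'b set) (Y :: 'b \<Rightarrow> 'c set).
    finite T \<Longrightarrow> vc_le (Y ` T) d \<Longrightarrow> vc_le {{t \<in> T. x \<in> Y t} |x. True} d \<Longrightarrow>
    (\<And>f. f \<in> {..<p} \<rightarrow> T \<Longrightarrow> \<exists>K\<subseteq>{..<p}. card K = Suc d \<and> (\<exists>x. \<forall>j\<in>K. x \<in> Y (f j))) \<Longrightarrow>
    \<exists>P. finite P \<and> card P \<le> N \<and> (\<forall>t\<in>T. Y t \<inter> P \<noteq> {})"
    by (rule pq_theorem[of d p, where 't='b and 'x='c]) blast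
  have "pierceable Y E N" unfolding pierceable_def
  proof (intro allI impI)
    fix T assume T: "T \<subseteq> E" "finite T"
    show "\<exists>Q. finite Q \<and> card Q \<le> N \<and> (\<forall>t\<in>T. Y t \<inter> Q \<noteq> {})"
    proof (rule N[OF T(2)])
      show "vc_le (Y ` T) d" by (rule vc_le_mono[OF vc(1)]) (use T(1) in auto)
      have "{{t \<in> T. x \<in> Y t} |x. True} \<subseteq> {{t \<in> T. t \<in> S} |S. S \<in> {{t. x \<in> Y t} |x. True}}"
      proof
        fix S assume "S \<in> {{t \<in> T. x \<in> Y t} |x. True}"
        then obtain x where "S = {t \<in> T. t \<in> {t. x \<in> Y t}}" by auto
        then show "S \<in> {{t \<in> T. t \<in> S} |S. S \<in> {{t. x \<in> Y t} |x. True}}" by blast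
      qed
      then show "vc_le {{t \<in> T. x \<in> Y t} |x. True} d" by (rule vc_le_mono[OF vc_le_traces[OF vc(2)]]) simp
      fix f assume f: "f \<in> {..<p} \<rightarrow> T"
      then have "\<forall>i<p. f i \<in> E" using T(1) by auto
      from p[OF this] show "\<exists>K\<subseteq>{..<p}. card K = Suc d \<and> (\<exists>x. \<forall>j\<in>K. x \<in> Y (f j))"
        unfolding k_inconsistent_upto_def by blast
    qed
  qed
  then show False using no by blast
qed

context fo_structure
begin

lemma coord_drop': "coord K k f \<Longrightarrow> j \<le> k \<Longrightarrow> coord K (k - j) (\<lambda>xs. drop j (f xs))"
  by (rule coord_drop) auto

lemma coord_append': "coord K a f \<Longrightarrow> coord K b g \<Longrightarrow> coord K (a + b) (\<lambda>xs. f xs @ g xs)"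
  by (rule coord_append) auto

lemma defrel_sub': "defrel k P \<Longrightarrow> coord K k' f \<Longrightarrow> k' = k \<Longrightarrow> defrel K (\<lambda>xs. P (f xs))"
  using defrel_sub by blast

lemmas coords = coord_append' coord_block coord_take coord_drop' coord_id
lemmas defrels = defrel_ex defrel_all defrel_bex defrel_ball defrel_not defrel_conj defrel_disj defrel_imp

text \<open>
  An \<open>N\<close>-tuple of points satisfies \<open>multi N n P\<close> if one of its members satisfies \<open>P\<close>. A family is pierceable by \<open>N\<close> points exactly when
  the corresponding family of sets of \<open>N\<close>-tuples has the finite intersection property.
\<close>

definition multi :: "nat \<Rightarrow> nat \<Rightarrow> ('a list \<Rightarrow> bool) \<Rightarrow> 'a list \<Rightarrow> bool" where
  "multi N n P zs \<longleftrightarrow> (\<exists>i\<in>{..<N}. P (block n i (take (N * n) zs) @ drop (N * n) zs))"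

lemma Suc_mult_le: "i < N \<Longrightarrow> Suc i * n \<le> N * (n :: nat)"
  by (rule mult_right_mono) auto

lemma Suc_mult_le': "i < N \<Longrightarrow> n + i * n \<le> N * (n :: nat)"
  using Suc_mult_le[of i N n] by simp

lemma defrel_multi:
  assumes "defrel (n + m) P" shows "defrel (N * n + m) (multi N n P)"
  unfolding multi_def
  by (rule defrel_bex defrel_sub'[OF assms] coords | (auto simp: Suc_mult_le'; fail))+

lemma fibre_multi: "x \<in> fibre (N * n) m (multi N n P) t \<longleftrightarrow> x \<in> TT (N * n) \<and> (\<exists>i<N. block n i x \<in> fibre n m P t)"
  by (auto simp: fibre_def multi_def tuples_length block_tuples)

text \<open>
  The combinatorial form of not forking over \<open>M\<close>.
\<close>

definition uniformly_pierced :: "'a set \<Rightarrow> nat \<Rightarrow> nat \<Rightarrow> ('a list \<Rightarrow> bool) \<Rightarrow> 'a list \<Rightarrow> bool" where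
  "uniformly_pierced M n m P t \<longleftrightarrow> (\<exists>D N. definable_over L C M m D \<and> t \<in> D \<and> pierceable (fibre n m P) D N)"

text \<open>
  That \<open>r\<close> elements of \<open>D\<close> are never pierced by \<open>N\<close> points can be refuted by a first-order statement about \<open>r\<close>-tuples over \<open>M\<close>, so a
  counterexample in the monster model yields one with coordinates in \<open>M\<close>.
\<close>

lemma pierceable_transfer:
  assumes M: "elementary_substructure L C M" and P: "defrel (n + m) P" and D: "definable_over L C M m D"
    and pc: "pierceable (fibre n m P) (D \<inter> tuples M m) N"
  shows "pierceable (fibre n m P) D N"
  unfolding pierceable_def
proof (intro allI impI, rule ccontr)
  fix T assume T: "T \<subseteq> D" "finite T" and no: "\<not> (\<exists>Q. finite Q \<and> card Q \<le> N \<and> (\<forall>t\<in>T. fibre n m P t \<inter> Q \<noteq> {}))"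
  obtain k PD b where PD: "defrel (m + k) PD" "b \<in> tuples M k" "D = {x \<in> TT m. PD (x @ b)}"
    using D by (rule definable_overE)
  have MC: "M \<subseteq> univ C" by (rule elem_sub[OF M])
  have lb: "length b = k" using PD(2) by (rule tuples_length)
  obtain ts where ts: "set ts = T" using finite_list[OF T(2)] by blast
  define r where "r = length ts"
  have tsT: "t \<in> TT m" if "t \<in> set ts" for t using that ts T(1) PD(3) by auto
  define R where "R zs \<longleftrightarrow> (\<forall>i\<in>{..<r}. PD (block m i (drop k zs) @ take k zs)) \<and>
    \<not> (\<exists>q\<in>TT (N * n). \<forall>i\<in>{..<r}. \<exists>j\<in>{..<N}. P (block n j q @ block m i (drop k zs)))" for zs
  have "defrel (k + r * m) R" unfolding R_def
    by (rule defrels defrel_sub'[OF PD(1)] defrel_sub'[OF P] coords | (auto simp: Suc_mult_le'; fail))+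
  moreover have "\<exists>x\<in>TT (r * m). R (b @ x)"
  proof
    show cT: "concat ts \<in> TT (r * m)" unfolding r_def by (rule concat_tuples[OF tsT])
    have block: "block m i (concat ts) = ts ! i" if "i < r" for i
      using block_concat[of ts m i] tsT tuples_length that by (metis r_def)
    show "R (b @ concat ts)" unfolding R_def
    proof (intro conjI ballI notI)
      fix i assume "i \<in> {..<r}"
      then have i: "i < r" by simp
      then have "ts ! i \<in> D" using ts T(1) by (auto simp: r_def)
      then show "PD (block m i (drop k (b @ concat ts)) @ take k (b @ concat ts))"
        using PD(3) lb block[OF i] by simp
    next
      assume "\<exists>q\<in>TT (N * n). \<forall>i\<in>{..<r}. \<exists>j\<in>{..<N}. P (block n j q @ block m i (drop k (b @ concat ts)))"
      then obtain q where q: "q \<in> TT (N * n)" "\<forall>i\<in>{..<r}. \<exists>j\<in>{..<N}. P (block n j q @ block m i (drop k (b @ concat ts)))"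
        by blast
      have "fibre n m P t \<inter> (\<lambda>j. block n j q) ` {..<N} \<noteq> {}" if t: "t \<in> T" for t
      proof -
        obtain i where i: "i < r" "t = ts ! i" using t ts by (metis in_set_conv_nth r_def)
        have "\<exists>j\<in>{..<N}. P (block n j q @ block m i (drop k (b @ concat ts)))" using q(2) i(1) by blast
        then obtain j where j: "j < N" "P (block n j q @ t)" using block[OF i(1)] lb i(2) by auto
        have "block n j q \<in> fibre n m P t" using j block_tuples[OF q(1) j(1)] tsT t ts by (auto simp: fibre_def)
        then show ?thesis using j(1) by blast
      qed
      moreover have "card ((\<lambda>j. block n j q) ` {..<N}) \<le> N" using card_image_le[of "{..<N}" "\<lambda>j. block n j q"] by simp
      ultimately show False using no by blast
    qed
  qed
  ultimately obtain x where x: "x \<in> tuples M (r * m)" "R (b @ x)" using elem_ex[OF M _ PD(2)] by blast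
  have xM: "block m i x \<in> tuples M m" if "i < r" for i by (rule block_tuples[OF x(1) that])
  let ?T = "(\<lambda>i. block m i x) ` {..<r}"
  have "?T \<subseteq> D \<inter> tuples M m"
  proof
    fix t assume "t \<in> ?T"
    then obtain i where i: "i < r" "t = block m i x" by auto
    then have "PD (t @ b)" using x(2) lb by (auto simp: R_def)
    then show "t \<in> D \<inter> tuples M m" using i xM[OF i(1)] tuples_mono[OF MC] PD(3) by auto
  qed
  then obtain Q where Q: "finite Q" "card Q \<le> N" "\<And>t. t \<in> ?T \<Longrightarrow> fibre n m P t \<inter> Q \<noteq> {}"
    using pierceableE[OF pc, of ?T] by auto
  have "card (Q \<inter> TT n) \<le> N" using Q(2) card_mono[OF Q(1), of "Q \<inter> TT n"] by simp
  then obtain q where q: "q \<in> TT (N * n)" "Q \<inter> TT n \<subseteq> (\<lambda>j. block n j q) ` {..<N}"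
    using enum_points[of "Q \<inter> TT n" "univ C" n N] Q(1) univ_ne by auto
  have "\<exists>j\<in>{..<N}. P (block n j q @ block m i (drop k (b @ x)))" if i: "i \<in> {..<r}" for i
  proof -
    obtain y where y: "y \<in> fibre n m P (block m i x)" "y \<in> Q" using Q(3)[of "block m i x"] i by blast
    then have "y \<in> Q \<inter> TT n" by (auto simp: fibre_def)
    then obtain j where "j < N" "y = block n j q" using q(2) by blast
    then show ?thesis using y(1) lb by (auto simp: fibre_def)
  qed
  then show False using x(2) q(1) unfolding R_def by blast
qed

text \<open>
  The type of \<open>t\<close> over \<open>M\<close> as a filter concentrated on \<open>M\<close>; over an elementary substructure it is proper.
\<close>

definition type_filter :: "'a set \<Rightarrow> nat \<Rightarrow> 'a list \<Rightarrow> 'a list filter" where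
  "type_filter M m t = (INF D\<in>{D. definable_over L C M m D \<and> t \<in> D}. principal (D \<inter> tuples M m))"

lemma eventually_type_filter:
  assumes "M \<subseteq> univ C" "t \<in> TT m"
  shows "eventually Q (type_filter M m t) \<longleftrightarrow> (\<exists>D. definable_over L C M m D \<and> t \<in> D \<and> (\<forall>s\<in>D \<inter> tuples M m. Q s))"
proof -
  have "eventually Q (type_filter M m t) \<longleftrightarrow> (\<exists>D\<in>{D. definable_over L C M m D \<and> t \<in> D}. eventually Q (principal (D \<inter> tuples M m)))"
    unfolding type_filter_def
  proof (rule eventually_INF_base)
    show "{D. definable_over L C M m D \<and> t \<in> D} \<noteq> {}" using definable_over_TT[OF assms(1)] assms(2) by blast
    fix D D' assume D: "D \<in> {D. definable_over L C M m D \<and> t \<in> D}" "D' \<in> {D. definable_over L C M m D \<and> t \<in> D}"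
    then have "D \<inter> D' \<in> {D. definable_over L C M m D \<and> t \<in> D}" using definable_over_Int assms(1) by auto
    then show "\<exists>x\<in>{D. definable_over L C M m D \<and> t \<in> D}. principal (x \<inter> tuples M m)
        \<le> inf (principal (D \<inter> tuples M m)) (principal (D' \<inter> tuples M m))"
      by (rule bexI[rotated]) auto
  qed
  then show ?thesis by (simp add: eventually_principal conj_assoc Bex_def)
qed

lemma type_filter_nonbot:
  assumes M: "elementary_substructure L C M" and t: "t \<in> TT m" shows "type_filter M m t \<noteq> bot"
proof
  assume "type_filter M m t = bot"
  then have "eventually (\<lambda>_. False) (type_filter M m t)" by simp
  then obtain D where D: "definable_over L C M m D" "t \<in> D" "\<forall>s\<in>D \<inter> tuples M m. False"
    unfolding eventually_type_filter[OF elem_sub[OF M] t] by blast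
  obtain s where "s \<in> tuples M m" "s \<in> D" using definable_over_elem_point[OF M D(1,2)] by blast
  then show False using D(3) by blast
qed

lemma type_filter_decides:
  assumes M: "M \<subseteq> univ C" and t: "t \<in> TT m" and R: "defrel (m + k) R" "a \<in> tuples M k"
  shows "eventually (\<lambda>s. R (s @ a)) (type_filter M m t) \<or> eventually (\<lambda>s. \<not> R (s @ a)) (type_filter M m t)"
proof (cases "R (t @ a)")
  case True
  then show ?thesis unfolding eventually_type_filter[OF M t]
    using definable_overI[OF R M] t by blast
next
  case False
  then show ?thesis unfolding eventually_type_filter[OF M t]
    using definable_overI[OF defrel_not[OF R(1)] R(2) M] t by blast
qed

lemma not_uniformly_pierced_inconsistent:
  assumes M: "elementary_substructure L C M" and nip: "NIP L C" and P: "defrel (n + m) P" and t: "t \<in> TT m"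
    and npov: "\<not> uniformly_pierced M n m P t"
  obtains d where "vc_le {{t. x \<in> fibre (N * n) m (multi N n P) t} |x. True} d"
    "\<And>Q p. eventually Q (type_filter M m t) \<Longrightarrow> \<exists>s. (\<forall>i<p. Q (s i)) \<and> k_inconsistent_upto (Suc d) (fibre (N * n) m (multi N n P)) p s"
proof -
  let ?Y = "fibre (N * n) m (multi N n P)"
  have MC: "M \<subseteq> univ C" by (rule elem_sub[OF M])
  obtain d where d: "vc_le (?Y ` TT m) d" "vc_le {{t. x \<in> ?Y t} |x. True} d"
    using NIP_fibre[OF nip defrel_multi[OF P, of N]] by blast
  show thesis
  proof (rule that[OF d(2)])
    fix Q p assume "eventually Q (type_filter M m t)"
    then obtain D where D: "definable_over L C M m D" "t \<in> D" "\<And>s. s \<in> D \<inter> tuples M m \<Longrightarrow> Q s"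
      unfolding eventually_type_filter[OF MC t] by blast
    let ?E = "D \<inter> tuples M m"
    have "\<not> pierceable ?Y ?E N'" for N'
    proof
      assume pc: "pierceable ?Y ?E N'"
      have "pierceable (fibre n m P) ?E (N' * N)" unfolding pierceable_def
      proof (intro allI impI)
        fix T assume T: "T \<subseteq> ?E" "finite T"
        obtain Q where Q: "finite Q" "card Q \<le> N'" "\<And>t. t \<in> T \<Longrightarrow> ?Y t \<inter> Q \<noteq> {}"
          by (rule pierceableE[OF pc T]) blast
        let ?Q = "(\<lambda>(q, i). block n i q) ` (Q \<times> {..<N})"
        have "card ?Q \<le> card (Q \<times> {..<N})" by (rule card_image_le) (use Q(1) in simp)
        also have "\<dots> \<le> N' * N" using Q(2) by (simp add: card_cartesian_product)
        finally have "card ?Q \<le> N' * N" .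
        moreover have "fibre n m P t \<inter> ?Q \<noteq> {}" if t: "t \<in> T" for t
        proof -
          obtain q where q: "q \<in> ?Y t" "q \<in> Q" using Q(3)[OF t] by blast
          then obtain i where i: "i < N" "block n i q \<in> fibre n m P t" unfolding fibre_multi by blast
          have "block n i q \<in> ?Q" using q(2) i(1) by (intro image_eqI[of _ _ "(q, i)"]) auto
          then show ?thesis using i(2) by blast
        qed
        ultimately show "\<exists>Q. finite Q \<and> card Q \<le> N' * N \<and> (\<forall>t\<in>T. fibre n m P t \<inter> Q \<noteq> {})"
          using Q(1) by (intro exI[of _ ?Q]) simp
      qed
      then have "pierceable (fibre n m P) D (N' * N)" by (rule pierceable_transfer[OF M P D(1)])
      then show False using npov D(1,2) unfolding uniformly_pierced_def by blast
    qed
    moreover have "vc_le (?Y ` ?E) d" by (rule vc_le_mono[OF d(1)]) (use tuples_mono[OF MC] in auto)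
    ultimately obtain s where "\<forall>i<p. s i \<in> ?E" "k_inconsistent_upto (Suc d) ?Y p s"
      using pierceable_or_inc[OF _ d(2), of ?E] by blast
    then show "\<exists>s. (\<forall>i<p. Q (s i)) \<and> k_inconsistent_upto (Suc d) ?Y p s" using D(3) by blast
  qed
qed

text \<open>
  Pass to \<open>N\<close>-tuples, so that the family for \<open>P1 \<or> P2\<close> has the finite intersection property. If neither disjunct
  were pierced near \<open>t\<close>, both would have long inconsistent sequences near the type of \<open>t\<close>, with parameters in \<open>M\<close>, and
  \<open>union_of_dividing\<close> would apply. The remaining work is to see that its covering condition is first-order, hence
  decided by the type.
\<close>

lemma uniformly_pierced_disj:
  assumes M: "elementary_substructure L C M" and nip: "NIP L C"
    and P1: "defrel (n + m) P1" and P2: "defrel (n + m) P2" and t: "t \<in> TT m"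
    and pv: "uniformly_pierced M n m (\<lambda>z. P1 z \<or> P2 z) t"
  shows "uniformly_pierced M n m P1 t \<or> uniformly_pierced M n m P2 t"
proof (rule ccontr)
  assume no: "\<not> ?thesis"
  have MC: "M \<subseteq> univ C" by (rule elem_sub[OF M])
  obtain D N where D: "definable_over L C M m D" "t \<in> D" and pc: "pierceable (fibre n m (\<lambda>z. P1 z \<or> P2 z)) D N"
    using pv unfolding uniformly_pierced_def by blast
  obtain k PD b where PD: "defrel (m + k) PD" "b \<in> tuples M k" "D = {x \<in> TT m. PD (x @ b)}"
    using D(1) by (rule definable_overE)
  have lb: "length b = k" using PD(2) by (rule tuples_length)
  let ?P = "\<lambda>z. P1 z \<or> P2 z"
  let ?X = "fibre (N * n) m (multi N n ?P)" and ?Y = "fibre (N * n) m (multi N n P1)" and ?Z = "fibre (N * n) m (multi N n P2)"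
  let ?D0 = "D \<inter> tuples M m"
  have dP: "defrel (n + m) ?P" by (rule defrel_disj[OF P1 P2])
  obtain d1 where d1: "\<And>Q p. eventually Q (type_filter M m t) \<Longrightarrow> \<exists>s. (\<forall>i<p. Q (s i)) \<and> k_inconsistent_upto (Suc d1) ?Y p s"
    using not_uniformly_pierced_inconsistent[OF M nip P1 t] no by metis
  obtain d2 where d2: "vc_le {{t. x \<in> ?Z t} |x. True} d2"
    "\<And>Q p. eventually Q (type_filter M m t) \<Longrightarrow> \<exists>s. (\<forall>i<p. Q (s i)) \<and> k_inconsistent_upto (Suc d2) ?Z p s"
    using not_uniformly_pierced_inconsistent[OF M nip P2 t] no by metis
  show False
  proof (rule union_of_dividing[where F = "type_filter M m t" and M = "tuples M m" and ?D0.0 = ?D0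
        and X = ?X and Y = ?Y and Z = ?Z and k = "Suc d1" and k' = "Suc d2" and d = d2])
    show "type_filter M m t \<noteq> bot" by (rule type_filter_nonbot[OF M t])
    show "eventually (\<lambda>s. s \<in> tuples M m) (type_filter M m t)" unfolding eventually_type_filter[OF MC t] using D by blast
    show "eventually (\<lambda>s. s \<in> ?D0) (type_filter M m t)" unfolding eventually_type_filter[OF MC t] using D by blast
    show "?X s \<subseteq> ?Y s \<union> ?Z s" for s by (auto simp: fibre_def multi_def)
    show "\<exists>x. \<forall>e\<in>set es. x \<in> ?X e" if es: "set es \<subseteq> ?D0" for es
    proof -
      obtain Q where Q: "finite Q" "card Q \<le> N" "\<And>s. s \<in> set es \<Longrightarrow> fibre n m ?P s \<inter> Q \<noteq> {}"
        by (rule pierceableE[OF pc, of "set es"]) (use es in auto)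
      have "card (Q \<inter> TT n) \<le> N" using Q(2) card_mono[OF Q(1), of "Q \<inter> TT n"] by simp
      then obtain q where q: "q \<in> TT (N * n)" "Q \<inter> TT n \<subseteq> (\<lambda>j. block n j q) ` {..<N}"
        using enum_points[of "Q \<inter> TT n" "univ C" n N] Q(1) univ_ne by auto
      have "q \<in> ?X e" if e: "e \<in> set es" for e
      proof -
        obtain y where y: "y \<in> fibre n m ?P e" "y \<in> Q" using Q(3)[OF e] by blast
        then have "y \<in> Q \<inter> TT n" by (auto simp: fibre_def)
        then obtain j where "j < N" "y = block n j q" using q(2) by blast
        then show ?thesis unfolding fibre_multi using q(1) y(1) by blast
      qed
      then show ?thesis by blast
    qed
    show "\<exists>es. length es = Suc d1 \<and> (\<forall>e\<in>set es. Q e) \<and> \<not> (\<exists>x. \<forall>e\<in>set es. x \<in> ?Y e)"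
      if Q: "eventually Q (type_filter M m t)" for Q
    proof -
      obtain s where s: "\<forall>i<Suc d1. Q (s i)" "k_inconsistent_upto (Suc d1) ?Y (Suc d1) s" using d1[OF Q] by blast
      have "\<not> (\<exists>x. \<forall>i\<in>{..<Suc d1}. x \<in> ?Y (s i))" using s(2) unfolding k_inconsistent_upto_def by simp
      then have "\<not> (\<exists>x. \<forall>e\<in>set (map s [0..<Suc d1]). x \<in> ?Y e)" by (simp del: upt_Suc add: atLeast0LessThan)
      moreover have "\<forall>e\<in>set (map s [0..<Suc d1]). Q e" using s(1) by (simp del: upt_Suc)
      moreover have "length (map s [0..<Suc d1]) = Suc d1" by (simp del: upt_Suc)
      ultimately show ?thesis by blast
    qed
    show "vc_le {{t. x \<in> ?Z t} |x. True} d2" by (rule d2(1))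
    show "\<exists>s. (\<forall>i<p. Q (s i)) \<and> k_inconsistent_upto (Suc d2) ?Z p s" if "eventually Q (type_filter M m t)" for Q p
      by (rule d2(2)[OF that])
    fix p :: nat and S :: "'a list list"
    assume "0 < p" and S: "set S \<subseteq> tuples M m"
    let ?l = "length S"
    let ?a = "b @ concat S"
    let ?K = "m + (k + ?l * m)"
    define R where "R zs \<longleftrightarrow> (\<exists>E\<in>TT (p * m). (\<forall>i\<in>{..<p}. PD (block m i E @ take k (drop m zs))) \<and>
      (\<forall>x\<in>TT (N * n). (\<forall>i\<in>{..<p}. multi N n ?P (x @ block m i E)) \<longrightarrow>
        (multi N n P1 (x @ take m zs) \<or> (\<exists>j\<in>{..<?l}. multi N n P1 (x @ block m j (drop k (drop m zs)))))))" for zs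
    have dR: "defrel ?K R" unfolding R_def
      by (rule defrels defrel_sub'[OF PD(1)] defrel_sub'[OF defrel_multi[OF P1]] defrel_sub'[OF defrel_multi[OF dP]] coords | (auto simp: Suc_mult_le'; fail))+
    have aM: "?a \<in> tuples M (k + ?l * m)"
      by (intro tuples_append PD(2) concat_tuples) (use S in auto)
    have blkS: "block m j (concat S) = S ! j" if "j < ?l" for j
      by (rule block_concat) (use S that tuples_length in auto)
    have STT: "s \<in> TT m" if "s \<in> set S" for s using that S tuples_mono[OF MC] by auto
    define Sig where "Sig s \<longleftrightarrow> (\<exists>es. length es = p \<and> set es \<subseteq> ?D0 \<and>
      (\<forall>x. (\<forall>e\<in>set es. x \<in> ?X e) \<longrightarrow> (\<exists>u\<in>set (s # S). x \<in> ?Y u)))" for s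
    have eq: "Sig s \<longleftrightarrow> R (s @ ?a)" if s: "s \<in> tuples M m" for s
    proof -
      have sTT: "s \<in> TT m" using s tuples_mono[OF MC] by blast
      have ls: "length s = m" using s by (rule tuples_length)
      define R' where "R' zs \<longleftrightarrow> (\<forall>i\<in>{..<p}. PD (block m i (drop ?K zs) @ take k (drop m zs))) \<and>
        (\<forall>x\<in>TT (N * n). (\<forall>i\<in>{..<p}. multi N n ?P (x @ block m i (drop ?K zs))) \<longrightarrow>
        (multi N n P1 (x @ take m zs) \<or> (\<exists>j\<in>{..<?l}. multi N n P1 (x @ block m j (take (?l * m) (drop k (drop m zs)))))))" for zs
      have dR': "defrel (?K + p * m) R'" unfolding R'_def
        by (rule defrels defrel_sub'[OF PD(1)] defrel_sub'[OF defrel_multi[OF P1]] defrel_sub'[OF defrel_multi[OF dP]] coords | (auto simp: Suc_mult_le'; fail))+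
      have la: "length ?a = k + ?l * m" using aM by (rule tuples_length)
      have lc: "length (concat S) = ?l * m" using la lb by simp
      have R'R: "R (s @ ?a) \<longleftrightarrow> (\<exists>E\<in>TT (p * m). R' ((s @ ?a) @ E))"
        unfolding R_def R'_def using ls lb lc by (simp del: append_assoc add: append_assoc[symmetric])
      have char: "R' ((s @ ?a) @ E) \<longleftrightarrow> (\<forall>i<p. block m i E \<in> D) \<and>
        (\<forall>x. (\<forall>i<p. x \<in> ?X (block m i E)) \<and> x \<in> TT (N * n) \<longrightarrow> (\<exists>u\<in>set (s # S). x \<in> ?Y u))"
        if E: "E \<in> TT (p * m)" for E
      proof -
        have bE: "block m i E \<in> TT m" if "i < p" for i by (rule block_tuples[OF E that])
        have 1: "(\<forall>i\<in>{..<p}. PD (block m i E @ b)) \<longleftrightarrow> (\<forall>i<p. block m i E \<in> D)"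
          using bE by (auto simp: PD(3))
        have 2: "(\<forall>i\<in>{..<p}. multi N n ?P (x @ block m i E)) \<longleftrightarrow> (\<forall>i<p. x \<in> ?X (block m i E))"
          if "x \<in> TT (N * n)" for x using bE that by (auto simp: fibre_def)
        have 3: "(\<exists>j\<in>{..<?l}. multi N n P1 (x @ block m j (concat S))) \<longleftrightarrow> (\<exists>u\<in>set S. x \<in> ?Y u)"
          if x: "x \<in> TT (N * n)" for x
        proof -
          have "(\<exists>j\<in>{..<?l}. multi N n P1 (x @ block m j (concat S))) \<longleftrightarrow> (\<exists>j<?l. multi N n P1 (x @ S ! j))"
            using blkS by auto
          also have "\<dots> \<longleftrightarrow> (\<exists>u\<in>set S. multi N n P1 (x @ u))" by (metis in_set_conv_nth)
          also have "\<dots> \<longleftrightarrow> (\<exists>u\<in>set S. x \<in> ?Y u)" using x STT by (auto simp: fibre_def)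
          finally show ?thesis .
        qed
        have 4: "multi N n P1 (x @ s) \<longleftrightarrow> x \<in> ?Y s" if "x \<in> TT (N * n)" for x
          using that sTT by (auto simp: fibre_def)
        have "R' ((s @ ?a) @ E) \<longleftrightarrow> (\<forall>i\<in>{..<p}. PD (block m i E @ b)) \<and>
          (\<forall>x\<in>TT (N * n). (\<forall>i\<in>{..<p}. multi N n ?P (x @ block m i E)) \<longrightarrow>
          (multi N n P1 (x @ s) \<or> (\<exists>j\<in>{..<?l}. multi N n P1 (x @ block m j (concat S)))))"
          unfolding R'_def using ls lb lc by simp
        also have "\<dots> \<longleftrightarrow> (\<forall>i<p. block m i E \<in> D) \<and>
          (\<forall>x\<in>TT (N * n). (\<forall>i<p. x \<in> ?X (block m i E)) \<longrightarrow> (x \<in> ?Y s \<or> (\<exists>u\<in>set S. x \<in> ?Y u)))"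
          unfolding 1 using 2 3 4 by simp
        also have "\<dots> \<longleftrightarrow> (\<forall>i<p. block m i E \<in> D) \<and>
          (\<forall>x. (\<forall>i<p. x \<in> ?X (block m i E)) \<and> x \<in> TT (N * n) \<longrightarrow> (\<exists>u\<in>set (s # S). x \<in> ?Y u))" by auto
        finally show ?thesis .
      qed
      show ?thesis
      proof
        assume "Sig s"
        then obtain es where es: "length es = p" "set es \<subseteq> ?D0"
          "\<forall>x. (\<forall>e\<in>set es. x \<in> ?X e) \<longrightarrow> (\<exists>u\<in>set (s # S). x \<in> ?Y u)" unfolding Sig_def by blast
        have esM: "e \<in> TT m" if "e \<in> set es" for e using that es(2) tuples_mono[OF MC] by blast
        have E: "concat es \<in> TT (p * m)" using concat_tuples[of es, OF esM] es(1) by simp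
        have bE: "block m i (concat es) = es ! i" if "i < p" for i
          by (rule block_concat) (use es(1) esM that tuples_length in auto)
        have 5: "(\<forall>i<p. x \<in> ?X (block m i (concat es))) \<longleftrightarrow> (\<forall>e\<in>set es. x \<in> ?X e)" for x
          using bE es(1) by (metis in_set_conv_nth)
        have "\<forall>i<p. block m i (concat es) \<in> D" using bE es(1,2) by auto
        then have "R' ((s @ ?a) @ concat es)" unfolding char[OF E] 5 using es(3) by blast
        then show "R (s @ ?a)" unfolding R'R using E by blast
      next
        assume "R (s @ ?a)"
        then have "\<exists>E\<in>TT (p * m). R' ((s @ ?a) @ E)" unfolding R'R .
        then obtain E where E: "E \<in> tuples M (p * m)" "R' ((s @ ?a) @ E)"
          using elem_ex[OF M dR' tuples_append[OF s aM]] by blast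
        have ETT: "E \<in> TT (p * m)" by (rule tuples_mono[OF MC E(1)])
        let ?es = "map (\<lambda>i. block m i E) [0..<p]"
        have R': "(\<forall>i<p. block m i E \<in> D) \<and>
          (\<forall>x. (\<forall>i<p. x \<in> ?X (block m i E)) \<and> x \<in> TT (N * n) \<longrightarrow> (\<exists>u\<in>set (s # S). x \<in> ?Y u))"
          using E(2) unfolding char[OF ETT] .
        have esD: "set ?es \<subseteq> ?D0" using R' block_tuples[OF E(1)] by auto
        show "Sig s" unfolding Sig_def
        proof (intro exI[of _ ?es] conjI allI impI esD)
          fix x assume x: "\<forall>e\<in>set ?es. x \<in> ?X e"
          show "\<exists>u\<in>set (s # S). x \<in> ?Y u"
          proof (cases "x \<in> TT (N * n)")
            case True
            then show ?thesis using R' x by simp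
          next
            case False
            have "block m 0 E \<in> set ?es" using \<open>0 < p\<close> by (simp del: upt_Suc)
            then have "x \<in> ?X (block m 0 E)" using x by blast
            then show ?thesis using False by (simp add: fibre_def)
          qed
        qed simp
      qed
    qed
    have "eventually (\<lambda>s. R (s @ ?a)) (type_filter M m t) \<or> eventually (\<lambda>s. \<not> R (s @ ?a)) (type_filter M m t)"
      by (rule type_filter_decides[OF MC t dR aM])
    moreover have ev: "eventually (\<lambda>s. s \<in> tuples M m) (type_filter M m t)" unfolding eventually_type_filter[OF MC t] using D by blast
    ultimately have "eventually Sig (type_filter M m t) \<or> eventually (\<lambda>s. \<not> Sig s) (type_filter M m t)"
    proof (elim disjE)
      assume "eventually (\<lambda>s. R (s @ ?a)) (type_filter M m t)"
      then have "eventually Sig (type_filter M m t)" using ev by eventually_elim (simp add: eq)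
      then show ?thesis ..
    next
      assume "eventually (\<lambda>s. \<not> R (s @ ?a)) (type_filter M m t)"
      then have "eventually (\<lambda>s. \<not> Sig s) (type_filter M m t)" using ev by eventually_elim (simp add: eq)
      then show ?thesis ..
    qed
    then show "eventually (\<lambda>s. \<exists>es. length es = p \<and> set es \<subseteq> ?D0 \<and>
        (\<forall>x. (\<forall>e\<in>set es. x \<in> ?X e) \<longrightarrow> (\<exists>u\<in>set (s # S). x \<in> ?Y u))) (type_filter M m t) \<or>
      eventually (\<lambda>s. \<not> (\<exists>es. length es = p \<and> set es \<subseteq> ?D0 \<and>
        (\<forall>x. (\<forall>e\<in>set es. x \<in> ?X e) \<longrightarrow> (\<exists>u\<in>set (s # S). x \<in> ?Y u)))) (type_filter M m t)"
      unfolding Sig_def .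
  qed
qed

end

section \<open>Models of bounded size and piercing versus forking\<close>

lemma wf_tm_mono: "wf_tm L n t \<Longrightarrow> n \<le> n' \<Longrightarrow> wf_tm L n' t"
  by (induction t) (auto simp: list_all_iff)

lemma wf_fm_mono: "wf_fm L n \<phi> \<Longrightarrow> n \<le> n' \<Longrightarrow> wf_fm L n' \<phi>"
  by (induction \<phi> arbitrary: n n') (auto simp: list_all_iff wf_tm_mono)

lemma Conj_formulas: "\<phi> \<in> formulas L \<Longrightarrow> \<psi> \<in> formulas L \<Longrightarrow> Conj \<phi> \<psi> \<in> formulas L"
proof -
  assume "\<phi> \<in> formulas L" "\<psi> \<in> formulas L"
  then obtain n m where "wf_fm L n \<phi>" "wf_fm L m \<psi>" by (auto simp: formulas_def)
  then have "wf_fm L (max n m) (Conj \<phi> \<psi>)" using wf_fm_mono by fastforce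
  then show ?thesis unfolding formulas_def by blast
qed

lemma Equal_Var_formulas: "Equal (Var i) (Var j) \<in> formulas L"
proof -
  have "wf_fm L (Suc (i + j)) (Equal (Var i) (Var j))" by simp
  then show ?thesis unfolding formulas_def by blast
qed

lemma infinite_formulas: "infinite (formulas L)"
proof
  assume "finite (formulas L)"
  moreover have "range (\<lambda>i. Equal (Var i) (Var 0)) \<subseteq> formulas L" using Equal_Var_formulas by auto
  ultimately have "finite (range (\<lambda>i. Equal (Var i) (Var 0) :: ('a, 'b) fm))" using finite_subset by blast
  moreover have "inj (\<lambda>i. Equal (Var i) (Var 0) :: ('a, 'b) fm)" by (rule injI) simp
  ultimately show False using finite_imageD by blast
qed

text \<open>
  Skolem terms are coded by formulas, so that the hull of \<open>b\<close> is visibly an image of the set of formulas: \<open>Conj \<phi> \<psi>\<close> stands for a Skolem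
  function of \<open>\<phi>\<close> applied to the list of elements coded by \<open>\<psi>\<close>, and \<open>Equal (Var i) t\<close> for the \<open>i\<close>-th
  element of \<open>b\<close>. The element \<open>d\<close> is a default value.
\<close>

fun skolem_val :: "('a, 'f, 'r) struct \<Rightarrow> 'a list \<Rightarrow> 'a \<Rightarrow> ('f, 'r) fm \<Rightarrow> 'a"
  and skolem_vals :: "('a, 'f, 'r) struct \<Rightarrow> 'a list \<Rightarrow> 'a \<Rightarrow> ('f, 'r) fm \<Rightarrow> 'a list" where
  "skolem_val C b d (Conj \<phi> \<psi>) = (let xs = skolem_vals C b d \<psi> in
     if \<exists>a\<in>univ C. sat C (a # xs) \<phi> then SOME a. a \<in> univ C \<and> sat C (a # xs) \<phi> else d)"
| "skolem_val C b d (Equal (Var i) t) = (if i < length b then b ! i else d)"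
| "skolem_val C b d _ = d"
| "skolem_vals C b d (Conj \<phi> \<psi>) = skolem_val C b d \<phi> # skolem_vals C b d \<psi>"
| "skolem_vals C b d _ = []"

lemma tm_val_univ: "tm_val (C\<lparr>univ := M\<rparr>) xs t = tm_val C xs t"
proof (induction t)
  case (Fn g ts)
  then have "map (tm_val (C\<lparr>univ := M\<rparr>) xs) ts = map (tm_val C xs) ts" by simp
  moreover have "fun_int (C\<lparr>univ := M\<rparr>) = fun_int C" by simp
  ultimately show ?case by (simp only: tm_val.simps)
qed simp

text \<open>
  The set of values of all codes contains \<open>b\<close> and is closed under witnesses, because a list of elements of the hull is again
  coded by a formula.
\<close>

lemma (in fo_structure) Loewenheim_Skolem:
  assumes b: "set b \<subseteq> univ C"
  obtains M where "elementary_substructure L C M" "set b \<subseteq> M" "|M| \<le>o |formulas L|"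
proof -
  obtain d where d: "d \<in> univ C" using univ_ne by blast
  define M where "M = skolem_val C b d ` formulas L"
  have skC: "skolem_val C b d \<phi> \<in> univ C" for \<phi>
  proof (cases \<phi>)
    case (Conj \<phi>' \<psi>)
    have "(SOME a. a \<in> univ C \<and> sat C (a # skolem_vals C b d \<psi>) \<phi>') \<in> univ C"
      if "\<exists>a\<in>univ C. sat C (a # skolem_vals C b d \<psi>) \<phi>'"
      using someI_ex[of "\<lambda>a. a \<in> univ C \<and> sat C (a # skolem_vals C b d \<psi>) \<phi>'"] that by blast
    then show ?thesis using Conj d by (auto simp: Let_def)
  next
    case (Equal s t)
    then show ?thesis using b d by (cases s) auto
  qed (use d in auto)
  have MC: "M \<subseteq> univ C" using skC by (auto simp: M_def)
  define enc where "enc cs = foldr Conj cs (Equal (Var 0) (Var 0))" for cs :: "('f, 'r) fm list"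
  have skolem_vals_enc: "skolem_vals C b d (enc cs) = map (skolem_val C b d) cs" for cs by (induction cs) (simp_all add: enc_def)
  have enc_formulas: "enc cs \<in> formulas L" if "set cs \<subseteq> formulas L" for cs
    using that by (induction cs) (simp_all add: enc_def Equal_Var_formulas Conj_formulas)
  have wit: "\<exists>a\<in>M. sat C (a # xs) \<phi>"
    if \<phi>: "wf_fm L n \<phi>" and xs: "set xs \<subseteq> M" and ex: "\<exists>a\<in>univ C. sat C (a # xs) \<phi>" for n \<phi> xs
  proof -
    have "\<exists>cs. set cs \<subseteq> formulas L \<and> map (skolem_val C b d) cs = xs"
      using xs
    proof (induction xs)
      case (Cons x xs)
      then obtain cs where cs: "set cs \<subseteq> formulas L" "map (skolem_val C b d) cs = xs" by auto
      obtain c where "c \<in> formulas L" "skolem_val C b d c = x" using Cons.prems by (auto simp: M_def)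
      then have "set (c # cs) \<subseteq> formulas L \<and> map (skolem_val C b d) (c # cs) = x # xs" using cs by simp
      then show ?case by (rule exI)
    qed simp
    then obtain cs where cs: "set cs \<subseteq> formulas L" "map (skolem_val C b d) cs = xs" by blast
    let ?a = "skolem_val C b d (Conj \<phi> (enc cs))"
    have "\<phi> \<in> formulas L" using \<phi> unfolding formulas_def by blast
    then have "?a \<in> M" unfolding M_def using Conj_formulas enc_formulas[OF cs(1)] by blast
    moreover have "?a = (SOME a. a \<in> univ C \<and> sat C (a # xs) \<phi>)" using ex by (simp add: skolem_vals_enc cs(2))
    then have "sat C (?a # xs) \<phi>" using someI_ex[of "\<lambda>a. a \<in> univ C \<and> sat C (a # xs) \<phi>"] ex by metis
    ultimately show ?thesis by blast
  qed
  have bM: "set b \<subseteq> M"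
  proof
    fix x assume "x \<in> set b"
    then obtain i where i: "i < length b" "b ! i = x" by (auto simp: in_set_conv_nth)
    then have "x = skolem_val C b d (Equal (Var i) (Var 0))" by simp
    then show "x \<in> M" unfolding M_def using Equal_Var_formulas by blast
  qed
  have Mne: "M \<noteq> {}" unfolding M_def using Equal_Var_formulas by blast
  have closed: "fun_int C f xs \<in> M" if f: "fun_ar L f = Some k" and xs: "xs \<in> tuples M k" for f k xs
  proof -
    let ?\<phi> = "Equal (Var 0) (Fn f (map (\<lambda>i. Var (Suc i)) [0..<k])) :: ('f, 'r) fm"
    have "wf_fm L (Suc k) ?\<phi>" using f by (auto simp: list_all_iff)
    moreover have sat: "sat C (a # xs) ?\<phi> \<longleftrightarrow> a = fun_int C f xs" for a
    proof -
      have "map (tm_val C (a # xs)) (map (\<lambda>i. Var (Suc i)) [0..<k]) = xs"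
        using tuples_length[OF xs] by (auto intro: nth_equalityI)
      then show ?thesis by (simp only: sat.simps tm_val.simps nth_Cons_0)
    qed
    moreover have "fun_int C f xs \<in> univ C"
      using struct f tuples_mono[OF MC xs] unfolding is_structure_def by blast
    ultimately have "\<exists>a\<in>M. sat C (a # xs) ?\<phi>" using wit[of "Suc k" ?\<phi> xs] xs by (auto simp: tuples_def)
    then obtain a where "a \<in> M" "sat C (a # xs) ?\<phi>" by blast
    then show ?thesis unfolding sat by simp
  qed
  have el: "sat (C\<lparr>univ := M\<rparr>) xs \<phi> \<longleftrightarrow> sat C xs \<phi>" if "wf_fm L n \<phi>" "set xs \<subseteq> M" for n \<phi> xs
    using that
  proof (induction \<phi> arbitrary: n xs)
    case (Pred r ts)
    have "map (tm_val (C\<lparr>univ := M\<rparr>) xs) ts = map (tm_val C xs) ts" by (simp add: tm_val_univ)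
    moreover have "rel_int (C\<lparr>univ := M\<rparr>) = rel_int C" by simp
    ultimately show ?case by (simp only: sat.simps)
  next
    case (Ex \<phi>)
    have "sat (C\<lparr>univ := M\<rparr>) xs (Ex \<phi>) \<longleftrightarrow> (\<exists>a\<in>M. sat C (a # xs) \<phi>)"
      using Ex.IH[of "Suc n"] Ex.prems by simp
    also have "\<dots> \<longleftrightarrow> (\<exists>a\<in>univ C. sat C (a # xs) \<phi>)"
      using wit[of "Suc n" \<phi> xs] Ex.prems MC by auto
    finally show ?case by simp
  qed (auto simp: tm_val_univ)
  have "elementary_substructure L C M" unfolding elementary_substructure_def
  proof (intro conjI allI impI ballI MC)
    show "is_structure L (C\<lparr>univ := M\<rparr>)" using Mne closed by (auto simp: is_structure_def)
    fix n \<phi> xs assume "wf_fm L n \<phi>" "xs \<in> tuples M n"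
    then show "sat (C\<lparr>univ := M\<rparr>) xs \<phi> \<longleftrightarrow> sat C xs \<phi>" using el by (auto simp: tuples_def)
  qed
  moreover have "|M| \<le>o |formulas L|" unfolding M_def by (rule card_of_image)
  ultimately show thesis using that bM by blast
qed

context fo_structure
begin

lemma not_uniformly_pierced_False: "\<not> uniformly_pierced M n m (\<lambda>_. False) t"
proof
  assume "uniformly_pierced M n m (\<lambda>_. False) t"
  then obtain D N where D: "t \<in> D" "pierceable (fibre n m (\<lambda>_. False)) D N" unfolding uniformly_pierced_def by blast
  obtain Q where "finite Q" "card Q \<le> N" "\<And>s. s \<in> {t} \<Longrightarrow> fibre n m (\<lambda>_. False) s \<inter> Q \<noteq> {}"
    by (rule pierceableE[OF D(2), of "{t}"]) (use D(1) in simp_all)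
  then show False by (auto simp: fibre_def)
qed

lemma not_uniformly_pierced_bex:
  assumes M: "elementary_substructure L C M" and nip: "NIP L C" and t: "t \<in> TT m"
  shows "(\<And>P. P \<in> set Ps \<Longrightarrow> defrel (n + m) P \<and> \<not> uniformly_pierced M n m P t) \<Longrightarrow> \<not> uniformly_pierced M n m (\<lambda>z. \<exists>P\<in>set Ps. P z) t"
proof (induction Ps)
  case Nil
  then show ?case using not_uniformly_pierced_False by simp
next
  case (Cons P Ps)
  have "defrel (n + m) (\<lambda>z. \<exists>P\<in>set Ps. P z)" by (rule defrel_bex) (use Cons.prems in auto)
  then have "\<not> uniformly_pierced M n m (\<lambda>z. P z \<or> (\<exists>P\<in>set Ps. P z)) t"
    using uniformly_pierced_disj[OF M nip _ _ t, of n P "\<lambda>z. \<exists>P\<in>set Ps. P z"] Cons by auto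
  then show ?case by simp
qed

text \<open>
  If \<open>D\<close> contained the parameter of a dividing formula, it would contain tuples above every member of the sequence that witnesses
  dividing, since the projection of \<open>D\<close> belongs to the common type. Among \<open>N * k' + 1\<close> members pierced by \<open>N\<close> points, \<open>k'\<close>
  share a point. The extra coordinates \<open>u\<close> and \<open>v\<close> allow several dividing formulas to be put over one parameter tuple.
\<close>

lemma divides_not_uniformly_pierced:
  assumes M: "M \<subseteq> univ C" and c: "c \<in> TT l" and \<psi>: "wf_fm L (n + l) \<psi>" and dv: "divides L C n M \<psi> c"
    and u: "u \<in> TT a" and v: "v \<in> TT e"
  shows "\<not> uniformly_pierced M n (a + (l + e)) (\<lambda>zs. sat C (take n zs @ take l (drop (n + a) zs)) \<psi>) (u @ c @ v)"
proof
  let ?m = "a + (l + e)"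
  let ?P = "\<lambda>zs. sat C (take n zs @ take l (drop (n + a) zs)) \<psi>"
  assume "uniformly_pierced M n ?m ?P (u @ c @ v)"
  then obtain D N where D: "definable_over L C M ?m D" "u @ c @ v \<in> D" and pc: "pierceable (fibre n ?m ?P) D N"
    unfolding uniformly_pierced_def by blast
  obtain k PD b where PD: "defrel (?m + k) PD" "b \<in> tuples M k" "D = {x \<in> TT ?m. PD (x @ b)}"
    using D(1) by (rule definable_overE)
  have lens: "length u = a" "length c = l" "length v = e" using u c v by (auto simp: tuples_length)
  obtain k' s where s: "\<And>i. s i \<in> TT l" "\<And>i. same_type L C M (s i) c"
    and inc: "k_inconsistent k' (TT n) (\<lambda>i. solutions C n \<psi> (s i))"
    using dv lens unfolding divides_def by blast
  define S where "S zs \<longleftrightarrow> (\<exists>w\<in>TT (a + e). PD (take a w @ take l zs @ drop a w @ drop l zs))" for zs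
  have dS: "defrel (l + k) S" unfolding S_def
    by (rule defrels defrel_sub'[OF PD(1)] coords | (auto; fail))+
  obtain \<sigma> where \<sigma>: "wf_fm L (l + k) \<sigma>" "\<And>xs. xs \<in> TT (l + k) \<Longrightarrow> S xs \<longleftrightarrow> sat C xs \<sigma>"
    using dS unfolding defrel_def by blast
  have bT: "b \<in> TT k" by (rule tuples_mono[OF M PD(2)])
  have Ssat: "S (y @ b) \<longleftrightarrow> sat C (y @ b) \<sigma>" if "y \<in> TT l" for y
    by (rule \<sigma>(2)[OF tuples_append[OF that bT]])
  have "S (c @ b)" unfolding S_def
    using D(2) PD(3) tuples_append[OF u v] lens by (intro bexI[of _ "u @ v"]) auto
  then have "sat C (c @ b) \<sigma>" using Ssat[OF c] by blast
  then have "sat C (s i @ b) \<sigma>" for i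
    using s(2)[of i] \<sigma>(1) PD(2) tuples_length[OF s(1)[of i]] unfolding same_type_def by blast
  then have Sb: "S (s i @ b)" for i using Ssat[OF s(1)] by blast
  have "\<exists>t. t \<in> D \<and> take l (drop a t) = s i" for i
  proof -
    obtain w where w: "w \<in> TT (a + e)" "PD (take a w @ s i @ drop a w @ b)"
      using Sb[of i] tuples_length[OF s(1)[of i]] unfolding S_def by auto
    let ?t = "take a w @ s i @ drop a w"
    have "?t \<in> TT ?m" using w(1) s(1) by (intro tuples_append tuples_take[of _ _ _ e] tuples_drop) auto
    then have "?t \<in> D" using w(2) PD(3) by simp
    moreover have "take l (drop a ?t) = s i" using tuples_length[OF w(1)] tuples_length[OF s(1)[of i]] by simp
    ultimately show ?thesis by blast
  qed
  then obtain t where t: "\<And>i. t i \<in> D" "\<And>i. take l (drop a (t i)) = s i" by metis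
  obtain Q where Q: "finite Q" "card Q \<le> N" "\<And>y. y \<in> t ` {..N * k'} \<Longrightarrow> fibre n ?m ?P y \<inter> Q \<noteq> {}"
    by (rule pierceableE[OF pc, of "t ` {..N * k'}"]) (use t(1) in auto)
  then have "\<forall>i\<in>{..N * k'}. \<exists>q. q \<in> fibre n ?m ?P (t i) \<and> q \<in> Q" by blast
  then obtain q where q: "\<And>i. i \<le> N * k' \<Longrightarrow> q i \<in> fibre n ?m ?P (t i) \<and> q i \<in> Q" by (metis atMost_iff)
  have "\<exists>p\<in>Q. k' \<le> card {i \<in> {..N * k'}. q i = p}"
  proof (rule ccontr)
    assume "\<not> ?thesis"
    then have small: "card {i \<in> {..N * k'}. q i = p} \<le> k'" if "p \<in> Q" for p using that by force
    have "{..N * k'} = (\<Union>p\<in>Q. {i \<in> {..N * k'}. q i = p})" using q by auto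
    then have "card {..N * k'} = card (\<Union>p\<in>Q. {i \<in> {..N * k'}. q i = p})" by (rule arg_cong)
    also have "\<dots> \<le> (\<Sum>p\<in>Q. card {i \<in> {..N * k'}. q i = p})" by (rule card_UN_le[OF Q(1)])
    also have "\<dots> \<le> (\<Sum>p\<in>Q. k')" by (rule sum_mono) (rule small)
    also have "\<dots> \<le> N * k'" using Q(2) by simp
    finally show False by simp
  qed
  then obtain p where p: "p \<in> Q" "k' \<le> card {i \<in> {..N * k'}. q i = p}" by blast
  obtain I where I: "I \<subseteq> {i \<in> {..N * k'}. q i = p}" "card I = k'" "finite I"
    by (rule obtain_subset_with_card_n[OF p(2)])
  have pi: "p \<in> TT n \<and> p \<in> solutions C n \<psi> (s i)" if "i \<le> N * k'" "q i = p" for i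
  proof -
    have pn: "p \<in> TT n" and sat: "?P (p @ t i)" using q[OF that(1)] that(2) by (auto simp: fibre_def)
    have lp: "length p = n" using pn by (rule tuples_length)
    have "take n (p @ t i) @ take l (drop (n + a) (p @ t i)) = p @ s i"
      using lp t(2)[of i] by simp
    then have "sat C (p @ s i) \<psi>" using sat by simp
    then show ?thesis using pn by (simp add: solutions_def)
  qed
  show False
  proof (cases "I = {}")
    case True
    then have "k' = 0" using I by simp
    obtain d where "d \<in> univ C" using univ_ne by blast
    then have "replicate n d \<in> TT n" by (auto simp: tuples_def)
    moreover have "\<not> (\<exists>x\<in>TT n. \<forall>i\<in>{}. x \<in> solutions C n \<psi> (s i))"
      using inc \<open>k' = 0\<close> unfolding k_inconsistent_def by (metis card.empty finite.emptyI)
    ultimately show False by blast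
  next
    case False
    then have "p \<in> TT n" using pi I(1) by blast
    moreover have "\<forall>i\<in>I. p \<in> solutions C n \<psi> (s i)" using pi I(1) by blast
    ultimately show False using inc I(2,3) unfolding k_inconsistent_def by blast
  qed
qed

text \<open>
  If the fibre over \<open>t\<close> is covered by the dividing formulas with parameters \<open>c\<^sub>1, ..., c\<^sub>r\<close>, then this covering is a definable condition on the
  concatenation of \<open>t\<close> with the \<open>c\<^sub>i\<close>, so the union of the dividing formulas is pierced near it, and by
  \<open>uniformly_pierced_disj\<close> one of them is.
\<close>

lemma uniformly_pierced_not_forks:
  assumes M: "elementary_substructure L C M" and nip: "NIP L C" and P: "defrel (n + m) P" and t: "t \<in> TT m"
    and pv: "uniformly_pierced M n m P t"
  shows "\<not> forks L C n M {x \<in> TT n. P (x @ t)}"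
proof
  have MC: "M \<subseteq> univ C" by (rule elem_sub[OF M])
  assume "forks L C n M {x \<in> TT n. P (x @ t)}"
  then obtain E where E: "finite E"
    "\<And>\<psi> c. (\<psi>, c) \<in> E \<Longrightarrow> c \<in> TT (length c) \<and> wf_fm L (n + length c) \<psi> \<and> divides L C n M \<psi> c"
    "{x \<in> TT n. P (x @ t)} \<subseteq> (\<Union>(\<psi>, c)\<in>E. solutions C n \<psi> c)"
    unfolding forks_def by blast
  obtain es where es: "set es = E" using finite_list[OF E(1)] by blast
  define w where "w = concat (map snd es)"
  define r where "r = length w"
  have wT: "w \<in> TT r" unfolding r_def w_def using E(2) es by (force simp: tuples_def)
  let ?t = "t @ w"
  let ?m = "m + r"
  have tT: "?t \<in> TT ?m" by (rule tuples_append[OF t wT])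
  have "\<exists>P'. defrel (n + ?m) P' \<and> \<not> uniformly_pierced M n ?m P' ?t \<and> solutions C n \<psi> c \<subseteq> {x \<in> TT n. P' (x @ ?t)}"
    if mem: "(\<psi>, c) \<in> set es" for \<psi> c
  proof -
    obtain es1 es2 where split: "es = es1 @ (\<psi>, c) # es2" using split_list[OF mem] by blast
    let ?u = "t @ concat (map snd es1)" and ?v = "concat (map snd es2)"
    let ?a = "length ?u" and ?l = "length c" and ?e = "length ?v"
    have teq: "?t = ?u @ c @ ?v" by (simp add: w_def split)
    have "set ?t \<subseteq> univ C" using tT by (simp add: tuples_def)
    then have uv: "?u \<in> TT ?a" "?v \<in> TT ?e" unfolding teq by (auto simp: tuples_def)
    have meq: "?m = ?a + (?l + ?e)" using tuples_length[OF tT] unfolding teq by simp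
    have c: "c \<in> TT ?l" "wf_fm L (n + ?l) \<psi>" "divides L C n M \<psi> c" using E(2) mem es by auto
    let ?P = "\<lambda>zs. sat C (take n zs @ take ?l (drop (n + ?a) zs)) \<psi>"
    have "defrel (n + (?a + (?l + ?e))) ?P"
      by (rule defrel_sub'[OF defrel_sat[OF c(2)]] coords | (auto; fail))+
    moreover have "\<not> uniformly_pierced M n (?a + (?l + ?e)) ?P (?u @ c @ ?v)"
      by (rule divides_not_uniformly_pierced[OF MC c(1,2,3) uv])
    moreover have "solutions C n \<psi> c \<subseteq> {x \<in> TT n. ?P (x @ ?u @ c @ ?v)}"
    proof
      fix x assume x: "x \<in> solutions C n \<psi> c"
      then have "length x = n" by (auto simp: solutions_def tuples_length)
      then have "take n (x @ ?u @ c @ ?v) @ take ?l (drop (n + ?a) (x @ ?u @ c @ ?v)) = x @ c" by simp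
      then show "x \<in> {x \<in> TT n. ?P (x @ ?u @ c @ ?v)}" using x by (simp only: solutions_def mem_Collect_eq)
    qed
    ultimately show ?thesis unfolding meq teq by blast
  qed
  then have "\<forall>q\<in>set es. \<exists>P'. defrel (n + ?m) P' \<and> \<not> uniformly_pierced M n ?m P' ?t \<and> solutions C n (fst q) (snd q) \<subseteq> {x \<in> TT n. P' (x @ ?t)}"
    by auto
  from bchoice[OF this] obtain pr where pr: "\<forall>q\<in>set es. defrel (n + ?m) (pr q) \<and> \<not> uniformly_pierced M n ?m (pr q) ?t
      \<and> solutions C n (fst q) (snd q) \<subseteq> {x \<in> TT n. pr q (x @ ?t)}" ..
  let ?Ps = "map pr es"
  let ?U = "\<lambda>z. \<exists>P\<in>set ?Ps. P z"
  have npU: "\<not> uniformly_pierced M n ?m ?U ?t" by (rule not_uniformly_pierced_bex[OF M nip tT]) (use pr in auto)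
  have dU: "defrel (n + ?m) ?U" by (rule defrel_bex) (use pr in auto)
  obtain D N where D: "definable_over L C M m D" "t \<in> D" and pc: "pierceable (fibre n m P) D N"
    using pv unfolding uniformly_pierced_def by blast
  obtain k PD b where PD: "defrel (m + k) PD" "b \<in> tuples M k" "D = {x \<in> TT m. PD (x @ b)}"
    using D(1) by (rule definable_overE)
  define R where "R zs \<longleftrightarrow> PD (take m zs @ drop ?m zs) \<and> (\<forall>x\<in>TT n. P (x @ take m zs) \<longrightarrow> ?U (x @ take ?m zs))" for zs
  have dR: "defrel (?m + k) R" unfolding R_def
    by (rule defrel_all defrel_conj defrel_imp defrel_sub'[OF PD(1)] defrel_sub'[OF P] defrel_sub'[OF dU] coords | (auto; fail))+
  define D' where "D' = {s \<in> TT ?m. R (s @ b)}"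
  have D'def: "definable_over L C M ?m D'" unfolding D'_def by (rule definable_overI[OF dR PD(2) MC])
  have lb: "length b = k" "length t = m" using PD(2) t by (auto simp: tuples_length)
  have "?t \<in> D'"
  proof -
    have "PD (t @ b)" using D(2) PD(3) by simp
    moreover have "?U (x @ ?t)" if x: "x \<in> TT n" "P (x @ t)" for x
    proof -
      obtain \<psi> c where "(\<psi>, c) \<in> E" "x \<in> solutions C n \<psi> c" using E(3) x by blast
      then show ?thesis using pr es by fastforce
    qed
    ultimately have "R (?t @ b)" unfolding R_def using lb tuples_length[OF wT] by simp
    then show ?thesis using tT by (simp add: D'_def)
  qed
  moreover have "pierceable (fibre n ?m ?U) D' N"
    unfolding pierceable_def
  proof (intro allI impI)
    fix T assume T: "T \<subseteq> D'" "finite T"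
    have TT': "s \<in> TT ?m \<and> take m s \<in> D \<and> (\<forall>x\<in>TT n. P (x @ take m s) \<longrightarrow> ?U (x @ s))" if "s \<in> T" for s
    proof -
      have s: "s \<in> TT ?m" "R (s @ b)" using that T(1) by (auto simp: D'_def)
      then show ?thesis using tuples_length[OF s(1)] tuples_take[OF s(1)] by (auto simp: R_def PD(3))
    qed
    have "take m ` T \<subseteq> D" using TT' by blast
    then obtain Q where Q: "finite Q" "card Q \<le> N" "\<And>s. s \<in> take m ` T \<Longrightarrow> fibre n m P s \<inter> Q \<noteq> {}"
      by (rule pierceableE[OF pc]) (use T(2) in auto)
    have "fibre n ?m ?U s \<inter> Q \<noteq> {}" if s: "s \<in> T" for s
    proof -
      obtain x where "x \<in> fibre n m P (take m s)" "x \<in> Q" using Q(3)[of "take m s"] s by blast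
      then have "x \<in> fibre n ?m ?U s" using TT'[OF s] unfolding fibre_def by blast
      then show ?thesis using \<open>x \<in> Q\<close> by blast
    qed
    then show "\<exists>Q. finite Q \<and> card Q \<le> N \<and> (\<forall>s\<in>T. fibre n ?m ?U s \<inter> Q \<noteq> {})" using Q(1,2) by blast
  qed
  ultimately show False using npU D'def unfolding uniformly_pierced_def by blast
qed

end

section \<open>Forking in saturated NIP structures\<close>

lemma block_take: "Suc i * m \<le> l \<Longrightarrow> block m i (take l xs) = block m i xs"
  by (simp add: block_def drop_take)

lemma block_append_left: "length xs = a * m \<Longrightarrow> i < a \<Longrightarrow> block m i (xs @ ys) = block m i xs"
proof -
  assume len: "length xs = a * m" and i: "i < a"
  have "Suc i * m \<le> a * m" using i by (intro mult_right_mono) auto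
  then have "block m i (take (a * m) (xs @ ys)) = block m i (xs @ ys)" by (rule block_take)
  then show ?thesis using len by simp
qed

lemma block_append_last: "length xs = a * m \<Longrightarrow> length c = m \<Longrightarrow> block m a (xs @ c @ ys) = c"
  by (simp add: block_def)

locale monster = fo_structure L C for L :: "('f, 'r) language" and C :: "('a, 'f, 'r) struct" +
  fixes \<kappa> :: "'k rel"
  assumes Card: "Card_order \<kappa>" and big: "|formulas L| <o \<kappa>" and sat\<kappa>: "saturated L \<kappa> C" and nip: "NIP L C"
begin

lemma infinite_Field: "infinite (Field \<kappa>)"
proof
  assume fin: "finite (Field \<kappa>)"
  have "|formulas L| \<le>o \<kappa>" using big by (rule ordLess_imp_ordLeq)
  also have "\<kappa> =o |Field \<kappa>|" using card_of_Field_ordIso[OF Card] by (rule ordIso_symmetric)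
  finally have "|formulas L| \<le>o |Field \<kappa>|" .
  then show False using card_of_ordLeq_finite fin infinite_formulas by blast
qed

lemma small_finite: "finite A \<Longrightarrow> small \<kappa> A"
  unfolding small_def
  by (rule finite_ordLess_infinite[OF card_of_Well_order])
    (use Card infinite_Field in \<open>auto simp: card_order_on_def Field_card_of\<close>)

lemma small_Un_finite: "small \<kappa> A \<Longrightarrow> finite B \<Longrightarrow> small \<kappa> (A \<union> B)"
  using card_of_Un_ordLess_infinite_Field[OF infinite_Field Card] small_finite unfolding small_def by blast

lemma saturatedD:
  assumes "A \<subseteq> univ C" "small \<kappa> A" "\<And>X. X \<in> p \<Longrightarrow> definable_over L C A n X"
    "\<And>q. q \<subseteq> p \<Longrightarrow> finite q \<Longrightarrow> \<exists>x\<in>TT n. \<forall>X\<in>q. x \<in> X"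
  obtains x where "x \<in> TT n" "\<And>X. X \<in> p \<Longrightarrow> x \<in> X"
proof -
  have "\<exists>x\<in>TT n. \<forall>X\<in>p. x \<in> X"
    using sat\<kappa>[unfolded saturated_def, rule_format, OF assms(1,2), of p n] assms(3,4) by auto
  then show thesis using that by auto
qed

lemma definable_finite_Inter:
  assumes M: "M \<subseteq> univ C" and t: "t \<in> TT m"
  shows "finite \<D> \<Longrightarrow> (\<And>D. D \<in> \<D> \<Longrightarrow> definable_over L C M m D \<and> t \<in> D) \<Longrightarrow>
    \<exists>D'. definable_over L C M m D' \<and> t \<in> D' \<and> (\<forall>D\<in>\<D>. D' \<subseteq> D)"
proof (induction \<D> rule: finite_induct)
  case empty
  then show ?case using definable_over_TT[OF M] t by blast
next
  case (insert D \<D>)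
  then obtain D' where "definable_over L C M m D'" "t \<in> D'" "\<forall>D\<in>\<D>. D' \<subseteq> D" by auto
  then show ?case using insert.prems[of D] definable_over_Int[of M m D' D] M
    by (intro exI[of _ "D' \<inter> D"]) auto
qed

text \<open>
  Since no \<open>D\<close> around \<open>t\<close> is pierceable, every \<open>D\<close> contains arbitrarily long \<open>Suc d\<close>-inconsistent sequences. Saturation builds an
  infinite one inside the type of \<open>t\<close>, one entry at a time; \<open>H r W\<close> says that the \<open>r\<close> entries in \<open>W\<close> can still be
  prolonged by arbitrarily many elements of every \<open>D\<close>.
\<close>

lemma not_uniformly_pierced_divides:
  assumes M: "M \<subseteq> univ C" "small \<kappa> M" and \<phi>: "wf_fm L (n + m) \<phi>" and t: "t \<in> TT m"
    and npov: "\<not> uniformly_pierced M n m (\<lambda>z. sat C z \<phi>) t"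
  shows "divides L C n M \<phi> t"
proof -
  let ?P = "\<lambda>z. sat C z \<phi>"
  let ?Y = "fibre n m ?P"
  have dP: "defrel (n + m) ?P" by (rule defrel_sat[OF \<phi>])
  obtain d where d: "vc_le (?Y ` TT m) d" "vc_le {{t. x \<in> ?Y t} |x. True} d"
    using NIP_fibre[OF nip dP] by blast
  let ?k = "Suc d"
  define inc where "inc q V \<longleftrightarrow> (\<forall>I\<in>{I. I \<subseteq> {..<q} \<and> card I = ?k}. \<not> (\<exists>x\<in>TT n. \<forall>i\<in>I. ?P (x @ block m i V)))"
    for q :: nat and V
  define H where "H r W \<longleftrightarrow> W \<in> TT (r * m) \<and> (\<forall>D p. definable_over L C M m D \<and> t \<in> D \<longrightarrow>
    (\<exists>E\<in>TT (p * m). (\<forall>i\<in>{..<p}. block m i E \<in> D) \<and> inc (r + p) (W @ E)))" for r W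
  have H0: "H 0 []" unfolding H_def
  proof (intro conjI allI impI)
    fix D p assume D: "definable_over L C M m D \<and> t \<in> D"
    then have DT: "D \<subseteq> TT m" using definable_over_sub by blast
    have "\<not> (\<exists>N. pierceable ?Y D N)" using npov D unfolding uniformly_pierced_def by blast
    moreover have "vc_le (?Y ` D) d" by (rule vc_le_mono[OF d(1)]) (use DT in auto)
    ultimately obtain s where s: "\<forall>i<p. s i \<in> D" "k_inconsistent_upto ?k ?Y p s"
      using pierceable_or_inc[OF _ d(2), of D] by blast
    let ?ts = "map s [0..<p]"
    have sT: "u \<in> TT m" if "u \<in> set ?ts" for u using that s(1) DT by auto
    have b: "block m i (concat ?ts) = s i" if "i < p" for i
    proof -
      have "block m i (concat ?ts) = ?ts ! i" by (rule block_concat) (use sT that tuples_length in auto)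
      then show ?thesis using that by simp
    qed
    show "\<exists>E\<in>TT (p * m). (\<forall>i\<in>{..<p}. block m i E \<in> D) \<and> inc (0 + p) ([] @ E)"
    proof (intro bexI conjI ballI)
      show "concat ?ts \<in> TT (p * m)" using concat_tuples[of ?ts, OF sT] by simp
      show "block m i (concat ?ts) \<in> D" if "i \<in> {..<p}" for i using b s(1) that by simp
      show "inc (0 + p) ([] @ concat ?ts)" unfolding inc_def
      proof (intro ballI notI)
        fix I assume I: "I \<in> {I. I \<subseteq> {..<0 + p} \<and> card I = ?k}"
          and "\<exists>x\<in>TT n. \<forall>i\<in>I. ?P (x @ block m i ([] @ concat ?ts))"
        then obtain x where x: "x \<in> TT n" "\<And>i. i \<in> I \<Longrightarrow> ?P (x @ block m i (concat ?ts))" by auto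
        have "x \<in> ?Y (s i)" if i: "i \<in> I" for i
        proof -
          have ip: "i < p" using i I by auto
          then have "s i \<in> TT m" using s(1) DT by blast
          then show ?thesis using x(1) x(2)[OF i] b[OF ip] by (simp add: fibre_def)
        qed
        then have "\<exists>x. \<forall>i\<in>I. x \<in> ?Y (s i)" by blast
        moreover have "I \<subseteq> {..<p}" "card I = ?k" using I by simp_all
        ultimately show False using s(2) unfolding k_inconsistent_upto_def by blast
      qed
    qed
  qed (simp add: tuples_def)
  have step: "\<exists>c. H (Suc r) (W @ c) \<and> c \<in> TT m \<and> (\<forall>D. definable_over L C M m D \<and> t \<in> D \<longrightarrow> c \<in> D)"
    if HW: "H r W" for r W
  proof -
    have W: "W \<in> TT (r * m)" "length W = r * m" using HW by (auto simp: H_def tuples_length)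
    define X where "X = (\<lambda>(D, p). {c \<in> TT m. c \<in> D \<and>
      (\<exists>E\<in>TT (p * m). (\<forall>i\<in>{..<p}. block m i E \<in> D) \<and> inc (Suc r + p) (W @ c @ E))})"
    define S where "S = {D. definable_over L C M m D \<and> t \<in> D} \<times> (UNIV :: nat set)"
    let ?A = "M \<union> set W"
    obtain c where c: "c \<in> TT m" "\<And>Z. Z \<in> X ` S \<Longrightarrow> c \<in> Z"
    proof (rule saturatedD[of ?A "X ` S" m])
      show AC: "?A \<subseteq> univ C" using M(1) W(1) by (auto simp: tuples_def)
      show "small \<kappa> ?A" by (rule small_Un_finite[OF M(2)]) simp
      fix Z assume "Z \<in> X ` S"
      then obtain D p where Dp: "Z = X (D, p)" "definable_over L C M m D" by (auto simp: S_def)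
      obtain k PD b where PD: "defrel (m + k) PD" "b \<in> tuples M k" "D = {x \<in> TT m. PD (x @ b)}"
        using Dp(2) by (rule definable_overE)
      have lb: "length b = k" using PD(2) by (rule tuples_length)
      define R where "R zs \<longleftrightarrow> PD (take m zs @ take k (drop m zs)) \<and>
        (\<exists>E\<in>TT (p * m). (\<forall>i\<in>{..<p}. PD (block m i E @ take k (drop m zs))) \<and>
        (\<forall>I\<in>{I. I \<subseteq> {..<Suc r + p} \<and> card I = ?k}. \<not> (\<exists>x\<in>TT n. \<forall>i\<in>I.
          ?P (x @ block m i (drop k (drop m zs) @ take m zs @ E)))))" for zs
      have le: "Suc i * m \<le> r * m + (m + p * m)" if "I \<in> {I. I \<subseteq> {..<Suc r + p} \<and> card I = ?k}" "i \<in> I" for i I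
      proof -
        have "i < Suc r + p" using that by blast
        then have "Suc i * m \<le> (Suc r + p) * m" by (rule Suc_mult_le)
        then show ?thesis by (simp add: algebra_simps)
      qed
      have finI: "finite {I. I \<subseteq> {..<Suc r + p} \<and> card I = ?k}" "\<And>I. I \<in> {I. I \<subseteq> {..<Suc r + p} \<and> card I = ?k} \<Longrightarrow> finite I"
        by (auto intro: finite_subset)
      have "defrel (m + (k + r * m)) R" unfolding R_def
        by (rule defrels finI(1) defrel_sub'[OF PD(1)] defrel_sub'[OF dP] coords
            | erule finI(2) | (drule (1) le, simp; fail) | assumption | (auto simp: Suc_mult_le'; fail))+
      from definable_overI[OF this, of "b @ W" ?A]
      have "definable_over L C ?A m {x \<in> TT m. R (x @ b @ W)}"
        using PD(2) W AC by (auto simp: tuples_def)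
      moreover have "{x \<in> TT m. R (x @ b @ W)} = Z"
        unfolding Dp(1)
      proof (rule Set.set_eqI)
        fix x
        show "x \<in> {x \<in> TT m. R (x @ b @ W)} \<longleftrightarrow> x \<in> X (D, p)"
        proof (cases "x \<in> TT m")
          case True
          have 1: "(\<forall>i\<in>{..<p}. PD (block m i E @ b)) \<longleftrightarrow> (\<forall>i\<in>{..<p}. block m i E \<in> D)" if "E \<in> TT (p * m)" for E
            using block_tuples[OF that] by (auto simp: PD(3))
          show ?thesis
            using True tuples_length[OF True] lb 1 unfolding R_def X_def inc_def
            by (simp add: PD(3))
        next
          case False
          then show ?thesis by (simp add: X_def)
        qed
      qed
      ultimately show "definable_over L C ?A m Z" by simp
    next
      fix q assume q: "q \<subseteq> X ` S" "finite q"
      then obtain S' where S': "S' \<subseteq> S" "finite S'" "q = X ` S'" using finite_subset_image by metis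
      have "\<exists>D'. definable_over L C M m D' \<and> t \<in> D' \<and> (\<forall>D\<in>fst ` S'. D' \<subseteq> D)"
        by (rule definable_finite_Inter[OF M(1) t]) (use S' in \<open>auto simp: S_def\<close>)
      then obtain D' where D': "definable_over L C M m D'" "t \<in> D'" "\<forall>D\<in>fst ` S'. D' \<subseteq> D" by blast
      obtain p' where p': "\<forall>p\<in>snd ` S'. p \<le> p'"
        using finite_nat_set_iff_bounded_le[of "snd ` S'"] S'(2) by auto
      obtain E where E: "E \<in> TT (Suc p' * m)" "\<forall>i\<in>{..<Suc p'}. block m i E \<in> D'" "inc (r + Suc p') (W @ E)"
        using HW D'(1,2) unfolding H_def by blast
      let ?c = "take m E" and ?E = "drop m E"
      have E': "E \<in> TT (m + p' * m)" using E(1) by simp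
      have cT: "?c \<in> TT m" "?E \<in> TT (p' * m)" using tuples_take[OF E'] tuples_drop[OF E'] by auto
      have cD: "?c \<in> D'" using E(2) by (force simp: block_def)
      show "\<exists>x\<in>TT m. \<forall>Z\<in>q. x \<in> Z"
      proof (intro bexI ballI)
        fix Z assume "Z \<in> q"
        then obtain D p where Dp: "(D, p) \<in> S'" "Z = X (D, p)" using S' by auto
        have DD: "D' \<subseteq> D" "p \<le> p'" using D'(3) p' Dp(1) by force+
        let ?F = "take (p * m) ?E"
        have pm: "p * m \<le> p' * m" using DD(2) by (rule mult_right_mono) simp
        have "?F \<in> TT (p * m)"
          using cT(2) pm by (auto simp: tuples_def dest!: in_set_takeD)
        moreover have "block m i ?F \<in> D" if i: "i < p" for i
        proof -
          have "block m i ?F = block m i ?E" by (rule block_take) (rule Suc_mult_le[OF i])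
          also have "\<dots> = block m (Suc i) E" by (simp add: block_def add.commute)
          finally show ?thesis using E(2) i DD by auto
        qed
        moreover have "inc (Suc r + p) (W @ ?c @ ?F)" unfolding inc_def
        proof (intro ballI)
          fix I assume I: "I \<in> {I. I \<subseteq> {..<Suc r + p} \<and> card I = ?k}"
          have "W @ ?c @ ?F = take ((Suc r + p) * m) (W @ E)"
          proof -
            have lm: "length E = m + p' * m" using E' by (rule tuples_length)
            have "take ((Suc r + p) * m) (W @ E) = W @ take (m + p * m) E" using W(2) by (simp add: algebra_simps)
            also have "take (m + p * m) E = ?c @ ?F" by (simp add: take_add)
            finally show ?thesis by simp
          qed
          then have eq: "block m i (W @ ?c @ ?F) = block m i (W @ E)" if "i \<in> I" for i
            using block_take[of i m "(Suc r + p) * m" "W @ E"] Suc_mult_le[of i "Suc r + p" m] that I by auto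
          have "I \<in> {I. I \<subseteq> {..<r + Suc p'} \<and> card I = ?k}" using I DD(2) by auto
          then have "\<not> (\<exists>x\<in>TT n. \<forall>i\<in>I. ?P (x @ block m i (W @ E)))" using E(3) unfolding inc_def by blast
          then show "\<not> (\<exists>x\<in>TT n. \<forall>i\<in>I. ?P (x @ block m i (W @ ?c @ ?F)))" using eq by simp
        qed
        moreover have "?c \<in> D" using cD DD by blast
        ultimately show "?c \<in> Z" unfolding Dp(2) X_def using cT(1) by blast
      qed (rule cT(1))
    qed blast
    have cX: "c \<in> X (D, p)" if "definable_over L C M m D \<and> t \<in> D" for D p
      using c(2)[of "X (D, p)"] that unfolding S_def by blast
    have "H (Suc r) (W @ c)" unfolding H_def
    proof (intro conjI allI impI)
      show "W @ c \<in> TT (Suc r * m)" using tuples_append[OF W(1) c(1)] by (simp add: add.commute)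
      fix D p assume "definable_over L C M m D \<and> t \<in> D"
      from cX[OF this, of p]
      show "\<exists>E\<in>TT (p * m). (\<forall>i\<in>{..<p}. block m i E \<in> D) \<and> inc (Suc r + p) ((W @ c) @ E)"
        unfolding X_def by simp
    qed
    moreover have "\<forall>D. definable_over L C M m D \<and> t \<in> D \<longrightarrow> c \<in> D"
      using cX unfolding X_def by blast
    ultimately show ?thesis using c(1) by blast
  qed
  have "\<exists>f. \<forall>r. H r (f r) \<and> (\<exists>c. f (Suc r) = f r @ c \<and> c \<in> TT m \<and> (\<forall>D. definable_over L C M m D \<and> t \<in> D \<longrightarrow> c \<in> D))"
  proof (rule dependent_nat_choice)
    show "\<exists>W. H 0 W" using H0 by blast
    fix W r assume "H r W"
    from step[OF this]
    show "\<exists>y. H (Suc r) y \<and> (\<exists>c. y = W @ c \<and> c \<in> TT m \<and> (\<forall>D. definable_over L C M m D \<and> t \<in> D \<longrightarrow> c \<in> D))"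
      by blast
  qed
  then obtain f where f: "\<And>r. H r (f r)"
    "\<And>r. \<exists>c. f (Suc r) = f r @ c \<and> c \<in> TT m \<and> (\<forall>D. definable_over L C M m D \<and> t \<in> D \<longrightarrow> c \<in> D)" by blast
  then obtain c where c: "\<And>r. f (Suc r) = f r @ c r" "\<And>r. c r \<in> TT m"
    "\<And>r D. definable_over L C M m D \<Longrightarrow> t \<in> D \<Longrightarrow> c r \<in> D" by metis
  have lf: "length (f r) = r * m" for r using f(1)[of r] by (auto simp: H_def tuples_length)
  have blkf: "i < r \<Longrightarrow> block m i (f r) = c i" for i r
  proof (induction r)
    case (Suc r)
    show ?case
    proof (cases "i = r")
      case True
      then show ?thesis using block_append_last[OF lf[of r] tuples_length[OF c(2)[of r]], of "[]"] c(1) by simp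
    next
      case False
      then show ?thesis using Suc block_append_left[OF lf[of r], of i "c r"] c(1) by simp
    qed
  qed simp
  have lt: "length t = m" using t by (rule tuples_length)
  have "same_type L C M (c i) t" for i
    unfolding same_type_def
  proof (intro conjI allI impI)
    show "length (c i) = length t" using c(2) lt tuples_length by metis
    fix k \<psi> a assume \<psi>: "wf_fm L (length (c i) + k) \<psi>" and a: "a \<in> tuples M k"
    have lc: "length (c i) = m" using c(2) by (rule tuples_length)
    have d\<psi>: "defrel (m + k) (\<lambda>z. sat C z \<psi>)" using defrel_sat \<psi> lc by simp
    show "sat C (c i @ a) \<psi> \<longleftrightarrow> sat C (t @ a) \<psi>"
    proof (cases "sat C (t @ a) \<psi>")
      case True
      then show ?thesis using c(3)[OF definable_overI[OF d\<psi> a M(1)]] t by blast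
    next
      case False
      then show ?thesis using c(3)[OF definable_overI[OF defrel_not[OF d\<psi>] a M(1)]] t by blast
    qed
  qed
  moreover have "k_inconsistent ?k (TT n) (\<lambda>i. solutions C n \<phi> (c i))"
    unfolding k_inconsistent_def
  proof (intro allI impI notI)
    fix I :: "nat set" assume I: "finite I" "card I = ?k" and "\<exists>x\<in>TT n. \<forall>i\<in>I. x \<in> solutions C n \<phi> (c i)"
    then obtain x where x: "x \<in> TT n" "\<forall>i\<in>I. ?P (x @ c i)" by (auto simp: solutions_def)
    obtain r where r: "I \<subseteq> {..<r}" using finite_nat_set_iff_bounded[of I] I(1) by auto
    obtain E where E: "inc (r + 0) (f r @ E)" "E \<in> TT (0 * m)"
      using f(1)[of r] definable_over_TT[OF M(1)] t unfolding H_def by blast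
    have "E = []" using E(2) by (simp add: tuples_def)
    then have "\<not> (\<exists>x\<in>TT n. \<forall>i\<in>I. ?P (x @ block m i (f r)))" using E(1) r I(2) unfolding inc_def by simp
    moreover have "\<forall>i\<in>I. ?P (x @ block m i (f r))" using x(2) blkf r by auto
    ultimately show False using x(1) by blast
  qed
  ultimately show ?thesis unfolding divides_def using c(2) lt by blast
qed

lemma forks_iff_not_uniformly_pierced:
  assumes M: "elementary_substructure L C M" "small \<kappa> M" and P: "defrel (n + m) P" and t: "t \<in> TT m"
  shows "forks L C n M {x \<in> TT n. P (x @ t)} \<longleftrightarrow> \<not> uniformly_pierced M n m P t"
proof
  show "forks L C n M {x \<in> TT n. P (x @ t)} \<Longrightarrow> \<not> uniformly_pierced M n m P t"
    using uniformly_pierced_not_forks[OF M(1) nip P t] by blast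
  assume npov: "\<not> uniformly_pierced M n m P t"
  obtain \<phi> where \<phi>: "wf_fm L (n + m) \<phi>" "\<And>xs. xs \<in> TT (n + m) \<Longrightarrow> P xs \<longleftrightarrow> sat C xs \<phi>"
    using P unfolding defrel_def by blast
  have eq: "P (x @ s) \<longleftrightarrow> sat C (x @ s) \<phi>" if "x \<in> TT n" "s \<in> TT m" for x s
    by (rule \<phi>(2)[OF tuples_append[OF that]])
  have "fibre n m (\<lambda>z. sat C z \<phi>) = fibre n m P" using eq by (auto simp: fibre_def fun_eq_iff)
  then have "\<not> uniformly_pierced M n m (\<lambda>z. sat C z \<phi>) t" using npov by (simp add: uniformly_pierced_def)
  from not_uniformly_pierced_divides[OF elem_sub[OF M(1)] M(2) \<phi>(1) t this]
  have dv: "divides L C n M \<phi> t" .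
  have "{x \<in> TT n. P (x @ t)} \<subseteq> solutions C n \<phi> t" using eq[OF _ t] by (auto simp: solutions_def)
  then show "forks L C n M {x \<in> TT n. P (x @ t)}"
    unfolding forks_def using dv t tuples_length[OF t] \<phi>(1)
    by (intro exI[of _ "{(\<phi>, t)}"]) auto
qed

lemma pierceable_finite_UN:
  "finite \<D> \<Longrightarrow> (\<And>D. D \<in> \<D> \<Longrightarrow> \<exists>N. pierceable Y D N) \<Longrightarrow> \<exists>N. pierceable Y (\<Union>\<D>) N"
proof (induction \<D> rule: finite_induct)
  case empty
  then show ?case by (auto simp: pierceable_def)
next
  case (insert D \<D>)
  obtain N where "pierceable Y D N" using insert.prems[of D] by blast
  moreover obtain N' where "pierceable Y (\<Union>\<D>) N'" using insert.IH insert.prems by auto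
  ultimately have "pierceable Y (D \<union> \<Union>\<D>) (N + N')" by (rule pierceable_Un)
  then show ?case by auto
qed

lemma definable_finite_UN:
  assumes "M \<subseteq> univ C"
  shows "finite \<D> \<Longrightarrow> (\<And>D. D \<in> \<D> \<Longrightarrow> definable_over L C M m D) \<Longrightarrow> definable_over L C M m (\<Union>\<D>)"
proof (induction \<D> rule: finite_induct)
  case empty
  then show ?case using definable_over_empty[OF assms] by simp
next
  case (insert D \<D>)
  then show ?case using definable_over_Un[of M m D "\<Union>\<D>"] assms by simp
qed

text \<open>
  Were there no finite cover, the complements of all pierceable definable sets would be finitely satisfiable in \<open>H\<close>, and an element realising them by
  saturation would contradict the hypothesis. Finite unions of pierceable sets are pierceable, so two sets suffice.
\<close>

lemma cover_compact:
  assumes M: "M \<subseteq> univ C" "small \<kappa> M" and H: "definable_over L C M q H" and b: "b \<in> TT m"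
    and cov: "\<And>u. u \<in> H \<Longrightarrow> uniformly_pierced M n (q + m) P1 (u @ b) \<or> uniformly_pierced M n (q + m) P2 (u @ b)"
  obtains D1 D2 N1 N2 where "definable_over L C M (q + m) D1" "definable_over L C M (q + m) D2"
    "pierceable (fibre n (q + m) P1) D1 N1" "pierceable (fibre n (q + m) P2) D2 N2"
    "\<forall>u\<in>H. u @ b \<in> D1 \<union> D2"
proof -
  define \<D> where "\<D> P = {D. definable_over L C M (q + m) D \<and> (\<exists>N. pierceable (fibre n (q + m) P) D N)}" for P
  define X where "X D = {u \<in> TT q. u @ b \<notin> D}" for D
  let ?A = "M \<union> set b"
  have AC: "?A \<subseteq> univ C" using M(1) b by (auto simp: tuples_def)
  have HT: "H \<subseteq> TT q" by (rule definable_over_sub[OF H])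
  have lb: "length b = m" using b by (rule tuples_length)
  have "\<exists>\<F>. finite \<F> \<and> \<F> \<subseteq> \<D> P1 \<union> \<D> P2 \<and> (\<forall>u\<in>H. \<exists>D\<in>\<F>. u @ b \<in> D)"
  proof (rule ccontr)
    assume no: "\<not> ?thesis"
    obtain u where u: "u \<in> TT q" "\<And>Z. Z \<in> insert H (X ` (\<D> P1 \<union> \<D> P2)) \<Longrightarrow> u \<in> Z"
    proof (rule saturatedD[of ?A "insert H (X ` (\<D> P1 \<union> \<D> P2))" q, OF AC small_Un_finite[OF M(2)]])
      fix Z assume "Z \<in> insert H (X ` (\<D> P1 \<union> \<D> P2))"
      then consider "Z = H" | D where "Z = X D" "definable_over L C M (q + m) D" by (auto simp: \<D>_def)
      then show "definable_over L C ?A q Z"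
      proof cases
        case 1
        then show ?thesis using definable_over_mono[OF H] by simp
      next
        case (2 D)
        obtain k PD a where PD: "defrel ((q + m) + k) PD" "a \<in> tuples M k" "D = {x \<in> TT (q + m). PD (x @ a)}"
          using 2(2) by (rule definable_overE)
        have ab: "b @ a \<in> tuples ?A (m + k)" using PD(2) lb by (auto simp: tuples_def)
        have "defrel (q + (m + k)) (\<lambda>z. \<not> PD z)" using defrel_not[OF PD(1)] by (simp add: add.assoc)
        from definable_overI[OF this ab AC]
        show ?thesis using tuples_append[OF _ b] by (auto simp: 2(1) X_def PD(3) intro: definable_over_cong)
      qed
    next
      fix p assume p: "p \<subseteq> insert H (X ` (\<D> P1 \<union> \<D> P2))" "finite p"
      have "p - {H} \<subseteq> X ` (\<D> P1 \<union> \<D> P2)" "finite (p - {H})" using p by auto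
      then obtain \<F> where \<F>: "\<F> \<subseteq> \<D> P1 \<union> \<D> P2" "finite \<F>" "p - {H} = X ` \<F>"
        using finite_subset_image by metis
      from \<F>(1,2) no have "\<not> (\<forall>u\<in>H. \<exists>D\<in>\<F>. u @ b \<in> D)" by (metis (no_types))
      then obtain u where u: "u \<in> H" "\<forall>D\<in>\<F>. u @ b \<notin> D" by blast
      then have "u \<in> TT q" using HT by blast
      moreover have "u \<in> Z" if Z: "Z \<in> p" for Z
      proof (cases "Z = H")
        case False
        then have "Z \<in> X ` \<F>" using Z \<F>(3) by blast
        then show ?thesis using u \<open>u \<in> TT q\<close> by (auto simp: X_def)
      qed (use u in simp)
      ultimately show "\<exists>x\<in>TT q. \<forall>X\<in>p. x \<in> X" by blast
    qed auto
    have "u \<in> H" using u(2) by blast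
    then obtain D where D: "D \<in> \<D> P1 \<union> \<D> P2" "u @ b \<in> D" using cov[of u] unfolding uniformly_pierced_def \<D>_def by blast
    then have "u \<in> X D" using u(2) by blast
    then show False using D(2) by (simp add: X_def)
  qed
  then obtain \<F> where \<F>: "finite \<F>" "\<F> \<subseteq> \<D> P1 \<union> \<D> P2" "\<forall>u\<in>H. \<exists>D\<in>\<F>. u @ b \<in> D" by blast
  have def: "definable_over L C M (q + m) (\<Union>(\<F> \<inter> \<D> P))" for P
    by (rule definable_finite_UN[OF M(1)]) (use \<F>(1) in \<open>auto simp: \<D>_def\<close>)
  have prc: "\<exists>N. pierceable (fibre n (q + m) P) (\<Union>(\<F> \<inter> \<D> P)) N" for P
    by (rule pierceable_finite_UN) (use \<F>(1) in \<open>auto simp: \<D>_def\<close>)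
  obtain N1 N2 where "pierceable (fibre n (q + m) P1) (\<Union>(\<F> \<inter> \<D> P1)) N1" "pierceable (fibre n (q + m) P2) (\<Union>(\<F> \<inter> \<D> P2)) N2"
    using prc by metis
  moreover have "\<forall>u\<in>H. u @ b \<in> \<Union>(\<F> \<inter> \<D> P1) \<union> \<Union>(\<F> \<inter> \<D> P2)" using \<F>(2,3) by blast
  ultimately show thesis by (rule that[OF def def])
qed

end

section \<open>Definable groups and weakly generic sets\<close>

lemma forks_mono: "forks L C n M Y \<Longrightarrow> X \<subseteq> Y \<Longrightarrow> forks L C n M X"
  unfolding forks_def by (meson order_trans)

lemma forks_Un: "forks L C n M X \<Longrightarrow> forks L C n M Y \<Longrightarrow> forks L C n M (X \<union> Y)"
  unfolding forks_def
  apply (elim exE conjE)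
  subgoal for D D'
    by (rule exI[of _ "D \<union> D'"]) blast
  done

lemma forks_empty: "forks L C n M {}"
  unfolding forks_def by (intro exI[of _ "{}"]) simp

lemma l_coset_mono: "X \<subseteq> Y \<Longrightarrow> g <#\<^bsub>G\<^esub> X \<subseteq> g <#\<^bsub>G\<^esub> Y"
  by (auto simp: l_coset_def)

lemma set_mult_mono: "X \<subseteq> Y \<Longrightarrow> s <#>\<^bsub>G\<^esub> X \<subseteq> s <#>\<^bsub>G\<^esub> Y"
  by (auto simp: set_mult_def)

lemma l_coset_Un: "g <#\<^bsub>G\<^esub> (X \<union> Y) = (g <#\<^bsub>G\<^esub> X) \<union> (g <#\<^bsub>G\<^esub> Y)"
  by (auto simp: l_coset_def)

lemma set_mult_Un: "s <#>\<^bsub>G\<^esub> (X \<union> Y) = (s <#>\<^bsub>G\<^esub> X) \<union> (s <#>\<^bsub>G\<^esub> Y)"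
  by (auto simp: set_mult_def)

lemma set_mult_UN: "s <#>\<^bsub>G\<^esub> X = (\<Union>f\<in>s. f <#\<^bsub>G\<^esub> X)"
  by (auto simp: set_mult_def l_coset_def)

context fo_structure
begin

lemma defrel_nth_eq: "i < k \<Longrightarrow> j < k \<Longrightarrow> defrel k (\<lambda>z. z ! i = z ! j)"
  using defrel_sat[of k "Equal (Var i) (Var j)"] by simp

lemma defrel_eq: "defrel (m + m) (\<lambda>z. take m z = drop m z)"
proof (rule defrel_cong)
  show "defrel (m + m) (\<lambda>z. \<forall>i\<in>{..<m}. z ! i = z ! (m + i))"
    by (rule defrel_ball) (auto intro: defrel_nth_eq)
  fix z assume "z \<in> TT (m + m)"
  then have "length z = m + m" by (rule tuples_length)
  then show "take m z = drop m z \<longleftrightarrow> (\<forall>i\<in>{..<m}. z ! i = z ! (m + i))"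
    by (auto simp: list_eq_iff_nth_eq)
qed

lemma dcl_univ: "dcl L C {} \<subseteq> univ C"
  by (auto simp: dcl_def)

text \<open>
  Each element of \<open>dcl {}\<close> is named by a formula, so such parameters can be quantified away.
\<close>

lemma defrel_param:
  assumes P: "defrel (k + l) P" and a: "a \<in> tuples (dcl L C {}) l"
  shows "defrel k (\<lambda>x. P (x @ a))"
proof -
  have la: "length a = l" using a by (rule tuples_length)
  have aT: "a \<in> TT l" by (rule tuples_mono[OF dcl_univ a])
  have "\<exists>\<delta>. defrel 1 \<delta> \<and> (\<forall>y\<in>TT 1. \<delta> y \<longleftrightarrow> y = [a ! i])" if i: "i \<in> {..<l}" for i
  proof -
    have "a ! i \<in> dcl L C {}" using a i la nth_mem[of i a] by (auto simp: tuples_def)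
    then have "definable_over L C {} 1 {[a ! i]}" by (simp add: dcl_def)
    then obtain \<delta> where "defrel 1 \<delta>" "{[a ! i]} = {x \<in> TT 1. \<delta> x}" unfolding definable_over_empty_params by blast
    then have "defrel 1 \<delta> \<and> (\<forall>y\<in>TT 1. \<delta> y \<longleftrightarrow> y = [a ! i])" by (auto simp: set_eq_iff)
    then show ?thesis by blast
  qed
  then have "\<forall>i\<in>{..<l}. \<exists>\<delta>. defrel 1 \<delta> \<and> (\<forall>y\<in>TT 1. \<delta> y \<longleftrightarrow> y = [a ! i])" by blast
  from bchoice[OF this] obtain \<delta> where \<delta>: "\<forall>i\<in>{..<l}. defrel 1 (\<delta> i) \<and> (\<forall>y\<in>TT 1. \<delta> i y \<longleftrightarrow> y = [a ! i])" ..
  have d: "defrel 1 (\<delta> i)" if "i \<in> {..<l}" for i using \<delta> that by blast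
  have "defrel k (\<lambda>x. \<exists>y\<in>TT l. (\<forall>i\<in>{..<l}. \<delta> i (block 1 i y)) \<and> P (x @ y))"
    by (rule defrels defrel_sub'[OF P] coords | (rule defrel_sub'[OF d]) | assumption | (auto; fail))+
  then show ?thesis
  proof (rule defrel_cong)
    fix x
    have "(\<forall>i\<in>{..<l}. \<delta> i (block 1 i y)) \<longleftrightarrow> y = a" if y: "y \<in> TT l" for y
    proof -
      have ly: "length y = l" using y by (rule tuples_length)
      have b1: "block 1 i y = [y ! i]" if "i < l" for i
        using that ly by (simp add: block_def Cons_nth_drop_Suc[symmetric])
      have "\<delta> i (block 1 i y) \<longleftrightarrow> y ! i = a ! i" if i: "i < l" for i
        using \<delta> i b1[OF i] block_tuples[of y "univ C" l 1 i] y by auto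
      then have "(\<forall>i\<in>{..<l}. \<delta> i (block 1 i y)) \<longleftrightarrow> (\<forall>i<l. y ! i = a ! i)" by auto
      also have "\<dots> \<longleftrightarrow> y = a" using ly la by (auto intro: nth_equalityI)
      finally show ?thesis .
    qed
    then show "P (x @ a) \<longleftrightarrow> (\<exists>y\<in>TT l. (\<forall>i\<in>{..<l}. \<delta> i (block 1 i y)) \<and> P (x @ y))" using aT by auto
  qed
qed

lemma definable_over_dcl:
  assumes "definable_over L C (dcl L C {}) k D"
  obtains P where "defrel k P" "D = {x \<in> TT k. P x}"
  using assms by (elim definable_overE) (use defrel_param in blast)

lemma same_type_empty:
  assumes "same_type L C {} t t'" "defrel m P" "t \<in> TT m" "t' \<in> TT m" "P t"
  shows "P t'"
proof -
  obtain \<phi> where \<phi>: "wf_fm L m \<phi>" "\<forall>xs\<in>TT m. P xs \<longleftrightarrow> sat C xs \<phi>" using assms(2) unfolding defrel_def by blast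
  have "wf_fm L (length t + 0) \<phi>" "[] \<in> tuples {} 0" using \<phi>(1) tuples_length[OF assms(3)] by (auto simp: tuples_def)
  then have "sat C (t @ []) \<phi> \<longleftrightarrow> sat C (t' @ []) \<phi>" using assms(1) unfolding same_type_def by blast
  then show ?thesis using \<phi>(2) assms(3-5) by simp
qed

end

locale monster_group = monster L C \<kappa> for L :: "('f, 'r) language" and C :: "('a, 'f, 'r) struct" and \<kappa> :: "'k rel" +
  fixes n :: nat and G :: "'a list monoid" (structure)
  assumes dg: "definable_group L C n G"
begin

sublocale group G using dg by (simp add: definable_group_def)

lemma defrel_car: "defrel n (\<lambda>x. x \<in> carrier G)" and car_TT: "carrier G \<subseteq> TT n"
proof -
  obtain P where P: "defrel n P" "carrier G = {x \<in> TT n. P x}"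
    using dg unfolding definable_group_def definable_over_empty_params by blast
  then show "defrel n (\<lambda>x. x \<in> carrier G)" "carrier G \<subseteq> TT n" by (auto intro: defrel_cong)
qed

lemma car_length: "x \<in> carrier G \<Longrightarrow> length x = n"
  using car_TT tuples_length by blast

definition mult_graph :: "'a list \<Rightarrow> bool" where
  "mult_graph z \<longleftrightarrow> (\<exists>x y. x \<in> carrier G \<and> y \<in> carrier G \<and> z = x @ y @ (x \<otimes> y))"

lemma defrel_mult_graph: "defrel (n + (n + n)) mult_graph"
proof -
  obtain P where P: "defrel (n + (n + n)) P"
    "{x @ y @ (x \<otimes> y) | x y. x \<in> carrier G \<and> y \<in> carrier G} = {z \<in> TT (n + (n + n)). P z}"
    using dg unfolding definable_group_def definable_over_empty_params by blast
  have "mult_graph z \<longleftrightarrow> z \<in> {x @ y @ (x \<otimes> y) | x y. x \<in> carrier G \<and> y \<in> carrier G}" for z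
    by (auto simp: mult_graph_def)
  then show ?thesis unfolding P(2) by (intro defrel_cong[OF P(1)]) simp
qed

lemma mult_graph_iff: "length x = n \<Longrightarrow> length y = n \<Longrightarrow> mult_graph (x @ y @ z) \<longleftrightarrow> x \<in> carrier G \<and> y \<in> carrier G \<and> z = x \<otimes> y"
  unfolding mult_graph_def using car_length by (metis append_eq_append_conv)

text \<open>
  Left translation as an operation on definable families: the coordinates of \<open>u\<close> are inserted between those of the point and those of the parameter
  (\<open>translate_rel_iff\<close>).
\<close>

definition translate_rel :: "('a list \<Rightarrow> bool) \<Rightarrow> 'a list \<Rightarrow> bool" where
  "translate_rel R zs \<longleftrightarrow> (\<exists>w\<in>TT n. R (w @ drop (n + n) zs) \<and> mult_graph (take n (drop n zs) @ w @ take n zs))"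

lemma defrel_translate_rel:
  assumes "defrel (n + m) R" shows "defrel (n + (n + m)) (translate_rel R)"
  unfolding translate_rel_def
  by (rule defrels defrel_sub'[OF assms] defrel_sub'[OF defrel_mult_graph] coords | (auto; fail))+

lemma translate_rel_iff:
  assumes "u \<in> carrier G" "x \<in> TT n"
  shows "translate_rel R (x @ u @ y) \<longleftrightarrow> x \<in> u <# {w \<in> carrier G. R (w @ y)}"
proof -
  have lx: "length x = n" "length u = n" using assms car_length tuples_length by auto
  have "translate_rel R (x @ u @ y) \<longleftrightarrow> (\<exists>w\<in>TT n. R (w @ y) \<and> w \<in> carrier G \<and> x = u \<otimes> w)"
    unfolding translate_rel_def using lx assms(1) by (auto simp: mult_graph_iff tuples_length)
  also have "\<dots> \<longleftrightarrow> x \<in> u <# {w \<in> carrier G. R (w @ y)}" using car_TT by (auto simp: l_coset_def)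
  finally show ?thesis .
qed

definition group_fibre :: "('a list \<Rightarrow> bool) \<Rightarrow> 'a list \<Rightarrow> 'a list set" where
  "group_fibre R y = {w \<in> carrier G. R (w @ y)}"

lemma group_fibre_sub: "group_fibre R y \<subseteq> carrier G"
  by (auto simp: group_fibre_def)

lemma l_coset_car: "u \<in> carrier G \<Longrightarrow> X \<subseteq> carrier G \<Longrightarrow> u <# X \<subseteq> carrier G"
  by (auto simp: l_coset_def)

lemma set_mult_car: "s \<subseteq> carrier G \<Longrightarrow> X \<subseteq> carrier G \<Longrightarrow> s <#> X \<subseteq> carrier G"
  by (auto simp: set_mult_def)

lemma translate_rel_set: "u \<in> carrier G \<Longrightarrow> {x \<in> TT n. translate_rel R (x @ u @ y)} = u <# group_fibre R y"
  using l_coset_car[of u "group_fibre R y"] group_fibre_sub[of R y] car_TT unfolding group_fibre_def by (auto simp: translate_rel_iff)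

lemma fibre_translate_rel: "u \<in> carrier G \<Longrightarrow> y \<in> TT m \<Longrightarrow> fibre n (n + m) (translate_rel R) (u @ y) = u <# group_fibre R y"
  using tuples_append[of u "univ C" n y m] car_TT translate_rel_set[of u R y] by (auto simp: fibre_def)

lemma definable_subset_group_fibre:
  assumes "definable_subset L C n G X"
  obtains m R b where "defrel (n + m) R" "b \<in> TT m" "X = group_fibre R b"
proof -
  obtain m R b where R: "defrel (n + m) R" "b \<in> TT m" "X = {x \<in> TT n. R (x @ b)}"
    using assms unfolding definable_subset_def by (elim conjE definable_overE)
  moreover have "X = group_fibre R b" using assms R(3) car_TT by (auto simp: definable_subset_def group_fibre_def)
  ultimately show thesis using that by blast
qed

lemma group_fibre_definable: "defrel (n + m) R \<Longrightarrow> b \<in> TT m \<Longrightarrow> definable_subset L C n G (group_fibre R b)"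
proof -
  assume R: "defrel (n + m) R" and b: "b \<in> TT m"
  have "defrel (n + m) (\<lambda>z. take n z \<in> carrier G \<and> R z)"
    by (rule defrels R defrel_sub'[OF defrel_car] coords | (auto; fail))+
  from definable_overI[OF this b] have "definable_over L C (univ C) n {x \<in> TT n. take n (x @ b) \<in> carrier G \<and> R (x @ b)}"
    by simp
  moreover have "{x \<in> TT n. take n (x @ b) \<in> carrier G \<and> R (x @ b)} = group_fibre R b"
    using car_TT by (auto simp: group_fibre_def tuples_length)
  ultimately show ?thesis by (simp add: definable_subset_def group_fibre_sub)
qed

lemma definable_subset_Un:
  "definable_subset L C n G X \<Longrightarrow> definable_subset L C n G Y \<Longrightarrow> definable_subset L C n G (X \<union> Y)"
  by (simp add: definable_subset_def definable_over_Un)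

lemma definable_subset_empty: "definable_subset L C n G {}"
  by (simp add: definable_subset_def definable_over_empty)

lemma definable_subset_l_coset:
  assumes "definable_subset L C n G X" "g \<in> carrier G" shows "definable_subset L C n G (g <# X)"
proof -
  obtain m R b where R: "defrel (n + m) R" "b \<in> TT m" "X = group_fibre R b" using assms(1) by (rule definable_subset_group_fibre)
  have "g @ b \<in> TT (n + m)" using tuples_append R(2) assms(2) car_TT by blast
  from definable_overI[OF defrel_translate_rel[OF R(1)] this subset_refl]
  show ?thesis using translate_rel_set[OF assms(2)] l_coset_car[OF assms(2) group_fibre_sub] by (simp add: definable_subset_def R(3))
qed

lemma definable_subset_finite_UN:
  "finite I \<Longrightarrow> (\<And>i. i \<in> I \<Longrightarrow> definable_subset L C n G (X i)) \<Longrightarrow> definable_subset L C n G (\<Union>i\<in>I. X i)"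
  by (induction I rule: finite_induct) (auto simp: definable_subset_empty definable_subset_Un)

lemma definable_subset_set_mult:
  "definable_subset L C n G X \<Longrightarrow> finite s \<Longrightarrow> s \<subseteq> carrier G \<Longrightarrow> definable_subset L C n G (s <#> X)"
  unfolding set_mult_UN by (rule definable_subset_finite_UN) (auto intro: definable_subset_l_coset)

lemma definable_subset_Diff:
  assumes "definable_subset L C n G X" shows "definable_subset L C n G (carrier G - X)"
proof -
  have "definable_over L C (univ C) n (carrier G)"
    using dg definable_over_mono unfolding definable_group_def by blast
  moreover have "definable_over L C (univ C) n (TT n - X)"
    using assms definable_over_Compl unfolding definable_subset_def by blast
  ultimately have "definable_over L C (univ C) n (carrier G \<inter> (TT n - X))" by (rule definable_over_Int) simp
  moreover have "carrier G \<inter> (TT n - X) = carrier G - X" using car_TT by blast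
  ultimately show ?thesis by (simp add: definable_subset_def)
qed

lemma forks_translate_iff:
  assumes M: "elementary_substructure L C M" "small \<kappa> M" and R: "defrel (n + m) R" and b: "b \<in> TT m"
    and u: "u \<in> carrier G"
  shows "forks L C n M (u <# group_fibre R b) \<longleftrightarrow> \<not> uniformly_pierced M n (n + m) (translate_rel R) (u @ b)"
proof -
  have "u @ b \<in> TT (n + m)" using u b car_TT tuples_append by blast
  from forks_iff_not_uniformly_pierced[OF M defrel_translate_rel[OF R] this] show ?thesis using translate_rel_set[OF u] by simp
qed

text \<open>
  The left translates have the finite intersection property.
\<close>

definition thick :: "'a list set \<Rightarrow> bool" where
  "thick X \<longleftrightarrow> (\<forall>T. finite T \<longrightarrow> T \<subseteq> carrier G \<longrightarrow> (\<exists>x. \<forall>g\<in>T. x \<in> g <# X))"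

text \<open>
  Compactness gives one piercing number for all translates, which is then lowered to one.
\<close>

lemma f_generic_piecewise_thick:
  assumes X: "definable_subset L C n G X" and s: "finite s" "s \<subseteq> carrier G" and fg: "f_generic L \<kappa> C n G (s <#> X)"
  shows "\<exists>s. finite s \<and> s \<subseteq> carrier G \<and> thick (s <#> X)"
proof -
  obtain M where M: "elementary_substructure L C M" "small \<kappa> M" "\<And>g. g \<in> carrier G \<Longrightarrow> \<not> forks L C n M (g <# (s <#> X))"
    using fg unfolding f_generic_def by blast
  obtain m R b where R: "defrel (n + m) R" "b \<in> TT m" "s <#> X = group_fibre R b"
    using definable_subset_set_mult[OF X s] by (rule definable_subset_group_fibre)
  have MC: "M \<subseteq> univ C" by (rule elem_sub[OF M(1)])
  have carM: "definable_over L C M n (carrier G)" using dg definable_over_mono unfolding definable_group_def by blast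
  have pv: "uniformly_pierced M n (n + m) (translate_rel R) (u @ b) \<or> uniformly_pierced M n (n + m) (translate_rel R) (u @ b)" if "u \<in> carrier G" for u
    using M(3)[OF that] forks_translate_iff[OF M(1,2) R(1,2) that] R(3) by simp
  obtain D1 D2 N1 N2 where "definable_over L C M (n + m) D1" "definable_over L C M (n + m) D2"
    and D: "pierceable (fibre n (n + m) (translate_rel R)) D1 N1" "pierceable (fibre n (n + m) (translate_rel R)) D2 N2"
    "\<forall>u\<in>carrier G. u @ b \<in> D1 \<union> D2"
    by (rule cover_compact[OF MC M(2) carM R(2) pv])
  have pc: "pierceable (fibre n (n + m) (translate_rel R)) (D1 \<union> D2) (N1 + N2)" by (rule pierceable_Un[OF D(1,2)])
  have "\<exists>P. finite P \<and> card P \<le> N1 + N2 \<and> (\<forall>g\<in>T. (g <# (s <#> X)) \<inter> P \<noteq> {})" if T: "finite T" "T \<subseteq> carrier G" for T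
  proof -
    have "(\<lambda>g. g @ b) ` T \<subseteq> D1 \<union> D2" using D(3) T(2) by blast
    then obtain Q where Q: "finite Q" "card Q \<le> N1 + N2" "\<And>t. t \<in> (\<lambda>g. g @ b) ` T \<Longrightarrow> fibre n (n + m) (translate_rel R) t \<inter> Q \<noteq> {}"
      by (rule pierceableE[OF pc]) (use T(1) in auto)
    have "(g <# (s <#> X)) \<inter> Q \<noteq> {}" if g: "g \<in> T" for g
      using Q(3)[of "g @ b"] g fibre_translate_rel[of g b m R] T(2) R(2,3) by auto
    then show ?thesis using Q(1,2) by blast
  qed
  then show ?thesis
    using pierced_translates_thick[of X s "N1 + N2"] X s unfolding thick_def definable_subset_def by blast
qed

text \<open>
  Over a model containing the parameters \<open>b\<close>, the tuples \<open>u @ b\<close> with \<open>u \<in> G\<close> form a definable set, and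
  thickness says that the family of translates over it is pierced by a single point.
\<close>

lemma thick_f_generic:
  assumes Z: "definable_subset L C n G Z" and th: "thick Z"
  shows "f_generic L \<kappa> C n G Z"
proof -
  obtain m R b where R: "defrel (n + m) R" "b \<in> TT m" "Z = group_fibre R b" using Z by (rule definable_subset_group_fibre)
  have "set b \<subseteq> univ C" using R(2) by (simp add: tuples_def)
  then obtain M where M: "elementary_substructure L C M" "set b \<subseteq> M" "|M| \<le>o |formulas L|" by (rule Loewenheim_Skolem)
  have sm: "small \<kappa> M" unfolding small_def using M(3) big by (rule ordLeq_ordLess_trans)
  have MC: "M \<subseteq> univ C" by (rule elem_sub[OF M(1)])
  have bM: "b \<in> tuples M m" using R(2) M(2) by (simp add: tuples_def)
  have "\<not> forks L C n M (g <# Z)" if g: "g \<in> carrier G" for g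
  proof -
    define E where "E z \<longleftrightarrow> take n z \<in> carrier G \<and> take m (take m (drop n z) @ drop (n + m) z) = drop m (take m (drop n z) @ drop (n + m) z)" for z
    have dE: "defrel ((n + m) + m) E" unfolding E_def
      by (rule defrel_conj defrel_sub'[OF defrel_car] defrel_sub'[OF defrel_eq] coords | (auto; fail))+
    define D where "D = {z \<in> TT (n + m). E (z @ b)}"
    have Ddef: "definable_over L C M (n + m) D" unfolding D_def by (rule definable_overI[OF dE bM MC])
    have lb: "length b = m" using R(2) by (rule tuples_length)
    have Diff: "z \<in> D \<longleftrightarrow> (\<exists>u\<in>carrier G. z = u @ b)" for z
    proof
      assume "z \<in> D"
      then have zT: "z \<in> TT (n + m)" and Ez: "E (z @ b)" by (simp_all add: D_def)
      have lz: "length z = n + m" using zT by (rule tuples_length)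
      have "take n z \<in> carrier G" "drop n z = b" using Ez lz lb by (simp_all add: E_def)
      then show "\<exists>u\<in>carrier G. z = u @ b" by (metis append_take_drop_id)
    next
      assume "\<exists>u\<in>carrier G. z = u @ b"
      then obtain u where u: "u \<in> carrier G" "z = u @ b" by blast
      then have "z \<in> TT (n + m)" using tuples_append R(2) car_TT by blast
      then show "z \<in> D" using u lb car_length[OF u(1)] by (simp add: D_def E_def)
    qed
    have "pierceable (fibre n (n + m) (translate_rel R)) D 1" unfolding pierceable_def
    proof (intro allI impI)
      fix T assume T: "T \<subseteq> D" "finite T"
      have "take n ` T \<subseteq> carrier G"
      proof
        fix v assume "v \<in> take n ` T"
        then obtain t where t: "t \<in> T" "v = take n t" by blast
        then obtain u where "u \<in> carrier G" "t = u @ b" using T(1) Diff by blast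
        then show "v \<in> carrier G" using t(2) car_length[of u] by simp
      qed
      then obtain x where x: "\<forall>g\<in>take n ` T. x \<in> g <# Z" using th T(2) unfolding thick_def by blast
      have "fibre n (n + m) (translate_rel R) t \<inter> {x} \<noteq> {}" if t: "t \<in> T" for t
      proof -
        obtain u where u: "u \<in> carrier G" "t = u @ b" using t T(1) Diff by blast
        have "u \<in> take n ` T" using t u car_length by (intro image_eqI[of _ _ t]) auto
        then show ?thesis using x fibre_translate_rel[OF u(1) R(2)] u(2) R(3) by auto
      qed
      then show "\<exists>Q. finite Q \<and> card Q \<le> 1 \<and> (\<forall>t\<in>T. fibre n (n + m) (translate_rel R) t \<inter> Q \<noteq> {})"
        by (intro exI[of _ "{x}"]) simp
    qed
    moreover have "g @ b \<in> D" using Diff g by blast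
    ultimately have "uniformly_pierced M n (n + m) (translate_rel R) (g @ b)" using Ddef unfolding uniformly_pierced_def by blast
    then show ?thesis using forks_translate_iff[OF M(1) sm R(1,2) g] R(3) by simp
  qed
  then show ?thesis unfolding f_generic_def using M(1) sm by blast
qed

text \<open>
  If \<open>X \<union> Y\<close> is generic through \<open>s\<close> and \<open>s X\<close> is not thick, then finitely many translates of \<open>Y\<close> cover \<open>G\<close>. If \<open>s X\<close> is thick,
  its complement is the required set that is not generic.
\<close>

lemma weakly_generic_iff:
  assumes X: "definable_subset L C n G X"
  shows "weakly_generic L C n G X \<longleftrightarrow> (\<exists>s. finite s \<and> s \<subseteq> carrier G \<and> thick (s <#> X))"
proof
  assume "weakly_generic L C n G X"
  then obtain Y where Y: "definable_subset L C n G Y" "\<not> generic G Y" "generic G (X \<union> Y)"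
    unfolding weakly_generic_def by blast
  obtain s where s: "finite s" "s \<subseteq> carrier G" "carrier G \<subseteq> (\<Union>g\<in>s. g <# (X \<union> Y))"
    using Y(3) unfolding generic_def by blast
  have YC: "Y \<subseteq> carrier G" and XC: "X \<subseteq> carrier G" using Y(1) X by (auto simp: definable_subset_def)
  have "thick (s <#> X)" unfolding thick_def
  proof (intro allI impI, rule ccontr)
    fix T assume T: "finite T" "T \<subseteq> carrier G" and no: "\<not> (\<exists>x. \<forall>g\<in>T. x \<in> g <# (s <#> X))"
    have "carrier G \<subseteq> (\<Union>k\<in>(\<lambda>(g, h). g \<otimes> h) ` (T \<times> s). k <# Y)"
    proof
      fix x assume x: "x \<in> carrier G"
      obtain g where g: "g \<in> T" "x \<notin> g <# (s <#> X)" using no by blast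
      have gC: "g \<in> carrier G" using g T by blast
      have "inv g \<otimes> x \<in> carrier G" using gC x by simp
      then obtain h where h: "h \<in> s" "inv g \<otimes> x \<in> h <# (X \<union> Y)" using s(3) by blast
      have "inv g \<otimes> x \<notin> s <#> X" using g(2) mem_l_coset_iff[OF gC set_mult_car[OF s(2) XC] x] by blast
      then have "inv g \<otimes> x \<in> h <# Y" using h by (auto simp: l_coset_Un set_mult_UN)
      then have "x \<in> g <# (h <# Y)"
        using mem_l_coset_iff[OF gC l_coset_car[of h Y] x] h(1) s(2) YC by blast
      then have "x \<in> (g \<otimes> h) <# Y" using lcos_m_assoc[OF YC gC] h(1) s(2) by (metis subsetD)
      then show "x \<in> (\<Union>k\<in>(\<lambda>(g, h). g \<otimes> h) ` (T \<times> s). k <# Y)" using g(1) h(1) by force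
    qed
    moreover have "finite ((\<lambda>(g, h). g \<otimes> h) ` (T \<times> s))" using T s by simp
    moreover have "(\<lambda>(g, h). g \<otimes> h) ` (T \<times> s) \<subseteq> carrier G" using T s by auto
    ultimately have "generic G Y" unfolding generic_def by blast
    then show False using Y(2) by blast
  qed
  then show "\<exists>s. finite s \<and> s \<subseteq> carrier G \<and> thick (s <#> X)" using s by blast
next
  assume "\<exists>s. finite s \<and> s \<subseteq> carrier G \<and> thick (s <#> X)"
  then obtain s where s: "finite s" "s \<subseteq> carrier G" "thick (s <#> X)" by blast
  have XC: "X \<subseteq> carrier G" using X by (auto simp: definable_subset_def)
  let ?Y = "carrier G - (s <#> X)"
  have "definable_subset L C n G ?Y" by (intro definable_subset_Diff definable_subset_set_mult X s)
  moreover have "\<not> generic G ?Y"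
  proof
    assume "generic G ?Y"
    then obtain t where t: "finite t" "t \<subseteq> carrier G" "carrier G \<subseteq> (\<Union>g\<in>t. g <# ?Y)" unfolding generic_def by blast
    \<comment> \<open>Adding \<open>\<one>\<close> to \<open>t\<close> forces the common point to lie in the carrier, even when \<open>t\<close> is empty.\<close>
    have "finite (insert \<one> t)" "insert \<one> t \<subseteq> carrier G" using t by auto
    then obtain x where x: "\<forall>g\<in>insert \<one> t. x \<in> g <# (s <#> X)" using s(3) unfolding thick_def by blast
    have sX: "s <#> X \<subseteq> carrier G" by (rule set_mult_car[OF s(2) XC])
    have xC: "x \<in> carrier G" using x l_coset_car[OF one_closed sX] by blast
    then obtain g where g: "g \<in> t" "x \<in> g <# ?Y" using t(3) by blast
    have gC: "g \<in> carrier G" using g t by blast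
    have "inv g \<otimes> x \<in> ?Y" using g(2) mem_l_coset_iff[OF gC _ xC, of ?Y] by blast
    moreover have "inv g \<otimes> x \<in> s <#> X" using x g(1) mem_l_coset_iff[OF gC sX xC] by blast
    ultimately show False by blast
  qed
  moreover have "generic G (X \<union> ?Y)" unfolding generic_def
  proof (intro exI[of _ "insert \<one> s"] conjI)
    show "carrier G \<subseteq> (\<Union>g\<in>insert \<one> s. g <# (X \<union> ?Y))"
    proof
      fix x assume x: "x \<in> carrier G"
      show "x \<in> (\<Union>g\<in>insert \<one> s. g <# (X \<union> ?Y))"
      proof (cases "x \<in> s <#> X")
        case True
        then show ?thesis by (auto simp: set_mult_UN l_coset_Un)
      next
        case False
        then have "x \<in> \<one> <# (X \<union> ?Y)" using x by (force simp: l_coset_def)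
        then show ?thesis by blast
      qed
    qed
  qed (use s in auto)
  ultimately show "weakly_generic L C n G X" unfolding weakly_generic_def by blast
qed

lemma piecewise_f_generic_iff:
  assumes X: "definable_subset L C n G X"
  shows "piecewise_f_generic L \<kappa> C n G X \<longleftrightarrow> weakly_generic L C n G X"
proof -
  have "piecewise_f_generic L \<kappa> C n G X \<longleftrightarrow> (\<exists>s. finite s \<and> s \<subseteq> carrier G \<and> thick (s <#> X))"
  proof
    assume "piecewise_f_generic L \<kappa> C n G X"
    then show "\<exists>s. finite s \<and> s \<subseteq> carrier G \<and> thick (s <#> X)"
      unfolding piecewise_f_generic_def using f_generic_piecewise_thick[OF X] by blast
  next
    assume "\<exists>s. finite s \<and> s \<subseteq> carrier G \<and> thick (s <#> X)"
    then obtain s where s: "finite s" "s \<subseteq> carrier G" "thick (s <#> X)" by blast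
    then show "piecewise_f_generic L \<kappa> C n G X"
      unfolding piecewise_f_generic_def using thick_f_generic[OF definable_subset_set_mult[OF X s(1,2)] s(3)] by blast
  qed
  then show ?thesis using weakly_generic_iff[OF X] by simp
qed

lemma weakly_generic_Un:
  assumes "definable_subset L C n G Y" "weakly_generic L C n G (X \<union> Y)"
  shows "weakly_generic L C n G X \<or> weakly_generic L C n G Y"
proof -
  obtain Z where Z: "definable_subset L C n G Z" "\<not> generic G Z" "generic G (X \<union> Y \<union> Z)"
    using assms(2) unfolding weakly_generic_def by blast
  show ?thesis
  proof (cases "generic G (Y \<union> Z)")
    case True
    then show ?thesis unfolding weakly_generic_def using Z by blast
  next
    case False
    moreover have "generic G (X \<union> (Y \<union> Z))" using Z(3) by (simp add: Un_assoc)
    ultimately show ?thesis unfolding weakly_generic_def using definable_subset_Un[OF assms(1) Z(1)] by blast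
  qed
qed

lemma set_mult_l_coset:
  assumes "s \<subseteq> carrier G" "g \<in> carrier G" "X \<subseteq> carrier G"
  shows "s <#> (g <# X) = ((\<lambda>h. h \<otimes> g) ` s) <#> X"
  unfolding set_mult_UN using lcos_m_assoc[OF assms(3) _ assms(2)] assms(1) by (auto simp: subset_iff)

end

section \<open>Strong f-generic sets over a model of definable points\<close>

locale dcl_model = monster_group L C \<kappa> n G
  for L :: "('f, 'r) language" and C :: "('a, 'f, 'r) struct" and \<kappa> :: "'k rel"
    and n :: nat and G :: "'a list monoid" (structure) +
  assumes el: "elementary_substructure L C (dcl L C {})"
begin

abbreviation M0 :: "'a set" where "M0 \<equiv> dcl L C {}"
abbreviation \<Gamma> :: "'a list set" where "\<Gamma> \<equiv> points n G M0"
abbreviation strong :: "'a list set \<Rightarrow> bool" where "strong \<equiv> strong_f_generic L C n G M0"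
abbreviation piecewise_strong :: "'a list set \<Rightarrow> 'a list set \<Rightarrow> bool" where
  "piecewise_strong W \<equiv> piecewise_strong_f_generic_in W L C n G M0"

text \<open>
  An element of \<open>dcl {}\<close> is determined by a formula that isolates it.
\<close>

lemma M0_small: "small \<kappa> M0"
proof -
  have "\<exists>\<phi>\<in>formulas L. {[a]} = solutions C 1 \<phi> []" if a: "a \<in> M0" for a
  proof -
    obtain m \<phi> b where "b \<in> tuples {} m" "wf_fm L (1 + m) \<phi>" "{[a]} = solutions C 1 \<phi> b"
      using a unfolding dcl_def definable_over_def by blast
    moreover then have "b = []" by (simp add: tuples_def)
    ultimately show ?thesis unfolding formulas_def by blast
  qed
  then have "\<forall>a\<in>M0. \<exists>\<phi>. \<phi> \<in> formulas L \<and> {[a]} = solutions C 1 \<phi> []" by blast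
  from bchoice[OF this] obtain f where f: "\<forall>a\<in>M0. f a \<in> formulas L \<and> {[a]} = solutions C 1 (f a) []" ..
  have "inj_on f M0"
  proof (rule inj_onI)
    fix a a' assume "a \<in> M0" "a' \<in> M0" "f a = f a'"
    then have "{[a]} = {[a']}" using f by metis
    then show "a = a'" by simp
  qed
  moreover have "f ` M0 \<subseteq> formulas L" using f by blast
  ultimately have "|M0| \<le>o |formulas L|" using card_of_ordLeq by blast
  then show ?thesis unfolding small_def using big by (rule ordLeq_ordLess_trans)
qed

lemma M0_sub: "M0 \<subseteq> univ C"
  by (rule elem_sub[OF el])

lemma \<Gamma>_car: "\<Gamma> \<subseteq> carrier G"
  by (simp add: points_def)

lemma one_\<Gamma>: "\<one> \<in> \<Gamma>"
proof -
  have d: "defrel (0 + n) (\<lambda>w. mult_graph (w @ w @ w))"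
    by (rule defrel_sub'[OF defrel_mult_graph] coords | (auto; fail))+
  have "\<one> \<in> TT n" using car_TT by blast
  moreover have "mult_graph (\<one> @ \<one> @ \<one>)" using mult_graph_iff car_length[OF one_closed] by simp
  ultimately have "\<exists>w\<in>TT n. mult_graph (([] @ w) @ ([] @ w) @ ([] @ w))" by auto
  from elem_ex[OF el d _ this] obtain w where w: "w \<in> tuples M0 n" "mult_graph (w @ w @ w)"
    by (auto simp: tuples_def)
  have lw: "length w = n" using w(1) by (rule tuples_length)
  have "w \<in> carrier G" "w = w \<otimes> w" using w(2) mult_graph_iff[OF lw lw] by blast+
  then have "w = \<one>" using l_cancel_one'[of w w] by simp
  then show ?thesis using w(1) by (simp add: points_def)
qed

lemma mult_\<Gamma>: "x \<in> \<Gamma> \<Longrightarrow> y \<in> \<Gamma> \<Longrightarrow> x \<otimes> y \<in> \<Gamma>"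
proof -
  assume "x \<in> \<Gamma>" "y \<in> \<Gamma>"
  then have xy: "x \<in> carrier G" "y \<in> carrier G" "x \<in> tuples M0 n" "y \<in> tuples M0 n" by (auto simp: points_def)
  have lxy: "length x = n" "length y = n" using xy car_length by auto
  have d: "defrel ((n + n) + n) mult_graph" using defrel_mult_graph by (simp add: add.assoc)
  have "x \<otimes> y \<in> TT n" using car_TT xy(1,2) by blast
  moreover have "mult_graph ((x @ y) @ (x \<otimes> y))" using mult_graph_iff[OF lxy] xy by simp
  ultimately have "\<exists>z\<in>TT n. mult_graph ((x @ y) @ z)" by blast
  from elem_ex[OF el d tuples_append[OF xy(3,4)] this] obtain z where z: "z \<in> tuples M0 n" "mult_graph ((x @ y) @ z)" ..
  then have "z = x \<otimes> y" using mult_graph_iff[OF lxy, of z] by simp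
  then show ?thesis using z(1) xy by (simp add: points_def)
qed

definition union_of_translates :: "'a list set \<Rightarrow> ('a list \<Rightarrow> bool) \<Rightarrow> 'a list \<Rightarrow> bool" where
  "union_of_translates s R z \<longleftrightarrow> (\<exists>f\<in>s. translate_rel R (take n z @ f @ drop n z))"

lemma defrel_union_of_translates:
  assumes R: "defrel (n + m) R" and s: "finite s" "s \<subseteq> \<Gamma>"
  shows "defrel (n + m) (union_of_translates s R)"
proof -
  define P where "P z \<longleftrightarrow> translate_rel R (take n z @ drop (n + m) z @ take m (drop n z))" for z
  have dP: "defrel ((n + m) + n) P" unfolding P_def
    by (rule defrel_sub'[OF defrel_translate_rel[OF R]] coords | (auto; fail))+
  have "defrel (n + m) (\<lambda>z. translate_rel R (take n z @ f @ drop n z))" if f: "f \<in> s" for f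
  proof (rule defrel_cong)
    show "defrel (n + m) (\<lambda>z. P (z @ f))"
      by (rule defrel_param[OF dP]) (use f s(2) in \<open>auto simp: points_def\<close>)
    fix z assume "z \<in> TT (n + m)"
    then have "length z = n + m" by (rule tuples_length)
    then show "translate_rel R (take n z @ f @ drop n z) \<longleftrightarrow> P (z @ f)" by (simp add: P_def)
  qed
  then show ?thesis unfolding union_of_translates_def by (intro defrel_bex s(1)) blast
qed

lemma group_fibre_union_of_translates: "s \<subseteq> carrier G \<Longrightarrow> group_fibre (union_of_translates s R) y = s <#> group_fibre R y"
proof -
  assume s: "s \<subseteq> carrier G"
  have "union_of_translates s R (x @ y) \<longleftrightarrow> (\<exists>f\<in>s. x \<in> f <# group_fibre R y)" if x: "x \<in> carrier G" for x
  proof -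
    have "translate_rel R (x @ f @ y) \<longleftrightarrow> x \<in> f <# group_fibre R y" if "f \<in> s" for f
      unfolding group_fibre_def by (rule translate_rel_iff) (use that s x car_TT in auto)
    then show ?thesis using car_length[OF x] by (simp add: union_of_translates_def)
  qed
  then have "group_fibre (union_of_translates s R) y = carrier G \<inter> (s <#> group_fibre R y)" unfolding set_mult_UN group_fibre_def[of "union_of_translates s R"] by auto
  then show ?thesis using set_mult_car[OF s group_fibre_sub] by blast
qed

definition cylinder :: "nat \<Rightarrow> ('a list \<Rightarrow> bool) \<Rightarrow> 'a list set" where
  "cylinder m \<eta> = {z \<in> TT (n + m). take n z \<in> carrier G \<and> \<eta> (drop n z)}"

lemma cylinder_iff: "z \<in> cylinder m \<eta> \<longleftrightarrow> (\<exists>u y. u \<in> carrier G \<and> y \<in> TT m \<and> \<eta> y \<and> z = u @ y)"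
proof
  assume "z \<in> cylinder m \<eta>"
  then have z: "z \<in> TT (n + m)" "take n z \<in> carrier G" "\<eta> (drop n z)" by (auto simp: cylinder_def)
  have "drop n z \<in> TT m" using z(1) set_drop_subset[of n z] by (auto simp: tuples_def)
  then show "\<exists>u y. u \<in> carrier G \<and> y \<in> TT m \<and> \<eta> y \<and> z = u @ y" using z by (metis append_take_drop_id)
next
  assume "\<exists>u y. u \<in> carrier G \<and> y \<in> TT m \<and> \<eta> y \<and> z = u @ y"
  then obtain u y where "u \<in> carrier G" "y \<in> TT m" "\<eta> y" "z = u @ y" by blast
  moreover then have "u @ y \<in> TT (n + m)" using tuples_append car_TT by blast
  ultimately show "z \<in> cylinder m \<eta>" using car_length[of u] by (simp add: cylinder_def)
qed

lemma cylinder_definable: "defrel m \<eta> \<Longrightarrow> definable_over L C M0 (n + m) (cylinder m \<eta>)"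
proof -
  assume \<eta>: "defrel m \<eta>"
  have "defrel (n + m) (\<lambda>z. take n z \<in> carrier G \<and> \<eta> (drop n z))"
    by (rule defrels defrel_sub'[OF defrel_car] defrel_sub'[OF \<eta>] coords | (auto; fail))+
  then have "definable_over L C {} (n + m) (cylinder m \<eta>)"
    unfolding definable_over_empty_params cylinder_def by blast
  then show ?thesis by (rule definable_over_mono) simp
qed

lemma strong_iff_uniformly_pierced:
  assumes R: "defrel (n + m) R" and b: "b \<in> TT m"
  shows "strong (group_fibre R b) \<longleftrightarrow> (\<forall>u\<in>carrier G. uniformly_pierced M0 n (n + m) (translate_rel R) (u @ b))"
  unfolding strong_f_generic_def using forks_translate_iff[OF el M0_small R b] by blast

text \<open>
  If both \<open>u X\<close> and \<open>u Y\<close> forked, so would \<open>u (X \<union> Y)\<close>. Over \<open>dcl {}\<close> the sets provided by compactness are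
  definable without parameters.
\<close>

lemma uniform_cover:
  assumes RA: "defrel (n + m) RA" and RB: "defrel (n + m) RB" and b: "b \<in> TT m"
    and st: "strong (group_fibre RA b \<union> group_fibre RB b)"
  obtains dA dB NA NB where "defrel (n + m) dA" "defrel (n + m) dB"
    "pierceable (fibre n (n + m) (translate_rel RA)) {z \<in> TT (n + m). dA z} NA"
    "pierceable (fibre n (n + m) (translate_rel RB)) {z \<in> TT (n + m). dB z} NB"
    "\<forall>u\<in>carrier G. dA (u @ b) \<or> dB (u @ b)"
proof -
  have car0: "definable_over L C M0 n (carrier G)" using dg definable_over_mono unfolding definable_group_def by blast
  have pv: "uniformly_pierced M0 n (n + m) (translate_rel RA) (u @ b) \<or> uniformly_pierced M0 n (n + m) (translate_rel RB) (u @ b)" if u: "u \<in> carrier G" for u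
  proof -
    have "\<not> forks L C n M0 ((u <# group_fibre RA b) \<union> (u <# group_fibre RB b))"
      using st u unfolding strong_f_generic_def l_coset_Un by blast
    then have "\<not> forks L C n M0 (u <# group_fibre RA b) \<or> \<not> forks L C n M0 (u <# group_fibre RB b)" using forks_Un by blast
    then show ?thesis using forks_translate_iff[OF el M0_small _ b u] RA RB by blast
  qed
  obtain D1 D2 N1 N2 where D: "definable_over L C M0 (n + m) D1" "definable_over L C M0 (n + m) D2"
    and P: "pierceable (fibre n (n + m) (translate_rel RA)) D1 N1" "pierceable (fibre n (n + m) (translate_rel RB)) D2 N2"
    and cov: "\<forall>u\<in>carrier G. u @ b \<in> D1 \<union> D2"
    by (rule cover_compact[OF M0_sub M0_small car0 b pv])
  obtain dA where dA: "defrel (n + m) dA" "D1 = {z \<in> TT (n + m). dA z}" using D(1) by (rule definable_over_dcl)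
  obtain dB where dB: "defrel (n + m) dB" "D2 = {z \<in> TT (n + m). dB z}" using D(2) by (rule definable_over_dcl)
  have "\<forall>u\<in>carrier G. dA (u @ b) \<or> dB (u @ b)" using cov dA(2) dB(2) by blast
  from that[OF dA(1) dB(1) P[unfolded dA(2) dB(2)] this] show thesis .
qed

text \<open>
  Being strong f-generic depends on the parameter through a single formula \<open>\<eta>\<close> without parameters, with a uniform
  piercing bound. This is what makes the notion invariant under automorphisms and usable along indiscernible sequences.
\<close>

lemma strong_iff_uniform:
  assumes R: "defrel (n + m) R" and b: "b \<in> TT m"
  shows "strong (group_fibre R b) \<longleftrightarrow> (\<exists>\<eta> N. defrel m \<eta> \<and> \<eta> b \<and> pierceable (fibre n (n + m) (translate_rel R)) (cylinder m \<eta>) N)"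
proof
  assume "strong (group_fibre R b)"
  then have "strong (group_fibre R b \<union> group_fibre R b)" by simp
  from uniform_cover[OF R R b this] obtain dA dB NA NB where d: "defrel (n + m) dA" "defrel (n + m) dB"
    and p: "pierceable (fibre n (n + m) (translate_rel R)) {z \<in> TT (n + m). dA z} NA"
    "pierceable (fibre n (n + m) (translate_rel R)) {z \<in> TT (n + m). dB z} NB"
    and cov: "\<forall>u\<in>carrier G. dA (u @ b) \<or> dB (u @ b)" .
  define \<eta> where "\<eta> y \<longleftrightarrow> (\<forall>u\<in>TT n. u \<in> carrier G \<longrightarrow> dA (u @ y) \<or> dB (u @ y))" for y
  have "defrel m \<eta>" unfolding \<eta>_def
    by (rule defrels defrel_sub'[OF defrel_car] defrel_sub'[OF d(1)] defrel_sub'[OF d(2)] coords | (auto; fail))+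
  moreover have "\<eta> b" using cov by (simp add: \<eta>_def)
  moreover have "pierceable (fibre n (n + m) (translate_rel R)) (cylinder m \<eta>) (NA + NB)"
  proof (rule pierceable_mono[OF pierceable_Un[OF p]])
    show "cylinder m \<eta> \<subseteq> {z \<in> TT (n + m). dA z} \<union> {z \<in> TT (n + m). dB z}"
    proof
      fix z assume z: "z \<in> cylinder m \<eta>"
      then have zT: "z \<in> TT (n + m)" by (simp add: cylinder_def)
      obtain u y where "u \<in> carrier G" "\<eta> y" "z = u @ y" using z unfolding cylinder_iff by blast
      then have "dA z \<or> dB z" using car_TT unfolding \<eta>_def by blast
      then show "z \<in> {z \<in> TT (n + m). dA z} \<union> {z \<in> TT (n + m). dB z}" using zT by blast
    qed
  qed auto
  ultimately show "\<exists>\<eta> N. defrel m \<eta> \<and> \<eta> b \<and> pierceable (fibre n (n + m) (translate_rel R)) (cylinder m \<eta>) N" by blast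
next
  assume "\<exists>\<eta> N. defrel m \<eta> \<and> \<eta> b \<and> pierceable (fibre n (n + m) (translate_rel R)) (cylinder m \<eta>) N"
  then obtain \<eta> N where \<eta>: "defrel m \<eta>" "\<eta> b" "pierceable (fibre n (n + m) (translate_rel R)) (cylinder m \<eta>) N" by blast
  have "u @ b \<in> cylinder m \<eta>" if "u \<in> carrier G" for u unfolding cylinder_iff using that b \<eta>(2) by blast
  then show "strong (group_fibre R b)"
    unfolding strong_iff_uniformly_pierced[OF R b] uniformly_pierced_def using cylinder_definable[OF \<eta>(1)] \<eta>(3) by blast
qed

text \<open>
  Translating a piercing set by \<open>inv u\<close> pierces the translates by \<open>k t\<close> instead of those by \<open>u \<otimes> k t\<close>.
\<close>

lemma pierceable_translates:
  assumes pc: "pierceable (fibre n (n + m) (translate_rel R)) D N"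
    and k: "\<And>t. t \<in> E \<Longrightarrow> k t \<in> carrier G" "\<And>t. t \<in> E \<Longrightarrow> y t \<in> TT m"
    and mv: "\<And>T. T \<subseteq> E \<Longrightarrow> finite T \<Longrightarrow> \<exists>u\<in>carrier G. \<forall>t\<in>T. (u \<otimes> k t) @ y t \<in> D"
  shows "pierceable (\<lambda>t. k t <# group_fibre R (y t)) E N"
  unfolding pierceable_def
proof (intro allI impI)
  fix T assume T: "T \<subseteq> E" "finite T"
  obtain u where u: "u \<in> carrier G" "\<forall>t\<in>T. (u \<otimes> k t) @ y t \<in> D" using mv[OF T] by blast
  have sub: "(\<lambda>t. (u \<otimes> k t) @ y t) ` T \<subseteq> D" using u(2) by blast
  have fin: "finite ((\<lambda>t. (u \<otimes> k t) @ y t) ` T)" using T(2) by simp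
  from pierceableE[OF pc sub fin] obtain Q where Q: "finite Q" "card Q \<le> N"
    "\<And>z. z \<in> (\<lambda>t. (u \<otimes> k t) @ y t) ` T \<Longrightarrow> fibre n (n + m) (translate_rel R) z \<inter> Q \<noteq> {}" by blast
  let ?Q = "(\<lambda>q. inv u \<otimes> q) ` Q"
  have "(k t <# group_fibre R (y t)) \<inter> ?Q \<noteq> {}" if t: "t \<in> T" for t
  proof -
    have kt: "k t \<in> carrier G" "y t \<in> TT m" using t T(1) k by auto
    have "fibre n (n + m) (translate_rel R) ((u \<otimes> k t) @ y t) \<inter> Q \<noteq> {}" using Q(3) t by blast
    then obtain q where q: "q \<in> (u \<otimes> k t) <# group_fibre R (y t)" "q \<in> Q" using fibre_translate_rel[of "u \<otimes> k t" "y t" m R] u kt by auto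
    then obtain w where w: "w \<in> group_fibre R (y t)" "q = (u \<otimes> k t) \<otimes> w" by (auto simp: l_coset_def)
    have "w \<in> carrier G" using w(1) group_fibre_sub by blast
    then have "inv u \<otimes> q = k t \<otimes> w" using w(2) u(1) kt(1) by (simp add: m_assoc inv_solve_left')
    then have "inv u \<otimes> q \<in> k t <# group_fibre R (y t)" using w(1) by (auto simp: l_coset_def)
    then show ?thesis using q(2) by blast
  qed
  moreover have "card ?Q \<le> N" using card_image_le[OF Q(1)] Q(2) by (rule order_trans)
  ultimately show "\<exists>P. finite P \<and> card P \<le> N \<and> (\<forall>t\<in>T. (k t <# group_fibre R (y t)) \<inter> P \<noteq> {})"
    using Q(1) by (intro exI[of _ ?Q]) simp
qed

text \<open>
  \<open>shattered_product_cover\<close>, applied to \<open>\<Gamma>\<close> and to parameters in \<open>M0\<close>, splits the set of triples \<open>(c, d, y)\<close> into finitely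
  many parts \<open>R\<close>, each with a multiplier \<open>f\<close>. With \<open>S\<close> the set of these multipliers, the union of \<open>c S X\<^sub>y\<close> and \<open>d S Y\<^sub>y\<close>
  is pierceable over every part, hence over \<open>M0\<close>, hence over the monster model. Letting \<open>c\<close> and \<open>d\<close> vary independently is what
  finally yields the alternative for all translates at once.
\<close>

lemma strong_Un_group_fibre:
  assumes RA: "defrel (n + m) RA" and RB: "defrel (n + m) RB" and b: "b \<in> TT m"
    and st: "strong (group_fibre RA b \<union> group_fibre RB b)"
  shows "\<exists>S. finite S \<and> S \<subseteq> \<Gamma> \<and> (strong (S <#> group_fibre RA b) \<or> strong (S <#> group_fibre RB b))"
proof -
  obtain dA dB NA NB where d: "defrel (n + m) dA" "defrel (n + m) dB"
    and p: "pierceable (fibre n (n + m) (translate_rel RA)) {z \<in> TT (n + m). dA z} NA"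
    "pierceable (fibre n (n + m) (translate_rel RB)) {z \<in> TT (n + m). dB z} NB"
    and cov: "\<forall>u\<in>carrier G. dA (u @ b) \<or> dB (u @ b)"
    by (rule uniform_cover[OF RA RB b st])
  \<comment> \<open>\<open>\<zeta>\<close> collects the parameters for which the two conditions still cover the group.\<close>
  define \<zeta> where "\<zeta> y \<longleftrightarrow> (\<forall>u\<in>TT n. u \<in> carrier G \<longrightarrow> dA (u @ y) \<or> dB (u @ y))" for y
  have d\<zeta>: "defrel m \<zeta>" unfolding \<zeta>_def
    by (rule defrels defrel_sub'[OF defrel_car] defrel_sub'[OF d(1)] defrel_sub'[OF d(2)] coords | (auto; fail))+
  have \<zeta>b: "\<zeta> b" using cov by (simp add: \<zeta>_def)
  define Bs where "Bs = {y \<in> tuples M0 m. \<zeta> y}"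
  have BsT: "Bs \<subseteq> TT m" using tuples_mono[OF M0_sub] by (auto simp: Bs_def)
  have \<Gamma>T: "\<Gamma> \<subseteq> TT n" using \<Gamma>_car car_TT by blast
  obtain e where e: "vc_le {{t. x \<in> fibre n m dA t} |x. True} e" using NIP_fibre[OF nip d(1)] by blast
  have "vc_le {{y \<in> Bs. dA (u @ y)} |u. u \<in> \<Gamma>} e"
  proof (rule vc_le_mono[OF vc_le_traces[OF e, of Bs "\<lambda>y. y"]])
    show "{{y \<in> Bs. dA (u @ y)} |u. u \<in> \<Gamma>} \<subseteq> {{j \<in> Bs. j \<in> S} |S. S \<in> {{t. x \<in> fibre n m dA t} |x. True}}"
    proof
      fix Z assume "Z \<in> {{y \<in> Bs. dA (u @ y)} |u. u \<in> \<Gamma>}"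
      then obtain u where u: "u \<in> \<Gamma>" "Z = {y \<in> Bs. dA (u @ y)}" by blast
      have "Z = {j \<in> Bs. j \<in> {t. u \<in> fibre n m dA t}}" unfolding u(2) fibre_def using u(1) BsT \<Gamma>T by auto
      then show "Z \<in> {{j \<in> Bs. j \<in> S} |S. S \<in> {{t. x \<in> fibre n m dA t} |x. True}}" by blast
    qed
  qed simp
  then obtain \<R> where \<R>: "finite \<R>" "\<Gamma> \<times> \<Gamma> \<times> Bs \<subseteq> (\<Union>(f, R)\<in>\<R>. R)"
    "\<And>f R. (f, R) \<in> \<R> \<Longrightarrow> f \<in> \<Gamma> \<and>
       ((\<forall>R'\<subseteq>R. finite R' \<longrightarrow> (\<exists>u\<in>\<Gamma>. \<forall>(c, d, y)\<in>R'. dA ((u \<otimes> c \<otimes> f) @ y))) \<or>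
        (\<forall>R'\<subseteq>R. finite R' \<longrightarrow> (\<exists>u\<in>\<Gamma>. \<forall>(c, d, y)\<in>R'. dB ((u \<otimes> d \<otimes> f) @ y))))"
    using shattered_product_cover[of \<Gamma> Bs "\<lambda>u y. dA (u @ y)" "\<lambda>u y. dB (u @ y)" e, OF \<Gamma>_car one_\<Gamma> mult_\<Gamma>]
      \<Gamma>T unfolding Bs_def \<zeta>_def by (smt (verit) mem_Collect_eq points_def IntD1 subsetD)
  define S where "S = fst ` \<R>"
  have S: "finite S" "S \<subseteq> \<Gamma>" using \<R>(1,3) by (auto simp: S_def)
  have SC: "S \<subseteq> carrier G" using S(2) \<Gamma>_car by blast
  define c1 where "c1 t = take n t" for t :: "'a list"
  define c2 where "c2 t = take n (drop n t)" for t :: "'a list"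
  define yy where "yy t = drop (n + n) t" for t :: "'a list"
  define U1 where "U1 z \<longleftrightarrow> translate_rel (union_of_translates S RA) (take n z @ c1 (drop n z) @ yy (drop n z))" for z
  define U2 where "U2 z \<longleftrightarrow> translate_rel (union_of_translates S RB) (take n z @ c2 (drop n z) @ yy (drop n z))" for z
  define U where "U z \<longleftrightarrow> U1 z \<or> U2 z" for z
  have dU: "defrel (n + (n + (n + m))) U" unfolding U_def U1_def U2_def c1_def c2_def yy_def
    by (rule defrels defrel_sub'[OF defrel_translate_rel[OF defrel_union_of_translates[OF RA S]]] defrel_sub'[OF defrel_translate_rel[OF defrel_union_of_translates[OF RB S]]] coords | (auto; fail))+
  define D where "D = {t \<in> TT (n + (n + m)). c1 t \<in> carrier G \<and> c2 t \<in> carrier G \<and> \<zeta> (yy t)}"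
  have "defrel (n + (n + m)) (\<lambda>t. c1 t \<in> carrier G \<and> c2 t \<in> carrier G \<and> \<zeta> (yy t))" unfolding c1_def c2_def yy_def
    by (rule defrels defrel_sub'[OF defrel_car] defrel_sub'[OF d\<zeta>] coords | (auto; fail))+
  then have "definable_over L C {} (n + (n + m)) D" unfolding definable_over_empty_params D_def by blast
  then have Ddef: "definable_over L C M0 (n + (n + m)) D" by (rule definable_over_mono) simp
  have slU: "x \<in> fibre n (n + (n + m)) U t \<longleftrightarrow>
      x \<in> c1 t <# (S <#> group_fibre RA (yy t)) \<or> x \<in> c2 t <# (S <#> group_fibre RB (yy t))"
    if t: "t \<in> D" for t x
  proof -
    have tT: "t \<in> TT (n + (n + m))" and tc: "c1 t \<in> carrier G" "c2 t \<in> carrier G" using t by (auto simp: D_def)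
    have SX: "S <#> group_fibre R y \<subseteq> carrier G" for R y by (rule set_mult_car[OF SC group_fibre_sub])
    show ?thesis
    proof (cases "x \<in> TT n")
      case True
      then have lx: "length x = n" by (rule tuples_length)
      have "U1 (x @ t) \<longleftrightarrow> x \<in> c1 t <# group_fibre (union_of_translates S RA) (yy t)"
        using translate_rel_iff[OF tc(1) True, of "union_of_translates S RA" "yy t"] lx by (simp add: U1_def group_fibre_def)
      moreover have "U2 (x @ t) \<longleftrightarrow> x \<in> c2 t <# group_fibre (union_of_translates S RB) (yy t)"
        using translate_rel_iff[OF tc(2) True, of "union_of_translates S RB" "yy t"] lx by (simp add: U2_def group_fibre_def)
      ultimately show ?thesis using True tT by (simp add: fibre_def U_def group_fibre_union_of_translates[OF SC])
    next
      case False
      have "c1 t <# (S <#> group_fibre RA (yy t)) \<subseteq> TT n" "c2 t <# (S <#> group_fibre RB (yy t)) \<subseteq> TT n"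
        using l_coset_car[OF tc(1) SX] l_coset_car[OF tc(2) SX] car_TT by (meson order_trans)+
      then show ?thesis using False unfolding fibre_def by blast
    qed
  qed
  define E where "E R = {t \<in> D. (c1 t, c2 t, yy t) \<in> R \<inter> \<Gamma> \<times> \<Gamma> \<times> Bs}" for R
  have ER: "\<exists>N. pierceable (fibre n (n + (n + m)) U) (E R) N" if fR: "(f, R) \<in> \<R>" for f R
  proof -
    have f: "f \<in> \<Gamma>" "f \<in> S" "f \<in> carrier G" using \<R>(3)[OF fR] fR \<Gamma>_car by (force simp: S_def)+
    have Et: "c1 t \<in> carrier G" "c2 t \<in> carrier G" "c1 t \<in> \<Gamma>" "c2 t \<in> \<Gamma>" "yy t \<in> TT m" "t \<in> D" if "t \<in> E R" for t
      using that \<Gamma>_car BsT by (auto simp: E_def)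
    have im: "(\<lambda>t. (c1 t, c2 t, yy t)) ` T \<subseteq> R" if "T \<subseteq> E R" for T using that by (auto simp: E_def)
    have inTT: "v @ yy t \<in> TT (n + m)" if "v \<in> carrier G" "t \<in> E R" for v t
      using that Et(5) car_TT tuples_append by blast
    from \<R>(3)[OF fR] consider
      "\<forall>R'\<subseteq>R. finite R' \<longrightarrow> (\<exists>u\<in>\<Gamma>. \<forall>(c, d, y)\<in>R'. dA ((u \<otimes> c \<otimes> f) @ y))"
      | "\<forall>R'\<subseteq>R. finite R' \<longrightarrow> (\<exists>u\<in>\<Gamma>. \<forall>(c, d, y)\<in>R'. dB ((u \<otimes> d \<otimes> f) @ y))" by blast
    then show ?thesis
    proof cases
      case 1
      have "pierceable (\<lambda>t. (c1 t \<otimes> f) <# group_fibre RA (yy t)) (E R) NA"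
      proof (rule pierceable_translates[OF p(1)])
        fix T assume T: "T \<subseteq> E R" "finite T"
        have "finite ((\<lambda>t. (c1 t, c2 t, yy t)) ` T)" using T(2) by simp
        from 1[THEN spec, THEN mp, OF im[OF T(1)], THEN mp, OF this]
        obtain u where u: "u \<in> \<Gamma>" "\<forall>(c, d, y)\<in>(\<lambda>t. (c1 t, c2 t, yy t)) ` T. dA ((u \<otimes> c \<otimes> f) @ y)" ..
        have uC: "u \<in> carrier G" using u(1) \<Gamma>_car by blast
        have "(u \<otimes> (c1 t \<otimes> f)) @ yy t \<in> {z \<in> TT (n + m). dA z}" if t: "t \<in> T" for t
        proof -
          have tE: "t \<in> E R" using t T(1) by blast
          have "dA ((u \<otimes> c1 t \<otimes> f) @ yy t)" using u(2) t by blast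
          then show ?thesis using inTT[OF _ tE] uC Et(1)[OF tE] f(3) by (simp add: m_assoc)
        qed
        then show "\<exists>u\<in>carrier G. \<forall>t\<in>T. (u \<otimes> (c1 t \<otimes> f)) @ yy t \<in> {z \<in> TT (n + m). dA z}" using uC by blast
      qed (use Et f in auto)
      then have "pierceable (fibre n (n + (n + m)) U) (E R) NA"
      proof (rule pierceable_mono)
        fix t assume t: "t \<in> E R"
        have "(c1 t \<otimes> f) <# group_fibre RA (yy t) \<subseteq> c1 t <# (S <#> group_fibre RA (yy t))"
          unfolding l_coset_set_mult_UN[OF Et(1)[OF t] SC group_fibre_sub] using f(2) by blast
        then show "(c1 t \<otimes> f) <# group_fibre RA (yy t) \<subseteq> fibre n (n + (n + m)) U t" using slU[OF Et(6)[OF t]] by blast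
      qed auto
      then show ?thesis by blast
    next
      case 2
      have "pierceable (\<lambda>t. (c2 t \<otimes> f) <# group_fibre RB (yy t)) (E R) NB"
      proof (rule pierceable_translates[OF p(2)])
        fix T assume T: "T \<subseteq> E R" "finite T"
        have "finite ((\<lambda>t. (c1 t, c2 t, yy t)) ` T)" using T(2) by simp
        from 2[THEN spec, THEN mp, OF im[OF T(1)], THEN mp, OF this]
        obtain u where u: "u \<in> \<Gamma>" "\<forall>(c, d, y)\<in>(\<lambda>t. (c1 t, c2 t, yy t)) ` T. dB ((u \<otimes> d \<otimes> f) @ y)" ..
        have uC: "u \<in> carrier G" using u(1) \<Gamma>_car by blast
        have "(u \<otimes> (c2 t \<otimes> f)) @ yy t \<in> {z \<in> TT (n + m). dB z}" if t: "t \<in> T" for t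
        proof -
          have tE: "t \<in> E R" using t T(1) by blast
          have "dB ((u \<otimes> c2 t \<otimes> f) @ yy t)" using u(2) t by blast
          then show ?thesis using inTT[OF _ tE] uC Et(2)[OF tE] f(3) by (simp add: m_assoc)
        qed
        then show "\<exists>u\<in>carrier G. \<forall>t\<in>T. (u \<otimes> (c2 t \<otimes> f)) @ yy t \<in> {z \<in> TT (n + m). dB z}" using uC by blast
      qed (use Et f in auto)
      then have "pierceable (fibre n (n + (n + m)) U) (E R) NB"
      proof (rule pierceable_mono)
        fix t assume t: "t \<in> E R"
        have "(c2 t \<otimes> f) <# group_fibre RB (yy t) \<subseteq> c2 t <# (S <#> group_fibre RB (yy t))"
          unfolding l_coset_set_mult_UN[OF Et(2)[OF t] SC group_fibre_sub] using f(2) by blast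
        then show "(c2 t \<otimes> f) <# group_fibre RB (yy t) \<subseteq> fibre n (n + (n + m)) U t" using slU[OF Et(6)[OF t]] by blast
      qed auto
      then show ?thesis by blast
    qed
  qed
  have "\<exists>N. pierceable (fibre n (n + (n + m)) U) (\<Union>((\<lambda>q. E (snd q)) ` \<R>)) N"
  proof (rule pierceable_finite_UN)
    fix D' assume "D' \<in> (\<lambda>q. E (snd q)) ` \<R>"
    then obtain f R where "(f, R) \<in> \<R>" "D' = E R" by force
    then show "\<exists>N. pierceable (fibre n (n + (n + m)) U) D' N" using ER by blast
  qed (use \<R>(1) in simp)
  then obtain N where N: "pierceable (fibre n (n + (n + m)) U) (\<Union>((\<lambda>q. E (snd q)) ` \<R>)) N" ..
  have "pierceable (fibre n (n + (n + m)) U) (D \<inter> tuples M0 (n + (n + m))) N"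
  proof (rule pierceable_mono[OF N])
    show "D \<inter> tuples M0 (n + (n + m)) \<subseteq> \<Union>((\<lambda>q. E (snd q)) ` \<R>)"
    proof
      fix t assume t: "t \<in> D \<inter> tuples M0 (n + (n + m))"
      have lt: "length t = n + (n + m)" "set t \<subseteq> M0" using t by (auto simp: tuples_def)
      have "set (c1 t) \<subseteq> M0" "set (c2 t) \<subseteq> M0" "set (yy t) \<subseteq> M0"
        unfolding c1_def c2_def yy_def using lt(2) by (meson order_trans set_take_subset set_drop_subset)+
      then have "c1 t \<in> \<Gamma>" "c2 t \<in> \<Gamma>" "yy t \<in> Bs"
        using t lt(1) by (auto simp: D_def points_def Bs_def tuples_def c1_def c2_def yy_def)
      then have mem: "(c1 t, c2 t, yy t) \<in> \<Gamma> \<times> \<Gamma> \<times> Bs" by simp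
      then have "(c1 t, c2 t, yy t) \<in> (\<Union>(f, R)\<in>\<R>. R)" using \<R>(2) by blast
      then obtain q where "q \<in> \<R>" "(c1 t, c2 t, yy t) \<in> snd q" by force
      then show "t \<in> \<Union>((\<lambda>q. E (snd q)) ` \<R>)" using mem t unfolding E_def by blast
    qed
  qed auto
  then have pD: "pierceable (fibre n (n + (n + m)) U) D N" by (rule pierceable_transfer[OF el dU Ddef])
  \<comment> \<open>If \<open>c (S X)\<close> and \<open>d (S Y)\<close> both forked, then so would their union.\<close>
  have nf: "\<not> forks L C n M0 (c <# (S <#> group_fibre RA b)) \<or> \<not> forks L C n M0 (d <# (S <#> group_fibre RB b))"
    if cd: "c \<in> carrier G" "d \<in> carrier G" for c d
  proof -
    let ?t = "c @ d @ b"
    have tT: "?t \<in> TT (n + (n + m))" using tuples_append[OF _ tuples_append[OF _ b]] cd car_TT by blast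
    have comp: "c1 ?t = c" "c2 ?t = d" "yy ?t = b" using cd car_length by (simp_all add: c1_def c2_def yy_def)
    have tD: "?t \<in> D" unfolding D_def using tT comp cd \<zeta>b by simp
    then have "uniformly_pierced M0 n (n + (n + m)) U ?t" unfolding uniformly_pierced_def using Ddef pD by blast
    from uniformly_pierced_not_forks[OF el nip dU tT this]
    have "\<not> forks L C n M0 (fibre n (n + (n + m)) U ?t)" using tT by (simp add: fibre_def)
    moreover have "fibre n (n + (n + m)) U ?t = (c <# (S <#> group_fibre RA b)) \<union> (d <# (S <#> group_fibre RB b))"
      using slU[OF tD] comp by (auto simp del: append_assoc)
    ultimately show ?thesis using forks_Un by metis
  qed
  then have "strong (S <#> group_fibre RA b) \<or> strong (S <#> group_fibre RB b)" unfolding strong_f_generic_def by blast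
  then show ?thesis using S by blast
qed

end

section \<open>The ideals and the S1 property\<close>

context monster_group
begin

lemma common_parameters:
  assumes "definable_subset L C n G X" "definable_subset L C n G Y"
  obtains m R S b where "defrel (n + m) R" "defrel (n + m) S" "b \<in> TT m" "X = group_fibre R b" "Y = group_fibre S b"
proof -
  obtain m1 R1 b1 where R1: "defrel (n + m1) R1" "b1 \<in> TT m1" "X = group_fibre R1 b1" using assms(1) by (rule definable_subset_group_fibre)
  obtain m2 R2 b2 where R2: "defrel (n + m2) R2" "b2 \<in> TT m2" "Y = group_fibre R2 b2" using assms(2) by (rule definable_subset_group_fibre)
  have l: "length b1 = m1" "length b2 = m2" using R1(2) R2(2) tuples_length by auto
  define R where "R z = R1 (take (n + m1) z)" for z
  define S where "S z = R2 (take n z @ drop (n + m1) z)" for z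
  have "defrel (n + (m1 + m2)) R" unfolding R_def by (rule defrel_sub'[OF R1(1)] coords | (auto; fail))+
  moreover have "defrel (n + (m1 + m2)) S" unfolding S_def by (rule defrel_sub'[OF R2(1)] coords | (auto; fail))+
  moreover have "X = group_fibre R (b1 @ b2)" "Y = group_fibre S (b1 @ b2)"
    using l unfolding R1(3) R2(3) group_fibre_def R_def S_def by (auto simp: car_length)
  ultimately show thesis using that tuples_append[OF R1(2) R2(2)] by blast
qed

lemma set_mult_l_coset_sub:
  assumes "finite s" "s \<subseteq> carrier G" "g \<in> carrier G" "X \<subseteq> carrier G"
  obtains s' where "finite s'" "s' \<subseteq> carrier G" "s <#> (g <# X) = s' <#> X"
  using that[of "(\<lambda>h. h \<otimes> g) ` s"] set_mult_l_coset[OF assms(2-4)] assms(1-3) by blast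

lemma f_generic_mono: "f_generic L \<kappa> C n G X \<Longrightarrow> X \<subseteq> Y \<Longrightarrow> f_generic L \<kappa> C n G Y"
  unfolding f_generic_def using forks_mono l_coset_mono by metis

lemma strong_f_generic_mono: "strong_f_generic L C n G M X \<Longrightarrow> X \<subseteq> Y \<Longrightarrow> strong_f_generic L C n G M Y"
  unfolding strong_f_generic_def using forks_mono l_coset_mono by metis

lemma piecewise_f_generic_mono:
  "piecewise_f_generic L \<kappa> C n G X \<Longrightarrow> X \<subseteq> Y \<Longrightarrow> piecewise_f_generic L \<kappa> C n G Y"
  unfolding piecewise_f_generic_def using f_generic_mono set_mult_mono by metis

lemma piecewise_strong_f_generic_mono:
  "piecewise_strong_f_generic_in W L C n G M X \<Longrightarrow> X \<subseteq> Y \<Longrightarrow> piecewise_strong_f_generic_in W L C n G M Y"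
  unfolding piecewise_strong_f_generic_in_def using strong_f_generic_mono set_mult_mono by metis

lemma forks_translate_empty: "forks L C n M (\<one> <# (s <#> {}))"
  using forks_empty by (simp add: l_coset_def set_mult_def)

lemma not_piecewise_f_generic_empty: "\<not> piecewise_f_generic L \<kappa> C n G {}"
  unfolding piecewise_f_generic_def f_generic_def using forks_translate_empty one_closed by blast

lemma not_piecewise_strong_f_generic_empty: "\<not> piecewise_strong_f_generic_in W L C n G M {}"
  unfolding piecewise_strong_f_generic_in_def strong_f_generic_def using forks_translate_empty one_closed by blast

lemma piecewise_f_generic_l_coset:
  assumes "piecewise_f_generic L \<kappa> C n G (g <# X)" "g \<in> carrier G" "X \<subseteq> carrier G"
  shows "piecewise_f_generic L \<kappa> C n G X"
proof -
  obtain s where s: "finite s" "s \<subseteq> carrier G" "f_generic L \<kappa> C n G (s <#> (g <# X))"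
    using assms(1) unfolding piecewise_f_generic_def by blast
  obtain s' where "finite s'" "s' \<subseteq> carrier G" "s <#> (g <# X) = s' <#> X"
    by (rule set_mult_l_coset_sub[OF s(1,2) assms(2,3)])
  then show ?thesis using s(3) unfolding piecewise_f_generic_def by metis
qed

lemma piecewise_strong_f_generic_l_coset:
  assumes "piecewise_strong_f_generic_in (carrier G) L C n G M (g <# X)" "g \<in> carrier G" "X \<subseteq> carrier G"
  shows "piecewise_strong_f_generic_in (carrier G) L C n G M X"
proof -
  obtain s where s: "finite s" "s \<subseteq> carrier G" "strong_f_generic L C n G M (s <#> (g <# X))"
    using assms(1) unfolding piecewise_strong_f_generic_in_def by blast
  obtain s' where "finite s'" "s' \<subseteq> carrier G" "s <#> (g <# X) = s' <#> X"
    by (rule set_mult_l_coset_sub[OF s(1,2) assms(2,3)])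
  then show ?thesis using s(3) unfolding piecewise_strong_f_generic_in_def by metis
qed

lemma definable_idealI:
  assumes "\<not> P {}" "\<And>X Y. P X \<Longrightarrow> X \<subseteq> Y \<Longrightarrow> P Y"
    "\<And>X Y. definable_subset L C n G X \<Longrightarrow> definable_subset L C n G Y \<Longrightarrow> P (X \<union> Y) \<Longrightarrow> P X \<or> P Y"
  shows "definable_ideal L C n G {X. definable_subset L C n G X \<and> \<not> P X}"
  unfolding definable_ideal_def
proof (intro conjI ballI allI impI)
  fix X Y assume "X \<in> {X. definable_subset L C n G X \<and> \<not> P X}" "definable_subset L C n G Y" "Y \<subseteq> X"
  then show "Y \<in> {X. definable_subset L C n G X \<and> \<not> P X}" using assms(2)[of Y X] by blast
next
  fix X Y assume "X \<in> {X. definable_subset L C n G X \<and> \<not> P X}" "Y \<in> {X. definable_subset L C n G X \<and> \<not> P X}"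
  then show "X \<union> Y \<in> {X. definable_subset L C n G X \<and> \<not> P X}" using assms(3)[of X Y] definable_subset_Un by blast
qed (use assms(1) definable_subset_empty in auto)

lemma translation_invariantI:
  assumes "\<And>g X. P (g <# X) \<Longrightarrow> g \<in> carrier G \<Longrightarrow> X \<subseteq> carrier G \<Longrightarrow> P X"
  shows "translation_invariant G {X. definable_subset L C n G X \<and> \<not> P X}"
  unfolding translation_invariant_def
proof (intro ballI)
  fix X g assume X: "X \<in> {X. definable_subset L C n G X \<and> \<not> P X}" and g: "g \<in> carrier G"
  have "\<not> P (g <# X)" using assms[OF _ g, of X] X by (auto simp: definable_subset_def)
  then show "g <# X \<in> {X. definable_subset L C n G X \<and> \<not> P X}" using definable_subset_l_coset[OF _ g, of X] X by blast
qed

end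

context dcl_model
begin

lemma strong_Un:
  assumes "definable_subset L C n G X" "definable_subset L C n G Y" "strong (X \<union> Y)"
  obtains S where "finite S" "S \<subseteq> \<Gamma>" "strong (S <#> X) \<or> strong (S <#> Y)"
proof -
  obtain m RA RB b where R: "defrel (n + m) RA" "defrel (n + m) RB" "b \<in> TT m" "X = group_fibre RA b" "Y = group_fibre RB b"
    by (rule common_parameters[OF assms(1,2)])
  have "strong (group_fibre RA b \<union> group_fibre RB b)" using assms(3) R(4,5) by simp
  from strong_Un_group_fibre[OF R(1-3) this] show thesis using that R(4,5) by blast
qed

text \<open>
  The finite sets \<open>S\<close> from \<open>strong_Un\<close> and \<open>s\<close> combine to \<open>S s\<close>, and \<open>S \<subseteq> \<Gamma>\<close>; so this works for every set \<open>W\<close> of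
  multipliers that contains \<open>\<Gamma>\<close> and is closed under multiplication, in particular for \<open>\<Gamma>\<close> and for \<open>G\<close>.
\<close>

lemma piecewise_strong_Un:
  assumes W: "\<Gamma> \<subseteq> W" "W \<subseteq> carrier G" "\<And>x y. x \<in> W \<Longrightarrow> y \<in> W \<Longrightarrow> x \<otimes> y \<in> W"
    and X: "definable_subset L C n G X" and Y: "definable_subset L C n G Y" and p: "piecewise_strong W (X \<union> Y)"
  shows "piecewise_strong W X \<or> piecewise_strong W Y"
proof -
  obtain s where s: "finite s" "s \<subseteq> W" "strong (s <#> (X \<union> Y))"
    using p unfolding piecewise_strong_f_generic_in_def by blast
  have sC: "s \<subseteq> carrier G" using s(2) W(2) by blast
  have XC: "X \<subseteq> carrier G" "Y \<subseteq> carrier G" using X Y by (auto simp: definable_subset_def)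
  have "strong ((s <#> X) \<union> (s <#> Y))" using s(3) by (simp add: set_mult_Un)
  then obtain t where t: "finite t" "t \<subseteq> \<Gamma>" "strong (t <#> (s <#> X)) \<or> strong (t <#> (s <#> Y))"
    by (rule strong_Un[OF definable_subset_set_mult[OF X s(1) sC] definable_subset_set_mult[OF Y s(1) sC]])
  have tC: "t \<subseteq> carrier G" using t(2) \<Gamma>_car by blast
  have "t <#> s = (\<lambda>(a, b). a \<otimes> b) ` (t \<times> s)" by (auto simp: set_mult_def)
  then have "finite (t <#> s)" using s(1) t(1) by simp
  moreover have "t <#> s \<subseteq> W"
  proof -
    have "x \<otimes> y \<in> W" if "x \<in> t" "y \<in> s" for x y using W(1,3) t(2) s(2) that by (meson subsetD)
    then show ?thesis unfolding set_mult_def by blast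
  qed
  moreover have "strong ((t <#> s) <#> X) \<or> strong ((t <#> s) <#> Y)"
    using t(3) set_mult_assoc[OF tC sC XC(1)] set_mult_assoc[OF tC sC XC(2)] by simp
  ultimately show ?thesis unfolding piecewise_strong_f_generic_in_def by blast
qed

lemma piecewise_strong_\<Gamma>_Un:
  "definable_subset L C n G X \<Longrightarrow> definable_subset L C n G Y \<Longrightarrow> piecewise_strong \<Gamma> (X \<union> Y) \<Longrightarrow> piecewise_strong \<Gamma> X \<or> piecewise_strong \<Gamma> Y"
  by (rule piecewise_strong_Un[OF subset_refl \<Gamma>_car mult_\<Gamma>])

lemma piecewise_strong_\<Gamma>_UN:
  "finite I \<Longrightarrow> (\<And>i. i \<in> I \<Longrightarrow> definable_subset L C n G (X i)) \<Longrightarrow> piecewise_strong \<Gamma> (\<Union>i\<in>I. X i) \<Longrightarrow> \<exists>i\<in>I. piecewise_strong \<Gamma> (X i)"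
proof (induction I rule: finite_induct)
  case empty
  then show ?case using not_piecewise_strong_f_generic_empty by simp
next
  case (insert j I)
  have "definable_subset L C n G (X j)" using insert.prems(1) by simp
  moreover have "definable_subset L C n G (\<Union>i\<in>I. X i)"
    using insert.hyps(1) insert.prems(1) by (intro definable_subset_finite_UN) auto
  moreover have "piecewise_strong \<Gamma> (X j \<union> (\<Union>i\<in>I. X i))" using insert.prems(2) by simp
  ultimately consider "piecewise_strong \<Gamma> (X j)" | "piecewise_strong \<Gamma> (\<Union>i\<in>I. X i)" using piecewise_strong_\<Gamma>_Un by blast
  then show ?case
  proof cases
    case 2
    then show ?thesis using insert.IH insert.prems(1) by blast
  qed blast
qed

lemma piecewise_strong_\<Gamma>_same_type:
  assumes R: "defrel (n + m) R" and t: "t \<in> TT m" "t' \<in> TT m" "same_type L C {} t t'" and p: "piecewise_strong \<Gamma> (group_fibre R t)"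
  shows "piecewise_strong \<Gamma> (group_fibre R t')"
proof -
  obtain s where s: "finite s" "s \<subseteq> \<Gamma>" "strong (s <#> group_fibre R t)"
    using p unfolding piecewise_strong_f_generic_in_def by blast
  have sC: "s \<subseteq> carrier G" using s(2) \<Gamma>_car by blast
  note RS = defrel_union_of_translates[OF R s(1,2)]
  have "strong (group_fibre (union_of_translates s R) t)" using s(3) by (simp add: group_fibre_union_of_translates[OF sC])
  then obtain \<eta> N where \<eta>: "defrel m \<eta>" "\<eta> t" "pierceable (fibre n (n + m) (translate_rel (union_of_translates s R))) (cylinder m \<eta>) N"
    unfolding strong_iff_uniform[OF RS t(1)] by blast
  have "\<eta> t'" by (rule same_type_empty[OF t(3) \<eta>(1) t(1,2) \<eta>(2)])
  then have "strong (group_fibre (union_of_translates s R) t')" unfolding strong_iff_uniform[OF RS t(2)] using \<eta>(1,3) by blast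
  then show ?thesis unfolding piecewise_strong_f_generic_in_def group_fibre_union_of_translates[OF sC] using s(1,2) by blast
qed

definition pairwise :: "nat \<Rightarrow> nat \<Rightarrow> ('a list \<Rightarrow> bool) \<Rightarrow> 'a list \<Rightarrow> bool" where
  "pairwise q m R z \<longleftrightarrow> (\<exists>i\<in>{..<q}. \<exists>j\<in>{..<q}. i < j \<and>
     R (take n z @ block m i (drop n z)) \<and> R (take n z @ block m j (drop n z)))"

lemma defrel_pairwise:
  assumes R: "defrel (n + m) R" shows "defrel (n + q * m) (pairwise q m R)"
proof -
  have c: "coord (n + q * m) (n + m) (\<lambda>z. take n z @ block m i (drop n z))" if i: "i < q" for i
    by (rule coords | (use Suc_mult_le'[OF i, of m] in \<open>auto; fail\<close>))+
  have "defrel (n + q * m) (\<lambda>z. i < j \<and> R (take n z @ block m i (drop n z)) \<and> R (take n z @ block m j (drop n z)))"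
    if ij: "i < q" "j < q" for i j
  proof (cases "i < j")
    case True
    show ?thesis using defrel_conj[OF defrel_sub[OF R c[OF ij(1)]] defrel_sub[OF R c[OF ij(2)]]] True by simp
  next
    case False
    show ?thesis using defrel_not[OF defrel_True] False by simp
  qed
  then show ?thesis unfolding pairwise_def by (intro defrel_bex) auto
qed

lemma group_fibre_pairwise: "group_fibre (pairwise q m R) \<beta> = (\<Union>(i, j)\<in>{(i, j). i < j \<and> j < q}. group_fibre R (block m i \<beta>) \<inter> group_fibre R (block m j \<beta>))"
proof (rule Set.set_eqI)
  fix x
  show "x \<in> group_fibre (pairwise q m R) \<beta> \<longleftrightarrow> x \<in> (\<Union>(i, j)\<in>{(i, j). i < j \<and> j < q}. group_fibre R (block m i \<beta>) \<inter> group_fibre R (block m j \<beta>))"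
  proof (cases "x \<in> carrier G")
    case True
    then have lx: "length x = n" by (rule car_length)
    have "pairwise q m R (x @ \<beta>) \<longleftrightarrow> (\<exists>i j. i < j \<and> j < q \<and> R (x @ block m i \<beta>) \<and> R (x @ block m j \<beta>))"
      unfolding pairwise_def using lx by (auto intro: less_trans)
    then show ?thesis using True by (auto simp: group_fibre_def)
  qed (auto simp: group_fibre_def)
qed

text \<open>
  Each of the \<open>q\<close> translates selects a piercing point and an element of \<open>s\<close>; two of them make the same selection.
\<close>

lemma pigeonhole_translates:
  assumes Q: "finite Q" and s: "finite s" "s \<subseteq> carrier G" and q: "card Q * card s < q" and u: "u \<in> carrier G"
    and hit: "\<And>i. i < q \<Longrightarrow> (u <# (s <#> group_fibre R (block m i \<beta>))) \<inter> Q \<noteq> {}"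
  shows "(u <# (s <#> group_fibre (pairwise q m R) \<beta>)) \<inter> Q \<noteq> {}"
proof -
  have "\<forall>i\<in>{..<q}. \<exists>ph. ph \<in> Q \<times> s \<and> fst ph \<in> (u \<otimes> snd ph) <# group_fibre R (block m i \<beta>)"
  proof
    fix i assume "i \<in> {..<q}"
    then obtain p where p: "p \<in> u <# (s <#> group_fibre R (block m i \<beta>))" "p \<in> Q" using hit[of i] by blast
    then obtain h where "h \<in> s" "p \<in> (u \<otimes> h) <# group_fibre R (block m i \<beta>)"
      unfolding l_coset_set_mult_UN[OF u s(2) group_fibre_sub] by blast
    then show "\<exists>ph. ph \<in> Q \<times> s \<and> fst ph \<in> (u \<otimes> snd ph) <# group_fibre R (block m i \<beta>)"
      using p(2) by (intro exI[of _ "(p, h)"]) simp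
  qed
  from bchoice[OF this] obtain f where f: "\<forall>i\<in>{..<q}. f i \<in> Q \<times> s \<and> fst (f i) \<in> (u \<otimes> snd (f i)) <# group_fibre R (block m i \<beta>)" ..
  have "f ` {..<q} \<subseteq> Q \<times> s" using f by blast
  then have "card (f ` {..<q}) \<le> card (Q \<times> s)" using Q s(1) by (intro card_mono) simp_all
  then have "card (f ` {..<q}) < card {..<q}" using q by (simp add: card_cartesian_product)
  then have "\<not> inj_on f {..<q}" by (rule pigeonhole)
  then obtain i j where ij: "i < q" "j < q" "i < j" "f i = f j"
    unfolding inj_on_def by (metis lessThan_iff linorder_neqE_nat)
  have iq: "i \<in> {..<q}" and jq: "j \<in> {..<q}" using ij by simp_all
  have fi: "f i \<in> Q \<times> s" "fst (f i) \<in> (u \<otimes> snd (f i)) <# group_fibre R (block m i \<beta>)" using f iq by blast+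
  have fj: "fst (f j) \<in> (u \<otimes> snd (f j)) <# group_fibre R (block m j \<beta>)" using f jq by blast
  define p h where "p = fst (f i)" and "h = snd (f i)"
  have ph: "p \<in> Q" "h \<in> s" "p \<in> (u \<otimes> h) <# group_fibre R (block m i \<beta>)" "p \<in> (u \<otimes> h) <# group_fibre R (block m j \<beta>)"
    using fi fj ij(4) unfolding p_def h_def by (simp_all add: mem_Times_iff)
  have uh: "u \<otimes> h \<in> carrier G" using u ph(2) s(2) by blast
  have pC: "p \<in> carrier G" using ph(3) l_coset_car[OF uh group_fibre_sub] by blast
  have "inv (u \<otimes> h) \<otimes> p \<in> group_fibre R (block m i \<beta>) \<inter> group_fibre R (block m j \<beta>)"
    using ph(3,4) mem_l_coset_iff[OF uh group_fibre_sub pC] by blast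
  then have "inv (u \<otimes> h) \<otimes> p \<in> group_fibre (pairwise q m R) \<beta>" unfolding group_fibre_pairwise using ij(2,3) by blast
  then have "p \<in> (u \<otimes> h) <# group_fibre (pairwise q m R) \<beta>" using mem_l_coset_iff[OF uh group_fibre_sub pC] by blast
  then show ?thesis unfolding l_coset_set_mult_UN[OF u s(2) group_fibre_sub] using ph(1,2) by blast
qed

text \<open>
  The \<open>q > N * card s\<close> first members of the sequence are put into one parameter tuple \<open>\<beta>\<close>. A set that pierces the
  translates of the \<open>s X\<^sub>i\<close> then pierces those of \<open>s\<close> times the union of the pairwise intersections.
\<close>

lemma piecewise_strong_\<Gamma>_indiscernible:
  assumes R: "defrel (n + m) R" and ind: "indiscernible L C m b" and p: "piecewise_strong \<Gamma> (group_fibre R (b 0))"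
  shows "piecewise_strong \<Gamma> (group_fibre R (b 0) \<inter> group_fibre R (b 1))"
proof -
  have bT: "b i \<in> TT m" for i using ind by (simp add: indiscernible_def)
  have st: "same_type L C {} (concat (map b is)) (concat (map b js))"
    if "length is = length js" "sorted_wrt (<) is" "sorted_wrt (<) js" for "is" js
    using ind that unfolding indiscernible_def by blast
  obtain s where s: "finite s" "s \<subseteq> \<Gamma>" "strong (s <#> group_fibre R (b 0))"
    using p unfolding piecewise_strong_f_generic_in_def by blast
  have sC: "s \<subseteq> carrier G" using s(2) \<Gamma>_car by blast
  have "strong (group_fibre (union_of_translates s R) (b 0))" using s(3) by (simp add: group_fibre_union_of_translates[OF sC])
  then obtain \<eta> N where \<eta>: "defrel m \<eta>" "\<eta> (b 0)" "pierceable (fibre n (n + m) (translate_rel (union_of_translates s R))) (cylinder m \<eta>) N"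
    unfolding strong_iff_uniform[OF defrel_union_of_translates[OF R s(1,2)] bT] by blast
  have \<eta>b: "\<eta> (b i)" for i
    using same_type_empty[OF _ \<eta>(1) bT bT \<eta>(2), of i] st[of "[0]" "[i]"] by simp
  define q where "q = Suc (N * card s)"
  define \<beta> where "\<beta> = concat (map b [0..<q])"
  have \<beta>T: "\<beta> \<in> TT (q * m)" unfolding \<beta>_def using concat_tuples[of "map b [0..<q]" "univ C" m] bT by auto
  have block\<beta>: "block m i \<beta> = b i" if "i < q" for i
    unfolding \<beta>_def using block_concat[of "map b [0..<q]" m i] tuples_length[OF bT] that by auto
  define \<theta> where "\<theta> z \<longleftrightarrow> (\<forall>i\<in>{..<q}. \<eta> (block m i z))" for z
  have d\<theta>: "defrel (q * m) \<theta>" unfolding \<theta>_def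
    by (rule defrels defrel_sub'[OF \<eta>(1)] coords | (auto simp: Suc_mult_le'; fail))+
  have \<theta>\<beta>: "\<theta> \<beta>" using \<eta>b block\<beta> by (simp add: \<theta>_def)
  have pc: "pierceable (fibre n (n + q * m) (translate_rel (union_of_translates s (pairwise q m R)))) (cylinder (q * m) \<theta>) N"
    unfolding pierceable_def
  proof (intro allI impI)
    fix T assume T: "T \<subseteq> cylinder (q * m) \<theta>" "finite T"
    let ?e = "\<lambda>(t, i). take n t @ block m i (drop n t)"
    have T2: "?e ` (T \<times> {..<q}) \<subseteq> cylinder m \<eta>"
    proof
      fix z assume "z \<in> ?e ` (T \<times> {..<q})"
      then obtain t i where ti: "t \<in> T" "i < q" "z = take n t @ block m i (drop n t)" by auto
      have "t \<in> cylinder (q * m) \<theta>" using ti(1) T(1) by blast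
      then obtain u y where uy: "u \<in> carrier G" "y \<in> TT (q * m)" "\<theta> y" "t = u @ y" unfolding cylinder_iff by blast
      have "\<eta> (block m i y)" using uy(3) ti(2) by (simp add: \<theta>_def)
      moreover have "block m i y \<in> TT m" by (rule block_tuples[OF uy(2) ti(2)])
      moreover have "z = u @ block m i y" using ti(3) uy(4) car_length[OF uy(1)] by simp
      ultimately show "z \<in> cylinder m \<eta>" unfolding cylinder_iff using uy(1) by blast
    qed
    have "finite (?e ` (T \<times> {..<q}))" using T(2) by simp
    from pierceableE[OF \<eta>(3) T2 this] obtain Q where Q: "finite Q" "card Q \<le> N"
      "\<And>z. z \<in> ?e ` (T \<times> {..<q}) \<Longrightarrow> fibre n (n + m) (translate_rel (union_of_translates s R)) z \<inter> Q \<noteq> {}" by blast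
    have "fibre n (n + q * m) (translate_rel (union_of_translates s (pairwise q m R))) t \<inter> Q \<noteq> {}" if t: "t \<in> T" for t
    proof -
      have "t \<in> cylinder (q * m) \<theta>" using t T(1) by blast
      then obtain u y where uy: "u \<in> carrier G" "y \<in> TT (q * m)" "\<theta> y" "t = u @ y" unfolding cylinder_iff by blast
      have "(u <# (s <#> group_fibre R (block m i y))) \<inter> Q \<noteq> {}" if i: "i < q" for i
      proof -
        have "u @ block m i y = ?e (t, i)" using uy(4) car_length[OF uy(1)] by simp
        then have "fibre n (n + m) (translate_rel (union_of_translates s R)) (u @ block m i y) \<inter> Q \<noteq> {}" using Q(3)[of "u @ block m i y"] t i by blast
        moreover have "block m i y \<in> TT m" by (rule block_tuples[OF uy(2) i])
        ultimately show ?thesis using fibre_translate_rel[OF uy(1), of "block m i y" m "union_of_translates s R"] group_fibre_union_of_translates[OF sC] by simp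
      qed
      moreover have "card Q * card s < q" unfolding q_def using Q(2) by (simp add: less_Suc_eq_le mult_right_mono)
      ultimately have "(u <# (s <#> group_fibre (pairwise q m R) y)) \<inter> Q \<noteq> {}"
        by (intro pigeonhole_translates[OF Q(1) s(1) sC _ uy(1)])
      then show ?thesis using fibre_translate_rel[OF uy(1,2), of "union_of_translates s (pairwise q m R)"] group_fibre_union_of_translates[OF sC] uy(4) by simp
    qed
    then show "\<exists>Q. finite Q \<and> card Q \<le> N \<and> (\<forall>t\<in>T. fibre n (n + q * m) (translate_rel (union_of_translates s (pairwise q m R))) t \<inter> Q \<noteq> {})"
      using Q(1,2) by blast
  qed
  have "strong (group_fibre (union_of_translates s (pairwise q m R)) \<beta>)"
    unfolding strong_iff_uniform[OF defrel_union_of_translates[OF defrel_pairwise[OF R] s(1,2)] \<beta>T] using d\<theta> \<theta>\<beta> pc by blast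
  then have big: "piecewise_strong \<Gamma> (group_fibre (pairwise q m R) \<beta>)"
    unfolding piecewise_strong_f_generic_in_def group_fibre_union_of_translates[OF sC] using s(1,2) by blast
  define R2 where "R2 z \<longleftrightarrow> R (take n z @ take m (drop n z)) \<and> R (take n z @ drop m (drop n z))" for z
  have dR2: "defrel (n + (m + m)) R2" unfolding R2_def
    by (rule defrels defrel_sub'[OF R] coords | (auto; fail))+
  have fR2: "group_fibre R2 (b i @ b j) = group_fibre R (b i) \<inter> group_fibre R (b j)" for i j
    using tuples_length[OF bT] by (auto simp: group_fibre_def R2_def car_length)
  let ?I = "{(i, j). i < j \<and> j < q}"
  have "group_fibre (pairwise q m R) \<beta> = (\<Union>k\<in>?I. group_fibre R2 (b (fst k) @ b (snd k)))"
    unfolding group_fibre_pairwise fR2 by (rule SUP_cong[OF refl]) (auto simp: block\<beta>)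
  then have "piecewise_strong \<Gamma> (\<Union>k\<in>?I. group_fibre R2 (b (fst k) @ b (snd k)))" using big by simp
  moreover have "finite ?I" by (rule finite_subset[of _ "{..<q} \<times> {..<q}"]) auto
  moreover have bbT: "b i @ b j \<in> TT (m + m)" for i j by (rule tuples_append[OF bT bT])
  ultimately have "\<exists>k\<in>?I. piecewise_strong \<Gamma> (group_fibre R2 (b (fst k) @ b (snd k)))"
    using piecewise_strong_\<Gamma>_UN[of ?I "\<lambda>k. group_fibre R2 (b (fst k) @ b (snd k))"] group_fibre_definable[OF dR2] by blast
  then obtain i j where ij: "i < j" "piecewise_strong \<Gamma> (group_fibre R2 (b i @ b j))" by auto
  have "same_type L C {} (b i @ b j) (b 0 @ b 1)" using st[of "[i, j]" "[0, 1]"] ij(1) by simp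
  from piecewise_strong_\<Gamma>_same_type[OF dR2 bbT bbT this ij(2)] show ?thesis by (simp only: fR2)
qed

lemma S1_\<Gamma>: "S1 L C n G {X. definable_subset L C n G X \<and> \<not> piecewise_strong \<Gamma> X}"
  unfolding S1_def
proof (intro allI impI)
  fix m \<phi> b
  assume \<phi>: "wf_fm L (n + m) \<phi>" "\<forall>c\<in>TT m. solutions C n \<phi> c \<subseteq> carrier G" and ind: "indiscernible L C m b"
    and inter: "solutions C n \<phi> (b 0) \<inter> solutions C n \<phi> (b 1) \<in> {X. definable_subset L C n G X \<and> \<not> piecewise_strong \<Gamma> X}"
  have bT: "b i \<in> TT m" for i using ind by (simp add: indiscernible_def)
  have d: "defrel (n + m) (\<lambda>z. sat C z \<phi>)" by (rule defrel_sat[OF \<phi>(1)])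
  have eq: "solutions C n \<phi> (b i) = group_fibre (\<lambda>z. sat C z \<phi>) (b i)" for i
  proof -
    have "solutions C n \<phi> (b i) \<subseteq> carrier G" using \<phi>(2) bT by blast
    then show ?thesis using car_TT by (auto simp: group_fibre_def solutions_def)
  qed
  have "\<not> piecewise_strong \<Gamma> (group_fibre (\<lambda>z. sat C z \<phi>) (b 0))" using piecewise_strong_\<Gamma>_indiscernible[OF d ind] inter unfolding eq by blast
  then show "solutions C n \<phi> (b 0) \<in> {X. definable_subset L C n G X \<and> \<not> piecewise_strong \<Gamma> X}"
    unfolding eq using group_fibre_definable[OF d bT] by blast
qed

end

theorem theorem1:
  fixes L :: "('f, 'r) language" and T :: "('f, 'r) fm set"
    and \<kappa> :: "'k rel" and C :: "('a, 'f, 'r) struct"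
    and n :: nat and G :: "'a list monoid" and M\<^sub>0 :: "'a set"
  assumes "complete_theory L T"
    and "monster_model L T \<kappa> C"
    and "NIP L C"
    and "definable_group L C n G"
    and "M\<^sub>0 = dcl L C {}"
    and "elementary_substructure L C M\<^sub>0"
  defines "I\<^sub>1 \<equiv> {X. definable_subset L C n G X \<and> \<not> piecewise_f_generic L \<kappa> C n G X}"
    and "I\<^sub>2 \<equiv> {X. definable_subset L C n G X \<and>
                    \<not> piecewise_strong_f_generic_in (carrier G) L C n G M\<^sub>0 X}"
    and "I\<^sub>3 \<equiv> {X. definable_subset L C n G X \<and>
                    \<not> piecewise_strong_f_generic_in (points n G M\<^sub>0) L C n G M\<^sub>0 X}"
  shows "(definable_ideal L C n G I\<^sub>1 \<and> translation_invariant G I\<^sub>1 \<and>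
          (\<forall>X. definable_subset L C n G X \<longrightarrow>
             (piecewise_f_generic L \<kappa> C n G X \<longleftrightarrow> weakly_generic L C n G X))) \<and>
         (definable_ideal L C n G I\<^sub>2 \<and> translation_invariant G I\<^sub>2) \<and>
         (definable_ideal L C n G I\<^sub>3 \<and> S1 L C n G I\<^sub>3)"
proof -
  have mm: "is_structure L C" "Card_order \<kappa>" "|formulas L| <o \<kappa>" "saturated L \<kappa> C"
    using assms(2) by (auto simp: monster_model_def is_model_def)
  interpret dcl_model L C \<kappa> n G
    by unfold_locales (use mm assms(3,4,6) in \<open>simp_all add: assms(5)\<close>)
  have 1: "definable_ideal L C n G I\<^sub>1" unfolding assms(7)
  proof (rule definable_idealI[of "piecewise_f_generic L \<kappa> C n G", OF not_piecewise_f_generic_empty piecewise_f_generic_mono])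
    fix X Y assume X: "definable_subset L C n G X" and Y: "definable_subset L C n G Y"
      and "piecewise_f_generic L \<kappa> C n G (X \<union> Y)"
    then have "weakly_generic L C n G (X \<union> Y)" using piecewise_f_generic_iff[OF definable_subset_Un[OF X Y]] by simp
    then show "piecewise_f_generic L \<kappa> C n G X \<or> piecewise_f_generic L \<kappa> C n G Y"
      using weakly_generic_Un[OF Y] piecewise_f_generic_iff X Y by blast
  qed
  have 2: "translation_invariant G I\<^sub>1" unfolding assms(7)
    by (rule translation_invariantI[of "piecewise_f_generic L \<kappa> C n G", OF piecewise_f_generic_l_coset])
  have 3: "definable_ideal L C n G I\<^sub>2" unfolding assms(5,8)
    by (rule definable_idealI[of "piecewise_strong (carrier G)", OF not_piecewise_strong_f_generic_empty piecewise_strong_f_generic_mono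
          piecewise_strong_Un[OF \<Gamma>_car subset_refl m_closed]])
  have 4: "translation_invariant G I\<^sub>2" unfolding assms(5,8)
    by (rule translation_invariantI[of "piecewise_strong (carrier G)", OF piecewise_strong_f_generic_l_coset])
  have 5: "definable_ideal L C n G I\<^sub>3" unfolding assms(5,9)
    by (rule definable_idealI[of "piecewise_strong \<Gamma>", OF not_piecewise_strong_f_generic_empty piecewise_strong_f_generic_mono piecewise_strong_\<Gamma>_Un])
  have 6: "S1 L C n G I\<^sub>3" unfolding assms(5,9) by (rule S1_\<Gamma>)
  show ?thesis using 1 2 3 4 5 6 piecewise_f_generic_iff by blast
qed

end
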